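(* Let $\omega\in\mathbb{R}^2$ satisfy the Diophantine condition with exponent $\tau=1$: there is $C_0>0$ such that $|\omega\cdot\nu|\ge C_0|\nu|^{-1}$ for all $\nu\in\mathbb{Z}^2\setminus\{0\}$, where $|\nu|=|\nu_1|+|\nu_2|$. Let $g:\mathbb{R}\to\mathbb{R}$ be real analytic, and let $f:\mathbb{R}^2\to\mathbb{R}$ be real analytic and $2\pi$-periodic in each variable, with Fourier expansion $f(\psi)=\sum_{\nu\in\mathbb{Z}^2}e^{i\nu\cdot\psi}f_\nu$. Assume that there is $c_0\in\mathbb{R}$ such that $g(c_0)=f_0$ (the average of $f$) and $g'(c_0)\neq0$. For $\varepsilon>0$ consider the ordinary differential equation $$\varepsilon\ddot x+\dot x+\varepsilon g(x)=\varepsilon f(\omega t).$$ Then there exists $\varepsilon_0>0$ such that for $0<\varepsilon<\varepsilon_0$ the equation has a quasi-periodic solution $x(t;\varepsilon)$ which has the same frequency vector $\omega$ as the forcing term and which is Borel summable in $\varepsilon$ at the origin. If moreover $g'(c_0)>0$, then this solution is a local attractor.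
   Context: Frequency vector: a solution is quasi-periodic with frequency vector $\omega$ if $x(t;\varepsilon)=X(\omega t;\varepsilon)$ with $X(\cdot;\varepsilon)$ a continuous function on $\mathbb{R}^2$, $2\pi$-periodic in each variable. Formal series: the equation has a formal power series solution $x_0(t;\varepsilon)=\sum_{k=0}^{\infty}\varepsilon^k x^{(k)}(t)$, with $x^{(0)}(t)\equiv c_0$ and coefficients of the form $x^{(k)}(t)=\sum_{\nu\in\mathbb{Z}^2}e^{i\nu\cdot\omega t}x^{(k)}_\nu$, which solves the equation order by order in $\varepsilon$. Borel summability: a formal power series $F(\varepsilon)=\sum_{n\ge 1}a_n\varepsilon^n$ is Borel summable if (1) $B(p):=\sum_{n\ge1}a_n p^{n-1}/(n-1)!$ converges in some disc $|p|<\delta$; (2) $B(p)$ has an analytic continuation to a neighbourhood of the positive real axis; (3) $G(\varepsilon)=\int_0^\infty e^{-p/\varepsilon}B(p)\,dp$ converges for some $\varepsilon>0$. The function $G$ is the Borel sum of $F$. A function admitting the formal expansion $F$ is called Borel summable if $F$ is Borel summable; in that case the function equals the Borel sum $G$. A constant term ($n=0$) is simply added to the Borel sum. For the solution $x(t;\varepsilon)$, Borel summability at the origin means that for every $t\in\mathbb{R}$ the series $\sum_{k\ge1}\varepsilon^k x^{(k)}(t)$ is Borel summable and $x(t;\varepsilon)-c_0$ equals its Borel sum for $0<\varepsilon<\varepsilon_0$. Local attractor: all solutions $\tilde x(t)$ of the equation with initial data $(\tilde x(0),\dot{\tilde x}(0))$ sufficiently close to $(x(0;\varepsilon),\dot x(0;\varepsilon))$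 exist for all $t\ge0$ and satisfy $|\tilde x(t)-x(t;\varepsilon)|+|\dot{\tilde x}(t)-\dot x(t;\varepsilon)|\to0$ as $t\to+\infty$. *)

theory Defs
  imports "HOL-Complex_Analysis.Complex_Analysis"
begin

definition real_analytic :: "(real \<Rightarrow> real) \<Rightarrow> bool" where
  "real_analytic g \<longleftrightarrow>
     (\<forall>x0. \<exists>r>0. \<exists>a. \<forall>x. \<bar>x - x0\<bar> < r \<longrightarrow> (\<lambda>n. a n * (x - x0) ^ n) sums g x)"

definition real_analytic2 :: "(real \<times> real \<Rightarrow> real) \<Rightarrow> bool" where
  "real_analytic2 f \<longleftrightarrow>
     (\<forall>x0 y0. \<exists>r>0. \<exists>a. \<forall>x y. \<bar>x - x0\<bar> < r \<and> \<bar>y - y0\<bar> < r \<longrightarrow>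
        ((\<lambda>(m, n). a m n * (x - x0) ^ m * (y - y0) ^ n) has_sum f (x, y)) UNIV)"

definition periodic2 :: "(real \<times> real \<Rightarrow> 'a) \<Rightarrow> bool" where
  "periodic2 f \<longleftrightarrow>
     (\<forall>\<psi>. f (\<psi> + (2 * pi, 0)) = f \<psi> \<and> f (\<psi> + (0, 2 * pi)) = f \<psi>)"

definition freq :: "int \<times> int \<Rightarrow> real \<times> real" where
  "freq \<nu> = (of_int (fst \<nu>), of_int (snd \<nu>))"

definition diophantine1 :: "real \<times> real \<Rightarrow> bool" where
  "diophantine1 \<omega> \<longleftrightarrow>
     (\<exists>C0>0. \<forall>\<nu>. \<nu> \<noteq> (0, 0) \<longrightarrow>
        \<bar>\<omega> \<bullet> freq \<nu>\<bar> \<ge> C0 / of_int (\<bar>fst \<nu>\<bar> + \<bar>snd \<nu>\<bar>))"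

definition fourier_coeff :: "(real \<times> real \<Rightarrow> real) \<Rightarrow> int \<times> int \<Rightarrow> complex" where
  "fourier_coeff f \<nu> =
     integral (cbox (0, 0) (2 * pi, 2 * pi))
       (\<lambda>\<psi>. complex_of_real (f \<psi>) * cis (- (freq \<nu> \<bullet> \<psi>))) / of_real ((2 * pi)\<^sup>2)"

text \<open>
  The pair \<open>(x, v)\<close> of position and velocity solves
  \<open>\<epsilon> x'' + x' + \<epsilon> g(x) = \<epsilon> f(\<omega> t)\<close> on the time set \<open>I\<close>; derivatives at endpoints
  of \<open>I\<close> are one-sided.
\<close>

definition ode_solution ::
  "(real \<Rightarrow> real) \<Rightarrow> (real \<times> real \<Rightarrow> real) \<Rightarrow> real \<times> real \<Rightarrow> real \<Rightarrow> real set
     \<Rightarrow> (real \<Rightarrow> real) \<Rightarrow> (real \<Rightarrow> real) \<Rightarrow> bool" where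
  "ode_solution g f \<omega> \<epsilon> I x v \<longleftrightarrow>
     (\<exists>a. \<forall>t\<in>I. (x has_real_derivative v t) (at t within I)
            \<and> (v has_real_derivative a t) (at t within I)
            \<and> \<epsilon> * a t + v t + \<epsilon> * g (x t) = \<epsilon> * f (t *\<^sub>R \<omega>))"

definition quasi_periodic :: "real \<times> real \<Rightarrow> (real \<Rightarrow> real) \<Rightarrow> bool" where
  "quasi_periodic \<omega> x \<longleftrightarrow>
     (\<exists>X. continuous_on UNIV X \<and> periodic2 X \<and> (\<forall>t. x t = X (t *\<^sub>R \<omega>)))"

text \<open>
  \<open>X k\<close> is the coefficient of \<open>\<epsilon>\<^sup>k\<close>. For each fixed \<open>t\<close> the equation is an identity between
  formal power series in \<open>\<epsilon>\<close> (the variable \<open>fps_X\<close>), where \<open>g\<close> enters through its Taylor series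
  at \<open>c0\<close>, composed with the series without constant term \<open>\<Sum>k\<ge>1. \<epsilon>\<^sup>k X k t\<close>.
\<close>

definition formal_solution ::
  "(real \<Rightarrow> real) \<Rightarrow> (real \<times> real \<Rightarrow> real) \<Rightarrow> real \<times> real \<Rightarrow> real
     \<Rightarrow> (nat \<Rightarrow> real \<Rightarrow> real) \<Rightarrow> bool" where
  "formal_solution g f \<omega> c0 X \<longleftrightarrow>
     (\<forall>t. X 0 t = c0) \<and>
     (\<forall>k. \<exists>c. \<forall>t. ((\<lambda>\<nu>. cis (t * (\<omega> \<bullet> freq \<nu>)) * c \<nu>) has_sum complex_of_real (X k t)) UNIV) \<and>
     (\<forall>k t. X k field_differentiable at t \<and> deriv (X k) field_differentiable at t) \<and>
     (\<forall>t. fps_X * Abs_fps (\<lambda>k. deriv (deriv (X k)) t) + Abs_fps (\<lambda>k. deriv (X k) t)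
            + fps_X * (Abs_fps (\<lambda>n. (deriv ^^ n) g c0 / fact n)
                        oo (Abs_fps (\<lambda>k. X k t) - fps_const c0))
          = fps_X * fps_const (f (t *\<^sub>R \<omega>)))"

text \<open>
  \<open>B\<close> is holomorphic on an open set containing a disc around 0 and the positive real axis, and on
  the disc it is the Borel transform of \<open>\<Sum>n\<ge>1. a n \<epsilon>\<^sup>n\<close>. The disc and the half-line lie in one
  component of that set, so \<open>B\<close> is determined by \<open>a\<close> on the half-line. The value \<open>a 0\<close> is not used.
\<close>

definition borel_continuation :: "(nat \<Rightarrow> complex) \<Rightarrow> (complex \<Rightarrow> complex) \<Rightarrow> bool" where
  "borel_continuation a B \<longleftrightarrow>
     (\<exists>S \<delta>. open S \<and> \<delta> > 0 \<and> ball 0 \<delta> \<subseteq> S \<and> complex_of_real ` {0<..} \<subseteq> S \<and>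
        B holomorphic_on S \<and>
        (\<forall>p\<in>ball 0 \<delta>. (\<lambda>n. a (Suc n) * p ^ n / fact n) sums B p))"

text \<open>
  The Henstock-Kurzweil integral over the half-line is the (possibly conditionally convergent)
  improper integral.
\<close>

definition borel_summable :: "(nat \<Rightarrow> complex) \<Rightarrow> bool" where
  "borel_summable a \<longleftrightarrow>
     (\<exists>B. borel_continuation a B \<and>
        (\<exists>\<epsilon>>0. (\<lambda>p::real. of_real (exp (- p / \<epsilon>)) * B (of_real p)) integrable_on {0..}))"

definition has_borel_sum :: "(nat \<Rightarrow> complex) \<Rightarrow> real \<Rightarrow> complex \<Rightarrow> bool" where
  "has_borel_sum a \<epsilon> s \<longleftrightarrow>
     (\<exists>B. borel_continuation a B \<and>
        ((\<lambda>p::real. of_real (exp (- p / \<epsilon>)) * B (of_real p)) has_integral s) {0..})"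

text \<open>
  That all solutions with nearby initial data exist for all \<open>t \<ge> 0\<close> is expressed by: there is a
  global forward solution, and every solution on some \<open>[0, T)\<close> extends to a global one.
\<close>

definition local_attractor ::
  "(real \<Rightarrow> real) \<Rightarrow> (real \<times> real \<Rightarrow> real) \<Rightarrow> real \<times> real \<Rightarrow> real
     \<Rightarrow> (real \<Rightarrow> real) \<Rightarrow> (real \<Rightarrow> real) \<Rightarrow> bool" where
  "local_attractor g f \<omega> \<epsilon> x v \<longleftrightarrow>
     (\<exists>\<eta>>0. \<forall>a b. \<bar>a - x 0\<bar> + \<bar>b - v 0\<bar> < \<eta> \<longrightarrow>
        (\<exists>y w. ode_solution g f \<omega> \<epsilon> {0..} y w \<and> y 0 = a \<and> w 0 = b) \<and>
        (\<forall>T>0. \<forall>y w. ode_solution g f \<omega> \<epsilon> {0..<T} y w \<and> y 0 = a \<and> w 0 = b \<longrightarrow>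
           (\<exists>Y W. ode_solution g f \<omega> \<epsilon> {0..} Y W \<and> (\<forall>t\<in>{0..<T}. Y t = y t \<and> W t = w t))) \<and>
        (\<forall>y w. ode_solution g f \<omega> \<epsilon> {0..} y w \<and> y 0 = a \<and> w 0 = b \<longrightarrow>
           ((\<lambda>t. \<bar>y t - x t\<bar> + \<bar>w t - v t\<bar>) \<longlongrightarrow> 0) at_top))"

end

(* Write x = c0 + u with u = \<epsilon> z, z = \<Sum> exp(i \<nu>.\<omega>t) z_\<nu>(\<epsilon>). After division by \<epsilon> the equation for the mode \<nu> is
     i\<lambda> (1 + i\<Omega> \<epsilon>) z_\<nu> = f_\<nu> - (\<epsilon>^2 \<Sum> g_(j+2) z^2 (\<epsilon> z)^j)_\<nu>,   \<lambda> = \<omega>.\<nu>,   \<Omega> = \<lambda> - g'(c0)/\<lambda>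
   (and g'(c0) \<epsilon> z_0 = - (...)_0 for \<nu> = 0). Under the Borel transform, 1/(1 + i\<Omega> \<epsilon>) becomes convolution with
   exp(-i\<Omega> p), which is entire, and since |\<Omega>| = O(|\<nu>|) by the Diophantine condition, the decay of f_\<nu> keeps the sums
   over \<nu> convergent in a strip |Im p| < \<delta>. There the transformed equation is a fixed point problem for a map that
   contracts in an exponentially weighted norm with large rate \<sigma>, as every convolution with the transform of \<epsilon>
   gains a factor 1/\<sigma>. The Taylor coefficients of its solution at p = 0 form the formal solution, its Laplace transform is
   a true solution with the former as Borel expansion. For g'(c0) > 0 the difference of two solutions near c0 decays
   by means of the Lyapunov function ((y + \<epsilon> y')^2 + (\<epsilon> y')^2) / 2. *)
theory Submission
  imports Defs
begin

section \<open>Dominated infinite sums\<close>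

text \<open>The obstacle is the small divisor 1/\<lambda>, which the Diophantine condition bounds
  only by a multiple of |\<nu>|. Met at every step of an iteration it would cost decay in \<nu>
  again and again. Here it is paid for once, in the term that comes from the forcing, with half of
  the exponential decay of f_\<nu>. The nonlinearity is multiplied by \<epsilon>^2 / (\<i> \<lambda>
  (1 + \<i> \<Omega> \<epsilon>)) instead, whose Borel transform is a primitive of exp(-\<i>
  \<Omega> p) / (\<i> \<lambda>). On the real axis it is bounded by a constant times 1 + |p|,
  uniformly in \<nu>: for small \<lambda> because \<lambda> \<Omega> = \<lambda>^2 - g'(c0) stays
  away from 0, for the other \<lambda> because 1/\<lambda> is bounded. So the contraction takes
  place in a single space. The second power of \<epsilon>, which makes this possible, comes from the
  quadratic term of g at u = \<epsilon> z.\<close>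

lemma dominated_abs_summable:
  fixes f :: "'i \<Rightarrow> 'a::banach" and B :: "'i \<Rightarrow> real"
  assumes "\<And>i. i \<in> I \<Longrightarrow> norm (f i) \<le> B i" "B summable_on I"
  shows "(\<lambda>i. norm (f i)) summable_on I"
  using assms by (intro summable_on_comparison_test[OF assms(2)]) auto

lemma dominated_summable:
  fixes f :: "'i \<Rightarrow> 'a::banach" and B :: "'i \<Rightarrow> real"
  assumes "\<And>i. i \<in> I \<Longrightarrow> norm (f i) \<le> B i" "B summable_on I"
  shows "f summable_on I"
  by (rule abs_summable_summable[OF dominated_abs_summable[OF assms]])

lemma dominated_infsum_le:
  fixes f :: "'i \<Rightarrow> 'a::banach" and B :: "'i \<Rightarrow> real"
  assumes "\<And>i. i \<in> I \<Longrightarrow> norm (f i) \<le> B i" "B summable_on I"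
  shows "norm (infsum f I) \<le> infsum B I"
  by (rule norm_infsum_le[OF has_sum_infsum[OF dominated_summable[OF assms]] has_sum_infsum[OF assms(2)] assms(1)])

text \<open>The factor \<open>M p\<close> lets the bounds grow with p, as the exponential weights
  below do. On a closed disc it is bounded, and the M-test gives uniform convergence of the finite
  partial sums there.\<close>

lemma holomorphic_on_infsum:
  fixes F :: "'i \<Rightarrow> complex \<Rightarrow> complex"
  assumes S: "open S" and hol: "\<And>i. F i holomorphic_on S"
    and bd: "\<And>i p. p \<in> S \<Longrightarrow> norm (F i p) \<le> B i * M p"
    and B: "B summable_on UNIV" and M: "continuous_on S M"
  shows "(\<lambda>p. infsum (\<lambda>i. F i p) UNIV) holomorphic_on S"
proof -
  have "\<exists>d>0. (\<lambda>p. infsum (\<lambda>i. F i p) UNIV) holomorphic_on ball z d" if z: "z \<in> S" for z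
  proof -
    obtain d where d: "d > 0" "cball z d \<subseteq> S"
      using S z open_contains_cball by blast
    have "compact (M ` cball z d)"
      using M d by (intro compact_continuous_image) (auto intro: continuous_on_subset)
    then obtain C where C: "\<And>p. p \<in> cball z d \<Longrightarrow> norm (M p) \<le> C"
      by (meson bounded_iff compact_imp_bounded imageI)
    have Bn: "0 \<le> norm (B i)" for i by simp
    have ub: "norm (F i p) \<le> norm (B i) * C" if "p \<in> cball z d" for i p
    proof -
      have "norm (F i p) \<le> B i * M p" using bd d that by blast
      also have "\<dots> \<le> norm (B i) * norm (M p)" by (metis abs_ge_self abs_mult real_norm_def)
      also have "\<dots> \<le> norm (B i) * C" using C[OF that] by (simp add: mult_left_mono)
      finally show ?thesis .
    qed
    have "(\<lambda>i. norm (B i)) summable_on UNIV" using B summable_on_iff_abs_summable_on_real by blast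
    hence sm: "(\<lambda>i. norm (B i) * C) summable_on UNIV" by (rule summable_on_cmult_left)
    have ul: "uniform_limit (cball z d) (\<lambda>X p. \<Sum>i\<in>X. F i p) (\<lambda>p. infsum (\<lambda>i. F i p) UNIV)
                (finite_subsets_at_top UNIV)"
      by (rule Weierstrass_m_test_general[OF _ sm]) (use ub in auto)
    have "(\<lambda>p. infsum (\<lambda>i. F i p) UNIV) holomorphic_on ball z d"
    proof (rule holomorphic_uniform_limit[OF _ ul])
      show "\<forall>\<^sub>F X in finite_subsets_at_top UNIV. continuous_on (cball z d) (\<lambda>p. \<Sum>i\<in>X. F i p) \<and>
              (\<lambda>p. \<Sum>i\<in>X. F i p) holomorphic_on ball z d"
      proof (intro always_eventually allI conjI)
        fix X
        show "continuous_on (cball z d) (\<lambda>p. \<Sum>i\<in>X. F i p)"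
          by (intro continuous_on_sum holomorphic_on_imp_continuous_on holomorphic_on_subset[OF hol] d)
        show "(\<lambda>p. \<Sum>i\<in>X. F i p) holomorphic_on ball z d"
          using d by (intro holomorphic_on_sum holomorphic_on_subset[OF hol]) auto
      qed
    qed auto
    thus ?thesis using d by blast
  qed
  thus ?thesis
    by (metis (no_types, lifting) at_within_open_NO_MATCH centre_in_ball field_differentiable_at_within
        holomorphic_on_def holomorphic_on_imp_differentiable_at open_ball)
qed

section \<open>Convolution on a strip with an adjoined unit\<close>

definition hstrip :: "real \<Rightarrow> complex set" where
  "hstrip \<delta> = {p. \<bar>Im p\<bar> < \<delta>}"

lemma open_hstrip: "open (hstrip \<delta>)"
  unfolding hstrip_def by (intro open_Collect_less continuous_intros)

lemma hstrip_scale: "\<tau> \<in> {0..1} \<Longrightarrow> p \<in> hstrip \<delta> \<Longrightarrow> of_real \<tau> * p \<in> hstrip \<delta>"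
proof -
  assume t: "\<tau> \<in> {0..1}" and p: "p \<in> hstrip \<delta>"
  have "\<bar>\<tau> * Im p\<bar> \<le> 1 * \<bar>Im p\<bar>" using t unfolding abs_mult by (intro mult_right_mono) auto
  thus ?thesis using p by (auto simp: hstrip_def)
qed

lemma convex_hstrip: "convex (hstrip \<delta>)"
proof -
  have "hstrip \<delta> = {p. Im p < \<delta>} \<inter> {p. Im p > -\<delta>}"
    by (auto simp: hstrip_def)
  thus ?thesis
    by (simp add: convex_Int convex_halfspace_Im_lt convex_halfspace_Im_gt)
qed

lemma ball_subset_hstrip: "ball 0 \<delta> \<subseteq> hstrip \<delta>"
  by (auto simp: hstrip_def intro: le_less_trans[OF abs_Im_le_cmod])

text \<open>The convolution of \<open>F\<close> and \<open>G\<close> along the segment from 0 to p,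
  with s = \<tau> p substituted. On the fixed interval [0, 1] the point p is a mere parameter, so
  that differentiation under the integral applies.\<close>

definition pconv :: "(complex \<Rightarrow> complex) \<Rightarrow> (complex \<Rightarrow> complex) \<Rightarrow> complex \<Rightarrow> complex" where
  "pconv F G p = integral (cbox 0 (1::real))
     (\<lambda>\<tau>. p * F (of_real \<tau> * p) * G (of_real (1 - \<tau>) * p))"

lemma pconv_0 [simp]: "pconv F G 0 = 0"
  by (simp add: pconv_def)

lemma pconv_continuous:
  assumes "continuous_on (hstrip \<delta>) F" "continuous_on (hstrip \<delta>) G" "p \<in> hstrip \<delta>"
  shows "continuous_on (cbox 0 (1::real)) (\<lambda>\<tau>. p * F (of_real \<tau> * p) * G (of_real (1 - \<tau>) * p))"
  using assms hstrip_scale[of _ p \<delta>] hstrip_scale[of "1 - _" p \<delta>]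
  by (intro continuous_intros continuous_on_compose2[OF assms(1)] continuous_on_compose2[OF assms(2)])
     (auto intro!: continuous_intros)

lemma one_minus_mult_deriv: "((\<lambda>w. (1 - w) * p) has_field_derivative - p) (at (x::complex))"
  by (auto intro!: derivative_eq_intros)

lemma DERIV_cmult_right_Id: "((\<lambda>w. w * p) has_field_derivative p) (at (x::complex))"
  by (auto intro!: derivative_eq_intros)

text \<open>The Leibniz rule first produces a term with \<open>deriv G\<close> as well. Integration
  by parts in \<tau> trades it for the boundary term, so that in the result only \<open>F\<close> is
  differentiated and the formula can be iterated.\<close>

lemma pconv_has_derivative:
  assumes F: "F holomorphic_on hstrip \<delta>" and G: "G holomorphic_on hstrip \<delta>" and p: "p \<in> hstrip \<delta>"
  shows "(pconv F G has_field_derivative F 0 * G p + pconv (deriv F) G p) (at p)"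
proof -
  note op = open_hstrip[of \<delta>]
  have F': "deriv F holomorphic_on hstrip \<delta>" and G': "deriv G holomorphic_on hstrip \<delta>"
    using F G op by (auto intro: holomorphic_deriv)
  note cF = holomorphic_on_imp_continuous_on[OF F] and cG = holomorphic_on_imp_continuous_on[OF G]
    and cF' = holomorphic_on_imp_continuous_on[OF F'] and cG' = holomorphic_on_imp_continuous_on[OF G']
  have dF: "(F has_field_derivative deriv F q) (at q)" if "q \<in> hstrip \<delta>" for q
    using F op that holomorphic_derivI by blast
  have dG: "(G has_field_derivative deriv G q) (at q)" if "q \<in> hstrip \<delta>" for q
    using G op that holomorphic_derivI by blast
  define fx where "fx = (\<lambda>q (\<tau>::real). F (of_real \<tau> * q) * G (of_real (1 - \<tau>) * q)
      + q * (of_real \<tau> * deriv F (of_real \<tau> * q)) * G (of_real (1 - \<tau>) * q)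
      + q * F (of_real \<tau> * q) * (of_real (1 - \<tau>) * deriv G (of_real (1 - \<tau>) * q)))"
  have sc: "of_real \<tau> * q \<in> hstrip \<delta>" "of_real (1 - \<tau>) * q \<in> hstrip \<delta>"
    if "\<tau> \<in> cbox 0 1" "q \<in> hstrip \<delta>" for \<tau> q
    using that hstrip_scale[of \<tau> q \<delta>] hstrip_scale[of "1 - \<tau>" q \<delta>] by auto
  have 1: "((\<lambda>q. integral (cbox 0 1) (\<lambda>\<tau>. q * F (of_real \<tau> * q) * G (of_real (1 - \<tau>) * q)))
          has_field_derivative integral (cbox 0 1) (fx p)) (at p within hstrip \<delta>)"
  proof (rule leibniz_rule_field_derivative)
    fix q \<tau> assume q: "q \<in> hstrip \<delta>" and t: "\<tau> \<in> cbox 0 (1::real)"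
    note s = sc[OF t q]
    have a: "((\<lambda>q. F (of_real \<tau> * q)) has_field_derivative of_real \<tau> * deriv F (of_real \<tau> * q)) (at q)"
      by (rule DERIV_cong[OF DERIV_chain2[where f = F and g = \<open>\<lambda>q. of_real \<tau> * q\<close> and x = \<open>q\<close> and s = UNIV and Db = \<open>of_real \<tau>\<close>, OF dF[OF s(1)]]]; (rule DERIV_cmult_Id | rule DERIV_cmult_right_Id | rule one_minus_mult_deriv | simp only: mult.commute mult_minus_left))
    have b: "((\<lambda>q. G (of_real (1-\<tau>) * q)) has_field_derivative of_real (1-\<tau>) * deriv G (of_real (1-\<tau>) * q)) (at q)"
      by (rule DERIV_cong[OF DERIV_chain2[where f = G and g = \<open>\<lambda>q. of_real (1 - \<tau>) * q\<close> and x = \<open>q\<close> and s = UNIV and Db = \<open>of_real (1 - \<tau>)\<close>, OF dG[OF s(2)]]]; (rule DERIV_cmult_Id | rule DERIV_cmult_right_Id | rule one_minus_mult_deriv | simp only: mult.commute mult_minus_left))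
    show "((\<lambda>q. q * F (of_real \<tau> * q) * G (of_real (1 - \<tau>) * q)) has_field_derivative fx q \<tau>)
            (at q within hstrip \<delta>)"
      unfolding fx_def
      by (rule has_field_derivative_at_within[OF DERIV_cong[OF DERIV_mult[OF DERIV_mult[OF DERIV_ident a] b]]])
         (simp add: algebra_simps)
  next
    fix q assume "q \<in> hstrip \<delta>"
    thus "(\<lambda>\<tau>. q * F (of_real \<tau> * q) * G (of_real (1 - \<tau>) * q)) integrable_on cbox 0 (1::real)"
      by (intro integrable_continuous pconv_continuous[OF cF cG])
  next
    have s1: "(\<lambda>x. of_real (snd x) * fst x) ` (hstrip \<delta> \<times> cbox 0 (1::real)) \<subseteq> hstrip \<delta>"
      and s2: "(\<lambda>x. of_real (1 - snd x) * fst x) ` (hstrip \<delta> \<times> cbox 0 (1::real)) \<subseteq> hstrip \<delta>"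
      using sc by auto
    show "continuous_on (hstrip \<delta> \<times> cbox 0 1) (\<lambda>(q, \<tau>). fx q \<tau>)"
      unfolding fx_def case_prod_beta
      by (intro continuous_intros continuous_on_compose2[OF cF _ s1] continuous_on_compose2[OF cG _ s2]
            continuous_on_compose2[OF cF' _ s1] continuous_on_compose2[OF cG' _ s2])
  qed (use p convex_hstrip in auto)
  \<comment> \<open>The difference of the integrands is the \<tau>-derivative of - (1 - \<tau>)
    F(\<tau> p) G((1 - \<tau>) p); only \<tau> = 0 contributes, with
    \<open>F 0 * G p\<close>.\<close>
  have 2: "((\<lambda>\<tau>. fx p \<tau> - p * deriv F (of_real \<tau> * p) * G (of_real (1 - \<tau>) * p)) has_integral
      (- of_real (1 - 1) * F (of_real 1 * p) * G (of_real (1 - 1) * p))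
       - (- of_real (1 - 0) * F (of_real 0 * p) * G (of_real (1 - 0) * p))) {0..1}"
  proof (rule fundamental_theorem_of_calculus)
    fix \<tau> :: real assume t: "\<tau> \<in> {0..1}"
    have s: "of_real \<tau> * p \<in> hstrip \<delta>" "(1 - of_real \<tau>) * p \<in> hstrip \<delta>"
      using sc[of \<tau> p] t p by auto
    have a: "((\<lambda>w. F (w * p)) has_field_derivative p * deriv F (of_real \<tau> * p)) (at (of_real \<tau>))"
      by (rule DERIV_cong[OF DERIV_chain2[where f = F and g = \<open>\<lambda>w. w * p\<close> and x = \<open>of_real \<tau>\<close> and s = UNIV and Db = \<open>p\<close>, OF dF[OF s(1)]]]; (rule DERIV_cmult_Id | rule DERIV_cmult_right_Id | rule one_minus_mult_deriv | simp only: mult.commute mult_minus_left))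
    have b: "((\<lambda>w. G ((1 - w) * p)) has_field_derivative - p * deriv G ((1 - of_real \<tau>) * p)) (at (of_real \<tau>))"
      by (rule DERIV_cong[OF DERIV_chain2[where f = G and g = \<open>\<lambda>w. (1 - w) * p\<close> and x = \<open>of_real \<tau>\<close> and s = UNIV and Db = \<open>- p\<close>, OF dG[OF s(2)]]]; (rule DERIV_cmult_Id | rule DERIV_cmult_right_Id | rule one_minus_mult_deriv | simp only: mult.commute mult_minus_left))
    have c: "((\<lambda>w. - (1 - w)) has_field_derivative 1) (at (of_real \<tau> :: complex))"
      by (auto intro!: derivative_eq_intros)
    have "((\<lambda>w. - (1 - w) * F (w * p) * G ((1 - w) * p)) has_field_derivative
            fx p \<tau> - p * deriv F (of_real \<tau> * p) * G (of_real (1 - \<tau>) * p)) (at (of_real \<tau>))"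
      unfolding fx_def
      by (rule DERIV_cong[OF DERIV_mult[OF DERIV_mult[OF c a] b]]) (simp add: algebra_simps)
    from has_vector_derivative_real_field[OF this]
    show "((\<lambda>\<tau>. - of_real (1 - \<tau>) * F (of_real \<tau> * p) * G (of_real (1 - \<tau>) * p)) has_vector_derivative
            fx p \<tau> - p * deriv F (of_real \<tau> * p) * G (of_real (1 - \<tau>) * p)) (at \<tau> within {0..1})"
      by (simp add: has_vector_derivative_at_within)
  qed simp
  have "((\<lambda>\<tau>. p * deriv F (of_real \<tau> * p) * G (of_real (1 - \<tau>) * p)) has_integral pconv (deriv F) G p) {0..1}"
    using integrable_integral[OF integrable_continuous[OF pconv_continuous[OF cF' cG p]]]
    unfolding pconv_def box_real .
  from has_integral_add[OF 2 this] have "(fx p has_integral F 0 * G p + pconv (deriv F) G p) {0..1}"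
    by simp
  hence "integral (cbox 0 1) (fx p) = F 0 * G p + pconv (deriv F) G p"
    unfolding box_real by (rule integral_unique)
  with 1 show ?thesis
    unfolding pconv_def[abs_def] using at_within_open[OF p op] by simp
qed

lemma pconv_holomorphic:
  assumes "F holomorphic_on hstrip \<delta>" "G holomorphic_on hstrip \<delta>"
  shows "pconv F G holomorphic_on hstrip \<delta>"
  using pconv_has_derivative[OF assms]
  by (metis field_differentiable_at_within field_differentiable_def holomorphic_on_def)

text \<open>Iterates \<open>pconv_has_derivative\<close>, the convolution itself being 0 at 0. The
  orders of differentiation add up to n - 1 and not n; \<open>tay\<close> below compensates for this
  by its shift of the index.\<close>

lemma pconv_higher_deriv:
  assumes \<delta>: "\<delta> > 0" and F: "F holomorphic_on hstrip \<delta>" and G: "G holomorphic_on hstrip \<delta>"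
  shows "(deriv ^^ n) (pconv F G) 0 = (\<Sum>j<n. (deriv ^^ j) F 0 * (deriv ^^ (n - 1 - j)) G 0)"
  using F
proof (induction n arbitrary: F)
  case (Suc n)
  have 0: "0 \<in> hstrip \<delta>" using \<delta> by (simp add: hstrip_def)
  have F': "deriv F holomorphic_on hstrip \<delta>" using Suc.prems open_hstrip holomorphic_deriv by blast
  have "deriv (pconv F G) p = F 0 * G p + pconv (deriv F) G p" if "p \<in> hstrip \<delta>" for p
    using pconv_has_derivative[OF Suc.prems G that] DERIV_imp_deriv by blast
  hence "\<forall>\<^sub>F p in nhds 0. deriv (pconv F G) p = F 0 * G p + pconv (deriv F) G p"
    using open_hstrip 0 by (metis (mono_tags, lifting) eventually_nhds)
  hence "(deriv ^^ Suc n) (pconv F G) 0 = (deriv ^^ n) (\<lambda>p. F 0 * G p + pconv (deriv F) G p) 0"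
    by (simp add: funpow_swap1 higher_deriv_cong_ev)
  also have "\<dots> = (deriv ^^ n) (\<lambda>p. F 0 * G p) 0 + (deriv ^^ n) (pconv (deriv F) G) 0"
    by (rule higher_deriv_add[OF _ pconv_holomorphic[OF F' G] open_hstrip 0]) (intro holomorphic_intros G)
  also have "(deriv ^^ n) (\<lambda>p. F 0 * G p) 0 = F 0 * (deriv ^^ n) G 0"
    by (rule higher_deriv_cmult[OF G 0 open_hstrip])
  also have "(deriv ^^ n) (pconv (deriv F) G) 0 = (\<Sum>j<n. (deriv ^^ Suc j) F 0 * (deriv ^^ (n - 1 - j)) G 0)"
    unfolding Suc.IH[OF F'] by (simp add: funpow_swap1)
  also have "F 0 * (deriv ^^ n) G 0 + \<dots> = (\<Sum>j<Suc n. (deriv ^^ j) F 0 * (deriv ^^ (Suc n - 1 - j)) G 0)"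
    by (subst sum.lessThan_Suc_shift) simp
  finally show ?case .
qed auto

text \<open>
  An element \<open>F\<close> stands for the generalised function \<open>F None * \<delta>\<^sub>0 + F (Some p)\<close> in the Borel plane, where the
  Dirac mass \<open>\<delta>\<^sub>0\<close> at the origin is the Borel transform of the constant \<open>1\<close>; \<open>star\<close> is the convolution of such
  functions and corresponds to the product of power series in \<open>\<epsilon>\<close>.
\<close>

definition star :: "(complex option \<Rightarrow> complex) \<Rightarrow> (complex option \<Rightarrow> complex) \<Rightarrow> complex option \<Rightarrow> complex" where
  "star F G x = (case x of None \<Rightarrow> F None * G None
     | Some p \<Rightarrow> F None * G (Some p) + F (Some p) * G None + pconv (\<lambda>q. F (Some q)) (\<lambda>q. G (Some q)) p)"

lemma star_simps:
  "star F G None = F None * G None"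
  "star F G (Some p) = F None * G (Some p) + F (Some p) * G None + pconv (\<lambda>q. F (Some q)) (\<lambda>q. G (Some q)) p"
  by (simp_all add: star_def)

section \<open>Exponential weights and the basic estimate of the convolution\<close>

definition hdom :: "real \<Rightarrow> complex option set" where
  "hdom \<delta> = insert None (Some ` hstrip \<delta>)"

lemma hdom_simps [simp]: "None \<in> hdom \<delta>" "Some p \<in> hdom \<delta> \<longleftrightarrow> p \<in> hstrip \<delta>"
  by (auto simp: hdom_def)

lemma Ball_hdom: "(\<forall>x\<in>hdom \<delta>. P x) \<longleftrightarrow> P None \<and> (\<forall>p\<in>hstrip \<delta>. P (Some p))"
  by (auto simp: hdom_def)

text \<open>
  The quadratic denominator makes the exponential weight an algebra weight: by
  \<open>inverse_square_product_le\<close>, the convolution of two copies is at most a multiple of the weight, uniformly in \<open>\<sigma>\<close>.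
\<close>

definition mw :: "real \<Rightarrow> real \<Rightarrow> real" where
  "mw \<sigma> r = \<sigma> * exp (\<sigma> * r) / (1 + (\<sigma> * r)\<^sup>2)"

text \<open>The Dirac mass gets weight 1, independently of \<sigma>, so that the unit keeps its size
  as \<sigma> grows.\<close>

definition mm :: "real \<Rightarrow> complex option \<Rightarrow> real" where
  "mm \<sigma> x = (case x of None \<Rightarrow> 1 | Some p \<Rightarrow> mw \<sigma> (cmod p))"

definition imx :: "complex option \<Rightarrow> real" where
  "imx x = (case x of None \<Rightarrow> 0 | Some p \<Rightarrow> \<bar>Im p\<bar>)"

lemma imx_simps [simp]: "imx None = 0" "imx (Some p) = \<bar>Im p\<bar>"
  by (auto simp: imx_def)

lemma mm_simps: "mm \<sigma> None = 1" "mm \<sigma> (Some p) = mw \<sigma> (cmod p)"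
  by (auto simp: mm_def)

lemma one_plus_square_pos: "1 + (x::real)\<^sup>2 > 0"
  by (metis add.commute add_pos_nonneg zero_le_power2 zero_less_one)

lemma mw_pos: "\<sigma> > 0 \<Longrightarrow> mw \<sigma> r > 0"
  unfolding mw_def by (intro divide_pos_pos mult_pos_pos one_plus_square_pos) auto

lemma mm_pos: "\<sigma> > 0 \<Longrightarrow> mm \<sigma> x > 0"
  by (cases x) (auto simp: mm_simps mw_pos)

text \<open>Divide 1 + (x + y)^2 <= 2 ((1 + x^2) + (1 + y^2)) by all three factors. It serves twice,
  for the weight along a segment in the Borel plane and for the weight on the lattice of
  modes.\<close>

lemma inverse_square_product_le:
  fixes x y :: real
  shows "1 / ((1 + x\<^sup>2) * (1 + y\<^sup>2)) \<le> 2 / (1 + (x + y)\<^sup>2) * (1 / (1 + x\<^sup>2) + 1 / (1 + y\<^sup>2))"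
proof -
  have "1 + (x + y)\<^sup>2 \<le> 2 * ((1 + x\<^sup>2) + (1 + y\<^sup>2))"
    using sum_squares_bound[of x y] by (simp add: power2_sum mult.assoc)
  hence "1 * ((1 + (x + y)\<^sup>2) * ((1 + x\<^sup>2) * (1 + y\<^sup>2)))
      \<le> (2 * ((1 + x\<^sup>2) + (1 + y\<^sup>2))) * ((1 + x\<^sup>2) * (1 + y\<^sup>2))"
    using one_plus_square_pos[of x] one_plus_square_pos[of y] by (simp add: mult_right_mono)
  moreover have "2 / (1 + (x + y)\<^sup>2) * (1 / (1 + x\<^sup>2) + 1 / (1 + y\<^sup>2))
      = (2 * ((1 + x\<^sup>2) + (1 + y\<^sup>2))) / ((1 + (x + y)\<^sup>2) * ((1 + x\<^sup>2) * (1 + y\<^sup>2)))"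
    using one_plus_square_pos[of x] one_plus_square_pos[of y] one_plus_square_pos[of "x+y"]
    by (simp add: divide_simps)
  ultimately show ?thesis
    using one_plus_square_pos[of x] one_plus_square_pos[of y] one_plus_square_pos[of "x+y"]
    by (simp add: divide_simps mult_ac)
qed

text \<open>The two exponentials multiply to exp(\<sigma> |p|) because the moduli of \<tau> p and (1
  - \<tau>) p add up to |p|. What remains is split by \<open>inverse_square_product_le\<close> into
  two terms with arctangents as primitives. The constant 7 bounds 2 * 2 arctan R, as 2 arctan R <
  \<pi> < 7/2.\<close>

lemma pconv_bound:
  assumes \<sigma>: "\<sigma> > 0" and F: "continuous_on (hstrip \<delta>) F" and G: "continuous_on (hstrip \<delta>) G"
    and p: "p \<in> hstrip \<delta>" and B: "B \<ge> 0"
    and bd: "\<And>\<tau>. \<tau> \<in> {0..1} \<Longrightarrow> norm (F (of_real \<tau> * p)) * norm (G (of_real (1 - \<tau>) * p))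
        \<le> B * mw \<sigma> (\<tau> * cmod p) * mw \<sigma> ((1 - \<tau>) * cmod p)"
  shows "norm (pconv F G p) \<le> 7 * B * mw \<sigma> (cmod p)"
proof -
  define R where "R = \<sigma> * cmod p"
  define g where "g = (\<lambda>\<tau>. B * \<sigma> * exp R * (2 / (1 + R\<^sup>2) * (R / (1 + (\<tau> * R)\<^sup>2) + R / (1 + ((1 - \<tau>) * R)\<^sup>2))))"
  have R: "R \<ge> 0" using \<sigma> by (simp add: R_def)
  have g: "(g has_integral B * \<sigma> * exp R * (2 / (1 + R\<^sup>2) * (arctan (1 * R) - arctan ((1 - 1) * R)))
      - B * \<sigma> * exp R * (2 / (1 + R\<^sup>2) * (arctan (0 * R) - arctan ((1 - 0) * R)))) {0..1}"
  proof (rule fundamental_theorem_of_calculus)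
    fix \<tau> :: real assume t: "\<tau> \<in> {0..1}"
    have "((\<lambda>\<tau>. B * \<sigma> * exp R * (2 / (1 + R\<^sup>2) * (arctan (\<tau> * R) - arctan ((1 - \<tau>) * R)))) has_real_derivative g \<tau>) (at \<tau>)"
      unfolding g_def
      by (rule derivative_eq_intros refl | simp)+ (simp add: divide_inverse algebra_simps)
    thus "((\<lambda>\<tau>. B * \<sigma> * exp R * (2 / (1 + R\<^sup>2) * (arctan (\<tau> * R) - arctan ((1 - \<tau>) * R)))) has_vector_derivative g \<tau>) (at \<tau> within {0..1})"
      by (simp add: has_real_derivative_iff_has_vector_derivative has_vector_derivative_at_within)
  qed simp
  have le: "norm (p * F (of_real \<tau> * p) * G (of_real (1 - \<tau>) * p)) \<le> g \<tau>" if t: "\<tau> \<in> cbox 0 1" for \<tau>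
  proof -
    have t': "\<tau> \<in> {0..1}" using t by simp
    have "norm (p * F (of_real \<tau> * p) * G (of_real (1 - \<tau>) * p))
        \<le> cmod p * (B * mw \<sigma> (\<tau> * cmod p) * mw \<sigma> ((1 - \<tau>) * cmod p))"
      using mult_left_mono[OF bd[OF t'], of "cmod p"] by (simp add: norm_mult mult.assoc)
    also have "\<dots> = B * \<sigma> * exp R * (R * (1 / ((1 + (\<tau> * R)\<^sup>2) * (1 + ((1 - \<tau>) * R)\<^sup>2))))"
    proof -
      have "exp (\<sigma> * (\<tau> * cmod p)) * exp (\<sigma> * ((1 - \<tau>) * cmod p)) = exp R"
        unfolding R_def exp_add[symmetric] by (simp add: algebra_simps)
      thus ?thesis
        by (simp add: mw_def R_def mult_ac)
    qed
    also have "\<dots> \<le> B * \<sigma> * exp R * (R * (2 / (1 + (\<tau> * R + (1 - \<tau>) * R)\<^sup>2) * (1 / (1 + (\<tau> * R)\<^sup>2) + 1 / (1 + ((1 - \<tau>) * R)\<^sup>2))))"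
      using B \<sigma> R by (intro mult_left_mono inverse_square_product_le) auto
    also have "\<dots> = g \<tau>"
      by (simp add: g_def algebra_simps add_divide_distrib)
    finally show ?thesis .
  qed
  have "norm (pconv F G p) \<le> integral (cbox 0 1) g"
    unfolding pconv_def
    by (rule integral_norm_bound_integral)
       (use le g pconv_continuous[OF F G p] in \<open>auto intro: integrable_continuous_interval\<close>)
  also have "\<dots> = B * \<sigma> * exp R * (2 / (1 + R\<^sup>2) * (2 * arctan R))"
    using integral_unique[OF g] by (simp add: algebra_simps)
  also have "\<dots> \<le> B * \<sigma> * exp R * (2 / (1 + R\<^sup>2) * (7 / 2))"
  proof -
    have "2 * arctan R \<le> 7 / 2" using arctan_ubound[of R] pi_approx by simp
    thus ?thesis using B \<sigma> one_plus_square_pos[of R] by (intro mult_left_mono) auto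
  qed
  also have "\<dots> = 7 * B * mw \<sigma> (cmod p)"
  proof -
    have "b * s * e * (2 / d * (7 / 2)) = 7 * b * (s * e / d)" for b s e d :: real by simp
    thus ?thesis unfolding mw_def R_def by blast
  qed
  finally show ?thesis .
qed

text \<open>9 = 1 + 1 + 7: two products with a Dirac mass and one convolution. The factors
  \<open>eF\<close> and \<open>eG\<close> may depend on the imaginary part, since those of \<tau> p
  and (1 - \<tau>) p have the same sign and their absolute values add up to |Im p|.\<close>

lemma star_bound:
  assumes \<sigma>: "\<sigma> > 0"
    and F: "continuous_on (hstrip \<delta>) (\<lambda>q. F (Some q))" and G: "continuous_on (hstrip \<delta>) (\<lambda>q. G (Some q))"
    and x: "x \<in> hdom \<delta>"
    and bF: "\<And>y. y \<in> hdom \<delta> \<Longrightarrow> norm (F y) \<le> eF (imx y) * mm \<sigma> y"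
    and bG: "\<And>y. y \<in> hdom \<delta> \<Longrightarrow> norm (G y) \<le> eG (imx y) * mm \<sigma> y"
    and e: "\<And>s t. 0 \<le> s \<Longrightarrow> 0 \<le> t \<Longrightarrow> s + t = imx x \<Longrightarrow> eF s * eG t \<le> B"
  shows "norm (star F G x) \<le> 9 * B * mm \<sigma> x"
proof (cases x)
  case None
  have e0: "norm (F None) \<le> eF 0" "norm (G None) \<le> eG 0"
    using bF[of None] bG[of None] by (auto simp: mm_simps)
  have "norm (F None * G None) \<le> eF 0 * eG 0"
    unfolding norm_mult by (meson e0 mult_mono norm_ge_zero order_trans)
  also have "\<dots> \<le> B" using e[of 0 0] None by simp
  finally have 1: "norm (F None * G None) \<le> B" .
  moreover from this have "B \<ge> 0" using norm_ge_zero order_trans by blast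
  ultimately show ?thesis using None by (simp add: star_simps mm_simps)
next
  case (Some p)
  have p: "p \<in> hstrip \<delta>" using x Some by simp
  let ?m = "mw \<sigma> (cmod p)"
  have m: "?m > 0" by (rule mw_pos[OF \<sigma>])
  have key: "norm (F y) * norm (G z) \<le> B * mm \<sigma> y * mm \<sigma> z"
    if y: "y \<in> hdom \<delta>" and z: "z \<in> hdom \<delta>" and yz: "imx y + imx z = imx x" for y z
  proof -
    have nn: "imx y \<ge> 0" "imx z \<ge> 0" by (cases y; simp) (cases z; simp)
    have "norm (F y) * norm (G z) \<le> (eF (imx y) * mm \<sigma> y) * (eG (imx z) * mm \<sigma> z)"
      using bF[OF y] bG[OF z] by (intro mult_mono) (auto intro: order_trans[OF norm_ge_zero])
    also have "\<dots> = (eF (imx y) * eG (imx z)) * (mm \<sigma> y * mm \<sigma> z)" by simp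
    also have "\<dots> \<le> B * (mm \<sigma> y * mm \<sigma> z)"
      using e[OF nn yz] mm_pos[OF \<sigma>, of y] mm_pos[OF \<sigma>, of z] by (intro mult_right_mono) auto
    finally show ?thesis by simp
  qed
  have 1: "norm (F None * G (Some p)) \<le> B * ?m"
    using key[of None "Some p"] p Some by (simp add: mm_simps norm_mult)
  have 2: "norm (F (Some p) * G None) \<le> B * ?m"
    using key[of "Some p" None] p Some by (simp add: mm_simps norm_mult)
  have B: "B \<ge> 0" using 1 m by (meson norm_ge_zero order_trans zero_le_mult_iff not_less)
  have 3: "norm (pconv (\<lambda>q. F (Some q)) (\<lambda>q. G (Some q)) p) \<le> 7 * B * ?m"
  proof (rule pconv_bound[OF \<sigma> F G p B])
    fix \<tau> :: real assume t: "\<tau> \<in> {0..1}"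
    have "\<bar>\<tau> * Im p\<bar> + \<bar>(1 - \<tau>) * Im p\<bar> = \<bar>Im p\<bar>"
      using t unfolding abs_mult by (simp add: algebra_simps)
    moreover have "cmod (of_real \<tau> * p) = \<tau> * cmod p"
      using t by (simp add: norm_mult)
    moreover have "cmod (of_real (1 - \<tau>) * p) = (1 - \<tau>) * cmod p"
      using t by (simp only: norm_mult norm_of_real) auto
    moreover have "Im (of_real \<tau> * p) = \<tau> * Im p" "Im (of_real (1 - \<tau>) * p) = (1 - \<tau>) * Im p" by auto
    moreover have "of_real \<tau> * p \<in> hstrip \<delta>" "of_real (1 - \<tau>) * p \<in> hstrip \<delta>"
      using hstrip_scale[of \<tau> p \<delta>] hstrip_scale[of "1 - \<tau>" p \<delta>] t p by auto
    ultimately show "norm (F (Some (of_real \<tau> * p))) * norm (G (Some (of_real (1 - \<tau>) * p)))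
        \<le> B * mw \<sigma> (\<tau> * cmod p) * mw \<sigma> ((1 - \<tau>) * cmod p)"
      using key[of "Some (of_real \<tau> * p)" "Some (of_real (1 - \<tau>) * p)"] Some 
      by (simp only: mm_simps hdom_simps imx_simps)
  qed
  have "norm (star F G x) \<le> B * ?m + B * ?m + 7 * B * ?m"
    unfolding Some star_simps
    by (intro norm_triangle_le add_mono 1 2 3)
  thus ?thesis using Some by (simp add: mm_simps algebra_simps)
qed

text \<open>\<open>A\<close> is some bound for the weighted supremum norm on the strip, not the norm
  itself, which avoids suprema in all later estimates.\<close>

definition adm :: "real \<Rightarrow> real \<Rightarrow> real \<Rightarrow> (complex option \<Rightarrow> complex) \<Rightarrow> bool" where
  "adm \<delta> \<sigma> A F \<longleftrightarrow> (\<lambda>p. F (Some p)) holomorphic_on hstrip \<delta> \<and> (\<forall>x\<in>hdom \<delta>. norm (F x) \<le> A * mm \<sigma> x)"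

lemma star_holomorphic:
  assumes "(\<lambda>p. F (Some p)) holomorphic_on hstrip \<delta>" "(\<lambda>p. G (Some p)) holomorphic_on hstrip \<delta>"
  shows "(\<lambda>p. star F G (Some p)) holomorphic_on hstrip \<delta>"
  unfolding star_simps by (intro holomorphic_intros pconv_holomorphic assms)

lemma adm_star:
  assumes "\<sigma> > 0" "adm \<delta> \<sigma> A F" "adm \<delta> \<sigma> B G"
  shows "adm \<delta> \<sigma> (9 * (A * B)) (star F G)"
  unfolding adm_def
proof (intro conjI ballI)
  fix x assume "x \<in> hdom \<delta>"
  thus "norm (star F G x) \<le> 9 * (A * B) * mm \<sigma> x"
    using assms unfolding adm_def
    by (intro star_bound[where eF = "\<lambda>_. A" and eG = "\<lambda>_. B"]) (auto intro: holomorphic_on_imp_continuous_on)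
qed (use assms in \<open>auto simp: adm_def intro!: star_holomorphic\<close>)

lemma adm_add: "adm \<delta> \<sigma> A F \<Longrightarrow> adm \<delta> \<sigma> B G \<Longrightarrow> adm \<delta> \<sigma> (A + B) (\<lambda>x. F x + G x)"
  unfolding adm_def by (auto intro!: holomorphic_intros norm_triangle_le simp: distrib_right add_mono)

lemma adm_cmult: "adm \<delta> \<sigma> A F \<Longrightarrow> adm \<delta> \<sigma> (norm c * A) (\<lambda>x. c * F x)"
  unfolding adm_def by (auto intro!: holomorphic_intros mult_left_mono simp: norm_mult mult.assoc)

lemma continuous_mw: "continuous_on UNIV (\<lambda>p::complex. mw \<sigma> (cmod p))"
proof -
  have "1 + (\<sigma> * cmod p)\<^sup>2 \<noteq> 0" for p using one_plus_square_pos[of "\<sigma> * cmod p"] by linarith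
  thus ?thesis unfolding mw_def by (intro continuous_intros) auto
qed

lemma adm_infsum:
  fixes F :: "'i \<Rightarrow> complex option \<Rightarrow> complex"
  assumes F: "\<And>i. adm \<delta> \<sigma> (B i) (F i)" and B: "B summable_on UNIV"
  shows "adm \<delta> \<sigma> (infsum B UNIV) (\<lambda>x. infsum (\<lambda>i. F i x) UNIV)"
  unfolding adm_def
proof (intro conjI ballI)
  show "(\<lambda>p. infsum (\<lambda>i. F i (Some p)) UNIV) holomorphic_on hstrip \<delta>"
    by (rule holomorphic_on_infsum[OF open_hstrip _ _ B, where M = "\<lambda>p. mw \<sigma> (cmod p)"])
       (use F in \<open>auto simp: adm_def mm_simps Ball_hdom intro: continuous_on_subset[OF continuous_mw]\<close>)
  fix x assume x: "x \<in> hdom \<delta>"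
  have "norm (infsum (\<lambda>i. F i x) UNIV) \<le> infsum (\<lambda>i. B i * mm \<sigma> x) UNIV"
    using F x by (intro dominated_infsum_le summable_on_cmult_left B) (auto simp: adm_def)
  also have "\<dots> = infsum B UNIV * mm \<sigma> x" by (rule infsum_cmult_left) (use B in auto)
  finally show "norm (infsum (\<lambda>i. F i x) UNIV) \<le> infsum B UNIV * mm \<sigma> x" .
qed

declare split_paired_All [simp del]

section \<open>Weighted families of Fourier modes\<close>

definition nn :: "int \<times> int \<Rightarrow> real" where
  "nn \<nu> = of_int (\<bar>fst \<nu>\<bar> + \<bar>snd \<nu>\<bar>)"

lemma nn_nonneg [simp]: "nn \<nu> \<ge> 0"
  by (simp add: nn_def)

lemma nn_triangle: "nn \<nu> \<le> nn \<mu> + nn (\<nu> - \<mu>)"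
  unfolding nn_def of_int_add[symmetric] of_int_le_iff by (simp add: fst_diff snd_diff)

lemma nn_uminus [simp]: "nn (- \<nu>) = nn \<nu>"
  by (simp add: nn_def)

text \<open>The purely exponential weight exp(- \<xi> |\<nu>|) is not closed under convolution on
  the lattice: the sum picks up a power of |\<nu>|. This summable factor repairs it, by
  \<open>qq_conv\<close>.\<close>

definition qq :: "int \<times> int \<Rightarrow> real" where
  "qq \<nu> = 1 / ((1 + (of_int (fst \<nu>))\<^sup>2) * (1 + (of_int (snd \<nu>))\<^sup>2))"

lemma qq_pos: "qq \<nu> > 0"
  unfolding qq_def by (intro divide_pos_pos mult_pos_pos one_plus_square_pos) auto

lemma qq_uminus [simp]: "qq (- \<nu>) = qq \<nu>"
  by (simp add: qq_def)

lemma summable_on_int_inverse_squares: "(\<lambda>n::int. 1 / (1 + (of_int n)\<^sup>2 :: real)) summable_on UNIV"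
proof -
  have "summable (\<lambda>n. 1 / (1 + (real n)\<^sup>2))"
  proof (rule summable_comparison_test[OF exI[of _ 1]])
    show "summable (\<lambda>n. inverse ((real n)\<^sup>2))" using inverse_power_summable[of 2, where 'a = real] by simp
    show "\<forall>n\<ge>1. norm (1 / (1 + (real n)\<^sup>2)) \<le> inverse ((real n)\<^sup>2)"
      by (auto simp: divide_simps add_pos_nonneg)
  qed
  hence s: "(\<lambda>n. 1 / (1 + (real n)\<^sup>2)) summable_on UNIV"
    by (subst summable_on_UNIV_nonneg_real_iff) auto
  have "(\<lambda>n::int. 1 / (1 + (of_int n)\<^sup>2 :: real)) summable_on range int"
    using s by (subst summable_on_reindex) (auto simp: o_def)
  moreover have "(\<lambda>n::int. 1 / (1 + (of_int n)\<^sup>2 :: real)) summable_on range (\<lambda>n. - int n)"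
    using s by (subst summable_on_reindex) (auto simp: o_def inj_on_def)
  ultimately have "(\<lambda>n::int. 1 / (1 + (of_int n)\<^sup>2 :: real)) summable_on range int \<union> range (\<lambda>n. - int n)"
    by (rule summable_on_union)
  moreover have "range int \<union> range (\<lambda>n. - int n) = UNIV"
  proof -
    have "x \<in> range int \<union> range (\<lambda>n. - int n)" for x by (cases x rule: int_cases2) auto
    thus ?thesis by blast
  qed
  ultimately show ?thesis by simp
qed

lemma qq_summable: "qq summable_on UNIV"
proof -
  define h where "h = (\<lambda>n::int. 1 / (1 + (of_int n)\<^sup>2 :: real))"
  have h: "h summable_on UNIV" unfolding h_def by (rule summable_on_int_inverse_squares)
  have hp: "h n \<ge> 0" for n using one_plus_square_pos[of "of_int n"] by (simp add: h_def less_imp_le)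
  have "(\<lambda>\<nu>. h (fst \<nu>) * h (snd \<nu>)) summable_on (UNIV \<times> UNIV)"
  proof (rule summable_on_SigmaI)
    show "((\<lambda>y. h (fst (x, y)) * h (snd (x, y))) has_sum (h x * infsum h UNIV)) UNIV" for x
      using has_sum_cmult_right[OF has_sum_infsum[OF h], of "h x"] by simp
    show "(\<lambda>x. h x * infsum h UNIV) summable_on UNIV" by (rule summable_on_cmult_left[OF h])
  qed (use hp in auto)
  thus ?thesis by (simp add: qq_def[abs_def] h_def)
qed

definition sq :: real where "sq = infsum qq UNIV"

lemma sq_pos: "sq > 0"
proof -
  have "qq 0 \<le> sq"
    using finite_sum_le_infsum[OF qq_summable, of "{0}"] qq_pos less_imp_le by (auto simp: sq_def)
  thus ?thesis using qq_pos[of 0] by simp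
qed

text \<open>\<open>inverse_square_product_le\<close> in both coordinates bounds the summand by
  \<open>4 * qq \<nu>\<close> times four terms, each of them \<open>qq\<close> after a bijection of
  the lattice: the identity, or a reflection in one or both coordinates. Hence 16 = 4 * 4.\<close>

lemma qq_conv:
  shows "(\<lambda>\<mu>. qq \<mu> * qq (\<nu> - \<mu>)) summable_on UNIV"
    and "infsum (\<lambda>\<mu>. qq \<mu> * qq (\<nu> - \<mu>)) UNIV \<le> 16 * sq * qq \<nu>"
proof -
  have bij: "bij (\<lambda>\<mu>. \<nu> - \<mu>)"
    by (rule o_bij[where g = "\<lambda>\<mu>. \<nu> - \<mu>"]) auto
  have bij1: "bij (\<lambda>\<mu>. (fst \<mu>, snd \<nu> - snd \<mu>))"
    by (rule o_bij[where g = "\<lambda>\<mu>. (fst \<mu>, snd \<nu> - snd \<mu>)"]) auto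
  have bij2: "bij (\<lambda>\<mu>. (fst \<nu> - fst \<mu>, snd \<mu>))"
    by (rule o_bij[where g = "\<lambda>\<mu>. (fst \<nu> - fst \<mu>, snd \<mu>)"]) auto
  have hs: "((\<lambda>\<mu>. qq (f \<mu>)) has_sum sq) UNIV" if "bij f" for f
    using has_sum_reindex_bij_betw[OF that, of qq sq] has_sum_infsum[OF qq_summable] by (simp add: sq_def)
  define g where "g = (\<lambda>\<mu>. 4 * qq \<nu> * (qq \<mu> + qq (fst \<mu>, snd \<nu> - snd \<mu>)
      + qq (fst \<nu> - fst \<mu>, snd \<mu>) + qq (\<nu> - \<mu>)))"
  have g: "(g has_sum 4 * qq \<nu> * (sq + sq + sq + sq)) UNIV"
    unfolding g_def using hs[OF bij] hs[OF bij1] hs[OF bij2] hs[OF bij_id]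
    by (intro has_sum_cmult_right has_sum_add) auto
  have le: "norm (qq \<mu> * qq (\<nu> - \<mu>)) \<le> g \<mu>" for \<mu>
  proof -
    let ?h = "\<lambda>x::real. 1 / (1 + x\<^sup>2)"
    let ?a = "of_int (fst \<mu>) :: real" and ?b = "of_int (fst \<nu> - fst \<mu>) :: real"
      and ?c = "of_int (snd \<mu>) :: real" and ?d = "of_int (snd \<nu> - snd \<mu>) :: real"
    have hp: "?h x \<ge> 0" for x using one_plus_square_pos[of x] by (simp add: less_imp_le)
    have "norm (qq \<mu> * qq (\<nu> - \<mu>)) = (1 / ((1 + ?a\<^sup>2) * (1 + ?b\<^sup>2))) * (1 / ((1 + ?c\<^sup>2) * (1 + ?d\<^sup>2)))"
      using qq_pos[of \<mu>] qq_pos[of "\<nu> - \<mu>"] by (simp add: qq_def mult_ac)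
    also have "\<dots> \<le> (2 / (1 + (?a + ?b)\<^sup>2) * (?h ?a + ?h ?b)) * (2 / (1 + (?c + ?d)\<^sup>2) * (?h ?c + ?h ?d))"
      using one_plus_square_pos[of ?a] one_plus_square_pos[of ?b] one_plus_square_pos[of ?c]
        one_plus_square_pos[of ?d] hp one_plus_square_pos[of "?a + ?b"]
      by (intro mult_mono inverse_square_product_le mult_nonneg_nonneg add_nonneg_nonneg)
         (auto intro!: divide_nonneg_nonneg mult_nonneg_nonneg less_imp_le)
    also have "\<dots> = 4 * (?h (?a + ?b) * ?h (?c + ?d)) * ((?h ?a + ?h ?b) * (?h ?c + ?h ?d))"
    proof -
      have "(2 / s * X) * (2 / t * Y) = 4 * (1 / s * (1 / t)) * (X * Y)" for s t X Y :: real by simp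
      thus ?thesis by blast
    qed
    also have "\<dots> = g \<mu>"
    proof -
      define h where "h = ?h"
      have 1: "qq \<mu> = h (of_int (fst \<mu>)) * h (of_int (snd \<mu>))" for \<mu> by (simp add: qq_def h_def)
      have 2: "1 / (1 + x\<^sup>2) = h x" for x by (simp add: h_def)
      show ?thesis unfolding g_def 1 2 by (simp add: algebra_simps)
    qed
    finally show ?thesis .
  qed
  show "(\<lambda>\<mu>. qq \<mu> * qq (\<nu> - \<mu>)) summable_on UNIV"
    using dominated_summable[OF le has_sum_imp_summable[OF g]] by simp
  have "norm (infsum (\<lambda>\<mu>. qq \<mu> * qq (\<nu> - \<mu>)) UNIV) \<le> infsum g UNIV"
    using dominated_infsum_le[OF le has_sum_imp_summable[OF g]] by simp
  thus "infsum (\<lambda>\<mu>. qq \<mu> * qq (\<nu> - \<mu>)) UNIV \<le> 16 * sq * qq \<nu>"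
    unfolding infsumI[OF g] by (simp add: algebra_simps)
qed

section \<open>Bilinearity and conjugation symmetry of the products\<close>

lemma infsum_diff:
  fixes f g :: "'i \<Rightarrow> 'a::banach"
  assumes "f summable_on I" "g summable_on I"
  shows "infsum (\<lambda>i. f i - g i) I = infsum f I - infsum g I"
  using infsum_add[of f I "\<lambda>i. - g i"] assms by (simp add: infsum_uminus summable_on_uminus)

lemma pconv_integrable:
  assumes "continuous_on (hstrip \<delta>) F" "continuous_on (hstrip \<delta>) G" "p \<in> hstrip \<delta>"
  shows "(\<lambda>\<tau>. p * F (of_real \<tau> * p) * G (of_real (1 - \<tau>) * p)) integrable_on cbox 0 (1::real)"
  by (rule integrable_continuous[OF pconv_continuous[OF assms]])

definition contx :: "real \<Rightarrow> (complex option \<Rightarrow> complex) \<Rightarrow> bool" where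
  "contx \<delta> F \<longleftrightarrow> continuous_on (hstrip \<delta>) (\<lambda>p. F (Some p))"

lemma star_diff:
  assumes x: "x \<in> hdom \<delta>" and c: "contx \<delta> F" "contx \<delta> G" "contx \<delta> F'" "contx \<delta> G'"
  shows "star F G x - star F' G' x = star (\<lambda>y. F y - F' y) G x + star F' (\<lambda>y. G y - G' y) x"
proof (cases x)
  case (Some p)
  have p: "p \<in> hstrip \<delta>" using x Some by simp
  note c = c[unfolded contx_def]
  have i: "(\<lambda>\<tau>. p * (F (Some (of_real \<tau> * p)) - F' (Some (of_real \<tau> * p))) * G (Some (of_real (1 - \<tau>) * p))) integrable_on cbox 0 (1::real)"
    by (rule pconv_integrable[of \<delta> "\<lambda>p. F (Some p) - F' (Some p)" "\<lambda>p. G (Some p)"]) (intro continuous_intros c p)+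
  have j: "(\<lambda>\<tau>. p * F' (Some (of_real \<tau> * p)) * (G (Some (of_real (1 - \<tau>) * p)) - G' (Some (of_real (1 - \<tau>) * p)))) integrable_on cbox 0 (1::real)"
    by (rule pconv_integrable[of \<delta> "\<lambda>p. F' (Some p)" "\<lambda>p. G (Some p) - G' (Some p)"]) (intro continuous_intros c p)+
  show ?thesis
    unfolding Some star_simps pconv_def
    using integral_diff[OF pconv_integrable[OF c(1,2) p] pconv_integrable[OF c(3,4) p]] integral_add[OF i j]
    by (simp add: algebra_simps)
qed (simp add: star_simps algebra_simps)

lemma star_cong:
  assumes x: "x \<in> hdom \<delta>" and F: "\<And>y. y \<in> hdom \<delta> \<Longrightarrow> F y = F' y" and G: "\<And>y. y \<in> hdom \<delta> \<Longrightarrow> G y = G' y"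
  shows "star F G x = star F' G' x"
proof (cases x)
  case (Some p)
  have p: "p \<in> hstrip \<delta>" using x Some by simp
  have "of_real \<tau> * p \<in> hstrip \<delta>" "of_real (1 - \<tau>) * p \<in> hstrip \<delta>" if "\<tau> \<in> cbox 0 1" for \<tau>
    using hstrip_scale[of \<tau> p \<delta>] hstrip_scale[of "1 - \<tau>" p \<delta>] that p by auto
  hence "pconv (\<lambda>q. F (Some q)) (\<lambda>q. G (Some q)) p = pconv (\<lambda>q. F' (Some q)) (\<lambda>q. G' (Some q)) p"
    unfolding pconv_def by (intro integral_cong) (simp add: F G)
  thus ?thesis using p Some by (simp add: star_simps F G)
qed (simp add: star_simps F G)

lemma map_cnj_hdom: "x \<in> hdom \<delta> \<Longrightarrow> map_option cnj x \<in> hdom \<delta>"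
  by (auto simp: hdom_def hstrip_def)

lemma map_cnj_map_cnj [simp]: "map_option cnj (map_option cnj x) = x"
  by (cases x) auto

lemma star_cnj: "star (\<lambda>y. cnj (F (map_option cnj y))) (\<lambda>y. cnj (G (map_option cnj y))) x
    = cnj (star F G (map_option cnj x))"
proof (cases x)
  case (Some p)
  have "pconv (\<lambda>q. cnj (F (Some (cnj q)))) (\<lambda>q. cnj (G (Some (cnj q)))) p
      = cnj (pconv (\<lambda>q. F (Some q)) (\<lambda>q. G (Some q)) (cnj p))"
    unfolding pconv_def integral_cnj by simp
  thus ?thesis using Some by (simp add: star_simps)
qed (simp add: star_simps)

text \<open>Reality seen from the Borel plane: it makes the sum of the Fourier series real after any
  functional that commutes with conjugation, as \<open>ev_real\<close> shows.\<close>

definition fsym :: "real \<Rightarrow> (int \<times> int \<Rightarrow> complex option \<Rightarrow> complex) \<Rightarrow> bool" where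
  "fsym \<delta> Z \<longleftrightarrow> (\<forall>\<nu>. \<forall>x\<in>hdom \<delta>. Z (- \<nu>) x = cnj (Z \<nu> (map_option cnj x)))"

text \<open>A convolution in \<nu> and in p at once, which represents the product of two functions
  of t and \<epsilon>.\<close>

definition fmul :: "(int \<times> int \<Rightarrow> complex option \<Rightarrow> complex) \<Rightarrow> (int \<times> int \<Rightarrow> complex option \<Rightarrow> complex)
    \<Rightarrow> int \<times> int \<Rightarrow> complex option \<Rightarrow> complex" where
  "fmul Z Y \<nu> x = infsum (\<lambda>\<mu>. star (Z \<mu>) (Y (\<nu> - \<mu>)) x) UNIV"

lemma fsym_star:
  assumes "fsym \<delta> Z" "fsym \<delta> Y" "x \<in> hdom \<delta>"
  shows "star (Z (- \<mu>)) (Y (- \<nu>)) x = cnj (star (Z \<mu>) (Y \<nu>) (map_option cnj x))"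
  unfolding star_cnj[symmetric] using assms(1,2) unfolding fsym_def
  by (intro star_cong[OF assms(3)]) blast+

lemma fsym_mul:
  assumes "fsym \<delta> Z" "fsym \<delta> Y"
  shows "fsym \<delta> (fmul Z Y)"
  unfolding fsym_def
proof (intro allI ballI)
  fix \<nu> x assume x: "x \<in> hdom \<delta>"
  have "fmul Z Y (- \<nu>) x = infsum (\<lambda>\<mu>. star (Z (- \<mu>)) (Y (- \<nu> - (- \<mu>))) x) UNIV"
    unfolding fmul_def
    by (rule infsum_reindex_bij_witness[where i = uminus and j = uminus]) auto
  also have "\<dots> = infsum (\<lambda>\<mu>. cnj (star (Z \<mu>) (Y (\<nu> - \<mu>)) (map_option cnj x))) UNIV"
    using fsym_star[OF assms x, of _ "\<nu> - _"] by (intro infsum_cong) (simp add: algebra_simps)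
  also have "\<dots> = cnj (fmul Z Y \<nu> (map_option cnj x))" by (simp add: fmul_def)
  finally show "fmul Z Y (- \<nu>) x = cnj (fmul Z Y \<nu> (map_option cnj x))" .
qed

text \<open>A Fourier multiplier: each mode is multiplied by a function of \<epsilon> of its
  own.\<close>

definition smul :: "(int \<times> int \<Rightarrow> complex option \<Rightarrow> complex) \<Rightarrow> (int \<times> int \<Rightarrow> complex option \<Rightarrow> complex)
    \<Rightarrow> int \<times> int \<Rightarrow> complex option \<Rightarrow> complex" where
  "smul k Y \<nu> = star (k \<nu>) (Y \<nu>)"

lemma fsym_smul: "fsym \<delta> k \<Longrightarrow> fsym \<delta> Y \<Longrightarrow> fsym \<delta> (smul k Y)"
  using fsym_star unfolding fsym_def smul_def by blast

text \<open>\<open>kappa_delta\<close> leaves a rate of decay in \<nu> of at least \<xi> / 2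
  everywhere in the strip.\<close>

locale borel_weights =
  fixes \<sigma> \<delta> \<xi> \<kappa> :: real
  assumes sigma: "\<sigma> \<ge> 1" and delta: "\<delta> > 0" and kappa: "\<kappa> \<ge> 0" and xi: "\<xi> > 0" and kappa_delta: "\<kappa> * \<delta> \<le> \<xi> / 2"
begin

lemma sigma_pos: "\<sigma> > 0" using sigma by linarith

text \<open>
  The factors \<open>exp (- \<i> \<Omega>\<^sub>\<nu> p)\<close> of the resolvent grow like \<open>exp (\<kappa> \<bar>Im p\<bar> \<bar>\<nu>\<bar>)\<close>; a rate of decay in \<open>\<nu>\<close> that
  shrinks linearly in \<open>\<bar>Im p\<bar>\<close> absorbs them, because imaginary parts add up under convolution.
\<close>

definition ew :: "int \<times> int \<Rightarrow> real \<Rightarrow> real" where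
  "ew \<nu> s = exp (- (\<xi> - \<kappa> * s) * nn \<nu>)"

definition wt :: "int \<times> int \<Rightarrow> complex option \<Rightarrow> real" where
  "wt \<nu> x = qq \<nu> * ew \<nu> (imx x) * mm \<sigma> x"

lemma wt_pos: "wt \<nu> x > 0"
  unfolding wt_def ew_def using qq_pos mm_pos[OF sigma_pos] by (intro mult_pos_pos) auto

definition fam :: "real \<Rightarrow> (int \<times> int \<Rightarrow> complex option \<Rightarrow> complex) \<Rightarrow> bool" where
  "fam A Z \<longleftrightarrow> (\<forall>\<nu>. (\<lambda>p. Z \<nu> (Some p)) holomorphic_on hstrip \<delta> \<and> (\<forall>x\<in>hdom \<delta>. norm (Z \<nu> x) \<le> A * wt \<nu> x))"

lemma famD: "fam A Z \<Longrightarrow> x \<in> hdom \<delta> \<Longrightarrow> norm (Z \<nu> x) \<le> A * wt \<nu> x"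
  unfolding fam_def by blast

lemma fam_holomorphic: "fam A Z \<Longrightarrow> (\<lambda>p. Z \<nu> (Some p)) holomorphic_on hstrip \<delta>"
  unfolding fam_def by blast

lemma fam_contx: "fam A Z \<Longrightarrow> contx \<delta> (Z \<nu>)"
  unfolding contx_def by (intro holomorphic_on_imp_continuous_on fam_holomorphic)

lemma fam_nonneg: "fam A Z \<Longrightarrow> A \<ge> 0"
  using famD[of A Z None 0] wt_pos[of 0 None] 
  by (metis hdom_simps(1) norm_ge_zero order_trans zero_le_mult_iff not_less)

lemma fam_mono: "fam A Z \<Longrightarrow> A \<le> B \<Longrightarrow> fam B Z"
  unfolding fam_def by (meson less_imp_le mult_right_mono order_trans wt_pos)

lemma fam_cong: "fam A Z \<Longrightarrow> (\<And>\<nu> x. x \<in> hdom \<delta> \<Longrightarrow> Z \<nu> x = Z' \<nu> x) \<Longrightarrow> fam A Z'"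
  unfolding fam_def Ball_hdom
  by (metis (no_types, lifting) hdom_simps holomorphic_cong)

lemma fam_add: "fam A Z \<Longrightarrow> fam B Y \<Longrightarrow> fam (A + B) (\<lambda>\<nu> x. Z \<nu> x + Y \<nu> x)"
  unfolding fam_def by (auto intro!: holomorphic_intros norm_triangle_le simp: distrib_right add_mono)

lemma fam_diff: "fam A Z \<Longrightarrow> fam B Y \<Longrightarrow> fam (A + B) (\<lambda>\<nu> x. Z \<nu> x - Y \<nu> x)"
  unfolding fam_def by (auto intro!: holomorphic_intros norm_triangle_le_diff simp: distrib_right add_mono)

lemma fam_cmult: "fam A Z \<Longrightarrow> fam (norm c * A) (\<lambda>\<nu> x. c * Z \<nu> x)"
  unfolding fam_def by (auto intro!: holomorphic_intros mult_left_mono simp: norm_mult mult.assoc)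

lemma fam_uminus: "fam A Z \<Longrightarrow> fam A (\<lambda>\<nu> x. - Z \<nu> x)"
  unfolding fam_def by (auto intro!: holomorphic_intros)

lemma imx_less: "x \<in> hdom \<delta> \<Longrightarrow> imx x < \<delta>"
  using delta by (cases x) (auto simp: hstrip_def)

lemma xi_kappa: "s < \<delta> \<Longrightarrow> \<xi> - \<kappa> * s \<ge> \<xi> / 2"
  using mult_left_mono[of s \<delta> \<kappa>] kappa kappa_delta by simp

text \<open>Each factor alone decays at least at the rate \<xi> - \<kappa> (s + t), which is
  nonnegative inside the strip, so the triangle inequality for |\<nu>| applies.\<close>

lemma ew_mult:
  assumes "0 \<le> s" "0 \<le> t" "s + t < \<delta>"
  shows "ew \<mu> s * ew (\<nu> - \<mu>) t \<le> ew \<nu> (s + t)"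
proof -
  have k: "\<xi> - \<kappa> * (s + t) \<ge> 0" using xi_kappa[OF assms(3)] xi by linarith
  have "(\<xi> - \<kappa> * (s + t)) * nn \<nu> \<le> (\<xi> - \<kappa> * (s + t)) * nn \<mu> + (\<xi> - \<kappa> * (s + t)) * nn (\<nu> - \<mu>)"
    using mult_left_mono[OF nn_triangle[of \<nu> \<mu>] k] by (simp add: distrib_left)
  also have "\<dots> \<le> (\<xi> - \<kappa> * s) * nn \<mu> + (\<xi> - \<kappa> * t) * nn (\<nu> - \<mu>)"
    using assms kappa by (intro add_mono mult_right_mono diff_left_mono mult_left_mono) auto
  finally have "- (\<xi> - \<kappa> * s) * nn \<mu> + - (\<xi> - \<kappa> * t) * nn (\<nu> - \<mu>) \<le> - (\<xi> - \<kappa> * (s + t)) * nn \<nu>"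
    unfolding mult_minus_left by linarith
  thus ?thesis unfolding ew_def exp_add[symmetric] exp_le_cancel_iff .
qed

lemma continuous_wt: "continuous_on UNIV (\<lambda>p. wt \<nu> (Some p))"
  unfolding wt_def ew_def imx_simps mm_simps by (intro continuous_intros continuous_mw)

lemma fam_infsum:
  assumes F: "\<And>i. fam (B i) (F i)" and B: "B summable_on UNIV"
  shows "fam (infsum B UNIV) (\<lambda>\<nu> x. infsum (\<lambda>i. F i \<nu> x) UNIV)"
  unfolding fam_def
proof (intro conjI ballI allI)
  fix \<nu>
  show "(\<lambda>p. infsum (\<lambda>i. F i \<nu> (Some p)) UNIV) holomorphic_on hstrip \<delta>"
    by (rule holomorphic_on_infsum[OF open_hstrip _ _ B, where M = "\<lambda>p. wt \<nu> (Some p)"])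
       (use fam_holomorphic[OF F] famD[OF F] in \<open>auto intro: continuous_on_subset[OF continuous_wt]\<close>)
  fix x assume x: "x \<in> hdom \<delta>"
  have "norm (infsum (\<lambda>i. F i \<nu> x) UNIV) \<le> infsum (\<lambda>i. B i * wt \<nu> x) UNIV"
    by (intro dominated_infsum_le summable_on_cmult_left B famD[OF F x])
  also have "\<dots> = infsum B UNIV * wt \<nu> x" by (rule infsum_cmult_left) (use B in auto)
  finally show "norm (infsum (\<lambda>i. F i \<nu> x) UNIV) \<le> infsum B UNIV * wt \<nu> x" .
qed

text \<open>144 = 9 * 16, from \<open>star_bound\<close> and \<open>qq_conv\<close>.\<close>

definition Ka :: real where "Ka = 144 * sq"

lemma Ka_pos: "Ka > 0" using sq_pos by (simp add: Ka_def)

lemma star_mode_bound: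
  assumes Z: "fam A Z" and Y: "fam B Y" and x: "x \<in> hdom \<delta>"
  shows "norm (star (Z \<mu>) (Y (\<nu> - \<mu>)) x) \<le> 9 * A * B * (qq \<mu> * qq (\<nu> - \<mu>)) * (ew \<nu> (imx x) * mm \<sigma> x)"
proof -
  have "norm (star (Z \<mu>) (Y (\<nu> - \<mu>)) x) \<le> 9 * (A * B * (qq \<mu> * qq (\<nu> - \<mu>)) * ew \<nu> (imx x)) * mm \<sigma> x"
  proof (rule star_bound[OF sigma_pos _ _ x,
        where eF = "\<lambda>s. A * (qq \<mu> * ew \<mu> s)" and eG = "\<lambda>s. B * (qq (\<nu> - \<mu>) * ew (\<nu> - \<mu>) s)"])
    fix s t :: real assume st: "0 \<le> s" "0 \<le> t" "s + t = imx x"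
    have "ew \<mu> s * ew (\<nu> - \<mu>) t \<le> ew \<nu> (imx x)"
      using ew_mult[of s t \<mu> \<nu>] st imx_less[OF x] by simp
    hence "(A * B * (qq \<mu> * qq (\<nu> - \<mu>))) * (ew \<mu> s * ew (\<nu> - \<mu>) t) \<le> (A * B * (qq \<mu> * qq (\<nu> - \<mu>))) * ew \<nu> (imx x)"
      using fam_nonneg[OF Z] fam_nonneg[OF Y] qq_pos[of \<mu>] qq_pos[of "\<nu> - \<mu>"]
      by (intro mult_left_mono) auto
    thus "A * (qq \<mu> * ew \<mu> s) * (B * (qq (\<nu> - \<mu>) * ew (\<nu> - \<mu>) t)) \<le> A * B * (qq \<mu> * qq (\<nu> - \<mu>)) * ew \<nu> (imx x)"
      by (simp add: mult_ac)
  next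
    show "continuous_on (hstrip \<delta>) (\<lambda>q. Z \<mu> (Some q))" "continuous_on (hstrip \<delta>) (\<lambda>q. Y (\<nu> - \<mu>) (Some q))"
      using fam_contx[OF Z] fam_contx[OF Y] by (auto simp: contx_def)
    fix y assume y: "y \<in> hdom \<delta>"
    show "norm (Z \<mu> y) \<le> A * (qq \<mu> * ew \<mu> (imx y)) * mm \<sigma> y"
      "norm (Y (\<nu> - \<mu>) y) \<le> B * (qq (\<nu> - \<mu>) * ew (\<nu> - \<mu>) (imx y)) * mm \<sigma> y"
      using famD[OF Z y, of \<mu>] famD[OF Y y, of "\<nu> - \<mu>"] by (simp_all add: wt_def mult_ac)
  qed
  thus ?thesis by (simp add: mult_ac)
qed

lemma fmul_summable:
  assumes Z: "fam A Z" and Y: "fam B Y" and x: "x \<in> hdom \<delta>"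
  shows "(\<lambda>\<mu>. star (Z \<mu>) (Y (\<nu> - \<mu>)) x) summable_on UNIV"
  by (rule dominated_summable[OF star_mode_bound[OF assms]])
     (intro summable_on_cmult_left summable_on_cmult_right qq_conv)

lemma fam_mul:
  assumes Z: "fam A Z" and Y: "fam B Y"
  shows "fam (Ka * (A * B)) (fmul Z Y)"
  unfolding fam_def
proof (intro conjI ballI allI)
  fix \<nu>
  note b = star_mode_bound[OF Z Y]
  show "(\<lambda>p. fmul Z Y \<nu> (Some p)) holomorphic_on hstrip \<delta>"
    unfolding fmul_def
  proof (rule holomorphic_on_infsum[OF open_hstrip])
    show "(\<lambda>p. star (Z \<mu>) (Y (\<nu> - \<mu>)) (Some p)) holomorphic_on hstrip \<delta>" for \<mu>
      by (intro star_holomorphic fam_holomorphic[OF Z] fam_holomorphic[OF Y])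
    show "cmod (star (Z \<mu>) (Y (\<nu> - \<mu>)) (Some p)) \<le> 9 * A * B * (qq \<mu> * qq (\<nu> - \<mu>)) * (ew \<nu> \<bar>Im p\<bar> * mw \<sigma> (cmod p))"
      if "p \<in> hstrip \<delta>" for \<mu> p
      using b[of "Some p" \<mu> \<nu>] that by (simp add: mm_simps)
    show "(\<lambda>\<mu>. 9 * A * B * (qq \<mu> * qq (\<nu> - \<mu>))) summable_on UNIV"
      by (intro summable_on_cmult_right qq_conv)
    show "continuous_on (hstrip \<delta>) (\<lambda>p. ew \<nu> \<bar>Im p\<bar> * mw \<sigma> (cmod p))"
      unfolding ew_def by (intro continuous_intros continuous_on_subset[OF continuous_mw]) auto
  qed
  fix x assume x: "x \<in> hdom \<delta>"
  have "norm (fmul Z Y \<nu> x) \<le> infsum (\<lambda>\<mu>. 9 * A * B * (qq \<mu> * qq (\<nu> - \<mu>)) * (ew \<nu> (imx x) * mm \<sigma> x)) UNIV"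
    unfolding fmul_def
    by (rule dominated_infsum_le[OF b[OF x]]) (intro summable_on_cmult_left summable_on_cmult_right qq_conv)
  also have "\<dots> = 9 * A * B * infsum (\<lambda>\<mu>. qq \<mu> * qq (\<nu> - \<mu>)) UNIV * (ew \<nu> (imx x) * mm \<sigma> x)"
    by (simp add: infsum_cmult_left' infsum_cmult_right')
  also have "\<dots> \<le> 9 * A * B * (16 * sq * qq \<nu>) * (ew \<nu> (imx x) * mm \<sigma> x)"
    using fam_nonneg[OF Z] fam_nonneg[OF Y] mm_pos[OF sigma_pos, of x]
    by (intro mult_right_mono mult_left_mono qq_conv) (auto simp: ew_def)
  also have "\<dots> = Ka * (A * B) * wt \<nu> x" by (simp add: Ka_def wt_def)
  finally show "norm (fmul Z Y \<nu> x) \<le> Ka * (A * B) * wt \<nu> x" .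
qed

lemma fmul_diff:
  assumes "fam A Z" "fam A' Z'" "fam B Y" "fam B' Y'"
    and dZ: "fam d (\<lambda>\<nu> x. Z \<nu> x - Z' \<nu> x)" and dY: "fam d' (\<lambda>\<nu> x. Y \<nu> x - Y' \<nu> x)"
  shows "fam (Ka * (d * B + A' * d')) (\<lambda>\<nu> x. fmul Z Y \<nu> x - fmul Z' Y' \<nu> x)"
proof -
  have "fam (Ka * (d * B) + Ka * (A' * d'))
     (\<lambda>\<nu> x. fmul (\<lambda>\<nu> x. Z \<nu> x - Z' \<nu> x) Y \<nu> x + fmul Z' (\<lambda>\<nu> x. Y \<nu> x - Y' \<nu> x) \<nu> x)"
    by (intro fam_add fam_mul assms)
  hence "fam (Ka * (d * B) + Ka * (A' * d')) (\<lambda>\<nu> x. fmul Z Y \<nu> x - fmul Z' Y' \<nu> x)"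
  proof (rule fam_cong)
    fix \<nu> x assume x: "x \<in> hdom \<delta>"
    show "fmul (\<lambda>\<nu> x. Z \<nu> x - Z' \<nu> x) Y \<nu> x + fmul Z' (\<lambda>\<nu> x. Y \<nu> x - Y' \<nu> x) \<nu> x
       = fmul Z Y \<nu> x - fmul Z' Y' \<nu> x"
    proof -
      note sm = fmul_summable[OF dZ assms(3) x] fmul_summable[OF assms(2) dY x]
        fmul_summable[OF assms(1,3) x] fmul_summable[OF assms(2,4) x]
      show ?thesis
        unfolding fmul_def infsum_add[OF sm(1,2), symmetric] infsum_diff[OF sm(3,4), symmetric]
        by (intro infsum_cong star_diff[OF x fam_contx fam_contx fam_contx fam_contx, symmetric]) (rule assms)+
    qed
  qed
  thus ?thesis by (simp add: distrib_left)
qed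

definition kerb :: "real \<Rightarrow> (int \<times> int \<Rightarrow> complex option \<Rightarrow> complex) \<Rightarrow> bool" where
  "kerb c k \<longleftrightarrow> (\<forall>\<nu>. (\<lambda>p. k \<nu> (Some p)) holomorphic_on hstrip \<delta> \<and>
     (\<forall>x\<in>hdom \<delta>. norm (k \<nu> x) \<le> c * exp (\<kappa> * imx x * nn \<nu>) * mm \<sigma> x))"

lemma kerb_contx: "kerb c k \<Longrightarrow> contx \<delta> (k \<nu>)"
  unfolding kerb_def contx_def by (blast intro: holomorphic_on_imp_continuous_on)

lemma kerbD: "kerb c k \<Longrightarrow> x \<in> hdom \<delta> \<Longrightarrow> norm (k \<nu> x) \<le> c * exp (\<kappa> * imx x * nn \<nu>) * mm \<sigma> x"
  unfolding kerb_def by blast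

lemma kerb_holomorphic: "kerb c k \<Longrightarrow> (\<lambda>p. k \<nu> (Some p)) holomorphic_on hstrip \<delta>"
  unfolding kerb_def by blast

lemma kerb_nonneg: "kerb c k \<Longrightarrow> c \<ge> 0"
  using kerbD[of c k None 0] order_trans[OF norm_ge_zero] by (fastforce simp: mm_simps)

text \<open>Multiplication by exp(\<kappa> s |\<nu>|) turns \<open>ew \<nu> t\<close> into exactly
  \<open>ew \<nu> (s + t)\<close>, so the growth allowed in \<open>kerb\<close> costs no decay in
  \<nu>.\<close>

lemma fam_smul:
  assumes k: "kerb c k" and Y: "fam A Y"
  shows "fam (9 * c * A) (smul k Y)"
  unfolding fam_def smul_def
proof (intro conjI ballI allI)
  fix \<nu>
  show "(\<lambda>p. star (k \<nu>) (Y \<nu>) (Some p)) holomorphic_on hstrip \<delta>"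
    by (intro star_holomorphic fam_holomorphic[OF Y] kerb_holomorphic[OF k])
  fix x assume x: "x \<in> hdom \<delta>"
  have "norm (star (k \<nu>) (Y \<nu>) x) \<le> 9 * (c * A * qq \<nu> * ew \<nu> (imx x)) * mm \<sigma> x"
  proof (rule star_bound[OF sigma_pos _ _ x,
        where eF = "\<lambda>s. c * exp (\<kappa> * s * nn \<nu>)" and eG = "\<lambda>s. A * (qq \<nu> * ew \<nu> s)"])
    fix s t :: real assume st: "0 \<le> s" "0 \<le> t" "s + t = imx x"
    have "exp (\<kappa> * s * nn \<nu>) * ew \<nu> t = ew \<nu> (imx x)"
      unfolding ew_def exp_add[symmetric] st(3)[symmetric] by (simp add: algebra_simps)
    thus "c * exp (\<kappa> * s * nn \<nu>) * (A * (qq \<nu> * ew \<nu> t)) \<le> c * A * qq \<nu> * ew \<nu> (imx x)"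
      by (metis (no_types, opaque_lifting) mult.assoc mult.left_commute order_refl)
  next
    show "continuous_on (hstrip \<delta>) (\<lambda>q. k \<nu> (Some q))" "continuous_on (hstrip \<delta>) (\<lambda>q. Y \<nu> (Some q))"
      using fam_contx[OF Y] kerb_contx[OF k] by (auto simp: contx_def)
    fix y assume y: "y \<in> hdom \<delta>"
    show "norm (k \<nu> y) \<le> c * exp (\<kappa> * imx y * nn \<nu>) * mm \<sigma> y" by (rule kerbD[OF k y])
    show "norm (Y \<nu> y) \<le> A * (qq \<nu> * ew \<nu> (imx y)) * mm \<sigma> y"
      using famD[OF Y y, of \<nu>] by (simp add: wt_def mult_ac)
  qed
  thus "norm (star (k \<nu>) (Y \<nu>) x) \<le> 9 * c * A * wt \<nu> x" by (simp add: wt_def mult_ac)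
qed

lemma smul_diff:
  assumes k: "kerb c k" and "fam A Y" "fam A' Y'" and d: "fam d (\<lambda>\<nu> x. Y \<nu> x - Y' \<nu> x)"
  shows "fam (9 * c * d) (\<lambda>\<nu> x. smul k Y \<nu> x - smul k Y' \<nu> x)"
proof (rule fam_cong[OF fam_smul[OF k d]])
  fix \<nu> x assume x: "x \<in> hdom \<delta>"
  have kc: "contx \<delta> (k \<nu>)" by (rule kerb_contx[OF k])
  have "star (\<lambda>y. k \<nu> y - k \<nu> y) (Y \<nu>) x = 0"
    by (cases x) (auto simp: star_simps pconv_def)
  thus "smul k (\<lambda>\<nu> x. Y \<nu> x - Y' \<nu> x) \<nu> x = smul k Y \<nu> x - smul k Y' \<nu> x"
    unfolding smul_def star_diff[OF x kc fam_contx[OF assms(2)] kc fam_contx[OF assms(3)]] by simp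
qed

end

section \<open>The fixed point in the Borel plane\<close>

text \<open>
  With \<open>u = \<epsilon> z\<close> and \<open>e\<close> representing \<open>\<epsilon>\<close>, \<open>fpow e Z j\<close> represents \<open>z\<^sup>2 u\<^sup>j\<close>, so that \<open>nonlin\<close> represents
  \<open>\<epsilon>\<^sup>-\<^sup>2 (g(c\<^sub>0 + u) - g(c\<^sub>0) - g'(c\<^sub>0) u)\<close> when \<open>c j = g\<^sub>j\<^sub>+\<^sub>2\<close>.
\<close>

primrec fpow :: "(int \<times> int \<Rightarrow> complex option \<Rightarrow> complex) \<Rightarrow> (int \<times> int \<Rightarrow> complex option \<Rightarrow> complex)
    \<Rightarrow> nat \<Rightarrow> int \<times> int \<Rightarrow> complex option \<Rightarrow> complex" where
  "fpow e Z 0 = fmul Z Z"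
| "fpow e Z (Suc j) = fmul (fpow e Z j) (smul e Z)"

definition nonlin :: "(nat \<Rightarrow> complex) \<Rightarrow> (int \<times> int \<Rightarrow> complex option \<Rightarrow> complex)
    \<Rightarrow> (int \<times> int \<Rightarrow> complex option \<Rightarrow> complex) \<Rightarrow> int \<times> int \<Rightarrow> complex option \<Rightarrow> complex" where
  "nonlin c e Z \<nu> x = infsum (\<lambda>j. c j * fpow e Z j \<nu> x) UNIV"

lemma fsym_fpow: "fsym \<delta> e \<Longrightarrow> fsym \<delta> Z \<Longrightarrow> fsym \<delta> (fpow e Z j)"
  by (induction j) (auto intro: fsym_mul fsym_smul)

lemma fsym_nonlin:
  assumes "\<And>j. c j \<in> \<real>" "fsym \<delta> e" "fsym \<delta> Z"
  shows "fsym \<delta> (nonlin c e Z)"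
  unfolding fsym_def
proof (intro allI ballI)
  fix \<nu> x assume x: "x \<in> hdom \<delta>"
  have "c j * fpow e Z j (- \<nu>) x = cnj (c j * fpow e Z j \<nu> (map_option cnj x))" for j
    using fsym_fpow[OF assms(2,3), of j] x assms(1)[of j] unfolding fsym_def
    by (simp add: Reals_cnj_iff)
  thus "nonlin c e Z (- \<nu>) x = cnj (nonlin c e Z \<nu> (map_option cnj x))"
    unfolding nonlin_def infsum_cnj[symmetric] by simp
qed

lemma geometric_summable_on:
  fixes C r :: real
  assumes "0 \<le> r" "r < 1"
  shows "(\<lambda>j::nat. C * r ^ j) summable_on UNIV" "infsum (\<lambda>j::nat. C * r ^ j) UNIV = C / (1 - r)"
proof -
  have "((\<lambda>j. r ^ j) has_sum (1 / (1 - r))) UNIV"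
    using assms geometric_sums[of r] by (intro norm_summable_imp_has_sum) (auto simp: summable_geometric)
  hence "((\<lambda>j. C * r ^ j) has_sum (C * (1 / (1 - r)))) UNIV" by (rule has_sum_cmult_right)
  thus "(\<lambda>j::nat. C * r ^ j) summable_on UNIV" "infsum (\<lambda>j::nat. C * r ^ j) UNIV = C / (1 - r)"
    by (auto dest: has_sum_imp_summable infsumI)
qed

text \<open>\<open>small1\<close> makes the terms of the nonlinearity decay like (1/4)^j,
  \<open>small2\<close> keeps the ball of radius \<open>A\<close> invariant, of which the free term
  \<open>zf\<close> takes one half, and \<open>small3\<close> gives the contraction factor
  1/2.\<close>

locale borel_fixpoint = borel_weights +
  fixes ce ck A M \<theta> :: real
    and e k zf :: "int \<times> int \<Rightarrow> complex option \<Rightarrow> complex" and c :: "nat \<Rightarrow> complex"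
  assumes e: "kerb ce e" and k: "kerb ck k" and zf: "fam (A / 2) zf"
    and c: "\<And>j. norm (c j) \<le> M * \<theta> ^ j" and M: "M \<ge> 0" and \<theta>: "\<theta> > 0" and A: "A > 0"
    and small1: "\<theta> * (Ka * (9 * ce * A)) \<le> 1 / 4"
    and small2: "9 * ck * (2 * M * Ka * A\<^sup>2) \<le> A / 2"
    and small3: "9 * ck * (4 * M * Ka * A) \<le> 1 / 2"
    and real: "\<And>j. c j \<in> \<real>" "fsym \<delta> e" "fsym \<delta> k" "fsym \<delta> zf"
begin

text \<open>The cost of one multiplication by \<epsilon> z, with z in the ball of radius
  \<open>A\<close>.\<close>

definition u :: real where "u = Ka * (9 * ce * A)"

lemma ce_nonneg: "ce \<ge> 0" and ck_nonneg: "ck \<ge> 0"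
  using kerb_nonneg e k by auto

lemma u_nonneg: "u \<ge> 0" using ce_nonneg Ka_pos A by (simp add: u_def)

lemma fam_fpow: "fam A Z \<Longrightarrow> fam (Ka * A\<^sup>2 * u ^ j) (fpow e Z j)"
proof (induction j)
  case 0
  thus ?case using fam_mul[of A Z A Z] by (simp add: power2_eq_square)
next
  case (Suc j)
  from fam_mul[OF Suc.IH[OF Suc.prems] fam_smul[OF e Suc.prems]]
  show ?case by (simp add: u_def mult_ac)
qed

lemma fam_cterm: "fam A Z \<Longrightarrow> fam (M * Ka * A\<^sup>2 * (1/4) ^ j) (\<lambda>\<nu> x. c j * fpow e Z j \<nu> x)"
proof (rule fam_mono[OF fam_cmult[OF fam_fpow]], assumption)
  have "norm (c j) * (Ka * A\<^sup>2 * u ^ j) \<le> (M * \<theta> ^ j) * (Ka * A\<^sup>2 * u ^ j)"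
    using Ka_pos u_nonneg by (intro mult_right_mono c) auto
  also have "\<dots> = M * Ka * A\<^sup>2 * (\<theta> * u) ^ j" by (simp add: power_mult_distrib)
  also have "\<dots> \<le> M * Ka * A\<^sup>2 * (1/4) ^ j"
  proof (intro mult_left_mono power_mono)
    show "\<theta> * u \<le> 1/4" using small1 by (simp add: u_def)
  qed (use M Ka_pos \<theta> u_nonneg in auto)
  finally show "norm (c j) * (Ka * A\<^sup>2 * u ^ j) \<le> M * Ka * A\<^sup>2 * (1/4) ^ j" .
qed

lemma nonlin_summable: "fam A Z \<Longrightarrow> x \<in> hdom \<delta> \<Longrightarrow> (\<lambda>j. c j * fpow e Z j \<nu> x) summable_on UNIV"
  by (rule dominated_summable[OF famD[OF fam_cterm]])
     (assumption | rule summable_on_cmult_left geometric_summable_on(1) | simp)+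

lemma fam_nonlin: "fam A Z \<Longrightarrow> fam (2 * M * Ka * A\<^sup>2) (nonlin c e Z)"
proof -
  assume Z: "fam A Z"
  have "fam (infsum (\<lambda>j. M * Ka * A\<^sup>2 * (1/4) ^ j) UNIV) (nonlin c e Z)"
    unfolding nonlin_def[abs_def]
    by (rule fam_infsum[OF fam_cterm[OF Z] geometric_summable_on(1)]) auto
  also have "infsum (\<lambda>j::nat. M * Ka * A\<^sup>2 * (1/4) ^ j) UNIV = M * Ka * A\<^sup>2 / (1 - 1/4)"
    by (rule geometric_summable_on(2)) auto
  finally show ?thesis
    by (rule fam_mono) (use M Ka_pos in \<open>auto simp: field_simps\<close>)
qed

text \<open>The product has j + 2 factors \<open>Z\<close>, which are exchanged for
  \<open>Z'\<close> one at a time.\<close>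

lemma fpow_diff:
  assumes Z: "fam A Z" and Z': "fam A Z'" and d: "fam d (\<lambda>\<nu> x. Z \<nu> x - Z' \<nu> x)"
  shows "fam (real (j + 2) * (Ka * A * d * u ^ j)) (\<lambda>\<nu> x. fpow e Z j \<nu> x - fpow e Z' j \<nu> x)"
proof (induction j)
  case 0
  from fmul_diff[OF Z Z' Z Z' d d] show ?case by (simp add: algebra_simps)
next
  case (Suc j)
  from fmul_diff[OF fam_fpow[OF Z] fam_fpow[OF Z'] fam_smul[OF e Z] fam_smul[OF e Z'] Suc.IH smul_diff[OF e Z Z' d]]
  have "fam (Ka * (real (j + 2) * (Ka * A * d * u ^ j) * (9 * ce * A) + Ka * A\<^sup>2 * u ^ j * (9 * ce * d)))
     (\<lambda>\<nu> x. fpow e Z (Suc j) \<nu> x - fpow e Z' (Suc j) \<nu> x)" by simp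
  also have "Ka * (real (j + 2) * (Ka * A * d * u ^ j) * (9 * ce * A) + Ka * A\<^sup>2 * u ^ j * (9 * ce * d))
      = real (Suc j + 2) * (Ka * A * d * u ^ Suc j)"
    by (simp add: u_def power2_eq_square algebra_simps)
  finally show ?case .
qed

lemma add_2_le_power: "real (j + 2) \<le> 2 * 2 ^ j"
  by (induction j) auto

text \<open>The factor j + 2 <= 2 * 2^j from \<open>fpow_diff\<close> worsens the ratio 1/4 to 1/2,
  and the geometric series contributes another factor 2.\<close>

lemma nonlin_diff:
  assumes Z: "fam A Z" and Z': "fam A Z'" and d: "fam d (\<lambda>\<nu> x. Z \<nu> x - Z' \<nu> x)"
  shows "fam (4 * M * Ka * A * d) (\<lambda>\<nu> x. nonlin c e Z \<nu> x - nonlin c e Z' \<nu> x)"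
proof -
  have d0: "d \<ge> 0" by (rule fam_nonneg[OF d])
  have t: "fam (2 * M * Ka * A * d * (1/2) ^ j) (\<lambda>\<nu> x. c j * (fpow e Z j \<nu> x - fpow e Z' j \<nu> x))" for j
  proof (rule fam_mono[OF fam_cmult[OF fpow_diff[OF Z Z' d]]])
    have "norm (c j) * (real (j + 2) * (Ka * A * d * u ^ j)) \<le> (M * \<theta> ^ j) * ((2 * 2 ^ j) * (Ka * A * d * u ^ j))"
      using Ka_pos u_nonneg A d0 M \<theta> by (intro mult_mono c add_2_le_power) auto
    also have "\<dots> = 2 * M * Ka * A * d * (2 * (\<theta> * u)) ^ j" by (simp add: power_mult_distrib)
    also have "\<dots> \<le> 2 * M * Ka * A * d * (1/2) ^ j"
    proof (intro mult_left_mono power_mono)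
      show "2 * (\<theta> * u) \<le> 1/2" using small1 by (simp add: u_def)
    qed (use M Ka_pos \<theta> u_nonneg A d0 in auto)
    finally show "norm (c j) * (real (j + 2) * (Ka * A * d * u ^ j)) \<le> 2 * M * Ka * A * d * (1/2) ^ j" .
  qed
  have "fam (infsum (\<lambda>j. 2 * M * Ka * A * d * (1/2) ^ j) UNIV)
     (\<lambda>\<nu> x. infsum (\<lambda>j. c j * (fpow e Z j \<nu> x - fpow e Z' j \<nu> x)) UNIV)"
    by (rule fam_infsum[OF t geometric_summable_on(1)]) auto
  also have "infsum (\<lambda>j::nat. 2 * M * Ka * A * d * (1/2) ^ j) UNIV = 2 * M * Ka * A * d / (1 - 1/2)"
    by (rule geometric_summable_on(2)) auto
  also have "\<dots> = 4 * M * Ka * A * d" by simp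
  finally show ?thesis
  proof (rule fam_cong)
    fix \<nu> x assume x: "x \<in> hdom \<delta>"
    show "infsum (\<lambda>j. c j * (fpow e Z j \<nu> x - fpow e Z' j \<nu> x)) UNIV = nonlin c e Z \<nu> x - nonlin c e Z' \<nu> x"
      unfolding nonlin_def infsum_diff[OF nonlin_summable[OF Z x] nonlin_summable[OF Z' x], symmetric]
      by (simp add: right_diff_distrib)
  qed
qed

definition \<Phi> :: "(int \<times> int \<Rightarrow> complex option \<Rightarrow> complex) \<Rightarrow> int \<times> int \<Rightarrow> complex option \<Rightarrow> complex" where
  "\<Phi> Z \<nu> x = zf \<nu> x - smul k (nonlin c e Z) \<nu> x"

lemma fam_Phi: "fam A Z \<Longrightarrow> fam A (\<Phi> Z)"
proof -
  assume Z: "fam A Z"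
  have "fam (A / 2 + 9 * ck * (2 * M * Ka * A\<^sup>2)) (\<Phi> Z)"
    unfolding \<Phi>_def[abs_def] by (intro fam_diff zf fam_smul k fam_nonlin Z)
  thus ?thesis by (rule fam_mono) (use small2 in simp)
qed

lemma Phi_diff:
  assumes Z: "fam A Z" and Z': "fam A Z'" and d: "fam d (\<lambda>\<nu> x. Z \<nu> x - Z' \<nu> x)"
  shows "fam (d / 2) (\<lambda>\<nu> x. \<Phi> Z \<nu> x - \<Phi> Z' \<nu> x)"
proof -
  from smul_diff[OF k fam_nonlin[OF Z] fam_nonlin[OF Z'] nonlin_diff[OF Z Z' d]]
  have "fam (9 * ck * (4 * M * Ka * A * d)) (\<lambda>\<nu> x. \<Phi> Z \<nu> x - \<Phi> Z' \<nu> x)"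
    unfolding \<Phi>_def by (drule_tac fam_uminus) simp
  thus ?thesis
    by (rule fam_mono) (use mult_right_mono[OF small3 fam_nonneg[OF d]] in \<open>simp add: mult_ac\<close>)
qed

lemma fsym_Phi: "fsym \<delta> Z \<Longrightarrow> fsym \<delta> (\<Phi> Z)"
  using real(4) fsym_smul[OF real(3) fsym_nonlin[OF real(1,2)]] unfolding fsym_def \<Phi>_def by simp

section \<open>The iteration and its limit\<close>

primrec Zs :: "nat \<Rightarrow> int \<times> int \<Rightarrow> complex option \<Rightarrow> complex" where
  "Zs 0 = zf" | "Zs (Suc n) = \<Phi> (Zs n)"

lemma fam_Zs: "fam A (Zs n)"
  by (induction n) (use zf A in \<open>auto intro: fam_Phi fam_mono\<close>)

lemma fsym_Zs: "fsym \<delta> (Zs n)"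
  by (induction n) (auto intro: fsym_Phi real)

lemma Zs_diff: "fam (A * 2 * (1/2) ^ n) (\<lambda>\<nu> x. Zs (Suc n) \<nu> x - Zs n \<nu> x)"
proof (induction n)
  case 0
  show ?case using fam_diff[OF fam_Zs[of 1] fam_Zs[of 0]] by (simp add: mult.commute)
next
  case (Suc n)
  from Phi_diff[OF fam_Zs fam_Zs Suc.IH] show ?case by simp
qed

text \<open>Written as a telescoping series and not as a limit, so that holomorphy follows from
  \<open>fam_infsum\<close>.\<close>

definition Z :: "int \<times> int \<Rightarrow> complex option \<Rightarrow> complex" where
  "Z \<nu> x = zf \<nu> x + infsum (\<lambda>n. Zs (Suc n) \<nu> x - Zs n \<nu> x) UNIV"

lemma Zs_lim: 
  assumes x: "x \<in> hdom \<delta>"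
  shows "(\<lambda>n. Zs n \<nu> x) \<longlonglongrightarrow> Z \<nu> x"
proof -
  have "(\<lambda>n. Zs (Suc n) \<nu> x - Zs n \<nu> x) summable_on UNIV"
    by (rule dominated_summable[OF famD[OF Zs_diff x]])
       (intro summable_on_cmult_left geometric_summable_on(1); simp)
  hence "(\<lambda>n. Zs (Suc n) \<nu> x - Zs n \<nu> x) sums (Z \<nu> x - zf \<nu> x)"
    unfolding Z_def by (simp add: has_sum_imp_sums)
  hence "(\<lambda>n. \<Sum>i<n. Zs (Suc i) \<nu> x - Zs i \<nu> x) \<longlonglongrightarrow> Z \<nu> x - zf \<nu> x"
    by (simp add: sums_def)
  hence "(\<lambda>n. Zs n \<nu> x - zf \<nu> x) \<longlonglongrightarrow> Z \<nu> x - zf \<nu> x"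
    using sum_lessThan_telescope[of "\<lambda>n. Zs n \<nu> x"] by (simp del: Zs.simps add: Zs.simps(1))
  from tendsto_add[OF this tendsto_const[of "zf \<nu> x"]] show ?thesis by simp
qed

lemma fam_limit:
  assumes Z: "\<And>\<nu> x. x \<in> hdom \<delta> \<Longrightarrow> (\<lambda>n. F n \<nu> x) \<longlonglongrightarrow> G \<nu> x"
    and F: "\<And>n. n \<ge> N \<Longrightarrow> fam B (F n)" and G: "\<And>\<nu>. (\<lambda>p. G \<nu> (Some p)) holomorphic_on hstrip \<delta>"
  shows "fam B G"
  unfolding fam_def
proof (intro allI conjI ballI G)
  fix \<nu> x assume x: "x \<in> hdom \<delta>"
  show "norm (G \<nu> x) \<le> B * wt \<nu> x"
    by (rule tendsto_upperbound[OF tendsto_norm[OF Z[OF x]]])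
       (auto intro!: eventually_mono[OF eventually_ge_at_top[of N]] famD[OF F x])
qed

lemma Z_holomorphic: "(\<lambda>p. Z \<nu> (Some p)) holomorphic_on hstrip \<delta>"
proof -
  have "fam (infsum (\<lambda>n. A * 2 * (1/2) ^ n) UNIV) (\<lambda>\<nu> x. infsum (\<lambda>n. Zs (Suc n) \<nu> x - Zs n \<nu> x) UNIV)"
    by (rule fam_infsum[OF Zs_diff geometric_summable_on(1)]) auto
  thus ?thesis unfolding Z_def by (intro holomorphic_on_add fam_holomorphic[OF zf] fam_holomorphic)
qed

lemma fam_Z: "fam A Z"
  by (rule fam_limit[OF Zs_lim fam_Zs Z_holomorphic])

lemma Zs_dist: "m \<ge> n \<Longrightarrow> fam (A * 4 * (1/2) ^ n) (\<lambda>\<nu> x. Zs m \<nu> x - Zs n \<nu> x)"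
proof -
  assume mn: "m \<ge> n"
  \<comment> \<open>The difference of two powers makes the induction exact: one step adds A * 2 *
    (1/2)^(n + i), which is A * 4 * ((1/2)^(n + i) - (1/2)^(n + i + 1)).\<close>
  have "fam (A * 4 * ((1/2) ^ n - (1/2) ^ (n + i))) (\<lambda>\<nu> x. Zs (n + i) \<nu> x - Zs n \<nu> x)" for i
  proof (induction i)
    case 0
    show ?case by (auto simp: fam_def)
  next
    case (Suc i)
    from fam_add[OF Suc.IH Zs_diff[of "n + i"]] show ?case by (simp add: algebra_simps)
  qed
  from this[of "m - n"] mn have "fam (A * 4 * ((1/2) ^ n - (1/2) ^ m)) (\<lambda>\<nu> x. Zs m \<nu> x - Zs n \<nu> x)" by simp
  thus ?thesis by (rule fam_mono) (use A in auto)
qed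

lemma Z_dist: "fam (A * 4 * (1/2) ^ n) (\<lambda>\<nu> x. Z \<nu> x - Zs n \<nu> x)"
proof (rule fam_limit[where F = "\<lambda>m \<nu> x. Zs m \<nu> x - Zs n \<nu> x", OF _ Zs_dist])
  show "(\<lambda>p. Z \<nu> (Some p) - Zs n \<nu> (Some p)) holomorphic_on hstrip \<delta>" for \<nu>
    by (rule holomorphic_on_diff[OF Z_holomorphic fam_holomorphic[OF fam_Zs]])
  show "(\<lambda>m. Zs m \<nu> x - Zs n \<nu> x) \<longlonglongrightarrow> Z \<nu> x - Zs n \<nu> x" if "x \<in> hdom \<delta>" for \<nu> x
    by (rule tendsto_diff[OF Zs_lim[OF that] tendsto_const])
qed

text \<open>The continuity of \<Phi> enters as the contraction estimate, which makes the bound for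
  \<open>\<Phi> Z - Zs (Suc n)\<close> half of that for \<open>Z - Zs n\<close>.\<close>

lemma Z_fixpoint: "x \<in> hdom \<delta> \<Longrightarrow> Z \<nu> x = zf \<nu> x - smul k (nonlin c e Z) \<nu> x"
proof -
  assume x: "x \<in> hdom \<delta>"
  have l: "(\<lambda>n. Zs (Suc n) \<nu> x) \<longlonglongrightarrow> Z \<nu> x" using Zs_lim[OF x] by (rule LIMSEQ_Suc)
  have "(\<lambda>n. \<Phi> Z \<nu> x - Zs (Suc n) \<nu> x) \<longlonglongrightarrow> 0"
  proof (rule Lim_null_comparison)
    show "\<forall>\<^sub>F n in sequentially. norm (\<Phi> Z \<nu> x - Zs (Suc n) \<nu> x) \<le> A * 4 * (1/2) ^ n / 2 * wt \<nu> x"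
      using famD[OF Phi_diff[OF fam_Z fam_Zs Z_dist] x] by simp
    show "(\<lambda>n. A * 4 * (1/2) ^ n / 2 * wt \<nu> x) \<longlonglongrightarrow> 0"
      by (intro tendsto_mult_left_zero tendsto_divide_zero tendsto_mult_right_zero LIMSEQ_power_zero) auto
  qed
  from tendsto_diff[OF tendsto_const[of "\<Phi> Z \<nu> x"] this] have "(\<lambda>n. Zs (Suc n) \<nu> x) \<longlonglongrightarrow> \<Phi> Z \<nu> x" by simp
  from LIMSEQ_unique[OF this l] show ?thesis by (simp add: \<Phi>_def)
qed

lemma fsym_Z: "fsym \<delta> Z"
  unfolding fsym_def
proof (intro allI ballI)
  fix \<nu> x assume x: "x \<in> hdom \<delta>"
  have "(\<lambda>n. Zs n (- \<nu>) x) \<longlonglongrightarrow> cnj (Z \<nu> (map_option cnj x))"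
    using tendsto_cnj[OF Zs_lim[OF map_cnj_hdom[OF x], of \<nu>]] fsym_Zs x unfolding fsym_def by simp
  from LIMSEQ_unique[OF Zs_lim[OF x] this] show "Z (- \<nu>) x = cnj (Z \<nu> (map_option cnj x))" .
qed

end

text \<open>From here on \<open>$\<close> denotes the coefficients of formal power series.\<close>

unbundle no vec_syntax

section \<open>Rapidly decreasing sequences of Fourier modes\<close>

lemma infsum_swap_dominated:
  fixes f :: "'i \<Rightarrow> 'j \<Rightarrow> complex"
  assumes f: "\<And>i j. norm (f i j) \<le> B i j" and B: "\<And>i. B i summable_on UNIV"
    and BB: "(\<lambda>i. infsum (B i) UNIV) summable_on UNIV"
  shows "infsum (\<lambda>i. infsum (f i) UNIV) UNIV = infsum (\<lambda>j. infsum (\<lambda>i. f i j) UNIV) UNIV"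
proof (rule infsum_swap_banach)
  have nn: "0 \<le> B i j" for i j using f[of i j] norm_ge_zero order_trans by blast
  have "(\<lambda>(i, j). B i j) summable_on UNIV \<times> UNIV"
    by (rule summable_on_SigmaI[OF _ BB]) (use nn B in auto)
  thus "(\<lambda>(i, j). f i j) summable_on UNIV \<times> UNIV"
    by (rule dominated_summable[rotated]) (use f in auto)
qed

lemma has_sum_finite_sum:
  fixes f :: "'k \<Rightarrow> 'i \<Rightarrow> 'a::topological_comm_monoid_add"
  assumes "finite K" "\<And>k. k \<in> K \<Longrightarrow> (f k has_sum s k) I"
  shows "((\<lambda>i. \<Sum>k\<in>K. f k i) has_sum (\<Sum>k\<in>K. s k)) I"
  using assms by (induction K) (auto intro: has_sum_add)

lemma power_le_fact_exp: "0 \<le> (y::real) \<Longrightarrow> y ^ k \<le> fact k * exp y"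
proof -
  assume y: "0 \<le> y"
  have "y ^ k / fact k \<le> (\<Sum>n. y ^ n / fact n)"
    using sum_le_suminf[OF summable_exp[of y], of "{k}"] y by (simp add: divide_inverse mult.commute)
  also have "\<dots> = exp y" by (simp add: exp_def divide_inverse scaleR_conv_of_real mult.commute)
  finally show ?thesis by (simp add: field_simps)
qed

text \<open>One term of the exponential series at h (1 + x).\<close>

lemma poly_exp_bound:
  assumes h: "(h::real) > 0" and x: "x \<ge> 0"
  shows "(1 + x) ^ k * exp (- h * x) \<le> fact k * exp h / h ^ k"
proof -
  have "(h * (1 + x)) ^ k \<le> fact k * exp (h * (1 + x))"
    using h x by (intro power_le_fact_exp) auto
  hence "(h * (1 + x)) ^ k * exp (- h * x) \<le> fact k * exp (h * (1 + x)) * exp (- h * x)"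
    by (intro mult_right_mono) auto
  also have "\<dots> = fact k * exp h"
    by (simp add: mult.assoc exp_add[symmetric] algebra_simps)
  finally have "((1 + x) ^ k * exp (- h * x)) * h ^ k \<le> fact k * exp h"
    unfolding power_mult_distrib by (simp only: mult_ac)
  thus ?thesis using h by (simp only: pos_le_divide_eq zero_less_power)
qed

text \<open>Faster than any power of |\<nu>|, so the factors \<lambda> from time derivatives do no
  harm; the extra \<open>qq \<nu>\<close> makes the sequence summable outright.\<close>

definition rdec :: "(int \<times> int \<Rightarrow> complex) \<Rightarrow> bool" where
  "rdec b \<longleftrightarrow> (\<forall>k. \<exists>C. \<forall>\<nu>. norm (b \<nu>) * (1 + nn \<nu>) ^ k \<le> C * qq \<nu>)"

lemma rdec_bound:
  assumes "rdec b"
  obtains C where "C \<ge> 0" "\<And>\<nu>. norm (b \<nu>) * (1 + nn \<nu>) ^ k \<le> C * qq \<nu>"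
proof -
  obtain C where C: "\<And>\<nu>. norm (b \<nu>) * (1 + nn \<nu>) ^ k \<le> C * qq \<nu>" using assms unfolding rdec_def by blast
  have "C \<ge> 0"
  proof -
    have "0 \<le> norm (b 0) * (1 + nn 0) ^ k" by simp
    also note C[of 0]
    finally show ?thesis using qq_pos[of 0] by (simp add: zero_le_mult_iff)
  qed
  thus ?thesis using C that by blast
qed

lemma rdec_bound0:
  assumes "rdec b"
  obtains C where "C \<ge> 0" "\<And>\<nu>. norm (b \<nu>) \<le> C * qq \<nu>"
proof -
  from rdec_bound[OF assms, of 0] obtain C where "C \<ge> 0" "\<And>\<nu>. norm (b \<nu>) * (1 + nn \<nu>) ^ 0 \<le> C * qq \<nu>" by blast
  thus ?thesis using that[of C] by simp
qed

lemma rdec_exp: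
  assumes h: "h > 0" and b: "\<And>\<nu>. norm (b \<nu>) \<le> C * qq \<nu> * exp (- h * nn \<nu>)"
  shows "rdec b"
  unfolding rdec_def
proof
  fix k
  have C: "C \<ge> 0"
  proof -
    have "0 \<le> norm (b 0)" by simp
    also note b[of 0]
    finally show ?thesis using qq_pos[of 0] by (simp add: zero_le_mult_iff nn_def)
  qed
  have "norm (b \<nu>) * (1 + nn \<nu>) ^ k \<le> (C * (fact k * exp h / h ^ k)) * qq \<nu>" for \<nu>
  proof -
    have "norm (b \<nu>) * (1 + nn \<nu>) ^ k \<le> (C * qq \<nu> * exp (- h * nn \<nu>)) * (1 + nn \<nu>) ^ k"
      by (intro mult_right_mono b) auto
    also have "\<dots> = C * qq \<nu> * ((1 + nn \<nu>) ^ k * exp (- h * nn \<nu>))" by simp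
    also have "\<dots> \<le> C * qq \<nu> * (fact k * exp h / h ^ k)"
      using C qq_pos[of \<nu>] h by (intro mult_left_mono poly_exp_bound) auto
    finally show ?thesis by (simp add: mult_ac)
  qed
  thus "\<exists>C. \<forall>\<nu>. norm (b \<nu>) * (1 + nn \<nu>) ^ k \<le> C * qq \<nu>" by blast
qed

lemma rdec_add: "rdec a \<Longrightarrow> rdec b \<Longrightarrow> rdec (\<lambda>\<nu>. a \<nu> + b \<nu>)"
  unfolding rdec_def
proof
  fix k assume *: "\<forall>k. \<exists>C. \<forall>\<nu>. norm (a \<nu>) * (1 + nn \<nu>) ^ k \<le> C * qq \<nu>" "\<forall>k. \<exists>C. \<forall>\<nu>. norm (b \<nu>) * (1 + nn \<nu>) ^ k \<le> C * qq \<nu>"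
  obtain C D where CD: "\<And>\<nu>. norm (a \<nu>) * (1 + nn \<nu>) ^ k \<le> C * qq \<nu>" "\<And>\<nu>. norm (b \<nu>) * (1 + nn \<nu>) ^ k \<le> D * qq \<nu>"
    using * by meson
  have "norm (a \<nu> + b \<nu>) * (1 + nn \<nu>) ^ k \<le> (C + D) * qq \<nu>" for \<nu>
  proof -
    have "norm (a \<nu> + b \<nu>) * (1 + nn \<nu>) ^ k \<le> (norm (a \<nu>) + norm (b \<nu>)) * (1 + nn \<nu>) ^ k"
      by (intro mult_right_mono norm_triangle_ineq) auto
    thus ?thesis using CD[of \<nu>] by (simp add: distrib_right)
  qed
  thus "\<exists>C. \<forall>\<nu>. norm (a \<nu> + b \<nu>) * (1 + nn \<nu>) ^ k \<le> C * qq \<nu>" by blast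
qed

lemma rdec_cmult: "rdec a \<Longrightarrow> rdec (\<lambda>\<nu>. c * a \<nu>)"
  unfolding rdec_def
proof
  fix k assume *: "\<forall>k. \<exists>C. \<forall>\<nu>. norm (a \<nu>) * (1 + nn \<nu>) ^ k \<le> C * qq \<nu>"
  obtain C where C: "\<And>\<nu>. norm (a \<nu>) * (1 + nn \<nu>) ^ k \<le> C * qq \<nu>" using * by meson
  have "norm (c * a \<nu>) * (1 + nn \<nu>) ^ k \<le> (norm c * C) * qq \<nu>" for \<nu>
    using mult_left_mono[OF C[of \<nu>], of "norm c"] by (simp add: norm_mult mult_ac)
  thus "\<exists>C. \<forall>\<nu>. norm (c * a \<nu>) * (1 + nn \<nu>) ^ k \<le> C * qq \<nu>" by blast
qed

lemma rdec_sum: "finite K \<Longrightarrow> (\<And>k. k \<in> K \<Longrightarrow> rdec (a k)) \<Longrightarrow> rdec (\<lambda>\<nu>. \<Sum>k\<in>K. a k \<nu>)"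
proof (induction K rule: finite_induct)
  case empty
  show ?case by (auto simp: rdec_def intro!: exI[of _ 0])
qed (auto intro: rdec_add)

lemma rdec_poly:
  assumes "rdec b" and d: "\<And>\<nu>. norm (d \<nu>) \<le> D * (1 + nn \<nu>)"
  shows "rdec (\<lambda>\<nu>. d \<nu> * b \<nu>)"
  unfolding rdec_def
proof
  fix k
  obtain C where C: "\<And>\<nu>. norm (b \<nu>) * (1 + nn \<nu>) ^ Suc k \<le> C * qq \<nu>"
    using assms unfolding rdec_def by meson
  have D: "D \<ge> 0"
  proof -
    have "0 \<le> norm (d 0)" by simp
    also note d[of 0]
    finally show ?thesis by (simp add: nn_def)
  qed
  have "norm (d \<nu> * b \<nu>) * (1 + nn \<nu>) ^ k \<le> (D * C) * qq \<nu>" for \<nu>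
  proof -
    have "norm (d \<nu> * b \<nu>) * (1 + nn \<nu>) ^ k \<le> (D * (1 + nn \<nu>)) * norm (b \<nu>) * (1 + nn \<nu>) ^ k"
      unfolding norm_mult by (intro mult_right_mono d) auto
    also have "\<dots> = D * (norm (b \<nu>) * (1 + nn \<nu>) ^ Suc k)" by simp
    also have "\<dots> \<le> D * (C * qq \<nu>)" by (intro mult_left_mono C D)
    finally show ?thesis by simp
  qed
  thus "\<exists>C. \<forall>\<nu>. norm (d \<nu> * b \<nu>) * (1 + nn \<nu>) ^ k \<le> C * qq \<nu>" by blast
qed

lemma rdec_summable:
  assumes "rdec b" "\<And>\<nu>. norm (d \<nu>) \<le> norm (b \<nu>)"
  shows "(d :: int \<times> int \<Rightarrow> 'a::banach) summable_on UNIV"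
proof -
  obtain C where C: "\<And>\<nu>. norm (b \<nu>) \<le> C * qq \<nu>" using rdec_bound0[OF assms(1)] by blast
  show ?thesis
    by (rule dominated_summable[OF order_trans[OF assms(2) C] summable_on_cmult_right[OF qq_summable]])
qed

lemma convolution_evaluation:
  assumes a: "rdec a" and b: "rdec b"
  shows "infsum (\<lambda>\<nu>. infsum (\<lambda>\<mu>. a \<mu> * b (\<nu> - \<mu>)) UNIV) UNIV = infsum a UNIV * infsum b UNIV"
proof -
  obtain C where C: "C \<ge> 0" "\<And>\<nu>. norm (a \<nu>) \<le> C * qq \<nu>" using rdec_bound0[OF a] by blast
  obtain D where D: "D \<ge> 0" "\<And>\<nu>. norm (b \<nu>) \<le> D * qq \<nu>" using rdec_bound0[OF b] by blast
  let ?B = "\<lambda>\<nu> \<mu>. (C * D) * (qq \<mu> * qq (\<nu> - \<mu>))"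
  have "infsum (\<lambda>\<nu>. infsum (\<lambda>\<mu>. a \<mu> * b (\<nu> - \<mu>)) UNIV) UNIV = infsum (\<lambda>\<mu>. infsum (\<lambda>\<nu>. a \<mu> * b (\<nu> - \<mu>)) UNIV) UNIV"
  proof (rule infsum_swap_dominated[where B = ?B])
    show "norm (a \<mu> * b (\<nu> - \<mu>)) \<le> ?B \<nu> \<mu>" for \<nu> \<mu>
      using mult_mono[OF C(2)[of \<mu>] D(2)[of "\<nu> - \<mu>"]] C(1) qq_pos[of \<mu>] by (simp add: norm_mult mult_ac)
    show "?B \<nu> summable_on UNIV" for \<nu> by (intro summable_on_cmult_right qq_conv)
    show "(\<lambda>\<nu>. infsum (?B \<nu>) UNIV) summable_on UNIV"
    proof (rule dominated_summable)
      show "norm (infsum (?B \<nu>) UNIV) \<le> C * D * (16 * sq * qq \<nu>)" for \<nu>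
      proof -
        have "infsum (?B \<nu>) UNIV \<ge> 0" using C D qq_pos by (intro infsum_nonneg) (simp add: less_imp_le)
        moreover have "infsum (?B \<nu>) UNIV \<le> C * D * (16 * sq * qq \<nu>)"
          unfolding infsum_cmult_right' using C D by (intro mult_left_mono qq_conv) auto
        ultimately show ?thesis by simp
      qed
      show "(\<lambda>\<nu>. C * D * (16 * sq * qq \<nu>)) summable_on UNIV" by (intro summable_on_cmult_right qq_summable)
    qed
  qed
  also have "\<dots> = infsum (\<lambda>\<mu>. a \<mu> * infsum b UNIV) UNIV"
  proof (rule infsum_cong)
    fix \<mu>
    have "infsum (\<lambda>\<nu>. b (\<nu> - \<mu>)) UNIV = infsum b UNIV"
      by (rule infsum_reindex_bij_witness[where i = "\<lambda>\<nu>. \<nu> + \<mu>" and j = "\<lambda>\<nu>. \<nu> - \<mu>"]) auto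
    thus "infsum (\<lambda>\<nu>. a \<mu> * b (\<nu> - \<mu>)) UNIV = a \<mu> * infsum b UNIV" by (simp add: infsum_cmult_right')
  qed
  also have "infsum (\<lambda>\<mu>. a \<mu> * infsum b UNIV) UNIV = infsum a UNIV * infsum b UNIV"
    by (rule infsum_cmult_left')
  finally show ?thesis .
qed

section \<open>Evaluation of Fourier series at a point of the torus\<close>

definition fcis :: "real \<times> real \<Rightarrow> int \<times> int \<Rightarrow> complex" where
  "fcis \<psi> \<nu> = cis (freq \<nu> \<bullet> \<psi>)"

lemma norm_fcis [simp]: "norm (fcis \<psi> \<nu>) = 1"
  by (simp add: fcis_def)

lemma fcis_add: "fcis \<psi> (\<mu> + \<nu>) = fcis \<psi> \<mu> * fcis \<psi> \<nu>"
  by (simp add: fcis_def cis_mult freq_def inner_prod_def algebra_simps)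

lemma fcis_uminus: "fcis \<psi> (- \<nu>) = cnj (fcis \<psi> \<nu>)"
  by (simp add: fcis_def cis_cnj freq_def inner_prod_def)

lemma rdec_fcis: "rdec b \<Longrightarrow> rdec (\<lambda>\<nu>. fcis \<psi> \<nu> * b \<nu>)"
  by (simp add: rdec_def norm_mult)

definition fdec :: "(int \<times> int \<Rightarrow> complex fps) \<Rightarrow> bool" where
  "fdec V \<longleftrightarrow> (\<forall>n. rdec (\<lambda>\<nu>. V \<nu> $ n))"

text \<open>The sum at \<psi> of a Fourier series whose coefficients are themselves power series,
  taken order by order.\<close>

definition ev :: "(int \<times> int \<Rightarrow> complex fps) \<Rightarrow> real \<times> real \<Rightarrow> complex fps" where
  "ev V \<psi> = Abs_fps (\<lambda>n. infsum (\<lambda>\<nu>. fcis \<psi> \<nu> * V \<nu> $ n) UNIV)"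

lemma ev_has_sum: "fdec V \<Longrightarrow> ((\<lambda>\<nu>. fcis \<psi> \<nu> * V \<nu> $ n) has_sum ev V \<psi> $ n) UNIV"
  unfolding fdec_def ev_def fps_nth_Abs_fps
  by (intro has_sum_infsum rdec_summable[where b = "\<lambda>\<nu>. V \<nu> $ n"]) (auto simp: norm_mult)

lemma fdec_add: "fdec V \<Longrightarrow> fdec W \<Longrightarrow> fdec (\<lambda>\<nu>. V \<nu> + W \<nu>)"
  by (simp add: fdec_def rdec_add)

lemma fdec_cmult: "fdec V \<Longrightarrow> fdec (\<lambda>\<nu>. E * V \<nu>)"
  unfolding fdec_def fps_mult_nth by (intro allI rdec_sum rdec_cmult) auto

lemma ev_add: "fdec V \<Longrightarrow> fdec W \<Longrightarrow> ev (\<lambda>\<nu>. V \<nu> + W \<nu>) \<psi> = ev V \<psi> + ev W \<psi>"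
proof (rule fps_ext)
  fix n assume VW: "fdec V" "fdec W"
  have "((\<lambda>\<nu>. fcis \<psi> \<nu> * (V \<nu> + W \<nu>) $ n) has_sum (ev V \<psi> + ev W \<psi>) $ n) UNIV"
    using has_sum_add[OF ev_has_sum[OF VW(1)] ev_has_sum[OF VW(2)]] by (simp add: distrib_left)
  thus "ev (\<lambda>\<nu>. V \<nu> + W \<nu>) \<psi> $ n = (ev V \<psi> + ev W \<psi>) $ n"
    using has_sum_unique ev_has_sum[OF fdec_add[OF VW]] by blast
qed

lemma ev_cmult: "fdec V \<Longrightarrow> ev (\<lambda>\<nu>. E * V \<nu>) \<psi> = E * ev V \<psi>"
proof (rule fps_ext)
  fix n assume V: "fdec V"
  have "((\<lambda>\<nu>. \<Sum>i=0..n. E $ i * (fcis \<psi> \<nu> * V \<nu> $ (n - i))) has_sum (\<Sum>i=0..n. E $ i * ev V \<psi> $ (n - i))) UNIV"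
    by (intro has_sum_finite_sum has_sum_cmult_right ev_has_sum V) auto
  hence "((\<lambda>\<nu>. fcis \<psi> \<nu> * (E * V \<nu>) $ n) has_sum (E * ev V \<psi>) $ n) UNIV"
    by (simp add: fps_mult_nth sum_distrib_left mult_ac)
  thus "ev (\<lambda>\<nu>. E * V \<nu>) \<psi> $ n = (E * ev V \<psi>) $ n"
    using has_sum_unique ev_has_sum[OF fdec_cmult[OF V]] by blast
qed

text \<open>The coefficients of the product enter through \<open>has_sum\<close> in each order, the
  form in which \<open>chi_fmul\<close> delivers them. The rest is the Cauchy product over the
  lattice, with \<open>fcis\<close> multiplicative in \<nu>.\<close>

lemma ev_mult:
  assumes V: "fdec V" and W: "fdec W"
    and U: "\<And>\<nu> n. ((\<lambda>\<mu>. (V \<mu> * W (\<nu> - \<mu>)) $ n) has_sum U \<nu> $ n) UNIV"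
  shows "ev U \<psi> = ev V \<psi> * ev W \<psi>"
proof (rule fps_ext)
  fix n
  define a where "a = (\<lambda>i \<nu>. fcis \<psi> \<nu> * V \<nu> $ i)"
  define b where "b = (\<lambda>i \<nu>. fcis \<psi> \<nu> * W \<nu> $ i)"
  have a: "rdec (a i)" and b: "rdec (b i)" for i
    using V W unfolding fdec_def a_def b_def by (auto intro: rdec_fcis)
  have conv: "(\<lambda>\<mu>. a i \<mu> * b j (\<nu> - \<mu>)) summable_on UNIV" for i j \<nu>
  proof -
    obtain C where C: "C \<ge> 0" "\<And>\<nu>. norm (a i \<nu>) \<le> C * qq \<nu>" using rdec_bound0[OF a[of i]] by blast
    obtain D where D: "D \<ge> 0" "\<And>\<nu>. norm (b j \<nu>) \<le> D * qq \<nu>" using rdec_bound0[OF b[of j]] by blast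
    show ?thesis
    proof (rule dominated_summable)
      show "norm (a i \<mu> * b j (\<nu> - \<mu>)) \<le> (C * D) * (qq \<mu> * qq (\<nu> - \<mu>))" for \<mu>
        using mult_mono[OF C(2)[of \<mu>] D(2)[of "\<nu> - \<mu>"]] C(1) qq_pos[of \<mu>] by (simp add: norm_mult mult_ac)
    qed (intro summable_on_cmult_right qq_conv)
  qed
  have U': "fcis \<psi> \<nu> * U \<nu> $ n = (\<Sum>i=0..n. infsum (\<lambda>\<mu>. a i \<mu> * b (n - i) (\<nu> - \<mu>)) UNIV)" for \<nu>
  proof (rule has_sum_unique)
    have "((\<lambda>\<mu>. fcis \<psi> \<nu> * (V \<mu> * W (\<nu> - \<mu>)) $ n) has_sum fcis \<psi> \<nu> * U \<nu> $ n) UNIV"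
      by (intro has_sum_cmult_right U)
    moreover have "fcis \<psi> \<nu> * (V \<mu> * W (\<nu> - \<mu>)) $ n = (\<Sum>i=0..n. a i \<mu> * b (n - i) (\<nu> - \<mu>))" for \<mu>
    proof -
      have "fcis \<psi> \<nu> = fcis \<psi> \<mu> * fcis \<psi> (\<nu> - \<mu>)" unfolding fcis_add[symmetric] by simp
      thus ?thesis unfolding fps_mult_nth a_def b_def by (simp add: sum_distrib_left mult_ac)
    qed
    ultimately show "((\<lambda>\<mu>. \<Sum>i=0..n. a i \<mu> * b (n - i) (\<nu> - \<mu>)) has_sum fcis \<psi> \<nu> * U \<nu> $ n) UNIV" by simp
    show "((\<lambda>\<mu>. \<Sum>i=0..n. a i \<mu> * b (n - i) (\<nu> - \<mu>)) has_sum
        (\<Sum>i=0..n. infsum (\<lambda>\<mu>. a i \<mu> * b (n - i) (\<nu> - \<mu>)) UNIV)) UNIV"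
      by (intro has_sum_finite_sum has_sum_infsum conv) auto
  qed
  have cs: "(\<lambda>\<nu>. infsum (\<lambda>\<mu>. a i \<mu> * b j (\<nu> - \<mu>)) UNIV) summable_on UNIV" for i j
  proof -
    obtain C where C: "C \<ge> 0" "\<And>\<nu>. norm (a i \<nu>) \<le> C * qq \<nu>" using rdec_bound0[OF a[of i]] by blast
    obtain D where D: "D \<ge> 0" "\<And>\<nu>. norm (b j \<nu>) \<le> D * qq \<nu>" using rdec_bound0[OF b[of j]] by blast
    show ?thesis
    proof (rule dominated_summable)
      fix \<nu>
      have "norm (infsum (\<lambda>\<mu>. a i \<mu> * b j (\<nu> - \<mu>)) UNIV) \<le> infsum (\<lambda>\<mu>. (C * D) * (qq \<mu> * qq (\<nu> - \<mu>))) UNIV"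
      proof (rule dominated_infsum_le)
        show "norm (a i \<mu> * b j (\<nu> - \<mu>)) \<le> (C * D) * (qq \<mu> * qq (\<nu> - \<mu>))" for \<mu>
          using mult_mono[OF C(2)[of \<mu>] D(2)[of "\<nu> - \<mu>"]] C(1) qq_pos[of \<mu>] by (simp add: norm_mult mult_ac)
      qed (intro summable_on_cmult_right qq_conv)
      also have "\<dots> \<le> C * D * (16 * sq * qq \<nu>)"
        unfolding infsum_cmult_right' using C D by (intro mult_left_mono qq_conv) auto
      finally show "norm (infsum (\<lambda>\<mu>. a i \<mu> * b j (\<nu> - \<mu>)) UNIV) \<le> C * D * (16 * sq * qq \<nu>)" .
    qed (intro summable_on_cmult_right qq_summable)
  qed
  have "ev U \<psi> $ n = infsum (\<lambda>\<nu>. \<Sum>i=0..n. infsum (\<lambda>\<mu>. a i \<mu> * b (n - i) (\<nu> - \<mu>)) UNIV) UNIV"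
    by (simp add: ev_def U')
  also have "\<dots> = (\<Sum>i=0..n. infsum (\<lambda>\<nu>. infsum (\<lambda>\<mu>. a i \<mu> * b (n - i) (\<nu> - \<mu>)) UNIV) UNIV)"
    by (intro infsumI has_sum_finite_sum has_sum_infsum cs) auto
  also have "\<dots> = (ev V \<psi> * ev W \<psi>) $ n"
    unfolding convolution_evaluation[OF a b] by (simp add: fps_mult_nth ev_def a_def b_def)
  finally show "ev U \<psi> $ n = (ev V \<psi> * ev W \<psi>) $ n" .
qed

section \<open>Multiplicative functionals\<close>

text \<open>\<epsilon> is the Laplace transform of the constant 1, without a Dirac mass.\<close>

definition epsx :: "complex option \<Rightarrow> complex" where
  "epsx x = (case x of None \<Rightarrow> 0 | Some p \<Rightarrow> 1)"

lemma epsx_simps [simp]: "epsx None = 0" "epsx (Some p) = 1"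
  by (simp_all add: epsx_def)

text \<open>
  Both the Taylor expansion in the formal variable \<open>\<epsilon>\<close> and the Laplace transform at a fixed \<open>\<epsilon> > 0\<close> (with constant
  series as values) are instances, so the formal solution and its Borel sum come from a single computation.
\<close>

locale character = borel_weights +
  fixes chi :: "(complex option \<Rightarrow> complex) \<Rightarrow> complex fps"
  assumes chi_add: "adm \<delta> \<sigma> A F \<Longrightarrow> adm \<delta> \<sigma> B G \<Longrightarrow> chi (\<lambda>x. F x + G x) = chi F + chi G"
    and chi_cmult: "adm \<delta> \<sigma> A F \<Longrightarrow> chi (\<lambda>x. z * F x) = fps_const z * chi F"
    and chi_bound: "\<exists>c\<ge>0. \<forall>A F. adm \<delta> \<sigma> A F \<longrightarrow> norm (chi F $ n) \<le> c * A"
    and chi_star: "adm \<delta> \<sigma> A F \<Longrightarrow> adm \<delta> \<sigma> B G \<Longrightarrow> chi (star F G) = chi F * chi G"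
    and chi_one: "chi (\<lambda>x. if x = None then 1 else 0) = 1"
    and chi_cnj: "adm \<delta> \<sigma> A F \<Longrightarrow> chi (\<lambda>x. cnj (F (map_option cnj x))) $ n = cnj (chi F $ n)"
begin

definition cb :: "nat \<Rightarrow> real" where
  "cb n = (SOME c. c \<ge> 0 \<and> (\<forall>A F. adm \<delta> \<sigma> A F \<longrightarrow> norm (chi F $ n) \<le> c * A))"

lemma cb: "cb n \<ge> 0" "adm \<delta> \<sigma> A F \<Longrightarrow> norm (chi F $ n) \<le> cb n * A"
  using someI_ex[OF chi_bound[unfolded Bex_def], of n] unfolding cb_def by blast+

lemma adm_cong: "adm \<delta> \<sigma> A F \<Longrightarrow> (\<And>x. x \<in> hdom \<delta> \<Longrightarrow> F x = G x) \<Longrightarrow> adm \<delta> \<sigma> A G"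
  unfolding adm_def Ball_hdom by (metis (no_types, lifting) hdom_simps holomorphic_cong)

lemma adm_diff: "adm \<delta> \<sigma> A F \<Longrightarrow> adm \<delta> \<sigma> B G \<Longrightarrow> adm \<delta> \<sigma> (A + B) (\<lambda>x. F x - G x)"
  using adm_add[of \<delta> \<sigma> A F B "\<lambda>x. - 1 * G x"] adm_cmult[of \<delta> \<sigma> B G "-1"] by simp

lemma chi_diff: "adm \<delta> \<sigma> A F \<Longrightarrow> adm \<delta> \<sigma> B G \<Longrightarrow> chi (\<lambda>x. F x - G x) = chi F - chi G"
  using chi_add[of A F B "\<lambda>x. - 1 * G x"] adm_cmult[of \<delta> \<sigma> B G "-1"] chi_cmult[of B G "-1"] by (simp flip: fps_const_neg)

text \<open>The difference is admissible with bound 0, hence mapped to 0. A functional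
  \<open>chi\<close> therefore sees only the values on \<open>hdom \<delta>\<close>.\<close>

lemma chi_cong:
  assumes F: "adm \<delta> \<sigma> A F" and eq: "\<And>x. x \<in> hdom \<delta> \<Longrightarrow> F x = G x"
  shows "chi F = chi G"
proof (rule fps_ext)
  fix n
  have G: "adm \<delta> \<sigma> A G" by (rule adm_cong[OF F eq])
  have "adm \<delta> \<sigma> 0 (\<lambda>x. F x - G x)"
    using adm_diff[OF F G] eq unfolding adm_def by auto
  from cb(2)[OF this, of n] have "chi (\<lambda>x. F x - G x) $ n = 0" by simp
  thus "chi F $ n = chi G $ n" unfolding chi_diff[OF F G] by simp
qed

text \<open>The remainder after a finite set X of indices is admissible with bound
  \<open>infsum B UNIV - sum B X\<close>, and \<open>chi_bound\<close> turns this into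
  convergence.\<close>

lemma chi_infsum:
  fixes F :: "'i \<Rightarrow> complex option \<Rightarrow> complex"
  assumes F: "\<And>i. adm \<delta> \<sigma> (B i) (F i)" and B: "B summable_on UNIV"
  shows "((\<lambda>i. chi (F i) $ n) has_sum chi (\<lambda>x. infsum (\<lambda>i. F i x) UNIV) $ n) UNIV"
proof -
  have adm0: "adm \<delta> \<sigma> 0 (\<lambda>x. 0)" by (simp add: adm_def)
  have fin: "adm \<delta> \<sigma> (sum B X) (\<lambda>x. \<Sum>i\<in>X. F i x) \<and> chi (\<lambda>x. \<Sum>i\<in>X. F i x) = (\<Sum>i\<in>X. chi (F i))" if "finite X" for X
    using that
  proof (induction X rule: finite_induct)
    case empty
    show ?case using adm0 chi_cmult[OF adm0, of 0] by simp
  next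
    case (insert i X)
    thus ?case using adm_add[OF F[of i], of "sum B X"] chi_add[OF F[of i], of "sum B X"] by simp
  qed
  note adm = adm_infsum[OF F B]
  have sumF: "(\<lambda>i. F i x) summable_on UNIV" if "x \<in> hdom \<delta>" for x
    by (rule dominated_summable[OF _ summable_on_cmult_left[OF B, of "mm \<sigma> x"]]) (use F that in \<open>auto simp: adm_def\<close>)
  have indic: "((\<lambda>i. if i \<in> X then f i else 0) has_sum sum f X) UNIV" if "finite X" for X and f :: "'i \<Rightarrow> 'c::banach"
    by (rule has_sum_finite_neutralI[where B = X]) (use that in auto)
  have key: "norm ((\<Sum>i\<in>X. chi (F i) $ n) - chi (\<lambda>x. infsum (\<lambda>i. F i x) UNIV) $ n) \<le> cb n * (infsum B UNIV - sum B X)"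
    if X: "finite X" for X
  proof -
    \<comment> \<open>Terms with index in X are replaced by 0 instead of being removed, so that the
      remainder is again a sum over the whole type.\<close>
    define F' where "F' = (\<lambda>i x. F i x - (if i \<in> X then F i x else 0))"
    define B' where "B' = (\<lambda>i. B i - (if i \<in> X then B i else 0))"
    have F': "adm \<delta> \<sigma> (B' i) (F' i)" for i
      using F[of i] adm0 by (auto simp: F'_def B'_def)
    have B': "(B' has_sum infsum B UNIV - sum B X) UNIV"
      using has_sum_add[OF has_sum_infsum[OF B] has_sum_uminusI[OF indic[OF X, of B]]] by (simp add: B'_def)
    have "adm \<delta> \<sigma> (infsum B UNIV - sum B X) (\<lambda>x. infsum (\<lambda>i. F' i x) UNIV)"
      using adm_infsum[OF F' has_sum_imp_summable[OF B']] infsumI[OF B'] by simp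
    hence a: "adm \<delta> \<sigma> (infsum B UNIV - sum B X) (\<lambda>x. infsum (\<lambda>i. F i x) UNIV - (\<Sum>i\<in>X. F i x))"
    proof (rule adm_cong)
      fix x assume x: "x \<in> hdom \<delta>"
      have "((\<lambda>i. F' i x) has_sum (infsum (\<lambda>i. F i x) UNIV - (\<Sum>i\<in>X. F i x))) UNIV"
        using has_sum_add[OF has_sum_infsum[OF sumF[OF x]] has_sum_uminusI[OF indic[OF X, of "\<lambda>i. F i x"]]]
        by (simp add: F'_def)
      thus "infsum (\<lambda>i. F' i x) UNIV = infsum (\<lambda>i. F i x) UNIV - (\<Sum>i\<in>X. F i x)" by (rule infsumI)
    qed
    from cb(2)[OF a, of n] show ?thesis
      unfolding chi_diff[OF adm conjunct1[OF fin[OF X]]] conjunct2[OF fin[OF X]]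
      by (simp add: norm_minus_commute fps_sum_nth)
  qed
  have "((\<lambda>X. (\<Sum>i\<in>X. chi (F i) $ n) - chi (\<lambda>x. infsum (\<lambda>i. F i x) UNIV) $ n) \<longlongrightarrow> 0) (finite_subsets_at_top UNIV)"
  proof (rule Lim_null_comparison)
    show "\<forall>\<^sub>F X in finite_subsets_at_top UNIV. norm ((\<Sum>i\<in>X. chi (F i) $ n) - chi (\<lambda>x. infsum (\<lambda>i. F i x) UNIV) $ n)
        \<le> cb n * (infsum B UNIV - sum B X)"
      using key by (intro eventually_finite_subsets_at_top_weakI)
    have "((\<lambda>X. cb n * (infsum B UNIV - sum B X)) \<longlongrightarrow> cb n * (infsum B UNIV - infsum B UNIV)) (finite_subsets_at_top UNIV)"
      using has_sum_infsum[OF B] unfolding has_sum_def by (intro tendsto_intros)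
    thus "((\<lambda>X. cb n * (infsum B UNIV - sum B X)) \<longlongrightarrow> 0) (finite_subsets_at_top UNIV)" by simp
  qed
  thus ?thesis unfolding has_sum_def by (simp add: LIM_zero_iff)
qed

lemma fam_adm: "fam A Z \<Longrightarrow> adm \<delta> \<sigma> (A * (qq \<nu> * exp (- (\<xi> / 2) * nn \<nu>))) (Z \<nu>)"
  unfolding adm_def
proof (intro conjI ballI)
  assume Z: "fam A Z"
  show "(\<lambda>p. Z \<nu> (Some p)) holomorphic_on hstrip \<delta>" by (rule fam_holomorphic[OF Z])
  fix x assume x: "x \<in> hdom \<delta>"
  have "ew \<nu> (imx x) \<le> exp (- (\<xi> / 2) * nn \<nu>)"
    using mult_right_mono[OF xi_kappa[OF imx_less[OF x]] nn_nonneg[of \<nu>]]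
    unfolding ew_def exp_le_cancel_iff mult_minus_left by linarith
  hence "A * (qq \<nu> * ew \<nu> (imx x) * mm \<sigma> x) \<le> A * (qq \<nu> * exp (- (\<xi> / 2) * nn \<nu>) * mm \<sigma> x)"
    using fam_nonneg[OF Z] qq_pos[of \<nu>] mm_pos[OF sigma_pos, of x] by (intro mult_left_mono mult_right_mono) auto
  with famD[OF Z x, of \<nu>] show "norm (Z \<nu> x) \<le> A * (qq \<nu> * exp (- (\<xi> / 2) * nn \<nu>)) * mm \<sigma> x"
    by (simp add: wt_def mult.assoc)
qed

lemma fdec_chi: "fam A Z \<Longrightarrow> fdec (\<lambda>\<nu>. chi (Z \<nu>))"
  unfolding fdec_def
proof
  fix n assume Z: "fam A Z"
  show "rdec (\<lambda>\<nu>. chi (Z \<nu>) $ n)"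
    by (rule rdec_exp[where h = "\<xi> / 2" and C = "cb n * A"]) (use cb(2)[OF fam_adm[OF Z]] xi in \<open>auto simp: mult_ac\<close>)
qed

lemma chi_fmul:
  assumes Z: "fam A Z" and Y: "fam B Y"
  shows "((\<lambda>\<mu>. (chi (Z \<mu>) * chi (Y (\<nu> - \<mu>))) $ n) has_sum chi (fmul Z Y \<nu>) $ n) UNIV"
proof -
  have "adm \<delta> \<sigma> (9 * A * B * (qq \<mu> * qq (\<nu> - \<mu>))) (star (Z \<mu>) (Y (\<nu> - \<mu>)))" for \<mu>
    unfolding adm_def
  proof (intro conjI ballI star_holomorphic fam_holomorphic[OF Z] fam_holomorphic[OF Y])
    fix x assume x: "x \<in> hdom \<delta>"
    have "ew \<nu> (imx x) \<le> 1"
      using xi_kappa[OF imx_less[OF x]] xi by (auto simp: ew_def intro!: mult_nonpos_nonneg)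
    hence "9 * A * B * (qq \<mu> * qq (\<nu> - \<mu>)) * (ew \<nu> (imx x) * mm \<sigma> x) \<le> 9 * A * B * (qq \<mu> * qq (\<nu> - \<mu>)) * (1 * mm \<sigma> x)"
      using fam_nonneg[OF Z] fam_nonneg[OF Y] qq_pos[of \<mu>] qq_pos[of "\<nu> - \<mu>"] mm_pos[OF sigma_pos, of x]
      by (intro mult_left_mono mult_right_mono) auto
    with star_mode_bound[OF Z Y x, of \<mu> \<nu>]
    show "norm (star (Z \<mu>) (Y (\<nu> - \<mu>)) x) \<le> 9 * A * B * (qq \<mu> * qq (\<nu> - \<mu>)) * mm \<sigma> x" by simp
  qed
  from chi_infsum[OF this summable_on_cmult_right[OF qq_conv(1)], of n]
  show ?thesis unfolding fmul_def[abs_def] chi_star[OF fam_adm[OF Z] fam_adm[OF Y]] .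
qed

lemma ev_fmul: "fam A Z \<Longrightarrow> fam B Y \<Longrightarrow> ev (\<lambda>\<nu>. chi (fmul Z Y \<nu>)) \<psi> = ev (\<lambda>\<nu>. chi (Z \<nu>)) \<psi> * ev (\<lambda>\<nu>. chi (Y \<nu>)) \<psi>"
  by (rule ev_mult[OF fdec_chi fdec_chi chi_fmul])

text \<open>Conjugation exchanges the modes \<nu> and -\<nu>, and the sum does not change under this
  reflection.\<close>

lemma ev_real:
  assumes Z: "fam A Z" and s: "fsym \<delta> Z"
  shows "cnj (ev (\<lambda>\<nu>. chi (Z \<nu>)) \<psi> $ n) = ev (\<lambda>\<nu>. chi (Z \<nu>)) \<psi> $ n"
proof -
  have c: "chi (Z (- \<nu>)) $ n = cnj (chi (Z \<nu>) $ n)" for \<nu>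
    unfolding chi_cnj[OF fam_adm[OF Z], symmetric]
    using chi_cong[OF fam_adm[OF Z, of "- \<nu>"], of "\<lambda>x. cnj (Z \<nu> (map_option cnj x))"] s
    unfolding fsym_def by simp
  have "cnj (ev (\<lambda>\<nu>. chi (Z \<nu>)) \<psi> $ n) = infsum (\<lambda>\<nu>. fcis \<psi> (- \<nu>) * chi (Z (- \<nu>)) $ n) UNIV"
    unfolding ev_def fps_nth_Abs_fps infsum_cnj[symmetric] complex_cnj_mult fcis_uminus c ..
  also have "\<dots> = ev (\<lambda>\<nu>. chi (Z \<nu>)) \<psi> $ n"
    unfolding ev_def fps_nth_Abs_fps
    by (rule infsum_reindex_bij_witness[where i = uminus and j = uminus]) auto
  finally show ?thesis .
qed

end

section \<open>The kernels of the small divisor equation\<close>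

lemma exp_ge_cubic: "x \<ge> 0 \<Longrightarrow> 1 + x + x\<^sup>2 / 2 + x ^ 3 / 6 \<le> exp (x::real)"
proof -
  assume x: "x \<ge> 0"
  have "(\<Sum>n\<in>{..<4}. inverse (fact n) *\<^sub>R x ^ n) \<le> (\<Sum>n. inverse (fact n) *\<^sub>R x ^ n)"
    using x by (intro sum_le_suminf summable_exp_generic) auto
  also have "(\<Sum>n\<in>{..<4}. inverse (fact n) *\<^sub>R x ^ n) = 1 + x + x\<^sup>2 / 2 + x ^ 3 / 6"
  proof -
    have "{..<4::nat} = {0, 1, 2, 3}" by auto
    thus ?thesis by (simp add: fact_numeral)
  qed
  finally show ?thesis unfolding exp_def .
qed

text \<open>This is the gain of 1/\<sigma> for every factor \<epsilon>: functions bounded by 1 + |p|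
  have norm at most 6/\<sigma>. The factor 6 = 3! matches the cubic term of the exponential series
  with that of (1 + x) (1 + x^2).\<close>

lemma mw_lower: "\<sigma> \<ge> 1 \<Longrightarrow> r \<ge> 0 \<Longrightarrow> 1 + r \<le> 6 / \<sigma> * mw \<sigma> r"
proof -
  assume s: "\<sigma> \<ge> 1" and r: "r \<ge> 0"
  define x where "x = \<sigma> * r"
  have x: "x \<ge> 0" "r \<le> x" using s r mult_right_mono[of 1 \<sigma> r] by (auto simp: x_def)
  have "(1 + r) * (1 + x\<^sup>2) \<le> (1 + x) * (1 + x\<^sup>2)"
    using x by (intro mult_right_mono) auto
  also have "\<dots> = 1 + x + x\<^sup>2 + x ^ 3" by (simp add: algebra_simps power2_eq_square power3_eq_cube)
  also have "\<dots> \<le> 6 * (1 + x + x\<^sup>2 / 2 + x ^ 3 / 6)" using x by simp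
  also have "\<dots> \<le> 6 * exp x" using exp_ge_cubic[OF x(1)] by simp
  finally have "1 + r \<le> 6 * exp x / (1 + x\<^sup>2)" using one_plus_square_pos[of x] by (simp only: pos_le_divide_eq)
  also have "\<dots> = 6 / \<sigma> * mw \<sigma> r" using s by (simp add: mw_def x_def)
  finally show ?thesis .
qed

text \<open>\<open>a\<close> stands for g'(c0), \<open>fc\<close> for the Fourier coefficients of f
  and \<open>gc j\<close> for the Taylor coefficient of g at c0 of order j + 2.\<close>

locale quasi =
  fixes \<omega> :: "real \<times> real" and a C0 :: real and fc :: "int \<times> int \<Rightarrow> complex" and Mf \<xi>0 :: real
    and gc :: "nat \<Rightarrow> complex" and Mg \<theta> :: real
  assumes a: "a \<noteq> 0" and C0: "C0 > 0" and dioph: "\<And>\<nu>. \<nu> \<noteq> 0 \<Longrightarrow> \<bar>\<omega> \<bullet> freq \<nu>\<bar> \<ge> C0 / nn \<nu>"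
    and xi0: "\<xi>0 > 0" and fc: "\<And>\<nu>. norm (fc \<nu>) \<le> Mf * exp (- \<xi>0 * nn \<nu>)" and fc_cnj: "\<And>\<nu>. fc (- \<nu>) = cnj (fc \<nu>)"
    and gc: "\<And>j. norm (gc j) \<le> Mg * \<theta> ^ j" and Mg: "Mg > 0" and theta: "\<theta> > 0" and gc_real: "\<And>j. gc j \<in> \<real>"
begin

definition lam :: "int \<times> int \<Rightarrow> real" where "lam \<nu> = \<omega> \<bullet> freq \<nu>"

text \<open>
  The linear part acts on the mode \<open>\<nu> \<noteq> 0\<close> as \<open>\<i> \<lambda> - \<epsilon> \<lambda>\<^sup>2 + \<epsilon> a = \<i> \<lambda> (1 + \<i> \<Omega> \<epsilon>)\<close> with \<open>\<lambda> = \<omega> \<bullet> \<nu>\<close>. The Borel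
  transform of \<open>\<epsilon> / (\<i> \<lambda> (1 + \<i> \<Omega> \<epsilon>))\<close> is the entire function \<open>enu\<close> below, and \<open>\<tau> = 1\<close> is exactly what makes
  \<open>\<Omega>\<close> grow at most linearly in \<open>\<nu>\<close>.
\<close>

definition Om :: "int \<times> int \<Rightarrow> real" where "Om \<nu> = lam \<nu> - a / lam \<nu>"

text \<open>The slope in |\<Omega>| <= \<kappa> |\<nu>|: the norm of \<omega> controls \<lambda>,
  the Diophantine condition controls a/\<lambda>.\<close>

definition \<kappa> :: real where "\<kappa> = norm \<omega> + \<bar>a\<bar> / C0"

text \<open>Half of the decay of \<open>fc\<close> serves as weight, the other half absorbs the
  polynomial factors in \<open>zf_bound\<close>.\<close>

definition \<xi> :: real where "\<xi> = \<xi>0 / 2"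

definition \<delta> :: real where "\<delta> = \<xi> / (2 * (\<kappa> + 1))"

text \<open>One summand for each case of \<open>kern_bound\<close>: \<lambda>^2 < |a|/2 and
  \<lambda>^2 >= |a|/2.\<close>

definition Ck :: real where "Ck = 4 / \<bar>a\<bar> + sqrt (2 / \<bar>a\<bar>)"

text \<open>The radius is chosen so that \<open>zf\<close> has norm at most A/2. Of the sixth power,
  two factors 1 + |\<nu>| come from \<Omega>/\<lambda> and four from the weight \<open>qq\<close>,
  by \<open>qq_lower\<close>.\<close>

definition A :: real where
  "A = 1 + 2 * (2 * (\<kappa> + 1) * Mf / C0 * (fact 6 * exp \<xi> / \<xi> ^ 6))"

text \<open>144 * sq is \<open>Ka\<close>. The coefficients solve \<open>small1\<close> and
  \<open>small3\<close> for \<sigma> with \<open>ce\<close> = 6/\<sigma> and \<open>ck\<close> = Ck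
  * 6/\<sigma>: 216 = 4 * 9 * 6 and 432 = 2 * 9 * 6 * 4. \<open>small2\<close> follows from
  \<open>small3\<close>.\<close>

definition \<sigma> :: real where
  "\<sigma> = 1 + 216 * \<theta> * (144 * sq) * A + 432 * Ck * Mg * (144 * sq) * A"

lemma nn_ge_1: "\<nu> \<noteq> 0 \<Longrightarrow> nn \<nu> \<ge> 1"
  unfolding nn_def by (cases \<nu>) (auto simp: zero_prod_def)

lemma lam_lower: "\<nu> \<noteq> 0 \<Longrightarrow> \<bar>lam \<nu>\<bar> \<ge> C0 / nn \<nu>"
  unfolding lam_def by (rule dioph)

lemma lam_nonzero: "\<nu> \<noteq> 0 \<Longrightarrow> lam \<nu> \<noteq> 0"
proof -
  assume n: "\<nu> \<noteq> 0"
  have "C0 / nn \<nu> > 0" using C0 nn_ge_1[OF n] by (intro divide_pos_pos) auto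
  thus ?thesis using lam_lower[OF n] by auto
qed

lemma inverse_lam: "\<nu> \<noteq> 0 \<Longrightarrow> 1 / \<bar>lam \<nu>\<bar> \<le> nn \<nu> / C0"
  using lam_lower[of \<nu>] lam_nonzero[of \<nu>] nn_ge_1[of \<nu>] C0 by (simp add: field_simps)

lemma lam_upper: "\<bar>lam \<nu>\<bar> \<le> norm \<omega> * nn \<nu>"
proof -
  have "\<bar>lam \<nu>\<bar> \<le> norm \<omega> * norm (freq \<nu>)"
    unfolding lam_def by (rule Cauchy_Schwarz_ineq2)
  also have "norm (freq \<nu>) \<le> nn \<nu>"
    using norm_Pair_le[of "of_int (fst \<nu>) :: real" "of_int (snd \<nu>) :: real"] by (simp add: freq_def nn_def)
  finally show ?thesis by (simp add: mult_left_mono)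
qed

lemma Om_upper: "\<nu> \<noteq> 0 \<Longrightarrow> \<bar>Om \<nu>\<bar> \<le> \<kappa> * nn \<nu>"
proof -
  assume n: "\<nu> \<noteq> 0"
  have "\<bar>Om \<nu>\<bar> \<le> \<bar>lam \<nu>\<bar> + \<bar>a\<bar> * (1 / \<bar>lam \<nu>\<bar>)"
    unfolding Om_def using abs_triangle_ineq4[of "lam \<nu>" "a / lam \<nu>"] by (simp add: abs_divide)
  also have "\<dots> \<le> norm \<omega> * nn \<nu> + \<bar>a\<bar> * (nn \<nu> / C0)"
    by (intro add_mono lam_upper mult_left_mono inverse_lam n) auto
  finally show ?thesis by (simp add: \<kappa>_def algebra_simps)
qed

lemma Om_lam: "\<nu> \<noteq> 0 \<Longrightarrow> lam \<nu> * Om \<nu> = (lam \<nu>)\<^sup>2 - a"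
  using lam_nonzero[of \<nu>] by (simp add: Om_def power2_eq_square right_diff_distrib)

lemma lam_uminus [simp]: "lam (- \<nu>) = - lam \<nu>"
  by (simp add: lam_def freq_def inner_prod_def)

lemma Om_uminus [simp]: "Om (- \<nu>) = - Om \<nu>"
  by (simp add: Om_def)

lemma kappa_nonneg: "\<kappa> \<ge> 0" using C0 by (simp add: \<kappa>_def)

lemma xi_pos: "\<xi> > 0" using xi0 by (simp add: \<xi>_def)

lemma Ck_pos: "Ck > 0" using a by (simp add: Ck_def add_pos_nonneg)

lemma Mf_nonneg: "Mf \<ge> 0"
  using order_trans[OF norm_ge_zero fc[of 0]] by (simp add: nn_def)

lemma A_ge_1: "A \<ge> 1"
  using kappa_nonneg Mf_nonneg C0 xi_pos unfolding A_def by simp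

lemma sigma_ge_1: "\<sigma> \<ge> 1"
  using A_ge_1 theta Ck_pos Mg sq_pos unfolding \<sigma>_def by simp

end

sublocale quasi \<subseteq> borel_weights \<sigma> \<delta> \<xi> \<kappa>
proof
  show "\<kappa> * \<delta> \<le> \<xi> / 2"
  proof -
    have "\<kappa> * \<delta> = \<kappa> / (\<kappa> + 1) * (\<xi> / 2)" by (simp add: \<delta>_def)
    also have "\<dots> \<le> 1 * (\<xi> / 2)" using kappa_nonneg xi_pos by (intro mult_right_mono) auto
    finally show ?thesis by simp
  qed
qed (use sigma_ge_1 kappa_nonneg xi_pos in \<open>auto simp: \<delta>_def\<close>)

context quasi
begin

section \<open>Borel transforms of the kernel and of the free term\<close>

definition enu :: "int \<times> int \<Rightarrow> complex option \<Rightarrow> complex" where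
  "enu \<nu> x = (case x of None \<Rightarrow> 0 | Some p \<Rightarrow> exp (- \<i> * of_real (Om \<nu>) * p) / (\<i> * of_real (lam \<nu>)))"

text \<open>What stands before the nonlinearity once the linear part is inverted: \<epsilon>^2 /
  (\<i> \<lambda> (1 + \<i> \<Omega> \<epsilon>)), and \<epsilon> / a for the mode 0.\<close>

definition kern :: "int \<times> int \<Rightarrow> complex option \<Rightarrow> complex" where
  "kern \<nu> = (if \<nu> = 0 then (\<lambda>x. 1 / of_real a * epsx x) else star (enu \<nu>) epsx)"

definition onex :: "complex option \<Rightarrow> complex" where
  "onex x = (if x = None then 1 else 0)"

text \<open>The transform of f_\<nu> / (\<i> \<lambda> (1 + \<i> \<Omega> \<epsilon>)), by 1 / (1 +
  \<i> \<Omega> \<epsilon>) = 1 - \<i> \<Omega> \<epsilon> / (1 + \<i> \<Omega> \<epsilon>). The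
  mode 0 is absent because f_0 cancels against g(c0).\<close>

definition zf :: "int \<times> int \<Rightarrow> complex option \<Rightarrow> complex" where
  "zf \<nu> x = (if \<nu> = 0 then 0 else fc \<nu> / (\<i> * of_real (lam \<nu>)) * onex x - \<i> * of_real (Om \<nu>) * fc \<nu> * enu \<nu> x)"

lemma enu_simps: "enu \<nu> None = 0" "enu \<nu> (Some p) = exp (- \<i> * of_real (Om \<nu>) * p) / (\<i> * of_real (lam \<nu>))"
  by (simp_all add: enu_def)

lemma exp_Om_integral:
  "((\<lambda>\<tau>. p * (\<i> * of_real w) * exp (- \<i> * of_real w * (of_real \<tau> * p))) has_integral 1 - exp (- \<i> * of_real w * p)) {0..1::real}"
proof -
  have "((\<lambda>\<tau>. p * (\<i> * of_real w) * exp (- \<i> * of_real w * (of_real \<tau> * p))) has_integral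
     - exp (- \<i> * of_real w * (of_real 1 * p)) - (- exp (- \<i> * of_real w * (of_real 0 * p)))) {0..1::real}"
  proof (rule fundamental_theorem_of_calculus)
    fix \<tau> :: real
    have "((\<lambda>z. - exp (- \<i> * of_real w * (z * p))) has_field_derivative
        p * (\<i> * of_real w) * exp (- \<i> * of_real w * (of_real \<tau> * p))) (at (of_real \<tau>))"
      by (auto intro!: derivative_eq_intros)
    from has_vector_derivative_real_field[OF this]
    show "((\<lambda>\<tau>. - exp (- \<i> * of_real w * (of_real \<tau> * p))) has_vector_derivative
        p * (\<i> * of_real w) * exp (- \<i> * of_real w * (of_real \<tau> * p))) (at \<tau> within {0..1})"
      by (rule has_vector_derivative_at_within)
  qed simp
  thus ?thesis by simp
qed

text \<open>The identity (1 + \<i> \<Omega> \<epsilon>) e = \<epsilon> / (\<i> \<lambda>) for e =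
  \<open>enu \<nu>\<close>; convolution with 1 integrates the exponential. Stated in the Borel plane
  it is available to every functional \<open>chi\<close>.\<close>

lemma enu_relation:
  assumes "\<nu> \<noteq> 0"
  shows "enu \<nu> x = 1 / (\<i> * of_real (lam \<nu>)) * epsx x - \<i> * of_real (Om \<nu>) * star (enu \<nu>) epsx x"
proof (cases x)
  case (Some p)
  let ?l = "\<i> * of_real (lam \<nu>)"
  have l: "?l \<noteq> 0" using lam_nonzero[OF assms] by simp
  have "\<i> * of_real (Om \<nu>) * star (enu \<nu>) epsx x
      = integral {0..1} (\<lambda>\<tau>. \<i> * of_real (Om \<nu>) * (p * (exp (- \<i> * of_real (Om \<nu>) * (of_real \<tau> * p)) / ?l)))"
    by (simp only: Some star_simps enu_simps pconv_def epsx_simps integral_mult_right box_real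
      mult_zero_left mult_zero_right mult_1_right add_0_left mult.assoc[symmetric] of_real_1)
  also have "\<dots> = integral {0..1} (\<lambda>\<tau>. p * (\<i> * of_real (Om \<nu>)) * exp (- \<i> * of_real (Om \<nu>) * (of_real \<tau> * p)) * (1 / ?l))"
    by (simp add: mult_ac)
  also have "\<dots> = (1 - exp (- \<i> * of_real (Om \<nu>) * p)) * (1 / ?l)"
    by (rule integral_unique[OF has_integral_mult_left[OF exp_Om_integral]])
  finally show ?thesis using l by (simp add: Some enu_simps field_simps)
qed (simp add: star_simps enu_simps)

lemma exp_Om_bound:
  assumes "\<nu> \<noteq> 0"
  shows "norm (exp (- \<i> * of_real (Om \<nu>) * p)) \<le> exp (\<kappa> * \<bar>Im p\<bar> * nn \<nu>)"
proof -
  have "Om \<nu> * Im p \<le> \<bar>Om \<nu>\<bar> * \<bar>Im p\<bar>" by (metis abs_ge_self abs_mult)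
  also have "\<dots> \<le> \<kappa> * nn \<nu> * \<bar>Im p\<bar>" by (intro mult_right_mono Om_upper assms) auto
  finally show ?thesis by (simp add: norm_exp_eq_Re mult_ac)
qed

lemma enu_bound:
  assumes "\<nu> \<noteq> 0" "x \<in> hdom \<delta>"
  shows "norm (enu \<nu> x) \<le> 1 / \<bar>lam \<nu>\<bar> * exp (\<kappa> * imx x * nn \<nu>)"
proof (cases x)
  case (Some p)
  show ?thesis using exp_Om_bound[OF assms(1), of p]
    by (simp add: Some enu_simps norm_divide norm_mult divide_right_mono)
qed (simp add: enu_simps)

lemma enu_holomorphic: "\<nu> \<noteq> 0 \<Longrightarrow> (\<lambda>p. enu \<nu> (Some p)) holomorphic_on S"
  using lam_nonzero[of \<nu>] unfolding enu_simps by (intro holomorphic_intros) auto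

text \<open>
  Uniformity in \<open>\<nu>\<close> in spite of the small divisors: if \<open>\<lambda>\<^sup>2\<close> is small compared with \<open>\<bar>a\<bar>\<close>, then \<open>enu\<close> itself is
  large, but its primitive \<open>(1 - exp (- \<i> \<Omega> p)) / (a - \<lambda>\<^sup>2)\<close> is not.
\<close>

lemma kern_bound:
  assumes x: "x \<in> hdom \<delta>"
  shows "norm (kern \<nu> x) \<le> Ck * (6 / \<sigma>) * exp (\<kappa> * imx x * nn \<nu>) * mm \<sigma> x"
proof (cases x)
  case None
  thus ?thesis using Ck_pos sigma_pos by (simp add: kern_def star_simps mm_simps)
next
  case (Some p)
  let ?E = "exp (\<kappa> * \<bar>Im p\<bar> * nn \<nu>)"
  have E: "?E \<ge> 1" using kappa_nonneg by simp
  have "norm (kern \<nu> x) \<le> Ck * (1 + cmod p) * ?E"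
  proof (cases "\<nu> = 0")
    case True
    have "1 / \<bar>a\<bar> \<le> Ck" using a by (simp add: Ck_def divide_right_mono add_increasing2)
    moreover have "Ck * 1 * 1 \<le> Ck * (1 + cmod p) * ?E"
      using Ck_pos E by (intro mult_mono) auto
    ultimately show ?thesis using True Some by (simp add: kern_def norm_divide)
  next
    case False
    let ?l = "\<i> * of_real (lam \<nu>) :: complex"
    have l: "lam \<nu> \<noteq> 0" using lam_nonzero[OF False] .
    show ?thesis
    proof (cases "(lam \<nu>)\<^sup>2 < \<bar>a\<bar> / 2")
      case True
      have ol: "\<bar>a\<bar> / 2 \<le> \<bar>lam \<nu> * Om \<nu>\<bar>" 
      proof -
        have "\<bar>a\<bar> / 2 \<le> \<bar>L - a\<bar>" if "0 \<le> L" "L < \<bar>a\<bar> / 2" for L using that by linarith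
        thus ?thesis using True unfolding Om_lam[OF False] by simp
      qed
      hence Om: "Om \<nu> \<noteq> 0" using a by auto
      \<comment> \<open>\<open>enu_relation\<close> solved for the convolution, which gives the
        primitive in closed form.\<close>
      have "kern \<nu> x = (1 / ?l * epsx x - enu \<nu> x) / (\<i> * of_real (Om \<nu>))"
        using enu_relation[OF False, of x] Om False by (simp add: kern_def)
      also have "\<dots> = (1 - exp (- \<i> * of_real (Om \<nu>) * p)) / (?l * (\<i> * of_real (Om \<nu>)))"
        using Om l Some by (simp add: enu_simps field_simps)
      also have "norm \<dots> = norm (1 - exp (- \<i> * of_real (Om \<nu>) * p)) / \<bar>lam \<nu> * Om \<nu>\<bar>"
        by (simp add: norm_divide norm_mult abs_mult)
      also have "\<dots> \<le> (1 + ?E) / (\<bar>a\<bar> / 2)"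
        using ol a exp_Om_bound[OF False, of p]
        by (intro frac_le norm_triangle_le_diff add_mono) auto
      also have "\<dots> \<le> (2 * ?E) / (\<bar>a\<bar> / 2)"
        using E a by (intro divide_right_mono) auto
      also have "\<dots> = 4 / \<bar>a\<bar> * 1 * ?E" by simp
      also have "\<dots> \<le> Ck * (1 + cmod p) * ?E"
        using a by (intro mult_right_mono mult_mono) (auto simp: Ck_def)
      finally show ?thesis .
    next
      \<comment> \<open>Now 1/|\<lambda>| is bounded, and |p| times the supremum of
        \<open>enu \<nu>\<close> over the segment suffices; this is where the linear growth in p
        comes from.\<close>
      case lam: False
      have "1 / \<bar>lam \<nu>\<bar> \<le> sqrt (2 / \<bar>a\<bar>)"
      proof (rule real_le_rsqrt)
        have "(1 / \<bar>lam \<nu>\<bar>)\<^sup>2 = 1 / (lam \<nu>)\<^sup>2" by (simp add: power_divide)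
        also have "\<dots> \<le> 1 / (\<bar>a\<bar> / 2)" using lam a l by (intro divide_left_mono) auto
        finally show "(1 / \<bar>lam \<nu>\<bar>)\<^sup>2 \<le> 2 / \<bar>a\<bar>" by simp
      qed
      hence il: "1 / \<bar>lam \<nu>\<bar> \<le> Ck" using a by (simp add: Ck_def add_increasing)
      have "norm (kern \<nu> x) = norm (integral (cbox 0 (1::real)) (\<lambda>\<tau>. p * enu \<nu> (Some (of_real \<tau> * p)) * 1))"
        by (simp add: kern_def False Some star_simps enu_simps pconv_def)
      also have "\<dots> \<le> integral (cbox 0 (1::real)) (\<lambda>\<tau>. cmod p * (1 / \<bar>lam \<nu>\<bar> * ?E))"
      proof (rule integral_norm_bound_integral)
        show "(\<lambda>\<tau>. p * enu \<nu> (Some (of_real \<tau> * p)) * 1) integrable_on cbox 0 (1::real)"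
          unfolding enu_simps using l by (intro integrable_continuous continuous_intros) auto
        fix \<tau> :: real assume t: "\<tau> \<in> cbox 0 1"
        have p: "of_real \<tau> * p \<in> hstrip \<delta>" using t x Some by (intro hstrip_scale) auto
        have "\<bar>\<tau> * Im p\<bar> \<le> 1 * \<bar>Im p\<bar>" unfolding abs_mult using t by (intro mult_right_mono) auto
        hence "\<kappa> * \<bar>\<tau> * Im p\<bar> * nn \<nu> \<le> \<kappa> * \<bar>Im p\<bar> * nn \<nu>"
          using kappa_nonneg by (intro mult_right_mono mult_left_mono) auto
        hence "1 / \<bar>lam \<nu>\<bar> * exp (\<kappa> * imx (Some (of_real \<tau> * p)) * nn \<nu>) \<le> 1 / \<bar>lam \<nu>\<bar> * ?E"
          by (intro mult_left_mono) auto
        with enu_bound[OF False, of "Some (of_real \<tau> * p)"] p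
        have "norm (enu \<nu> (Some (of_real \<tau> * p))) \<le> 1 / \<bar>lam \<nu>\<bar> * ?E" by simp
        from mult_left_mono[OF this norm_ge_zero[of p]]
        show "norm (p * enu \<nu> (Some (of_real \<tau> * p)) * 1) \<le> cmod p * (1 / \<bar>lam \<nu>\<bar> * ?E)"
          by (simp only: norm_mult norm_one mult_1_right)
      qed auto
      also have "\<dots> = 1 / \<bar>lam \<nu>\<bar> * cmod p * ?E" by simp
      also have "\<dots> \<le> Ck * (1 + cmod p) * ?E"
        using il Ck_pos by (intro mult_right_mono mult_mono) auto
      finally show ?thesis .
    qed
  qed
  also have "\<dots> \<le> Ck * (6 / \<sigma> * mw \<sigma> (cmod p)) * ?E"
    using Ck_pos by (intro mult_right_mono mult_left_mono mw_lower sigma_ge_1) auto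
  finally show ?thesis by (simp add: Some mm_simps mult_ac)
qed

lemma kern_holomorphic: "(\<lambda>p. kern \<nu> (Some p)) holomorphic_on hstrip \<delta>"
proof (cases "\<nu> = 0")
  case False
  thus ?thesis unfolding kern_def by (simp add: star_holomorphic enu_holomorphic)
qed (simp add: kern_def)

lemma kerb_kern: "kerb (Ck * (6 / \<sigma>)) kern"
  unfolding kerb_def using kern_bound kern_holomorphic by blast

lemma epsx_bound: "norm (epsx x) \<le> 6 / \<sigma> * mm \<sigma> x"
proof (cases x)
  case (Some p)
  have "1 \<le> 1 + cmod p" by simp
  also have "\<dots> \<le> 6 / \<sigma> * mw \<sigma> (cmod p)" by (rule mw_lower[OF sigma_ge_1]) simp
  finally show ?thesis by (simp add: Some mm_simps)
qed (use sigma_pos in \<open>simp add: mm_simps\<close>)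

lemma kerb_epsx: "kerb (6 / \<sigma>) (\<lambda>_. epsx)"
  unfolding kerb_def
proof (intro allI conjI ballI)
  fix \<nu> :: "int \<times> int" and x assume "x \<in> hdom \<delta>"
  have i: "imx x \<ge> 0" by (cases x) auto
  have "6 / \<sigma> * mm \<sigma> x * 1 \<le> 6 / \<sigma> * mm \<sigma> x * exp (\<kappa> * imx x * nn \<nu>)"
    using sigma_pos mm_pos[OF sigma_pos, of x] kappa_nonneg i by (intro mult_left_mono) auto
  with epsx_bound[of x] show "norm (epsx x) \<le> 6 / \<sigma> * exp (\<kappa> * imx x * nn \<nu>) * mm \<sigma> x" by (simp add: mult_ac)
qed simp

text \<open>Four powers of 1 + |\<nu>| taken from an exponential buy the weight
  \<open>qq\<close>.\<close>

lemma qq_lower: "1 \<le> qq \<nu> * (1 + nn \<nu>) ^ 4"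
proof -
  have h: "1 + (of_int n)\<^sup>2 \<le> (1 + nn \<nu>)\<^sup>2" if "\<bar>n\<bar> \<le> \<bar>fst \<nu>\<bar> + \<bar>snd \<nu>\<bar>" for n :: int
  proof -
    have "\<bar>of_int n\<bar> \<le> nn \<nu>" using that unfolding nn_def of_int_abs[symmetric] of_int_le_iff .
    hence "(of_int n)\<^sup>2 \<le> (nn \<nu>)\<^sup>2" by (metis abs_le_square_iff abs_of_nonneg nn_nonneg)
    moreover have "(1 + nn \<nu>)\<^sup>2 = 1 + 2 * nn \<nu> + (nn \<nu>)\<^sup>2" by (simp add: power2_sum)
    ultimately show ?thesis using nn_nonneg[of \<nu>] by linarith
  qed
  have "(1 + (of_int (fst \<nu>))\<^sup>2) * (1 + (of_int (snd \<nu>))\<^sup>2) \<le> (1 + nn \<nu>)\<^sup>2 * (1 + nn \<nu>)\<^sup>2"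
    by (intro mult_mono h) auto
  also have "\<dots> = (1 + nn \<nu>) ^ 4" by (simp add: power_add[symmetric])
  finally show ?thesis
    using mult_pos_pos[OF one_plus_square_pos[of "of_int (fst \<nu>)"] one_plus_square_pos[of "of_int (snd \<nu>)"]]
    unfolding qq_def by (simp add: pos_le_divide_eq)
qed

text \<open>The place where 1/\<lambda> is met without compensation. Together with \<Omega> it costs
  two powers of |\<nu>|, paid from the decay of \<open>fc\<close>.\<close>

lemma zf_bound:
  assumes x: "x \<in> hdom \<delta>"
  shows "norm (zf \<nu> x) \<le> A / 2 * wt \<nu> x"
proof (cases "\<nu> = 0")
  case True
  thus ?thesis using A_ge_1 wt_pos[of \<nu> x] by (simp add: zf_def)
next
  case False
  let ?E = "exp (\<kappa> * imx x * nn \<nu>)" and ?n = "1 + nn \<nu>"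
  \<comment> \<open>The weight never falls below 1/2, so bounded functions have finite norm.\<close>
  have m2: "1 \<le> 2 * mm \<sigma> x"
  proof (cases x)
    case (Some p)
    have s: "\<sigma> * cmod p \<ge> 0" using sigma_pos by simp
    have "1 + (\<sigma> * cmod p)\<^sup>2 \<le> 2 * exp (\<sigma> * cmod p)"
      using exp_ge_cubic[OF s] s zero_le_power[OF s, of 3] by linarith
    also have "\<dots> \<le> 2 * (\<sigma> * exp (\<sigma> * cmod p))" using sigma_ge_1 by simp
    finally show ?thesis using one_plus_square_pos[of "\<sigma> * cmod p"] by (simp add: Some mm_simps mw_def field_simps)
  qed (simp add: mm_simps)
  have l: "lam \<nu> \<noteq> 0" by (rule lam_nonzero[OF False])
  have E1: "?E \<ge> 1" using kappa_nonneg by (cases x) auto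
  have 1: "norm (zf \<nu> x) \<le> (\<kappa> + 1) * ?n * (nn \<nu> / C0) * norm (fc \<nu>) * ?E"
  proof (cases x)
    case None
    have "norm (zf \<nu> x) = 1 / \<bar>lam \<nu>\<bar> * norm (fc \<nu>)"
      using False None by (simp add: zf_def onex_def enu_simps norm_divide norm_mult)
    also have "\<dots> \<le> (nn \<nu> / C0) * norm (fc \<nu>)" by (intro mult_right_mono inverse_lam False) auto
    also have "\<dots> \<le> ((\<kappa> + 1) * ?n) * ((nn \<nu> / C0) * norm (fc \<nu>))"
      using mult_mono[of 1 "\<kappa> + 1" 1 ?n] kappa_nonneg C0 mult_right_mono[of 1 "(\<kappa> + 1) * ?n" "(nn \<nu> / C0) * norm (fc \<nu>)"]
      by simp
    finally show ?thesis using None by (simp add: mult_ac)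
  next
    case (Some p)
    have "norm (zf \<nu> x) = \<bar>Om \<nu>\<bar> * norm (fc \<nu>) * norm (enu \<nu> x)"
      using False Some by (simp add: zf_def onex_def norm_mult)
    also have "\<dots> \<le> (\<kappa> * nn \<nu>) * norm (fc \<nu>) * ((nn \<nu> / C0) * ?E)"
    proof (intro mult_mono Om_upper False order_refl)
      show "norm (enu \<nu> x) \<le> (nn \<nu> / C0) * ?E"
        by (rule order_trans[OF enu_bound[OF False x]]) (intro mult_right_mono inverse_lam False; simp)
    qed (use kappa_nonneg in auto)
    also have "\<dots> = (\<kappa> * nn \<nu>) * (norm (fc \<nu>) * ((nn \<nu> / C0) * ?E))" by simp
    also have "\<dots> \<le> ((\<kappa> + 1) * ?n) * (norm (fc \<nu>) * ((nn \<nu> / C0) * ?E))"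
      using kappa_nonneg C0 by (intro mult_right_mono mult_mono) auto
    finally show ?thesis by (simp add: mult_ac)
  qed
  also have "\<dots> \<le> (\<kappa> + 1) * ?n * (?n / C0) * (Mf * exp (- \<xi>0 * nn \<nu>)) * ?E"
    using kappa_nonneg C0 by (intro mult_right_mono mult_mono fc divide_right_mono) auto
  \<comment> \<open>exp(- \<xi>0 |\<nu>|) is split into two equal factors: one absorbs the
    polynomial, the other joins \<open>?E\<close> to form \<open>ew \<nu> (imx x)\<close>.\<close>
  also have "\<dots> = (\<kappa> + 1) * Mf / C0 * (?n ^ 2 * exp (- \<xi> * nn \<nu>)) * (exp (- \<xi> * nn \<nu>) * ?E)"
  proof -
    have "exp (- \<xi>0 * nn \<nu>) = exp (- \<xi> * nn \<nu>) * exp (- \<xi> * nn \<nu>)"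
      unfolding exp_add[symmetric] by (simp add: \<xi>_def)
    thus ?thesis by (simp add: power2_eq_square mult_ac)
  qed
  also have "exp (- \<xi> * nn \<nu>) * ?E = ew \<nu> (imx x)"
    unfolding ew_def exp_add[symmetric] by (simp add: algebra_simps)
  also have "(\<kappa> + 1) * Mf / C0 * (?n ^ 2 * exp (- \<xi> * nn \<nu>)) * ew \<nu> (imx x)
      \<le> (\<kappa> + 1) * Mf / C0 * ((fact 6 * exp \<xi> / \<xi> ^ 6) * qq \<nu>) * ew \<nu> (imx x)"
  proof (intro mult_right_mono mult_left_mono)
    have "?n ^ 2 * exp (- \<xi> * nn \<nu>) * 1 \<le> ?n ^ 2 * exp (- \<xi> * nn \<nu>) * (qq \<nu> * ?n ^ 4)"
      by (intro mult_left_mono qq_lower) auto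
    also have "\<dots> = (?n ^ 6 * exp (- \<xi> * nn \<nu>)) * qq \<nu>" by (simp add: power_add[symmetric] mult_ac)
    also have "\<dots> \<le> (fact 6 * exp \<xi> / \<xi> ^ 6) * qq \<nu>"
      using qq_pos[of \<nu>] by (intro mult_right_mono poly_exp_bound xi_pos) auto
    finally show "?n ^ 2 * exp (- \<xi> * nn \<nu>) \<le> (fact 6 * exp \<xi> / \<xi> ^ 6) * qq \<nu>" by simp
  qed (use kappa_nonneg Mf_nonneg C0 in \<open>auto simp: ew_def\<close>)
  also have "\<dots> = ((\<kappa> + 1) * Mf / C0 * (fact 6 * exp \<xi> / \<xi> ^ 6)) * qq \<nu> * ew \<nu> (imx x) * 1"
    by (simp add: mult_ac)
  also have "\<dots> \<le> ((\<kappa> + 1) * Mf / C0 * (fact 6 * exp \<xi> / \<xi> ^ 6)) * qq \<nu> * ew \<nu> (imx x) * (2 * mm \<sigma> x)"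
    using kappa_nonneg Mf_nonneg C0 xi_pos qq_pos[of \<nu>] by (intro mult_left_mono m2) (auto simp: ew_def)
  also have "\<dots> = (2 * (\<kappa> + 1) * Mf / C0 * (fact 6 * exp \<xi> / \<xi> ^ 6)) * wt \<nu> x" by (simp add: wt_def mult_ac)
  also have "\<dots> \<le> A / 2 * wt \<nu> x"
    using wt_pos[of \<nu> x] unfolding A_def by (intro mult_right_mono) auto
  finally show ?thesis .
qed

lemma fam_zf: "fam (A / 2) zf"
  unfolding fam_def
proof (intro allI conjI ballI zf_bound)
  fix \<nu> show "(\<lambda>p. zf \<nu> (Some p)) holomorphic_on hstrip \<delta>"
    by (cases "\<nu> = 0") (auto simp: zf_def onex_def intro!: holomorphic_intros enu_holomorphic)
qed

lemma enu_cnj: "enu (- \<nu>) x = cnj (enu \<nu> (map_option cnj x))"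
  by (cases x) (auto simp: enu_simps exp_cnj)

lemma fsym_epsx: "fsym \<delta> (\<lambda>_. epsx)"
  unfolding fsym_def epsx_def by (auto split: option.splits)

lemma fsym_zf: "fsym \<delta> zf"
  unfolding fsym_def by (auto simp: zf_def enu_cnj fc_cnj onex_def)

lemma fsym_kern: "fsym \<delta> kern"
  unfolding fsym_def
proof (intro allI ballI)
  fix \<nu> x assume x: "x \<in> hdom \<delta>"
  have e: "cnj (epsx (map_option cnj y)) = epsx y" for y by (cases y) auto
  show "kern (- \<nu>) x = cnj (kern \<nu> (map_option cnj x))"
  proof (cases "\<nu> = 0")
    case False
    have "star (enu (- \<nu>)) epsx x = star (\<lambda>y. cnj (enu \<nu> (map_option cnj y))) (\<lambda>y. cnj (epsx (map_option cnj y))) x"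
      unfolding enu_cnj[abs_def] e ..
    thus ?thesis using False by (simp add: kern_def star_cnj)
  qed (use e[of x] in \<open>simp add: kern_def epsx_def split: option.splits\<close>)
qed

end

sublocale quasi \<subseteq> borel_fixpoint \<sigma> \<delta> \<xi> \<kappa> "6 / \<sigma>" "Ck * (6 / \<sigma>)" A Mg \<theta> "\<lambda>_. epsx" kern zf gc
proof
  have 1: "216 * \<theta> * Ka * A \<le> \<sigma>" and 2: "432 * Ck * Mg * Ka * A \<le> \<sigma>"
    using A_ge_1 theta Ck_pos Mg sq_pos unfolding \<sigma>_def Ka_def by auto
  have "\<theta> * (Ka * (9 * (6 / \<sigma>) * A)) = (216 * \<theta> * Ka * A) / \<sigma> / 4" by simp
  also have "\<dots> \<le> \<sigma> / \<sigma> / 4" using 1 sigma_pos by (intro divide_right_mono) auto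
  finally show "\<theta> * (Ka * (9 * (6 / \<sigma>) * A)) \<le> 1 / 4" using sigma_pos by simp
  have "9 * (Ck * (6 / \<sigma>)) * (4 * Mg * Ka * A) = (432 * Ck * Mg * Ka * A) / \<sigma> / 2" by simp
  also have "\<dots> \<le> \<sigma> / \<sigma> / 2" using 2 sigma_pos by (intro divide_right_mono) auto
  finally show 3: "9 * (Ck * (6 / \<sigma>)) * (4 * Mg * Ka * A) \<le> 1 / 2" using sigma_pos by simp
  have "9 * (Ck * (6 / \<sigma>)) * (2 * Mg * Ka * A\<^sup>2) = 9 * (Ck * (6 / \<sigma>)) * (4 * Mg * Ka * A) * (A / 2)"
    by (simp add: power2_eq_square)
  also have "\<dots> \<le> 1 / 2 * (A / 2)" using A_ge_1 by (intro mult_right_mono 3) auto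
  finally show "9 * (Ck * (6 / \<sigma>)) * (2 * Mg * Ka * A\<^sup>2) \<le> A / 2" using A_ge_1 by simp
qed (use kerb_epsx kerb_kern fam_zf gc Mg theta A_ge_1 gc_real fsym_epsx fsym_kern fsym_zf in auto)

section \<open>The equation for the Fourier modes\<close>

lemma has_vector_derivativeI_quadratic:
  fixes F :: "real \<Rightarrow> 'a::real_normed_vector"
  assumes "\<And>h. norm (F (t + h) - F t - h *\<^sub>R D) \<le> C * h\<^sup>2"
  shows "(F has_vector_derivative D) (at t)"
  unfolding has_vector_derivative_def has_derivative_at
proof
  show "bounded_linear (\<lambda>h. h *\<^sub>R D)" by (rule bounded_linear_scaleR_left)
  show "(\<lambda>h. norm (F (t + h) - F t - h *\<^sub>R D) / norm h) \<midarrow>0\<rightarrow> 0"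
  proof (rule Lim_null_comparison[where g = "\<lambda>h. C * norm h"])
    show "\<forall>\<^sub>F h in at 0. norm (norm (F (t + h) - F t - h *\<^sub>R D) / norm h) \<le> C * norm h"
      using assms by (auto simp: eventually_at_filter divide_simps power2_eq_square mult.assoc)
    show "(\<lambda>h. C * norm h) \<midarrow>0\<rightarrow> 0"
      by (intro tendsto_mult_right_zero tendsto_norm_zero tendsto_ident_at)
  qed
qed

lemma cis_taylor: "cmod (cis (x + h) - cis x - of_real h * (\<i> * cis x)) \<le> h\<^sup>2"
proof -
  have "cis (x + h) - cis x - of_real h * (\<i> * cis x) = cis x * (exp (\<i> * of_real h) - (\<Sum>k\<le>1. (\<i> * of_real h) ^ k / fact k))"
    by (simp add: cis_conv_exp exp_add algebra_simps)
  also have "cmod \<dots> = cmod (exp (\<i> * of_real h) - (\<Sum>k\<le>1. (\<i> * of_real h) ^ k / fact k))"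
    by (simp add: norm_mult)
  also have "\<dots> \<le> h\<^sup>2" using Taylor_exp[of "\<i> * of_real h" 1] by (simp add: norm_mult power2_eq_square)
  finally show ?thesis .
qed

text \<open>Each mode differs from its linearisation in h by at most (h l_\<nu>)^2 |b_\<nu>|, and
  rapid decay makes these bounds sum to a multiple of h^2.\<close>

lemma fourier_series_derivative:
  assumes b: "rdec b" and l: "\<And>\<nu>. \<bar>l \<nu>\<bar> \<le> K * nn \<nu>"
  shows "((\<lambda>t. infsum (\<lambda>\<nu>. cis (t * l \<nu>) * b \<nu>) UNIV) has_vector_derivative
          infsum (\<lambda>\<nu>. cis (t * l \<nu>) * (\<i> * of_real (l \<nu>) * b \<nu>)) UNIV) (at t)"
proof (rule has_vector_derivativeI_quadratic)
  fix h
  have K: "\<bar>l \<nu>\<bar> \<le> \<bar>K\<bar> * (1 + nn \<nu>)" for \<nu>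
  proof -
    have "\<bar>l \<nu>\<bar> \<le> K * nn \<nu>" by (rule l)
    also have "\<dots> \<le> \<bar>K\<bar> * (1 + nn \<nu>)" by (intro mult_mono) auto
    finally show ?thesis .
  qed
  have b1: "rdec (\<lambda>\<nu>. \<i> * of_real (l \<nu>) * b \<nu>)"
    by (rule rdec_poly[OF b]) (use K in \<open>simp add: norm_mult\<close>)
  have b2: "rdec (\<lambda>\<nu>. \<i> * of_real (l \<nu>) * (\<i> * of_real (l \<nu>) * b \<nu>))"
    by (rule rdec_poly[OF b1]) (use K in \<open>simp add: norm_mult\<close>)
  define s where "s = infsum (\<lambda>\<nu>. norm (\<i> * of_real (l \<nu>) * (\<i> * of_real (l \<nu>) * b \<nu>))) UNIV"
  have s: "((\<lambda>\<nu>. norm (\<i> * of_real (l \<nu>) * (\<i> * of_real (l \<nu>) * b \<nu>))) has_sum s) UNIV"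
    unfolding s_def by (intro has_sum_infsum rdec_summable[OF b2]) simp
  have S: "(\<lambda>\<nu>. cis (t * l \<nu>) * b \<nu>) summable_on UNIV" for t
    by (rule rdec_summable[OF b]) (simp add: norm_mult)
  have S1: "(\<lambda>\<nu>. cis (t * l \<nu>) * (\<i> * of_real (l \<nu>) * b \<nu>)) summable_on UNIV"
    by (rule rdec_summable[OF b1]) (simp add: norm_mult)
  let ?L = "infsum (\<lambda>\<nu>. cis ((t + h) * l \<nu>) * b \<nu>) UNIV - infsum (\<lambda>\<nu>. cis (t * l \<nu>) * b \<nu>) UNIV
      - h *\<^sub>R infsum (\<lambda>\<nu>. cis (t * l \<nu>) * (\<i> * of_real (l \<nu>) * b \<nu>)) UNIV"
  have L: "((\<lambda>\<nu>. cis ((t + h) * l \<nu>) * b \<nu> - cis (t * l \<nu>) * b \<nu> - h *\<^sub>R (cis (t * l \<nu>) * (\<i> * of_real (l \<nu>) * b \<nu>))) has_sum ?L) UNIV"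
    using has_sum_add[OF has_sum_add[OF has_sum_infsum[OF S[of "t + h"]] has_sum_uminusI[OF has_sum_infsum[OF S[of t]]]]
      has_sum_uminusI[OF has_sum_scaleR[OF has_sum_infsum[OF S1], of h]]] by simp
  show "norm ?L \<le> s * h\<^sup>2"
  proof (rule norm_infsum_le[OF L has_sum_cmult_left[OF s, of "h\<^sup>2"]])
    fix \<nu>
    have "cis ((t + h) * l \<nu>) * b \<nu> - cis (t * l \<nu>) * b \<nu> - h *\<^sub>R (cis (t * l \<nu>) * (\<i> * of_real (l \<nu>) * b \<nu>))
      = (cis (t * l \<nu> + h * l \<nu>) - cis (t * l \<nu>) - of_real (h * l \<nu>) * (\<i> * cis (t * l \<nu>))) * b \<nu>"
      by (simp add: algebra_simps scaleR_conv_of_real)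
    also have "norm \<dots> \<le> (h * l \<nu>)\<^sup>2 * norm (b \<nu>)"
      unfolding norm_mult by (intro mult_right_mono cis_taylor) auto
    also have "\<dots> = norm (\<i> * of_real (l \<nu>) * (\<i> * of_real (l \<nu>) * b \<nu>)) * h\<^sup>2"
      by (simp add: norm_mult power_mult_distrib power2_eq_square abs_mult_self_eq mult_ac)
    finally show "norm (cis ((t + h) * l \<nu>) * b \<nu> - cis (t * l \<nu>) * b \<nu> - h *\<^sub>R (cis (t * l \<nu>) * (\<i> * of_real (l \<nu>) * b \<nu>)))
        \<le> norm (\<i> * of_real (l \<nu>) * (\<i> * of_real (l \<nu>) * b \<nu>)) * h\<^sup>2" .
  qed
qed

section \<open>The equation satisfied by the fixed point\<close>

context quasi
begin

lemma fcis_scaleR: "fcis (t *\<^sub>R \<omega>) \<nu> = cis (t * lam \<nu>)"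
  by (simp add: fcis_def lam_def inner_commute)

lemma ev_derivative:
  assumes "fdec V"
  shows "((\<lambda>t. ev V (t *\<^sub>R \<omega>) $ n) has_vector_derivative
      ev (\<lambda>\<nu>. fps_const (\<i> * of_real (lam \<nu>)) * V \<nu>) (t *\<^sub>R \<omega>) $ n) (at t)"
  using fourier_series_derivative[of "\<lambda>\<nu>. V \<nu> $ n" lam "norm \<omega>" t] assms lam_upper
  unfolding fdec_def ev_def fps_nth_Abs_fps fcis_scaleR fps_mult_left_const_nth by blast

lemma fdec_lam: "fdec V \<Longrightarrow> fdec (\<lambda>\<nu>. fps_const (\<i> * of_real (lam \<nu>)) * V \<nu>)"
  unfolding fdec_def fps_mult_left_const_nth
proof
  fix n assume V: "\<forall>n. rdec (\<lambda>\<nu>. V \<nu> $ n)"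
  show "rdec (\<lambda>\<nu>. \<i> * of_real (lam \<nu>) * V \<nu> $ n)"
  proof (rule rdec_poly[where D = "norm \<omega>"])
    fix \<nu>
    have "norm \<omega> * nn \<nu> \<le> norm \<omega> * (1 + nn \<nu>)" by (intro mult_left_mono) auto
    thus "norm (\<i> * of_real (lam \<nu>)) \<le> norm \<omega> * (1 + nn \<nu>)" using lam_upper[of \<nu>] by (simp add: norm_mult)
  qed (use V in auto)
qed

abbreviation Y :: "int \<times> int \<Rightarrow> complex option \<Rightarrow> complex" where
  "Y \<equiv> nonlin gc (\<lambda>_. epsx) Z"

lemma adm_epsx: "adm \<delta> \<sigma> (6 / \<sigma>) epsx"
  unfolding adm_def using epsx_bound by auto

lemma adm_onex: "adm \<delta> \<sigma> 1 onex"
  unfolding adm_def onex_def Ball_hdom using mm_pos[OF sigma_pos] by (auto simp: less_imp_le mm_simps(1))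

text \<open>The bound may grow with \<nu>, since \<open>mode_equation\<close> treats one mode at a
  time.\<close>

lemma adm_enu: "\<nu> \<noteq> 0 \<Longrightarrow> adm \<delta> \<sigma> (1 / \<bar>lam \<nu>\<bar> * exp (\<kappa> * \<delta> * nn \<nu>) * 2) (enu \<nu>)"
  unfolding adm_def
proof (intro conjI ballI enu_holomorphic)
  assume n: "\<nu> \<noteq> 0"
  fix x assume x: "x \<in> hdom \<delta>"
  have m2: "1 \<le> 2 * mm \<sigma> x"
  proof (cases x)
    case (Some p)
    have s: "\<sigma> * cmod p \<ge> 0" using sigma_pos by simp
    have "1 + (\<sigma> * cmod p)\<^sup>2 \<le> 2 * exp (\<sigma> * cmod p)"
      using exp_ge_cubic[OF s] s zero_le_power[OF s, of 3] by linarith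
    also have "\<dots> \<le> 2 * (\<sigma> * exp (\<sigma> * cmod p))" using sigma_ge_1 by simp
    finally show ?thesis using one_plus_square_pos[of "\<sigma> * cmod p"] by (simp add: Some mm_simps mw_def field_simps)
  qed (simp add: mm_simps)
  have "\<kappa> * imx x * nn \<nu> \<le> \<kappa> * \<delta> * nn \<nu>"
    using kappa_nonneg imx_less[OF x] by (intro mult_right_mono mult_left_mono) auto
  hence "1 / \<bar>lam \<nu>\<bar> * exp (\<kappa> * imx x * nn \<nu>) * 1 \<le> 1 / \<bar>lam \<nu>\<bar> * exp (\<kappa> * \<delta> * nn \<nu>) * (2 * mm \<sigma> x)"
    using m2 by (intro mult_mono) auto
  with enu_bound[OF n x] show "norm (enu \<nu> x) \<le> 1 / \<bar>lam \<nu>\<bar> * exp (\<kappa> * \<delta> * nn \<nu>) * 2 * mm \<sigma> x" by simp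
qed

lemma adm_kern: "\<exists>B. adm \<delta> \<sigma> B (kern \<nu>)"
  using adm_cmult[OF adm_epsx, of "1 / of_real a"] adm_star[OF sigma_pos adm_enu adm_epsx, of \<nu>]
  by (cases "\<nu> = 0") (auto simp: kern_def)

text \<open>Multiplying the fixed point equation by \<i> \<lambda> (1 + \<i> \<Omega> E) undoes the
  inversion of the linear part. After \<open>chi\<close> is applied the argument consists of ring
  identities, so \<open>E\<close> may be the formal variable or a number.\<close>

lemma mode_equation:
  assumes ch: "character \<sigma> \<delta> \<xi> \<kappa> chi"
  defines "E \<equiv> chi epsx" and "L \<equiv> \<lambda>\<nu>. fps_const (\<i> * of_real (lam \<nu>))"
  shows "L \<nu> * chi (Z \<nu>) + E * (L \<nu> * (L \<nu> * chi (Z \<nu>))) + fps_const (of_real a) * (E * chi (Z \<nu>)) + E\<^sup>2 * chi (Y \<nu>)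
    = fps_const (if \<nu> = 0 then 0 else fc \<nu>)"
proof -
  interpret character \<sigma> \<delta> \<xi> \<kappa> chi by (rule ch)
  have Yad: "\<exists>B. adm \<delta> \<sigma> B (Y \<nu>)" for \<nu> using fam_adm[OF fam_nonlin[OF fam_Z]] by blast
  have zfad: "\<exists>B. adm \<delta> \<sigma> B (zf \<nu>)" using fam_adm[OF fam_zf] by blast
  obtain By where By: "adm \<delta> \<sigma> By (Y \<nu>)" using Yad by blast
  obtain Bk where Bk: "adm \<delta> \<sigma> Bk (kern \<nu>)" using adm_kern by blast
  obtain Bz where Bz: "adm \<delta> \<sigma> Bz (zf \<nu>)" using zfad by blast
  have "chi (Z \<nu>) = chi (\<lambda>x. zf \<nu> x - star (kern \<nu>) (Y \<nu>) x)"
    by (rule chi_cong[OF fam_adm[OF fam_Z]]) (use Z_fixpoint in \<open>auto simp: smul_def\<close>)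
  also have "\<dots> = chi (zf \<nu>) - chi (kern \<nu>) * chi (Y \<nu>)"
    unfolding chi_diff[OF Bz adm_star[OF sigma_pos Bk By]] chi_star[OF Bk By] ..
  finally have Zeq: "chi (Z \<nu>) = chi (zf \<nu>) - chi (kern \<nu>) * chi (Y \<nu>)" .
  show ?thesis
  proof (cases "\<nu> = 0")
    case True
    have "lam \<nu> = 0" using True by (simp add: lam_def freq_def zero_prod_def[symmetric])
    moreover have "chi (zf \<nu>) = 0"
    proof -
      have "zf \<nu> = (\<lambda>x. 0 * epsx x)" using True by (auto simp: zf_def)
      thus ?thesis using chi_cmult[OF adm_epsx, of 0] by simp
    qed
    moreover have "chi (kern \<nu>) = fps_const (1 / of_real a) * E"
      using True chi_cmult[OF adm_epsx, of "1 / of_real a"] by (simp add: kern_def E_def)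
    moreover have "fps_const (of_real a :: complex) * fps_const (1 / of_real a) = 1"
      using a by simp
    ultimately show ?thesis using True Zeq
      by (simp add: L_def power2_eq_square algebra_simps)
  next
    case False
    define e where "e = chi (enu \<nu>)"
    let ?l = "\<i> * of_real (lam \<nu>) :: complex" and ?o = "\<i> * of_real (Om \<nu>) :: complex"
    have l: "?l \<noteq> 0" using lam_nonzero[OF False] by simp
    note Be = adm_enu[OF False]
    have k: "chi (kern \<nu>) = e * E"
      using False chi_star[OF Be adm_epsx] by (simp add: kern_def e_def E_def)
    have "e = chi (\<lambda>x. 1 / ?l * epsx x - ?o * star (enu \<nu>) epsx x)"
      unfolding e_def by (rule arg_cong[where f = chi]) (use enu_relation[OF False] in auto)
    also have "\<dots> = fps_const (1 / ?l) * E - fps_const ?o * (e * E)"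
      unfolding chi_diff[OF adm_cmult[OF adm_epsx] adm_cmult[OF adm_star[OF sigma_pos Be adm_epsx]]]
        chi_cmult[OF adm_epsx] chi_cmult[OF adm_star[OF sigma_pos Be adm_epsx]] chi_star[OF Be adm_epsx] E_def e_def ..
    finally have e: "e = fps_const (1 / ?l) * E - fps_const ?o * (e * E)" .
    have li: "L \<nu> * fps_const (1 / ?l) = 1" using l by (simp add: L_def)
    \<comment> \<open>This is (1 + \<i> \<Omega> E) e = E / (\<i> \<lambda>), multiplied by \<i>
      \<lambda> so that no division occurs.\<close>
    have Le: "L \<nu> * e + L \<nu> * fps_const ?o * (E * e) = E"
    proof -
      have "L \<nu> * e = (L \<nu> * fps_const (1 / ?l)) * E - L \<nu> * fps_const ?o * (e * E)"
        by (subst e) (simp only: right_diff_distrib mult.assoc)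
      thus ?thesis unfolding li by (simp add: mult_ac)
    qed
    have zf: "chi (zf \<nu>) = fps_const (fc \<nu>) * fps_const (1 / ?l) - fps_const (fc \<nu>) * (fps_const ?o * e)"
    proof -
      have "chi (zf \<nu>) = chi (\<lambda>x. (fc \<nu> / ?l) * onex x - (?o * fc \<nu>) * enu \<nu> x)"
        by (rule arg_cong[where f = chi]) (use False in \<open>auto simp: zf_def\<close>)
      also have "\<dots> = fps_const (fc \<nu> / ?l) * chi onex - fps_const (?o * fc \<nu>) * e"
        unfolding chi_diff[OF adm_cmult[OF adm_onex] adm_cmult[OF Be]] chi_cmult[OF adm_onex] chi_cmult[OF Be] e_def ..
      also have "chi onex = 1" using chi_one by (simp add: onex_def[abs_def])
      finally show ?thesis by (simp add: mult_ac flip: fps_const_mult) 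
    qed
    \<comment> \<open>The factor \<i> \<lambda> \<i> \<Omega> = - \<lambda>^2 + a of
      \<open>E\<close> combines the second time derivative with the linear term of g.\<close>
    have LL: "L \<nu> * fps_const ?o = L \<nu> * L \<nu> + fps_const (of_real a)"
    proof -
      have "?l * ?o = - of_real (lam \<nu> * Om \<nu>)" by (simp add: complex_eq_iff)
      also have "\<dots> = ?l * ?l + of_real a" unfolding Om_lam[OF False] by (simp add: power2_eq_square complex_eq_iff)
      finally show ?thesis by (simp add: L_def flip: fps_const_add)
    qed
    define W where "W = chi (Y \<nu>)"
    define F where "F = fps_const (fc \<nu>)"
    define O' where "O' = fps_const ?o"
    define I where "I = fps_const (1 / ?l)"
    define z where "z = chi (Z \<nu>)"
    have z: "z = F * I - F * (O' * e) - e * E * W"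
      using Zeq unfolding zf k z_def W_def F_def O'_def I_def by simp
    have "L \<nu> * z + E * (L \<nu> * (L \<nu> * z)) + fps_const (of_real a) * (E * z) = L \<nu> * z + E * ((L \<nu> * O') * z)"
      unfolding O'_def LL by (simp add: algebra_simps)
    also have "\<dots> = F * (L \<nu> * I) * (1 + E * O') - (F * O' + E * W) * (L \<nu> * e + L \<nu> * O' * (E * e))"
      unfolding z by (simp add: algebra_simps)
    also have "\<dots> = F - E\<^sup>2 * W"
      using li Le unfolding I_def[symmetric] O'_def[symmetric] by (simp add: algebra_simps power2_eq_square)
    finally show ?thesis using False by (simp add: z_def W_def F_def)
  qed
qed

lemma evaluated_equation:
  assumes ch: "character \<sigma> \<delta> \<xi> \<kappa> chi"
  defines "E \<equiv> chi epsx" and "L \<equiv> \<lambda>\<nu>. fps_const (\<i> * of_real (lam \<nu>))"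
  shows "ev (\<lambda>\<nu>. L \<nu> * chi (Z \<nu>)) \<psi> + E * ev (\<lambda>\<nu>. L \<nu> * (L \<nu> * chi (Z \<nu>))) \<psi>
     + fps_const (of_real a) * (E * ev (\<lambda>\<nu>. chi (Z \<nu>)) \<psi>) + E\<^sup>2 * ev (\<lambda>\<nu>. chi (Y \<nu>)) \<psi>
    = ev (\<lambda>\<nu>. fps_const (if \<nu> = 0 then 0 else fc \<nu>)) \<psi>"
proof -
  interpret character \<sigma> \<delta> \<xi> \<kappa> chi by (rule ch)
  have V: "fdec (\<lambda>\<nu>. chi (Z \<nu>))" and W: "fdec (\<lambda>\<nu>. chi (Y \<nu>))"
    by (rule fdec_chi[OF fam_Z] fdec_chi[OF fam_nonlin[OF fam_Z]])+
  have V1: "fdec (\<lambda>\<nu>. L \<nu> * chi (Z \<nu>))" and V2: "fdec (\<lambda>\<nu>. L \<nu> * (L \<nu> * chi (Z \<nu>)))"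
    unfolding L_def by (intro fdec_lam V)+
  have me: "L \<nu> * chi (Z \<nu>) + E * (L \<nu> * (L \<nu> * chi (Z \<nu>))) + fps_const (of_real a) * (E * chi (Z \<nu>)) + E\<^sup>2 * chi (Y \<nu>)
    = fps_const (if \<nu> = 0 then 0 else fc \<nu>)" for \<nu>
    using mode_equation[OF ch, of \<nu>] unfolding L_def E_def .
  have "ev (\<lambda>\<nu>. fps_const (if \<nu> = 0 then 0 else fc \<nu>)) \<psi>
     = ev (\<lambda>\<nu>. L \<nu> * chi (Z \<nu>) + E * (L \<nu> * (L \<nu> * chi (Z \<nu>))) + fps_const (of_real a) * (E * chi (Z \<nu>)) + E\<^sup>2 * chi (Y \<nu>)) \<psi>"
    unfolding me ..
  also have "\<dots> = ev (\<lambda>\<nu>. L \<nu> * chi (Z \<nu>)) \<psi> + E * ev (\<lambda>\<nu>. L \<nu> * (L \<nu> * chi (Z \<nu>))) \<psi>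
     + fps_const (of_real a) * (E * ev (\<lambda>\<nu>. chi (Z \<nu>)) \<psi>) + E\<^sup>2 * ev (\<lambda>\<nu>. chi (Y \<nu>)) \<psi>"
    using V W V1 V2 by (simp only: ev_add ev_cmult fdec_add fdec_cmult)
  finally show ?thesis ..
qed

lemma ev_fpow:
  assumes ch: "character \<sigma> \<delta> \<xi> \<kappa> chi"
  shows "ev (\<lambda>\<nu>. chi (fpow (\<lambda>_. epsx) Z j \<nu>)) \<psi> = (ev (\<lambda>\<nu>. chi (Z \<nu>)) \<psi>)\<^sup>2 * (chi epsx * ev (\<lambda>\<nu>. chi (Z \<nu>)) \<psi>) ^ j"
proof -
  interpret character \<sigma> \<delta> \<xi> \<kappa> chi by (rule ch)
  show ?thesis
  proof (induction j)
    case 0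
    show ?case using ev_fmul[OF fam_Z fam_Z] by (simp add: power2_eq_square)
  next
    case (Suc j)
    have "chi (smul (\<lambda>_. epsx) Z \<nu>) = chi epsx * chi (Z \<nu>)" for \<nu>
      unfolding smul_def by (rule chi_star[OF adm_epsx fam_adm[OF fam_Z]])
    hence "ev (\<lambda>\<nu>. chi (smul (\<lambda>_. epsx) Z \<nu>)) \<psi> = chi epsx * ev (\<lambda>\<nu>. chi (Z \<nu>)) \<psi>"
      using ev_cmult[OF fdec_chi[OF fam_Z]] by simp
    thus ?case using ev_fmul[OF fam_fpow[OF fam_Z] fam_smul[OF e fam_Z]] Suc.IH
      by (simp add: mult_ac)
  qed
qed

text \<open>Sums over the orders j and the modes \<nu> are interchanged; a multiple of (1/4)^j
  \<open>qq \<nu>\<close> is a majorant summable in both.\<close>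

lemma ev_nonlin:
  fixes \<psi> :: "real \<times> real"
  assumes ch: "character \<sigma> \<delta> \<xi> \<kappa> chi"
  defines "V \<equiv> ev (\<lambda>\<nu>. chi (Z \<nu>)) \<psi>"
  shows "((\<lambda>j. gc j * (V\<^sup>2 * (chi epsx * V) ^ j) $ n) has_sum ev (\<lambda>\<nu>. chi (Y \<nu>)) \<psi> $ n) UNIV"
proof -
  interpret character \<sigma> \<delta> \<xi> \<kappa> chi by (rule ch)
  let ?P = "\<lambda>j. fpow (\<lambda>_. epsx) Z j" and ?C = "Mg * Ka * A\<^sup>2"
  have g: "(\<lambda>j. ?C * (1/4) ^ j * b) summable_on UNIV" for b :: real
    by (intro summable_on_cmult_left geometric_summable_on(1)) auto
  have pj: "chi (\<lambda>x. gc j * ?P j \<nu> x) = fps_const (gc j) * chi (?P j \<nu>)" for j \<nu>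
    by (rule chi_cmult[OF fam_adm[OF fam_fpow[OF fam_Z]]])
  have ad: "adm \<delta> \<sigma> (?C * (1/4) ^ j * (qq \<nu> * exp (- (\<xi> / 2) * nn \<nu>))) (\<lambda>x. gc j * ?P j \<nu> x)" for j \<nu>
    by (rule fam_adm[OF fam_cterm[OF fam_Z]])
  have hs: "((\<lambda>j. gc j * chi (?P j \<nu>) $ n) has_sum chi (Y \<nu>) $ n) UNIV" for \<nu>
    using chi_infsum[where n = n, OF ad[of _ \<nu>] g] unfolding pj nonlin_def[abs_def] by simp
  define f where "f = (\<lambda>\<nu> j. fcis \<psi> \<nu> * (gc j * chi (?P j \<nu>) $ n))"
  have bd: "norm (f \<nu> j) \<le> (cb n * ?C) * (1/4) ^ j * qq \<nu>" for \<nu> j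
  proof -
    have "norm (f \<nu> j) = norm (chi (\<lambda>x. gc j * ?P j \<nu> x) $ n)" by (simp add: f_def pj norm_mult)
    also have "\<dots> \<le> cb n * (?C * (1/4) ^ j * (qq \<nu> * exp (- (\<xi> / 2) * nn \<nu>)))" by (rule cb(2)[OF ad])
    also have "\<dots> \<le> cb n * (?C * (1/4) ^ j * (qq \<nu> * 1))"
      using cb(1)[of n] Mg Ka_pos qq_pos[of \<nu>] xi_pos by (intro mult_left_mono) (auto simp: mult_nonneg_nonneg)
    finally show ?thesis by (simp add: mult_ac)
  qed
  let ?B = "\<lambda>\<nu> j. (cb n * ?C) * (1/4) ^ j * qq \<nu>"
  have B: "?B \<nu> summable_on UNIV" for \<nu>
    by (intro summable_on_cmult_left geometric_summable_on(1)) auto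
  have BB: "(\<lambda>\<nu>. infsum (?B \<nu>) UNIV) summable_on UNIV"
    unfolding infsum_cmult_left' by (intro summable_on_cmult_right qq_summable)
  have fsum: "(\<lambda>(\<nu>, j). f \<nu> j) summable_on UNIV \<times> UNIV"
  proof -
    have nn: "0 \<le> ?B \<nu> j" for \<nu> j using bd[of \<nu> j] norm_ge_zero order_trans by blast
    have "(\<lambda>(\<nu>, j). ?B \<nu> j) summable_on UNIV \<times> UNIV"
      by (rule summable_on_SigmaI[OF _ BB]) (use nn B in auto)
    thus ?thesis by (rule dominated_summable[rotated]) (use bd in auto)
  qed
  have "((\<lambda>(j, \<nu>). f \<nu> j) has_sum infsum (\<lambda>(\<nu>, j). f \<nu> j) (UNIV \<times> UNIV)) (UNIV \<times> UNIV)"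
    using has_sum_infsum[OF fsum] by (subst (asm) has_sum_swap) auto
  hence "((\<lambda>j. infsum (\<lambda>\<nu>. f \<nu> j) UNIV) has_sum infsum (\<lambda>(\<nu>, j). f \<nu> j) (UNIV \<times> UNIV)) UNIV"
  proof (rule has_sum_SigmaD)
    fix j
    show "((\<lambda>\<nu>. case (j, \<nu>) of (j, \<nu>) \<Rightarrow> f \<nu> j) has_sum infsum (\<lambda>\<nu>. f \<nu> j) UNIV) UNIV"
      using bd by (auto intro!: has_sum_infsum dominated_summable[OF bd] summable_on_cmult_right qq_summable)
  qed
  moreover have "infsum (\<lambda>\<nu>. f \<nu> j) UNIV = gc j * (V\<^sup>2 * (chi epsx * V) ^ j) $ n" for j
  proof -
    have "infsum (\<lambda>\<nu>. f \<nu> j) UNIV = gc j * ev (\<lambda>\<nu>. chi (?P j \<nu>)) \<psi> $ n"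
      unfolding ev_def fps_nth_Abs_fps f_def infsum_cmult_right'[symmetric] by (simp add: mult_ac)
    thus ?thesis unfolding V_def ev_fpow[OF ch] .
  qed
  moreover have "infsum (\<lambda>(\<nu>, j). f \<nu> j) (UNIV \<times> UNIV) = ev (\<lambda>\<nu>. chi (Y \<nu>)) \<psi> $ n"
  proof -
    have "infsum (\<lambda>(\<nu>, j). f \<nu> j) (UNIV \<times> UNIV) = infsum (\<lambda>\<nu>. infsum (f \<nu>) UNIV) UNIV"
      using infsum_Sigma'_banach[OF fsum] by simp
    also have "(\<lambda>\<nu>. infsum (f \<nu>) UNIV) = (\<lambda>\<nu>. fcis \<psi> \<nu> * chi (Y \<nu>) $ n)"
      unfolding f_def by (intro ext infsumI has_sum_cmult_right hs)
    finally show ?thesis by (simp add: ev_def)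
  qed
  ultimately show ?thesis by simp
qed

end

section \<open>Taylor coefficients and the Laplace transform\<close>

text \<open>The Borel transform divides the coefficient of \<epsilon>^(m+1) by m!, so this
  coefficient is the m-th derivative at 0; the Dirac mass is the constant term.\<close>

definition tay :: "(complex option \<Rightarrow> complex) \<Rightarrow> complex fps" where
  "tay F = Abs_fps (\<lambda>n. case n of 0 \<Rightarrow> F None | Suc m \<Rightarrow> (deriv ^^ m) (\<lambda>p. F (Some p)) 0)"

lemma tay_nth: "tay F $ 0 = F None" "tay F $ Suc m = (deriv ^^ m) (\<lambda>p. F (Some p)) 0"
  by (simp_all add: tay_def)

lemma higher_deriv_cnj_cnj:
  assumes f: "f holomorphic_on S" and S: "open S" "\<And>z. z \<in> S \<Longrightarrow> cnj z \<in> S" and z: "z \<in> S"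
  shows "(deriv ^^ n) (\<lambda>z. cnj (f (cnj z))) z = cnj ((deriv ^^ n) f (cnj z))"
  using f
proof (induction n arbitrary: f)
  case (Suc n)
  have d: "deriv (\<lambda>z. cnj (f (cnj z))) w = cnj (deriv f (cnj w))" if "w \<in> S" for w
    using has_field_derivative_cnj_cnj[OF holomorphic_derivI[OF Suc.prems S(1) S(2)[OF that]]]
    by (simp add: o_def DERIV_imp_deriv)
  have "(deriv ^^ Suc n) (\<lambda>z. cnj (f (cnj z))) z = (deriv ^^ n) (deriv (\<lambda>z. cnj (f (cnj z)))) z"
    by (simp add: funpow_swap1)
  also have "\<dots> = (deriv ^^ n) (\<lambda>z. cnj (deriv f (cnj z))) z"
    using d S(1) z by (intro higher_deriv_cong_ev) (auto simp: eventually_nhds)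
  also have "\<dots> = cnj ((deriv ^^ Suc n) f (cnj z))"
    using Suc.IH[of "deriv f"] Suc.prems S(1) by (simp add: funpow_swap1 holomorphic_deriv)
  finally show ?case .
qed simp

lemma tay_epsx: "tay epsx = fps_X"
proof (rule fps_ext)
  fix n show "tay epsx $ n = fps_X $ n"
    by (cases n) (auto simp: tay_nth)
qed

lemma integrable_convolution:
  fixes f g :: "real \<Rightarrow> complex"
  assumes f: "integrable lborel f" and g: "integrable lborel g"
  shows "(\<integral>p. (\<integral>s. f s * g (p - s) \<partial>lborel) \<partial>lborel) = (\<integral>s. f s \<partial>lborel) * (\<integral>s. g s \<partial>lborel)"
proof -
  have [measurable]: "f \<in> borel_measurable borel" "g \<in> borel_measurable borel"
    using f g by auto
  have gt: "integrable lborel (\<lambda>p. g (p - s))" and gi: "(\<integral>p. g (p - s) \<partial>lborel) = (\<integral>p. g p \<partial>lborel)" for s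
    using lborel_integrable_real_affine[OF g, of 1 "- s"] lborel_integral_real_affine[of 1 g "- s"] by auto
  have gn: "(\<integral>p. norm (g (p - s)) \<partial>lborel) = (\<integral>p. norm (g p) \<partial>lborel)" for s
    using lborel_integral_real_affine[of 1 "\<lambda>p. norm (g p)" "- s"] by auto
  have "integrable (lborel \<Otimes>\<^sub>M lborel) (\<lambda>(s, p). f s * g (p - s))"
  proof (rule lborel_pair.Fubini_integrable)
    show "(\<lambda>(s, p). f s * g (p - s)) \<in> borel_measurable (lborel \<Otimes>\<^sub>M lborel)" by measurable
    show "integrable lborel (\<lambda>s. \<integral>p. norm (case (s, p) of (s, p) \<Rightarrow> f s * g (p - s)) \<partial>lborel)"
      using f by (simp add: norm_mult gn)
    show "AE s in lborel. integrable lborel (\<lambda>p. case (s, p) of (s, p) \<Rightarrow> f s * g (p - s))"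
      using gt by simp
  qed
  from lborel_pair.Fubini_integral[OF this]
  have "(\<integral>p. (\<integral>s. f s * g (p - s) \<partial>lborel) \<partial>lborel) = (\<integral>s. (\<integral>p. f s * g (p - s) \<partial>lborel) \<partial>lborel)" .
  also have "\<dots> = (\<integral>s. f s \<partial>lborel) * (\<integral>s. g s \<partial>lborel)" by (simp add: gi)
  finally show ?thesis .
qed

definition lapi :: "real \<Rightarrow> (complex \<Rightarrow> complex) \<Rightarrow> complex" where
  "lapi E B = integral {0..} (\<lambda>p. of_real (exp (- p / E)) * B (of_real p))"

definition lap :: "real \<Rightarrow> (complex option \<Rightarrow> complex) \<Rightarrow> complex fps" where
  "lap E F = fps_const (F None + lapi E (\<lambda>p. F (Some p)))"

context borel_weights
begin

lemma zero_in_hstrip: "0 \<in> hstrip \<delta>"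
  using delta by (simp add: hstrip_def)

lemma real_in_hstrip: "of_real p \<in> hstrip \<delta>"
  using delta by (simp add: hstrip_def)

lemma adm_holomorphic: "adm \<delta> \<sigma> A F \<Longrightarrow> (\<lambda>p. F (Some p)) holomorphic_on hstrip \<delta>"
  by (simp add: adm_def)

lemma adm_cauchy:
  assumes "adm \<delta> \<sigma> A F"
  shows "norm ((deriv ^^ m) (\<lambda>p. F (Some p)) 0) \<le> fact m * mw \<sigma> (\<delta> / 2) / (\<delta> / 2) ^ m * A"
proof -
  have sub: "cball 0 (\<delta> / 2) \<subseteq> hstrip \<delta>"
    using delta ball_subset_hstrip[of \<delta>] by (auto simp: subset_iff)
  have hol: "(\<lambda>p. F (Some p)) holomorphic_on cball 0 (\<delta> / 2)"
    by (rule holomorphic_on_subset[OF adm_holomorphic[OF assms] sub])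
  have "norm ((deriv ^^ m) (\<lambda>p. F (Some p)) 0) \<le> fact m * (A * mw \<sigma> (\<delta> / 2)) / (\<delta> / 2) ^ m"
  proof (rule Cauchy_inequality)
    show "(\<lambda>p. F (Some p)) holomorphic_on ball 0 (\<delta> / 2)"
      by (rule holomorphic_on_subset[OF hol]) auto
    fix p :: complex assume "norm (0 - p) = \<delta> / 2"
    hence p: "cmod p = \<delta> / 2" by simp
    hence "Some p \<in> hdom \<delta>" using sub by auto
    thus "norm (F (Some p)) \<le> A * mw \<sigma> (\<delta> / 2)"
      using assms p unfolding adm_def by (metis mm_simps(2))
  qed (use hol delta in \<open>auto intro: holomorphic_on_imp_continuous_on\<close>)
  thus ?thesis by (simp add: mult_ac)
qed

text \<open>In the Cauchy product of order m + 1 the convolution supplies the inner terms 1, ..., m,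
  and the Dirac masses supply the two end terms.\<close>

lemma tay_star:
  assumes F: "adm \<delta> \<sigma> A F" and G: "adm \<delta> \<sigma> B G"
  shows "tay (star F G) = tay F * tay G"
proof (rule fps_ext)
  fix n
  note hF = adm_holomorphic[OF F] and hG = adm_holomorphic[OF G]
  show "tay (star F G) $ n = (tay F * tay G) $ n"
  proof (cases n)
    case 0
    thus ?thesis by (simp add: tay_nth star_simps)
  next
    case (Suc m)
    have h1: "(\<lambda>p. F None * G (Some p)) holomorphic_on hstrip \<delta>" "(\<lambda>p. F (Some p) * G None) holomorphic_on hstrip \<delta>"
      by (intro holomorphic_intros hF hG)+
    note h2 = pconv_holomorphic[OF hF hG]
    have "(deriv ^^ m) (\<lambda>p. star F G (Some p)) 0 = F None * tay G $ Suc m + tay F $ Suc m * G None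
       + (\<Sum>j<m. tay F $ Suc j * tay G $ Suc (m - 1 - j))"
      unfolding star_simps
      using higher_deriv_add[OF holomorphic_on_add[OF h1] h2 open_hstrip zero_in_hstrip, of m]
        higher_deriv_add[OF h1 open_hstrip zero_in_hstrip, of m]
        higher_deriv_cmult[OF hG zero_in_hstrip open_hstrip, of m "F None"]
        higher_deriv_cmult[OF hF zero_in_hstrip open_hstrip, of m "G None"]
        pconv_higher_deriv[OF delta hF hG, of m]
      by (simp add: tay_nth mult.commute)
    also have "(\<Sum>j<m. tay F $ Suc j * tay G $ Suc (m - 1 - j)) = (\<Sum>j<m. tay F $ Suc j * tay G $ (Suc m - Suc j))"
      by (intro sum.cong) (auto simp: Suc_diff_Suc)
    also have "F None * tay G $ Suc m + tay F $ Suc m * G None + \<dots> = (\<Sum>i\<le>Suc m. tay F $ i * tay G $ (Suc m - i))"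
    proof -
      have "(\<Sum>i\<le>Suc m. h i) = h 0 + (\<Sum>j<m. h (Suc j)) + h (Suc m)" for h :: "nat \<Rightarrow> complex"
        by (induction m) (auto simp: add_ac)
      from this[of "\<lambda>i. tay F $ i * tay G $ (Suc m - i)"] show ?thesis by (simp only: diff_self_eq_0 diff_zero tay_nth(1) add_ac)
    qed
    finally show ?thesis using Suc by (simp add: fps_mult_nth tay_nth atMost_atLeast0)
  qed
qed

lemma character_tay: "character \<sigma> \<delta> \<xi> \<kappa> tay"
proof
  fix A F B G and z :: complex and n :: nat
  assume F: "adm \<delta> \<sigma> A F"
  show "tay (\<lambda>x. z * F x) = fps_const z * tay F"
  proof (rule fps_ext)
    fix n show "tay (\<lambda>x. z * F x) $ n = (fps_const z * tay F) $ n"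
      using higher_deriv_cmult[OF adm_holomorphic[OF F] zero_in_hstrip open_hstrip]
      by (cases n) (auto simp: tay_nth)
  qed
  show "tay (\<lambda>x. cnj (F (map_option cnj x))) $ n = cnj (tay F $ n)"
    using higher_deriv_cnj_cnj[OF adm_holomorphic[OF F] open_hstrip _ zero_in_hstrip]
    by (cases n) (auto simp: tay_nth hstrip_def)
  assume G: "adm \<delta> \<sigma> B G"
  show "tay (\<lambda>x. F x + G x) = tay F + tay G"
  proof (rule fps_ext)
    fix n show "tay (\<lambda>x. F x + G x) $ n = (tay F + tay G) $ n"
      using higher_deriv_add[OF adm_holomorphic[OF F] adm_holomorphic[OF G] open_hstrip zero_in_hstrip]
      by (cases n) (auto simp: tay_nth)
  qed
  show "tay (star F G) = tay F * tay G" by (rule tay_star[OF F G])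
next
  fix n
  show "\<exists>c\<ge>0. \<forall>A F. adm \<delta> \<sigma> A F \<longrightarrow> norm (tay F $ n) \<le> c * A"
  proof (cases n)
    case 0
    thus ?thesis by (intro exI[of _ 1]) (auto simp: tay_nth adm_def Ball_hdom mm_simps)
  next
    case (Suc m)
    thus ?thesis
      using adm_cauchy mw_pos[OF sigma_pos, of "\<delta> / 2"] delta
      by (intro exI[of _ "fact m * mw \<sigma> (\<delta> / 2) / (\<delta> / 2) ^ m"]) (auto simp: tay_nth)
  qed
next
  show "tay (\<lambda>x. if x = None then 1 else 0) = 1"
  proof (rule fps_ext)
    fix n show "tay (\<lambda>x. if x = None then 1 else 0) $ n = 1 $ n"
      by (cases n) (auto simp: tay_nth)
  qed
qed

section \<open>The Laplace transform as a multiplicative functional\<close>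

lemma adm_exp_bound:
  assumes F: "adm \<delta> \<sigma> A F" and p: "p \<ge> 0"
  shows "norm (F (Some (of_real p))) \<le> A * \<sigma> * exp (\<sigma> * p)"
proof -
  have A: "A \<ge> 0" using F unfolding adm_def Ball_hdom by (auto simp: mm_simps intro: order_trans[OF norm_ge_zero])
  have "norm (F (Some (of_real p))) \<le> A * mw \<sigma> (cmod (of_real p))"
    using F real_in_hstrip[of p] unfolding adm_def by (metis hdom_simps(2) mm_simps(2))
  also have "mw \<sigma> (cmod (of_real p)) \<le> \<sigma> * exp (\<sigma> * p) / 1"
    unfolding mw_def using p sigma_pos by (intro frac_le) auto
  finally show ?thesis using A by (simp add: mult_left_mono mult.assoc)
qed

context
  fixes E :: real assumes E: "E > 0" "2 * \<sigma> * E \<le> 1"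
begin

text \<open>2 \<sigma> E <= 1 leaves exp(- p/E) a rate of decay of at least \<sigma> after the
  growth exp(\<sigma> p) is compensated. This cancels the factor \<sigma> of the weight, so that the
  Laplace transform is bounded by the same \<open>A\<close> for all such E.\<close>

lemma E': "1 / E - \<sigma> \<ge> \<sigma>" "1 / E - \<sigma> > 0"
proof -
  show "1 / E - \<sigma> \<ge> \<sigma>" using E by (simp add: field_simps)
  thus "1 / E - \<sigma> > 0" using sigma_pos by linarith
qed

lemma laplace_integrable:
  assumes c: "continuous_on (hstrip \<delta>) B" and bd: "\<And>p. p \<ge> 0 \<Longrightarrow> norm (B (of_real p)) \<le> C * exp (\<sigma> * p)"
  shows "integrable lborel (\<lambda>p. indicator {0..} p *\<^sub>R (of_real (exp (- p / E)) * B (of_real p)))"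
    and "((\<lambda>p. of_real (exp (- p / E)) * B (of_real p)) has_integral lapi E B) {0..}"
    and "lapi E B = (\<integral>p. indicator {0..} p *\<^sub>R (of_real (exp (- p / E)) * B (of_real p)) \<partial>lborel)"
    and "norm (lapi E B) \<le> C / (1 / E - \<sigma>)"
proof -
  let ?f = "\<lambda>p. of_real (exp (- p / E)) * B (of_real p)"
  have cf: "continuous_on {0..} ?f"
    using E by (intro continuous_intros continuous_on_compose2[OF c]) (auto simp: real_in_hstrip)
  have g: "((\<lambda>p. C * exp (- (1 / E - \<sigma>) * p)) has_integral C * (exp (- (1 / E - \<sigma>) * 0) / (1 / E - \<sigma>))) {0..}"
    by (intro has_integral_mult_right has_integral_exp_minus_to_infinity E')
  have le: "norm (?f p) \<le> C * exp (- (1 / E - \<sigma>) * p)" if "p \<in> {0..}" for p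
  proof -
    have "norm (?f p) \<le> exp (- p / E) * (C * exp (\<sigma> * p))"
      using bd[of p] that by (simp add: norm_mult)
    also have "\<dots> = C * exp (- (1 / E - \<sigma>) * p)"
      by (simp add: exp_add[symmetric] algebra_simps)
    finally show ?thesis .
  qed
  have "?f absolutely_integrable_on {0..}"
    by (rule measurable_bounded_by_integrable_imp_absolutely_integrable[OF _ _ has_integral_integrable[OF g] le])
       (use cf in \<open>auto intro!: continuous_imp_measurable_on_sets_lebesgue\<close>)
  hence "integrable lebesgue (\<lambda>p. indicator {0..} p *\<^sub>R ?f p)" by (simp add: set_integrable_def)
  moreover have m: "(\<lambda>p. indicator {0..} p *\<^sub>R ?f p) \<in> borel_measurable lborel"
    using borel_measurable_continuous_on_indicator[OF _ cf] by simp
  ultimately show i: "integrable lborel (\<lambda>p. indicator {0..} p *\<^sub>R ?f p)"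
    using integrable_completion[OF m] by simp
  hence si: "set_integrable lborel {0..} ?f" by (simp add: set_integrable_def)
  show hi: "(?f has_integral lapi E B) {0..}"
    unfolding lapi_def by (rule integrable_integral[OF set_borel_integral_eq_integral(1)[OF si]])
  show "lapi E B = (\<integral>p. indicator {0..} p *\<^sub>R ?f p \<partial>lborel)"
    using set_borel_integral_eq_integral(2)[OF si] by (simp add: lapi_def set_lebesgue_integral_def)
  have "norm (lapi E B) \<le> integral {0..} (\<lambda>p. C * exp (- (1 / E - \<sigma>) * p))"
    unfolding lapi_def by (rule integral_norm_bound_integral[OF _ has_integral_integrable[OF g] le])
      (use hi in \<open>auto simp: integrable_on_def\<close>)
  also have "\<dots> = C / (1 / E - \<sigma>)" using integral_unique[OF g] by simp
  finally show "norm (lapi E B) \<le> C / (1 / E - \<sigma>)" .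
qed

lemma adm_lap:
  assumes F: "adm \<delta> \<sigma> A F"
  shows "integrable lborel (\<lambda>p. indicator {0..} p *\<^sub>R (of_real (exp (- p / E)) * F (Some (of_real p))))"
    and "((\<lambda>p. of_real (exp (- p / E)) * F (Some (of_real p))) has_integral lapi E (\<lambda>p. F (Some p))) {0..}"
    and "lapi E (\<lambda>p. F (Some p)) = (\<integral>p. indicator {0..} p *\<^sub>R (of_real (exp (- p / E)) * F (Some (of_real p))) \<partial>lborel)"
    and "norm (lapi E (\<lambda>p. F (Some p))) \<le> A"
proof -
  note * = laplace_integrable[OF holomorphic_on_imp_continuous_on[OF adm_holomorphic[OF F]] adm_exp_bound[OF F]]
  show "integrable lborel (\<lambda>p. indicator {0..} p *\<^sub>R (of_real (exp (- p / E)) * F (Some (of_real p))))"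
    "((\<lambda>p. of_real (exp (- p / E)) * F (Some (of_real p))) has_integral lapi E (\<lambda>p. F (Some p))) {0..}"
    "lapi E (\<lambda>p. F (Some p)) = (\<integral>p. indicator {0..} p *\<^sub>R (of_real (exp (- p / E)) * F (Some (of_real p))) \<partial>lborel)"
    by (rule *; assumption)+
  have A: "A \<ge> 0" using F unfolding adm_def Ball_hdom by (auto simp: mm_simps intro: order_trans[OF norm_ge_zero])
  have "norm (lapi E (\<lambda>p. F (Some p))) \<le> A * \<sigma> / (1 / E - \<sigma>)" by (rule *(4))
  also have "\<dots> \<le> A * \<sigma> / \<sigma>" using A sigma_pos E' by (intro divide_left_mono) auto
  finally show "norm (lapi E (\<lambda>p. F (Some p))) \<le> A" using sigma_pos by simp
qed

text \<open>Both Laplace integrands, cut off to the half-line, have as convolution on the real line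
  the cut-off of \<open>pconv\<close> times exp(- p/E); Fubini does the rest.\<close>

lemma lapi_pconv:
  assumes F: "adm \<delta> \<sigma> A F" and G: "adm \<delta> \<sigma> B G"
  shows "((\<lambda>p. of_real (exp (- p / E)) * pconv (\<lambda>q. F (Some q)) (\<lambda>q. G (Some q)) (of_real p)) has_integral
      lapi E (\<lambda>p. F (Some p)) * lapi E (\<lambda>p. G (Some p))) {0..}"
proof -
  define f where "f = (\<lambda>p. indicator {0..} p *\<^sub>R (of_real (exp (- p / E)) * F (Some (of_real p))))"
  define g where "g = (\<lambda>p. indicator {0..} p *\<^sub>R (of_real (exp (- p / E)) * G (Some (of_real p))))"
  let ?P = "pconv (\<lambda>q. F (Some q)) (\<lambda>q. G (Some q))"
  note cF = holomorphic_on_imp_continuous_on[OF adm_holomorphic[OF F]] and cG = holomorphic_on_imp_continuous_on[OF adm_holomorphic[OF G]]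
  have conv: "(\<integral>s. f s * g (p - s) \<partial>lborel) = indicator {0..} p *\<^sub>R (of_real (exp (- p / E)) * ?P (of_real p))" for p
  proof (cases "p > 0")
    case False
    have "f s * g (p - s) = 0" if "s \<noteq> 0" for s
      using False that by (auto simp: f_def g_def indicator_def)
    hence "AE s in lborel. f s * g (p - s) = 0"
      using AE_lborel_singleton[of 0] by (auto elim: eventually_mono)
    hence "(\<integral>s. f s * g (p - s) \<partial>lborel) = 0"
      by (rule integral_eq_zero_AE)
    moreover have "indicator {0..} p *\<^sub>R (of_real (exp (- p / E)) * ?P (of_real p)) = 0"
      using False by (cases "p = 0") auto
    ultimately show ?thesis by simp
  next
    case True
    let ?h = "\<lambda>\<tau>. of_real p * F (Some (of_real \<tau> * of_real p)) * G (Some (of_real (1 - \<tau>) * of_real p))"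
    \<comment> \<open>The substitution s = p \<tau> moves the segment to the unit interval of
      \<open>pconv\<close>.\<close>
    have "(\<integral>s. f s * g (p - s) \<partial>lborel) = p *\<^sub>R (\<integral>\<tau>. f (p * \<tau>) * g (p - p * \<tau>) \<partial>lborel)"
      using lborel_integral_real_affine[of p "\<lambda>s. f s * g (p - s)" 0] True by simp
    also have "\<dots> = (\<integral>\<tau>. p *\<^sub>R (f (p * \<tau>) * g (p - p * \<tau>)) \<partial>lborel)" by simp
    also have "\<dots> = (\<integral>\<tau>. indicator {0..1} \<tau> *\<^sub>R (of_real (exp (- p / E)) * ?h \<tau>) \<partial>lborel)"
    proof (rule Bochner_Integration.integral_cong[OF refl])
      fix \<tau> :: real
      have "exp (- (p * \<tau>) / E) * exp (- (p - p * \<tau>) / E) = exp (- p / E)"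
        unfolding exp_add[symmetric] by (simp add: diff_divide_distrib[symmetric] add_divide_distrib[symmetric])
      hence e: "complex_of_real (exp (- (p * \<tau>) / E)) * of_real (exp (- (p - p * \<tau>) / E)) = of_real (exp (- p / E))"
        by (metis of_real_mult)
      have i: "indicator {0..} (p * \<tau>) * indicator {0..} (p - p * \<tau>) = (indicator {0..1} \<tau> :: real)"
        using True by (auto simp: indicator_def zero_le_mult_iff)
      have "p *\<^sub>R (f (p * \<tau>) * g (p - p * \<tau>)) = (indicator {0..} (p * \<tau>) * indicator {0..} (p - p * \<tau>)) *\<^sub>R
        ((of_real (exp (- (p * \<tau>) / E)) * of_real (exp (- (p - p * \<tau>) / E))) *
         (of_real p * F (Some (of_real (p * \<tau>))) * G (Some (of_real (p - p * \<tau>)))))"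
        unfolding f_def g_def by (simp only: scaleR_conv_of_real of_real_mult mult_ac)
      also have "of_real (p * \<tau>) = (of_real \<tau> * of_real p :: complex)" by simp
      also have "of_real (p - p * \<tau>) = (of_real (1 - \<tau>) * of_real p :: complex)" by (simp add: algebra_simps)
      finally show "p *\<^sub>R (f (p * \<tau>) * g (p - p * \<tau>)) = indicator {0..1} \<tau> *\<^sub>R (of_real (exp (- p / E)) * ?h \<tau>)"
        unfolding i e .
    qed
    also have "\<dots> = of_real (exp (- p / E)) * ?P (of_real p)"
    proof -
      have "continuous_on {0..1} (\<lambda>\<tau>. of_real (exp (- p / E)) * ?h \<tau>)"
        by (rule continuous_on_mult_left[OF pconv_continuous[OF cF cG real_in_hstrip, of p, unfolded box_real]])
      hence si: "set_integrable lborel {0..1} (\<lambda>\<tau>. of_real (exp (- p / E)) * ?h \<tau>)"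
        by (rule borel_integrable_atLeastAtMost')
      show ?thesis using set_borel_integral_eq_integral(2)[OF si]
        unfolding set_lebesgue_integral_def pconv_def box_real integral_mult_right .
    qed
    finally show ?thesis using True by simp
  qed
  have "(\<integral>p. (\<integral>s. f s * g (p - s) \<partial>lborel) \<partial>lborel) = lapi E (\<lambda>p. F (Some p)) * lapi E (\<lambda>p. G (Some p))"
    unfolding adm_lap(3)[OF F] adm_lap(3)[OF G] f_def[symmetric] g_def[symmetric]
    by (rule integrable_convolution) (use adm_lap(1)[OF F] adm_lap(1)[OF G] in \<open>simp_all add: f_def g_def\<close>)
  hence e: "(\<integral>p. indicator {0..} p *\<^sub>R (of_real (exp (- p / E)) * ?P (of_real p)) \<partial>lborel)
      = lapi E (\<lambda>p. F (Some p)) * lapi E (\<lambda>p. G (Some p))"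
    unfolding conv .
  \<comment> \<open>Without the Dirac masses \<open>star\<close> is just \<open>pconv\<close>, and
    \<open>adm_star\<close> with \<open>adm_lap\<close> gives the existence of the integral.\<close>
  define F0 where "F0 = (\<lambda>x. if x = None then 0 else F x)"
  have "adm \<delta> \<sigma> A F0" using F unfolding adm_def Ball_hdom F0_def
    by (auto simp: mm_simps intro: order_trans[OF norm_ge_zero])
  define G0 where "G0 = (\<lambda>x. if x = None then 0 else G x)"
  have "adm \<delta> \<sigma> B G0" using G unfolding adm_def Ball_hdom G0_def
    by (auto simp: mm_simps intro: order_trans[OF norm_ge_zero])
  from adm_star[OF sigma_pos \<open>adm \<delta> \<sigma> A F0\<close> this] have s: "adm \<delta> \<sigma> (9 * (A * B)) (star F0 G0)" .
  have s': "star F0 G0 (Some p) = ?P p" for p by (simp add: star_simps F0_def G0_def)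
  show ?thesis
    using adm_lap(2,3)[OF s] unfolding s' e by simp
qed

lemma character_lap: "character \<sigma> \<delta> \<xi> \<kappa> (lap E)"
proof
  fix A F B G and z :: complex and n :: nat
  assume F: "adm \<delta> \<sigma> A F"
  have "lapi E (\<lambda>p. z * F (Some p)) = z * lapi E (\<lambda>p. F (Some p))"
    using integral_unique[OF has_integral_mult_right[OF adm_lap(2)[OF F], of z]] by (simp add: lapi_def mult_ac)
  thus "lap E (\<lambda>x. z * F x) = fps_const z * lap E F"
    by (simp add: lap_def distrib_left)
  have "lapi E (\<lambda>p. cnj (F (Some (cnj p)))) = cnj (lapi E (\<lambda>p. F (Some p)))"
    unfolding lapi_def integral_cnj by simp
  thus "lap E (\<lambda>x. cnj (F (map_option cnj x))) $ n = cnj (lap E F $ n)"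
    by (simp add: lap_def)
  assume G: "adm \<delta> \<sigma> B G"
  have "lapi E (\<lambda>p. F (Some p) + G (Some p)) = lapi E (\<lambda>p. F (Some p)) + lapi E (\<lambda>p. G (Some p))"
    using integral_unique[OF has_integral_add[OF adm_lap(2)[OF F] adm_lap(2)[OF G]]] by (simp add: lapi_def distrib_left)
  thus "lap E (\<lambda>x. F x + G x) = lap E F + lap E G"
    by (simp add: lap_def add_ac)
  have "((\<lambda>p. of_real (exp (- p / E)) * star F G (Some (of_real p))) has_integral
      F None * lapi E (\<lambda>p. G (Some p)) + lapi E (\<lambda>p. F (Some p)) * G None
      + lapi E (\<lambda>p. F (Some p)) * lapi E (\<lambda>p. G (Some p))) {0..}"
    using has_integral_add[OF has_integral_add[OF has_integral_mult_right[OF adm_lap(2)[OF G], of "F None"]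
      has_integral_mult_left[OF adm_lap(2)[OF F], of "G None"]] lapi_pconv[OF F G]]
    by (simp add: star_simps algebra_simps)
  hence "lapi E (\<lambda>p. star F G (Some p)) = F None * lapi E (\<lambda>p. G (Some p)) + lapi E (\<lambda>p. F (Some p)) * G None
      + lapi E (\<lambda>p. F (Some p)) * lapi E (\<lambda>p. G (Some p))"
    unfolding lapi_def[of _ "\<lambda>p. star F G (Some p)"] by (rule integral_unique)
  thus "lap E (star F G) = lap E F * lap E G"
    by (simp add: lap_def star_simps algebra_simps)
next
  fix n
  show "\<exists>c\<ge>0. \<forall>A F. adm \<delta> \<sigma> A F \<longrightarrow> norm (lap E F $ n) \<le> c * A"
  proof (intro exI[of _ 2] conjI allI impI)
    fix A F assume F: "adm \<delta> \<sigma> A F"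
    have N: "norm (F None) \<le> A" using F by (auto simp: adm_def Ball_hdom mm_simps)
    have "norm (F None + lapi E (\<lambda>p. F (Some p))) \<le> A + A"
      by (intro norm_triangle_le add_mono N adm_lap(4)[OF F])
    moreover have "A \<ge> 0" using order_trans[OF norm_ge_zero N] .
    ultimately show "norm (lap E F $ n) \<le> 2 * A" by (simp add: lap_def)
  qed simp
next
  show "lap E (\<lambda>x. if x = None then 1 else 0) = 1"
    by (simp add: lap_def lapi_def)
qed

lemma lap_epsx: "lap E epsx = fps_const (of_real E)"
proof -
  have "((\<lambda>p. exp (- (1 / E) * p)) has_integral exp (- (1 / E) * 0) / (1 / E)) {0..}"
    by (rule has_integral_exp_minus_to_infinity) (use E in simp)
  hence "((\<lambda>p. of_real (exp (- (1 / E) * p))) has_integral (of_real (exp (- (1 / E) * 0) / (1 / E)) :: complex)) {0..}"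
    by (rule has_integral_of_real)
  hence "lapi E (\<lambda>p. 1) = of_real E" unfolding lapi_def by (intro integral_unique) simp
  thus ?thesis by (simp add: lap_def)
qed

end

end

section \<open>Real analytic functions\<close>

text \<open>f is real, so the derivative of \<open>H\<close> along the real segment has imaginary
  part 0; this carries the correspondence from each order to the next.\<close>

lemma higher_deriv_real_restriction:
  fixes f :: "real \<Rightarrow> real" and H :: "complex \<Rightarrow> complex"
  assumes H: "H holomorphic_on S" "open S" and I: "open I" "\<And>x. x \<in> I \<Longrightarrow> of_real (x - c) \<in> S"
    and eq: "\<And>x. x \<in> I \<Longrightarrow> of_real (f x) = H (of_real (x - c))" and x: "x \<in> I"
  shows "of_real ((deriv ^^ n) f x) = (deriv ^^ n) H (of_real (x - c))"
    and "((deriv ^^ n) f has_real_derivative (deriv ^^ Suc n) f x) (at x)"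
proof -
  have "(\<forall>x\<in>I. of_real ((deriv ^^ n) f x) = (deriv ^^ n) H (of_real (x - c))) \<and>
        (\<forall>x\<in>I. ((deriv ^^ n) f has_real_derivative (deriv ^^ Suc n) f x) (at x))"
  proof (induction n)
    have step: "(\<forall>x\<in>I. (h has_real_derivative deriv h x) (at x)) \<and> (\<forall>x\<in>I. of_real (deriv h x) = deriv G (of_real (x - c)))"
      if G: "G holomorphic_on S" and h: "\<forall>x\<in>I. of_real (h x) = G (of_real (x - c))" for h :: "real \<Rightarrow> real" and G
    proof -
      have *: "(h has_real_derivative Re (deriv G (of_real (x - c)))) (at x) \<and> Im (deriv G (of_real (x - c))) = 0" if x: "x \<in> I" for x
      proof -
        have "(G has_field_derivative deriv G (of_real (x - c))) (at (of_real (x - c)))"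
          using G H(2) I(2)[OF x] by (rule holomorphic_derivI)
        from has_vector_derivative_real_field[OF this]
        have 1: "((\<lambda>y. G (of_real y)) has_vector_derivative deriv G (of_real (x - c))) (at (x - c))" .
        have 2: "((\<lambda>y. y - c) has_vector_derivative 1) (at x)"
          by (auto intro!: derivative_eq_intros simp flip: has_real_derivative_iff_has_vector_derivative)
        have "((\<lambda>y. G (of_real (y - c))) has_vector_derivative deriv G (of_real (x - c))) (at x)"
          using vector_diff_chain_at[OF 2, of "\<lambda>y. G (of_real y)"] 1 by (simp add: o_def)
        hence v: "((\<lambda>y. of_real (h y)) has_vector_derivative deriv G (of_real (x - c))) (at x)"
          by (rule has_vector_derivative_transform_within_open[OF _ I(1) x]) (use h in auto)
        from bounded_linear.has_vector_derivative[OF bounded_linear_Re v]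
        have "(h has_real_derivative Re (deriv G (of_real (x - c)))) (at x)"
          by (simp add: has_real_derivative_iff_has_vector_derivative)
        moreover from bounded_linear.has_vector_derivative[OF bounded_linear_Im v]
        have "((\<lambda>y. 0 :: real) has_real_derivative Im (deriv G (of_real (x - c)))) (at x)"
          by (simp add: has_real_derivative_iff_has_vector_derivative)
        hence "Im (deriv G (of_real (x - c))) = 0" using DERIV_unique DERIV_const by blast
        ultimately show ?thesis by blast
      qed
      have "deriv h x = Re (deriv G (of_real (x - c)))" if "x \<in> I" for x
        using *[OF that] by (blast intro: DERIV_imp_deriv)
      thus ?thesis using * by (auto simp: complex_eq_iff)
    qed
    case 0
    show ?case using step[OF H(1), of f] eq by auto
    case (Suc n)
    have "(deriv ^^ n) H holomorphic_on S" "(deriv ^^ Suc n) H holomorphic_on S"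
      using H by (auto intro!: holomorphic_higher_deriv holomorphic_deriv)
    thus ?case
      using step[of "(deriv ^^ n) H" "(deriv ^^ n) f"] step[of "(deriv ^^ Suc n) H" "(deriv ^^ Suc n) f"] Suc by auto
  qed
  thus "of_real ((deriv ^^ n) f x) = (deriv ^^ n) H (of_real (x - c))"
    "((deriv ^^ n) f has_real_derivative (deriv ^^ Suc n) f x) (at x)" using x by blast+
qed

text \<open>The holomorphic extension identifies the coefficients of the given series as Taylor
  coefficients. Convergence at the point c + s, with s half the given radius, bounds them
  geometrically.\<close>

lemma real_analytic_taylor:
  assumes "real_analytic g"
  obtains r M where "r > 0" "M > 0" "\<And>n. \<bar>(deriv ^^ n) g c / fact n\<bar> \<le> M * (1 / r) ^ n"
    "\<And>x. \<bar>x - c\<bar> < r \<Longrightarrow> (\<lambda>n. (deriv ^^ n) g c / fact n * (x - c) ^ n) sums g x"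
    "\<And>x n. \<bar>x - c\<bar> < r \<Longrightarrow> ((deriv ^^ n) g has_real_derivative (deriv ^^ Suc n) g x) (at x)"
proof -
  obtain r a where r: "r > 0" and a: "\<And>x. \<bar>x - c\<bar> < r \<Longrightarrow> (\<lambda>n. a n * (x - c) ^ n) sums g x"
    using assms unfolding real_analytic_def by meson
  define s where "s = r / 2"
  have s: "s > 0" "s < r" using r by (auto simp: s_def)
  define F where "F = Abs_fps (\<lambda>n. complex_of_real (a n))"
  have "(\<lambda>n. a n * s ^ n) sums g (c + s)" using a[of "c + s"] s by simp
  hence sm: "summable (\<lambda>n. a n * s ^ n)" by (rule sums_summable)
  hence "summable (\<lambda>n. complex_of_real (a n) * of_real s ^ n)"
    using summable_of_real[OF sm, where 'a = complex] by simp
  from conv_radius_geI[OF this] have rad: "fps_conv_radius F \<ge> s"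
    using s by (simp add: fps_conv_radius_def F_def)
  have rad0: "fps_conv_radius F > 0"
    by (rule less_le_trans[OF _ rad]) (use s in simp)
  have hol: "eval_fps F holomorphic_on ball 0 s"
  proof (rule holomorphic_on_eval_fps)
    show "ball (0 :: complex) s \<subseteq> eball 0 (fps_conv_radius F)"
    proof (rule subsetI)
      fix x :: complex assume "x \<in> ball 0 s"
      hence "ereal (dist 0 x) < ereal s" by simp
      hence "ereal (dist 0 x) < fps_conv_radius F" using rad by (rule less_le_trans)
      thus "x \<in> eball 0 (fps_conv_radius F)" by (simp add: in_eball_iff)
    qed
  qed
  let ?I = "{c - s<..<c + s}"
  have eq: "of_real (g x) = eval_fps F (of_real (x - c))" if "x \<in> ?I" for x
  proof -
    have "(\<lambda>n. a n * (x - c) ^ n) sums g x" using that s by (intro a) auto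
    from sums_of_real[OF this, where 'a = complex] show ?thesis
      by (simp add: eval_fps_def F_def sums_iff)
  qed
  have IS: "of_real (x - c) \<in> ball (0 :: complex) s" if "x \<in> ?I" for x
    using that by (simp only: mem_ball_0 norm_of_real) auto
  note hd = higher_deriv_real_restriction[OF hol open_ball open_greaterThanLessThan IS eq]
  have an: "a n = (deriv ^^ n) g c / fact n" for n
  proof -
    have "complex_of_real (a n) = (deriv ^^ n) (eval_fps F) 0 / fact n"
      using fps_nth_conv_deriv[OF rad0, of n] by (simp add: F_def)
    also have "(deriv ^^ n) (eval_fps F) 0 = of_real ((deriv ^^ n) g c)"
      using hd(1)[where x = c and n = n] s by simp
    finally have "complex_of_real (a n) = of_real ((deriv ^^ n) g c / fact n)" by simp
    thus ?thesis by (simp only: of_real_eq_iff)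
  qed
  obtain M where M: "M > 0" "\<And>n. norm (a n * s ^ n) \<le> M"
    using summable_imp_Bseq[OF sm] by (auto simp: Bseq_def)
  show ?thesis
  proof (rule that[of s M])
    show "\<bar>(deriv ^^ n) g c / fact n\<bar> \<le> M * (1 / s) ^ n" for n
      using M(2)[of n] s unfolding an[symmetric] by (simp add: abs_mult field_simps power_divide)
    show "(\<lambda>n. (deriv ^^ n) g c / fact n * (x - c) ^ n) sums g x" if "\<bar>x - c\<bar> < s" for x
      using a[of x] that s unfolding an by auto
    show "((deriv ^^ n) g has_real_derivative (deriv ^^ Suc n) g x) (at x)" if "\<bar>x - c\<bar> < s" for x n
      by (rule hd(2)) (use that in auto)
  qed (use s M in auto)
qed

section \<open>Uniform derivative bounds on compact sets\<close>

lemma compact_uniform_bound: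
  fixes K :: "'a::metric_space set" and Q :: "real \<Rightarrow> 'a \<Rightarrow> bool"
  assumes K: "compact K" and mono: "\<And>C D z. Q C z \<Longrightarrow> C \<le> D \<Longrightarrow> Q D z"
    and loc: "\<And>z. z \<in> K \<Longrightarrow> \<exists>U C. open U \<and> z \<in> U \<and> (\<forall>w\<in>U. Q C w)"
  shows "\<exists>C. \<forall>z\<in>K. Q C z"
proof -
  obtain U C where UC: "\<And>z. z \<in> K \<Longrightarrow> open (U z) \<and> z \<in> U z \<and> (\<forall>w\<in>U z. Q (C z) w)" using loc by metis
  obtain T where T: "T \<subseteq> K" "finite T" "K \<subseteq> (\<Union>z\<in>T. U z)"
    by (rule compactE_image[OF K, of K U]) (use UC in auto)
  have "Q (Max (C ` T)) w" if w: "w \<in> K" for w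
  proof -
    obtain z where z: "z \<in> T" "w \<in> U z" using T(3) w by blast
    hence "Q (C z) w" using UC T by auto
    thus ?thesis by (rule mono) (use z T in auto)
  qed
  thus ?thesis by blast
qed

text \<open>One constant plays the role of prefactor and of rate, and C >= 1 makes the condition
  monotone in C, which suits the covering argument of \<open>compact_uniform_bound\<close>.\<close>

definition gevrey1 :: "(real \<Rightarrow> real) \<Rightarrow> real \<Rightarrow> real \<Rightarrow> bool" where
  "gevrey1 h C x \<longleftrightarrow> C \<ge> 1 \<and> (\<forall>n. \<bar>(deriv ^^ n) h x\<bar> \<le> C * fact n * C ^ n)"

lemma gevrey1_mono: "gevrey1 h C x \<Longrightarrow> C \<le> D \<Longrightarrow> gevrey1 h D x"
  unfolding gevrey1_def
proof (intro conjI allI)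
  assume *: "1 \<le> C \<and> (\<forall>n. \<bar>(deriv ^^ n) h x\<bar> \<le> C * fact n * C ^ n)" "C \<le> D"
  fix n
  have "C * fact n * C ^ n \<le> D * fact n * D ^ n"
    using * by (intro mult_mono power_mono) auto
  thus "\<bar>(deriv ^^ n) h x\<bar> \<le> D * fact n * D ^ n" using * by (meson order_trans)
qed auto

text \<open>With y frozen, the double series is holomorphic in x and bounded by \<open>M\<close>,
  the absolute sum at a corner of a smaller square, uniformly in y. Cauchy's inequality on discs of
  radius t/4 about points with |x - x0| < t/2 gives all derivatives.\<close>

lemma real_analytic2_local:
  assumes "real_analytic2 f"
  obtains s C where "s > 0" "\<And>x y. \<bar>x - x0\<bar> < s \<Longrightarrow> \<bar>y - y0\<bar> < s \<Longrightarrow> gevrey1 (\<lambda>x. f (x, y)) C x"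
    "\<And>x y n. \<bar>x - x0\<bar> < s \<Longrightarrow> \<bar>y - y0\<bar> < s \<Longrightarrow>
      ((deriv ^^ n) (\<lambda>x. f (x, y)) has_real_derivative (deriv ^^ Suc n) (\<lambda>x. f (x, y)) x) (at x)"
proof -
  obtain r a where r: "r > 0" and a: "\<And>x y. \<bar>x - x0\<bar> < r \<and> \<bar>y - y0\<bar> < r \<Longrightarrow>
      ((\<lambda>(m, n). a m n * (x - x0) ^ m * (y - y0) ^ n) has_sum f (x, y)) UNIV"
    using assms unfolding real_analytic2_def by meson
  define t where "t = r / 2"
  have t: "t > 0" "t < r" using r by (auto simp: t_def)
  define B where "B = (\<lambda>(m, n). \<bar>a m n\<bar> * t ^ m * t ^ n)"
  have "(\<lambda>(m, n). a m n * t ^ m * t ^ n) summable_on UNIV"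
    using a[of "x0 + t" "y0 + t"] t by (auto dest: has_sum_imp_summable)
  hence "(\<lambda>i. norm ((\<lambda>(m, n). a m n * t ^ m * t ^ n) i)) summable_on UNIV"
    using summable_on_iff_abs_summable_on_real by blast
  also have "(\<lambda>i. norm ((\<lambda>(m, n). a m n * t ^ m * t ^ n) i)) = B"
    using t by (auto simp: B_def abs_mult)
  finally have B: "B summable_on UNIV" .
  define M where "M = infsum B UNIV"
  have "infsum B UNIV \<ge> 0" unfolding B_def using t by (intro infsum_nonneg) auto
  hence M: "M \<ge> 0" by (simp add: M_def)
  define C where "C = M + 1 + 4 / t"
  have C: "C \<ge> 1" "M \<le> C" "4 / t \<le> C" using M t by (auto simp: C_def)
  have main: "gevrey1 (\<lambda>x. f (x, y)) C x \<and>
     (\<forall>n. ((deriv ^^ n) (\<lambda>x. f (x, y)) has_real_derivative (deriv ^^ Suc n) (\<lambda>x. f (x, y)) x) (at x))"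
    if x: "\<bar>x - x0\<bar> < t / 2" and y: "\<bar>y - y0\<bar> < t / 2" for x y
  proof -
    define F where "F = (\<lambda>i z. case i of (m, n) \<Rightarrow> complex_of_real (a m n) * z ^ m * complex_of_real ((y - y0) ^ n))"
    define H where "H = (\<lambda>z. infsum (\<lambda>i. F i z) UNIV)"
    have Fb: "norm (F i z) \<le> B i" if "z \<in> ball 0 t" for i z
    proof (cases i)
      case (Pair m n)
      have "norm (F i z) = \<bar>a m n\<bar> * cmod z ^ m * \<bar>y - y0\<bar> ^ n" by (simp add: F_def Pair norm_mult norm_power power_abs del: of_real_diff)
      also have "\<dots> \<le> \<bar>a m n\<bar> * t ^ m * t ^ n"
        using that y t by (intro mult_mono power_mono) auto
      finally show ?thesis by (simp add: B_def Pair)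
    qed
    have hol: "H holomorphic_on ball 0 t"
      unfolding H_def
    proof (rule holomorphic_on_infsum[OF open_ball _ _ B, where M = "\<lambda>_. 1"])
      show "F i holomorphic_on ball 0 t" for i
        unfolding F_def by (cases i) (auto intro!: holomorphic_intros)
    qed (use Fb in auto)
    have Hb: "norm (H z) \<le> M" if "z \<in> ball 0 t" for z
      unfolding H_def M_def using Fb[OF that] B by (rule dominated_infsum_le)
    let ?I = "{x0 - t<..<x0 + t}"
    have eq: "of_real (f (x, y)) = H (of_real (x - x0))" if "x \<in> ?I" for x
    proof -
      have "((\<lambda>i. of_real ((\<lambda>(m, n). a m n * (x - x0) ^ m * (y - y0) ^ n) i)) has_sum complex_of_real (f (x, y))) UNIV"
        by (rule has_sum_of_real[OF a]) (use that y t in auto)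
      also have "(\<lambda>i. complex_of_real ((\<lambda>(m, n). a m n * (x - x0) ^ m * (y - y0) ^ n) i)) = (\<lambda>i. F i (of_real (x - x0)))"
        by (auto simp: F_def)
      finally show ?thesis unfolding H_def by (metis infsumI)
    qed
    have IS: "of_real (x - x0) \<in> ball (0 :: complex) t" if "x \<in> ?I" for x
      using that by (simp only: mem_ball_0 norm_of_real) auto
    have xI: "x \<in> ?I" using x t unfolding greaterThanLessThan_iff by arith
    note hd = higher_deriv_real_restriction[OF hol open_ball open_greaterThanLessThan IS eq xI]
    have "\<bar>(deriv ^^ n) (\<lambda>x. f (x, y)) x\<bar> \<le> C * fact n * C ^ n" for n
    proof -
      have sub: "cball (of_real (x - x0)) (t / 4) \<subseteq> ball (0::complex) t"
      proof
        fix z :: complex assume "z \<in> cball (of_real (x - x0)) (t / 4)"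
        hence "cmod (z - of_real (x - x0)) \<le> t / 4" by (simp add: dist_norm norm_minus_commute)
        moreover have "cmod (of_real (x - x0)) < t / 2" using x by (simp only: norm_of_real)
        ultimately show "z \<in> ball 0 t"
          using norm_triangle_ineq[of "z - of_real (x - x0)" "of_real (x - x0)"] t by simp
      qed
      have "\<bar>(deriv ^^ n) (\<lambda>x. f (x, y)) x\<bar> = norm ((deriv ^^ n) H (of_real (x - x0)))"
        using arg_cong[OF hd(1)[where n = n], of norm] by (simp del: of_real_diff)
      also have "\<dots> \<le> fact n * M / (t / 4) ^ n"
      proof (rule Cauchy_inequality)
        show "H holomorphic_on ball (of_real (x - x0)) (t / 4)"
          by (rule holomorphic_on_subset[OF hol]) (use sub in auto)
        show "continuous_on (cball (of_real (x - x0)) (t / 4)) H"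
          by (rule holomorphic_on_imp_continuous_on[OF holomorphic_on_subset[OF hol sub]])
        fix z :: complex assume "norm (of_real (x - x0) - z) = t / 4"
        hence "z \<in> ball 0 t" using sub by (auto simp: dist_norm subset_iff)
        thus "norm (H z) \<le> M" by (rule Hb)
      qed (use t in auto)
      also have "\<dots> = M * fact n * (4 / t) ^ n" by (simp add: power_divide)
      also have "\<dots> \<le> C * fact n * C ^ n" using C M t by (intro mult_mono power_mono) auto
      finally show ?thesis .
    qed
    thus ?thesis using hd(2) C by (auto simp: gevrey1_def)
  qed
  show ?thesis by (rule that[of "t / 2" C]) (use main t in auto)
qed

section \<open>Fourier series of analytic functions on the torus\<close>

lemma integral_cis_2pi: "((\<lambda>x. cis (of_int k * x)) has_integral (if k = 0 then 2 * of_real pi else 0)) {0..2 * pi}"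
proof (cases "k = 0")
  case True
  thus ?thesis using has_integral_const_real[of "1 :: complex" 0 "2 * pi"] by (simp add: scaleR_conv_of_real)
next
  case False
  have "((\<lambda>x. cis (of_int k * x)) has_integral
     (cis (of_int k * (2 * pi)) / (\<i> * of_int k) - cis (of_int k * 0) / (\<i> * of_int k))) {0..2 * pi}"
  proof (rule fundamental_theorem_of_calculus)
    fix x :: real
    have "((\<lambda>z. exp (\<i> * of_int k * z) / (\<i> * of_int k)) has_field_derivative exp (\<i> * of_int k * of_real x)) (at (of_real x))"
      using False by (auto intro!: derivative_eq_intros)
    from has_vector_derivative_real_field[OF this]
    show "((\<lambda>x. cis (of_int k * x) / (\<i> * of_int k)) has_vector_derivative cis (of_int k * x)) (at x within {0..2 * pi})"
      by (simp add: cis_conv_exp has_vector_derivative_at_within mult_ac)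
  qed simp
  moreover have "cis (of_int k * (2 * pi)) = 1"
    using cis_multiple_2pi[of "of_int k"] by (simp add: mult_ac)
  ultimately show ?thesis using False by simp
qed

lemma higher_deriv_periodic:
  fixes h :: "real \<Rightarrow> real"
  assumes "\<And>x. h (x + c) = h x"
  shows "(deriv ^^ n) h (x + c) = (deriv ^^ n) h x"
proof (induction n arbitrary: x)
  case (Suc n)
  have "((deriv ^^ n) h has_real_derivative D) (at (x + c)) \<longleftrightarrow> ((deriv ^^ n) h has_real_derivative D) (at x)" for D
    using DERIV_shift[of "(deriv ^^ n) h" D x c] Suc.IH by simp
  thus ?case unfolding funpow.simps o_def deriv_def[of "(deriv ^^ n) h"] by simp
qed (use assms in simp)

text \<open>n integrations by parts bound |k|^n times the coefficient by 2 \<pi> C n! C^n; a good n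
  is proportional to |k|.\<close>

lemma fourier_decay_1d:
  fixes h :: "real \<Rightarrow> real" and k :: int
  assumes d: "\<And>n x. ((deriv ^^ n) h has_real_derivative (deriv ^^ Suc n) h x) (at x)"
    and per: "\<And>x. h (x + 2 * pi) = h x" and g: "\<And>x. x \<in> {0..2 * pi} \<Longrightarrow> gevrey1 h C x"
  shows "norm (integral {0..2 * pi} (\<lambda>x. of_real (h x) * cis (- (of_int k * x))))
     \<le> 4 * pi * C * exp (- (ln 2 / (2 * C)) * \<bar>of_int k\<bar>)"
proof -
  have C: "C \<ge> 1" using g[of 0] by (simp add: gevrey1_def)
  define I where "I = (\<lambda>n. integral {0..2 * pi} (\<lambda>x. of_real ((deriv ^^ n) h x) * cis (- (of_int k * x))))"
  have cont: "continuous_on S ((deriv ^^ n) h)" for n S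
    by (meson DERIV_continuous_on d has_field_derivative_at_within)
  have hi: "((\<lambda>x. of_real ((deriv ^^ n) h x) * cis (- (of_int k * x))) has_integral I n) {0..2 * pi}" for n
    unfolding I_def by (intro integrable_integral integrable_continuous_interval continuous_intros cont)
  have step: "I (Suc n) = \<i> * of_int k * I n" for n
  proof -
    let ?P = "\<lambda>x. of_real ((deriv ^^ n) h x) * cis (- (of_int k * x))"
    have "((\<lambda>x. of_real ((deriv ^^ Suc n) h x) * cis (- (of_int k * x)) - \<i> * of_int k * ?P x) has_integral ?P (2 * pi) - ?P 0) {0..2 * pi}"
    proof (rule fundamental_theorem_of_calculus)
      fix x :: real
      have 1: "((\<lambda>x. complex_of_real ((deriv ^^ n) h x)) has_vector_derivative of_real ((deriv ^^ Suc n) h x)) (at x)"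
        using d[of n x] by (rule has_vector_derivative_of_real)
      have "((\<lambda>z. exp (- (\<i> * of_int k * z))) has_field_derivative - (\<i> * of_int k) * exp (- (\<i> * of_int k * of_real x))) (at (of_real x))"
        by (auto intro!: derivative_eq_intros)
      from has_vector_derivative_real_field[OF this]
      have 2: "((\<lambda>x. cis (- (of_int k * x))) has_vector_derivative - (\<i> * of_int k) * cis (- (of_int k * x))) (at x)"
        by (simp add: cis_conv_exp mult_ac)
      from has_vector_derivative_mult[OF 1 2]
      show "(?P has_vector_derivative of_real ((deriv ^^ Suc n) h x) * cis (- (of_int k * x)) - \<i> * of_int k * ?P x) (at x within {0..2 * pi})"
        by (rule has_vector_derivative_at_within[OF has_vector_derivative_eq_rhs]) (simp add: algebra_simps)
    qed simp
    moreover have "?P (2 * pi) = ?P 0"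
      using higher_deriv_periodic[of h "2 * pi" n 0, OF per] cis_multiple_2pi[of "- of_int k"] by (simp add: mult_ac)
    ultimately have "((\<lambda>x. of_real ((deriv ^^ Suc n) h x) * cis (- (of_int k * x)) - \<i> * of_int k * ?P x) has_integral 0) {0..2 * pi}"
      by simp
    from has_integral_unique[OF this has_integral_diff[OF hi[of "Suc n"] has_integral_mult_right[OF hi[of n], of "\<i> * of_int k"]]]
    show ?thesis by simp
  qed
  have pow: "norm (I n) = \<bar>of_int k\<bar> ^ n * norm (I 0)" for n
    by (induction n) (auto simp: step norm_mult)
  have bd: "norm (I n) \<le> 2 * pi * (C * fact n * C ^ n)" for n
  proof -
    have "norm (I n) \<le> integral {0..2 * pi} (\<lambda>x. C * fact n * C ^ n)"
      unfolding I_def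
    proof (rule integral_norm_bound_integral)
      fix x assume "x \<in> {0..2 * pi}"
      from g[OF this] have "\<bar>(deriv ^^ n) h x\<bar> \<le> C * fact n * C ^ n" unfolding gevrey1_def by blast
      thus "norm (complex_of_real ((deriv ^^ n) h x) * cis (- (of_int k * x))) \<le> C * fact n * C ^ n"
        by (simp add: norm_mult)
    qed (use hi in \<open>auto simp: integrable_on_def\<close>)
    thus ?thesis by (simp add: mult_ac)
  qed
  have "norm (I 0) \<le> 4 * pi * C * exp (- (ln 2 / (2 * C)) * \<bar>of_int k\<bar>)"
  proof (cases "k = 0")
    case True
    have "norm (I 0) \<le> 2 * pi * C" using bd[of 0] by simp
    also have "2 * pi * C \<le> 4 * pi * C" using C by (intro mult_right_mono) auto
    finally show ?thesis using True by simp
  next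
    case False
    define K where "K = \<bar>real_of_int k\<bar>"
    have K: "K \<ge> 1" using False by (simp add: K_def) 
    \<comment> \<open>Then n C <= |k|/2, so each of the n steps gains a factor 1/2. Rounding down
      loses at most one such factor, which turns 2 \<pi> into 4 \<pi>.\<close>
    define n where "n = nat \<lfloor>K / (2 * C)\<rfloor>"
    have n: "real n \<le> K / (2 * C)" "K / (2 * C) - 1 \<le> real n"
      using K C by (auto simp: n_def)
    have "K ^ n * norm (I 0) \<le> 2 * pi * (C * fact n * C ^ n)" using bd[of n] pow[of n] by (simp add: K_def)
    also have "fact n \<le> real n ^ n" using fact_le_power[of n, where 'a = real] by simp
    hence "2 * pi * (C * fact n * C ^ n) \<le> 2 * pi * (C * real n ^ n * C ^ n)"
      using C by (intro mult_left_mono mult_right_mono) auto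
    also have "\<dots> = 2 * pi * C * (real n * C) ^ n" by (simp add: power_mult_distrib)
    also have "\<dots> \<le> 2 * pi * C * (K / 2) ^ n"
      using n(1) C by (intro mult_left_mono power_mono) (auto simp: field_simps)
    also have "\<dots> = K ^ n * (2 * pi * C * (1 / 2) ^ n)" by (simp add: power_divide)
    finally have "norm (I 0) \<le> 2 * pi * C * (1 / 2) ^ n" using K by simp
    also have "(1 / 2 :: real) ^ n = exp (- (ln 2 * real n))"
      by (simp add: exp_minus exp_of_nat2_mult power_one_over inverse_eq_divide)
    also have "2 * pi * C * exp (- (ln 2 * real n)) \<le> 2 * pi * C * exp (- (ln 2 * (K / (2 * C) - 1)))"
      using n(2) C by (intro mult_left_mono) auto
    also have "exp (- (ln 2 * (K / (2 * C) - 1))) = 2 * exp (- (ln 2 / (2 * C)) * K)"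
    proof -
      have "- (ln 2 * (K / (2 * C) - 1)) = ln 2 + - (ln 2 / (2 * C)) * K" by (simp add: algebra_simps)
      thus ?thesis by (simp only: exp_add) simp
    qed
    finally show ?thesis by (simp add: K_def)
  qed
  thus ?thesis by (simp add: I_def)
qed

text \<open>h is tested against powers of the trigonometric polynomial 1 + cos(x - x0), which
  concentrate at x0: were h x0 > 0, the integrals would be positive for large powers, while they are
  all 0.\<close>

lemma fourier_unique_real:
  fixes h :: "real \<Rightarrow> real"
  assumes c: "continuous_on {0..2 * pi} h"
    and z: "\<And>k::int. integral {0..2 * pi} (\<lambda>x. of_real (h x) * cis (of_int k * x)) = 0"
    and x0: "x0 \<in> {0<..<2 * pi}"
  shows "h x0 \<le> 0"
proof (rule ccontr)
  assume "\<not> h x0 \<le> 0"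
  define d where "d = h x0"
  have d: "d > 0" using \<open>\<not> h x0 \<le> 0\<close> by (simp add: d_def)
  define P where "P = (\<lambda>x. 1 + cos (x - x0))"
  have P0: "0 \<le> P x" "P x \<le> 2" for x
    using cos_ge_minus_one[of "x - x0"] cos_le_one[of "x - x0"] unfolding P_def by linarith+
  have Pc: "complex_of_real (P x) = 1 + (cis (- x0) * cis x + cis x0 * cis (- x)) / 2" for x
    by (simp add: P_def cis_mult complex_eq_iff cos_diff sin_diff)
  have all: "\<forall>k::int. ((\<lambda>x. of_real (h x * P x ^ n) * cis (of_int k * x)) has_integral 0) {0..2 * pi}" for n
  proof (induction n)
    case 0
    show ?case
    proof
      fix k :: int
      have "(\<lambda>x. of_real (h x) * cis (of_int k * x)) integrable_on {0..2 * pi}"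
        by (intro integrable_continuous_interval continuous_intros c)
      from integrable_integral[OF this] z[of k]
      show "((\<lambda>x. of_real (h x * P x ^ 0) * cis (of_int k * x)) has_integral 0) {0..2 * pi}" by simp
    qed
  next
    case (Suc n)
    show ?case
    proof
      fix k :: int
      let ?Q = "\<lambda>k x. of_real (h x * P x ^ n) * cis (of_int k * x)"
      have "((\<lambda>x. ?Q k x + (cis (- x0) / 2 * ?Q (k + 1) x + cis x0 / 2 * ?Q (k - 1) x)) has_integral
          0 + (cis (- x0) / 2 * 0 + cis x0 / 2 * 0)) {0..2 * pi}"
        by (intro has_integral_add has_integral_mult_right) (use Suc in blast)+
      moreover have "?Q k x + (cis (- x0) / 2 * ?Q (k + 1) x + cis x0 / 2 * ?Q (k - 1) x)
         = of_real (h x * P x ^ Suc n) * cis (of_int k * x)" for x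
      proof -
        have 1: "cis (of_int (k + 1) * x) = cis (of_int k * x) * cis x" by (simp add: cis_mult distrib_right)
        have 2: "cis (of_int (k - 1) * x) = cis (of_int k * x) * cis (- x)" by (simp add: cis_mult left_diff_distrib)
        have "of_real (h x * P x ^ Suc n) * cis (of_int k * x) = ?Q k x * of_real (P x)" by simp
        also have "\<dots> = ?Q k x + (cis (- x0) / 2 * ?Q (k + 1) x + cis x0 / 2 * ?Q (k - 1) x)"
          unfolding Pc 1 2 by (simp add: algebra_simps)
        finally show ?thesis ..
      qed
      ultimately show "((\<lambda>x. of_real (h x * P x ^ Suc n) * cis (of_int k * x)) has_integral 0) {0..2 * pi}" by simp
    qed
  qed
  have I: "((\<lambda>x. h x * P x ^ n) has_integral 0) {0..2 * pi}" for n
    using has_integral_linear[OF spec[OF all[of n], where x = 0] bounded_linear_Re] by (simp add: o_def)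
  have "isCont h x0"
    using c x0 by (intro continuous_on_interior[OF c]) (simp add: interior_atLeastAtMost_real)
  then obtain e where e: "e > 0" "\<And>x. \<bar>x - x0\<bar> < e \<Longrightarrow> \<bar>h x - h x0\<bar> < d / 2"
    using d unfolding continuous_at_eps_delta dist_real_def by (meson half_gt_zero)
  \<comment> \<open>Small enough for h > d/2 within \<eta> of x0, for the \<eta>-neighbourhood to
    lie in [0, 2 \<pi>], and for cos \<eta> >= 0, which keeps \<open>a\<close> positive.\<close>
  define \<eta> where "\<eta> = min (e / 2) (min (min x0 (2 * pi - x0)) (pi / 2))"
  have \<eta>: "\<eta> > 0" "\<eta> < e" "\<eta> \<le> x0" "\<eta> \<le> 2 * pi - x0" using e x0 by (auto simp: \<eta>_def)
  have \<eta>5: "\<eta> \<le> pi / 2" unfolding \<eta>_def by (rule min.coboundedI2[OF min.cobounded2])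
  note \<eta> = \<eta> \<eta>5
  define a where "a = 1 + cos \<eta>"
  define b where "b = 1 + cos (\<eta> / 2)"
  have ab: "0 < a" "a < b"
  proof -
    have "cos \<eta> < cos (\<eta> / 2)" using \<eta> pi_gt_zero by (intro cos_monotone_0_pi) linarith+
    thus "a < b" by (simp add: a_def b_def)
    have "cos \<eta> \<ge> 0" using \<eta> by (intro cos_ge_zero) auto
    thus "0 < a" by (simp add: a_def)
  qed
  obtain M where M: "\<And>x. x \<in> {0..2 * pi} \<Longrightarrow> \<bar>h x\<bar> \<le> M"
    using compact_imp_bounded[OF compact_continuous_image[OF c compact_Icc]] unfolding bounded_iff
    by (metis imageI real_norm_def)
  have M0: "M \<ge> 0" using M[of 0] pi_gt_zero by force
  have inner: "b \<le> P x" if "\<bar>x - x0\<bar> \<le> \<eta> / 2" for x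
  proof -
    have "cos (\<eta> / 2) \<le> cos \<bar>x - x0\<bar>" using that \<eta> pi_gt_zero by (intro cos_monotone_0_pi_le) linarith+
    thus ?thesis by (simp add: P_def b_def)
  qed
  have outer: "P x \<le> a" if x: "\<bar>x - x0\<bar> \<ge> \<eta>" "x \<in> {0..2 * pi}" for x
  proof (cases "\<bar>x - x0\<bar> \<le> pi")
    case True
    have "cos \<bar>x - x0\<bar> \<le> cos \<eta>" using True x \<eta> by (intro cos_monotone_0_pi_le) auto
    thus ?thesis by (simp add: P_def a_def)
  next
    case False
    \<comment> \<open>Past distance \<pi> the cosine rises again, but x0 keeps distance \<eta> from
      both ends of the period.\<close>
    have "\<bar>x - x0\<bar> \<le> 2 * pi - \<eta>" using x \<eta> by (auto simp: abs_if)
    hence "cos (2 * pi - \<bar>x - x0\<bar>) \<le> cos \<eta>" using False \<eta> by (intro cos_monotone_0_pi_le) auto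
    thus ?thesis by (simp add: P_def a_def cos_2pi_minus)
  qed
  \<comment> \<open>The integral of h P^n vanishes, so its part near x0, at least of order b^n, is
    balanced by the rest, at most of order a^n. As a < b, this fails for large n.\<close>
  have low: "d / 2 * b ^ n * \<eta> \<le> 2 * pi * (M * a ^ n)" for n
  proof -
    let ?J = "{x0 - \<eta> / 2..x0 + \<eta> / 2}"
    have J: "?J \<subseteq> {0..2 * pi}" using \<eta> by auto
    have "((\<lambda>x. d / 2 * b ^ n) has_integral (d / 2 * b ^ n * \<eta>)) ?J"
      using has_integral_const_real[of "d / 2 * b ^ n" "x0 - \<eta> / 2" "x0 + \<eta> / 2"] \<eta> by (simp add: mult_ac)
    hence 1: "((\<lambda>x. if x \<in> ?J then d / 2 * b ^ n else 0) has_integral (d / 2 * b ^ n * \<eta>)) {0..2 * pi}"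
      using J by (subst has_integral_restrict)
    have 2: "((\<lambda>x. M * a ^ n) has_integral (2 * pi * (M * a ^ n))) {0..2 * pi}"
      using has_integral_const_real[of "M * a ^ n" 0 "2 * pi"] by simp
    have "d / 2 * b ^ n * \<eta> - 2 * pi * (M * a ^ n) \<le> 0"
    proof (rule has_integral_le[OF has_integral_diff[OF 1 2] I[of n]])
      fix x assume x: "x \<in> {0..2 * pi}"
      have Man: "0 \<le> M * a ^ n" using M0 ab by simp
      show "(if x \<in> ?J then d / 2 * b ^ n else 0) - M * a ^ n \<le> h x * P x ^ n"
      proof (cases "\<bar>x - x0\<bar> < \<eta>")
        case True
        hence "\<bar>h x - h x0\<bar> < d / 2" using e(2)[of x] \<eta>(2) by linarith
        hence hx: "d / 2 \<le> h x" unfolding d_def by linarith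
        have "(if x \<in> ?J then d / 2 * b ^ n else 0) \<le> h x * P x ^ n"
        proof (cases "x \<in> ?J")
          case True
          hence "\<bar>x - x0\<bar> \<le> \<eta> / 2" unfolding atLeastAtMost_iff by linarith
          hence "b \<le> P x" by (rule inner)
          hence "d / 2 * b ^ n \<le> h x * P x ^ n" using hx d ab by (intro mult_mono power_mono) auto
          thus ?thesis using True by simp
        qed (use hx d P0 in auto)
        thus ?thesis using Man by linarith
      next
        case False
        hence nJ: "x \<notin> ?J" using \<eta>(1) by (auto simp: abs_if split: if_splits)
        have "\<bar>h x\<bar> * P x ^ n \<le> M * a ^ n"
          using M[OF x] outer[OF _ x] False P0 M0 by (intro mult_mono power_mono) auto
        moreover have "- (\<bar>h x\<bar> * P x ^ n) \<le> h x * P x ^ n"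
          using mult_right_mono[of "- \<bar>h x\<bar>" "h x" "P x ^ n"] P0[of x] by simp
        ultimately have "0 - M * a ^ n \<le> h x * P x ^ n" by linarith
        thus ?thesis unfolding if_not_P[OF nJ] .
      qed
    qed
    thus ?thesis by simp
  qed
  obtain n where n: "4 * pi * M / (d * \<eta>) < (b / a) ^ n"
    using real_arch_pow[of "b / a"] ab by (metis less_divide_eq_1_pos)
  have "4 * pi * M / (d * \<eta>) * (d * \<eta>) < (b / a) ^ n * (d * \<eta>)"
    using n d \<eta> by (intro mult_strict_right_mono) auto
  hence "4 * pi * M * a ^ n < b ^ n * (d * \<eta>)" using d \<eta> ab by (simp add: power_divide field_simps)
  moreover have "b ^ n * (d * \<eta>) = 2 * (d / 2 * b ^ n * \<eta>)" "4 * pi * M * a ^ n = 2 * (2 * pi * (M * a ^ n))" by simp_all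
  ultimately show False using low[of n] by linarith
qed

text \<open>The one-sided statement is applied to both signs of the real and imaginary parts; the
  end points follow by continuity.\<close>

lemma fourier_unique:
  fixes h :: "real \<Rightarrow> complex"
  assumes c: "continuous_on {0..2 * pi} h"
    and z: "\<And>k::int. integral {0..2 * pi} (\<lambda>x. h x * cis (of_int k * x)) = 0"
    and x: "x \<in> {0..2 * pi}"
  shows "h x = 0"
proof -
  have i: "(\<lambda>x. h x * cis (of_int k * x)) integrable_on {0..2 * pi}" for k
    by (intro integrable_continuous_interval continuous_intros c)
  have hz: "((\<lambda>x. h x * cis (of_int k * x)) has_integral 0) {0..2 * pi}" for k :: int
    using integrable_integral[OF i[of k]] z[of k] by simp
  have hz': "((\<lambda>x. cnj (h x) * cis (of_int k * x)) has_integral 0) {0..2 * pi}" for k :: int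
  proof -
    have "((cnj \<circ> (\<lambda>x. h x * cis (of_int (- k) * x))) has_integral cnj 0) {0..2 * pi}"
      using hz[of "- k"] by (subst has_integral_cnj)
    thus ?thesis by (simp add: o_def cis_cnj)
  qed
  have re: "integral {0..2 * pi} (\<lambda>x. of_real (s * Re (h x)) * cis (of_int k * x)) = 0" for s :: real and k :: int
  proof -
    have "((\<lambda>x. of_real s / 2 * (h x * cis (of_int k * x) + cnj (h x) * cis (of_int k * x))) has_integral of_real s / 2 * (0 + 0)) {0..2 * pi}"
      by (intro has_integral_mult_right has_integral_add hz hz')
    moreover have "of_real s / 2 * (h x * cis (of_int k * x) + cnj (h x) * cis (of_int k * x)) = of_real (s * Re (h x)) * cis (of_int k * x)" for x
      unfolding distrib_right[symmetric] complex_add_cnj by simp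
    ultimately have "((\<lambda>x. of_real (s * Re (h x)) * cis (of_int k * x)) has_integral of_real s / 2 * (0 + 0)) {0..2 * pi}"
      by (simp only:)
    from integral_unique[OF this] show ?thesis by simp
  qed
  have im: "integral {0..2 * pi} (\<lambda>x. of_real (s * Im (h x)) * cis (of_int k * x)) = 0" for s :: real and k :: int
  proof -
    have "((\<lambda>x. of_real s / (2 * \<i>) * (h x * cis (of_int k * x) - cnj (h x) * cis (of_int k * x))) has_integral of_real s / (2 * \<i>) * (0 - 0)) {0..2 * pi}"
      by (intro has_integral_mult_right has_integral_diff hz hz')
    moreover have "of_real s / (2 * \<i>) * (h x * cis (of_int k * x) - cnj (h x) * cis (of_int k * x)) = of_real (s * Im (h x)) * cis (of_int k * x)" for x
      unfolding left_diff_distrib[symmetric] complex_diff_cnj by (simp add: field_simps)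
    ultimately have "((\<lambda>x. of_real (s * Im (h x)) * cis (of_int k * x)) has_integral of_real s / (2 * \<i>) * (0 - 0)) {0..2 * pi}"
      by (simp only:)
    from integral_unique[OF this] show ?thesis by simp
  qed
  have "h y = 0" if y: "y \<in> {0<..<2 * pi}" for y
  proof -
    have "s * Re (h y) \<le> 0" "s * Im (h y) \<le> 0" for s
      by (rule fourier_unique_real[OF _ _ y]; intro continuous_intros c re im)+
    from this[of 1] this[of "-1"] show ?thesis by (simp add: complex_eq_iff)
  qed
  moreover have "closure {0<..<2 * pi} = {0..2 * pi}" by (simp add: closure_greaterThanLessThan)
  ultimately show ?thesis using continuous_constant_on_closure[of "{0<..<2 * pi}" h 0 x] c x by simp
qed

lemma real_analytic2_swap:
  assumes "real_analytic2 f"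
  shows "real_analytic2 (\<lambda>(x, y). f (y, x))"
  unfolding real_analytic2_def
proof (intro allI)
  fix x0 y0
  obtain r a where r: "r > 0" and a: "\<And>x y. \<bar>x - y0\<bar> < r \<and> \<bar>y - x0\<bar> < r \<Longrightarrow>
      ((\<lambda>(m, n). a m n * (x - y0) ^ m * (y - x0) ^ n) has_sum f (x, y)) UNIV"
    using assms unfolding real_analytic2_def by meson
  have "((\<lambda>(m, n). a n m * (x - x0) ^ m * (y - y0) ^ n) has_sum f (y, x)) UNIV"
    if "\<bar>x - x0\<bar> < r \<and> \<bar>y - y0\<bar> < r" for x y
  proof -
    have "((\<lambda>(m, n). a m n * (y - y0) ^ m * (x - x0) ^ n) has_sum f (y, x)) (UNIV \<times> UNIV)"
      using a[of y x] that by simp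
    hence "((\<lambda>(m, n). (\<lambda>(m, n). a m n * (y - y0) ^ m * (x - x0) ^ n) (n, m)) has_sum f (y, x)) (UNIV \<times> UNIV)"
      by (subst (asm) has_sum_swap)
    thus ?thesis by (simp add: mult_ac case_prod_unfold)
  qed
  thus "\<exists>r>0. \<exists>a. \<forall>x y. \<bar>x - x0\<bar> < r \<and> \<bar>y - y0\<bar> < r \<longrightarrow>
      ((\<lambda>(m, n). a m n * (x - x0) ^ m * (y - y0) ^ n) has_sum (case (x, y) of (x, y) \<Rightarrow> f (y, x))) UNIV"
    using r by (intro exI[of _ r] conjI exI[of _ "\<lambda>m n. a n m"]) auto
qed

lemma real_analytic2_continuous:
  assumes "real_analytic2 f"
  shows "continuous_on UNIV f"
proof -
  have "isCont f (x0, y0)" for x0 y0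
  proof -
    obtain r a where r: "r > 0" and a: "\<And>x y. \<bar>x - x0\<bar> < r \<and> \<bar>y - y0\<bar> < r \<Longrightarrow>
        ((\<lambda>(m, n). a m n * (x - x0) ^ m * (y - y0) ^ n) has_sum f (x, y)) UNIV"
      using assms unfolding real_analytic2_def by meson
    define t where "t = r / 2"
    have t: "t > 0" "t < r" using r by (auto simp: t_def)
    define F where "F = (\<lambda>i z. case i of (m, n) \<Rightarrow> a m n * (fst z - x0) ^ m * (snd z - y0) ^ n)"
    define S where "S = {x0 - t<..<x0 + t} \<times> {y0 - t<..<y0 + t}"
    have Ff: "((\<lambda>i. F i z) has_sum f z) UNIV" if z: "\<bar>fst z - x0\<bar> < r" "\<bar>snd z - y0\<bar> < r" for z
      using a[of "fst z" "snd z"] z by (simp add: F_def case_prod_unfold)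
    have "(\<lambda>i. F i (x0 + t, y0 + t)) summable_on UNIV"
      using Ff[of "(x0 + t, y0 + t)"] t by (auto dest: has_sum_imp_summable)
    hence B: "(\<lambda>i. norm (F i (x0 + t, y0 + t))) summable_on UNIV"
      by (rule iffD1[OF summable_on_iff_abs_summable_on_real])
    have le: "norm (F i z) \<le> norm (F i (x0 + t, y0 + t))" if "z \<in> S" for i z
    proof -
      have "\<bar>fst z - x0\<bar> \<le> t" "\<bar>snd z - y0\<bar> \<le> t" using that by (auto simp: S_def mem_Times_iff)
      thus ?thesis using t
        by (auto simp: F_def abs_mult power_abs case_prod_unfold intro!: mult_mono power_mono)
    qed
    have ul: "uniform_limit S (\<lambda>X z. \<Sum>i\<in>X. F i z) (\<lambda>z. infsum (\<lambda>i. F i z) UNIV) (finite_subsets_at_top UNIV)"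
      by (rule Weierstrass_m_test_general[OF le B])
    have "continuous_on S (\<lambda>z. infsum (\<lambda>i. F i z) UNIV)"
    proof (rule uniform_limit_theorem[OF _ ul])
      show "\<forall>\<^sub>F X in finite_subsets_at_top UNIV. continuous_on S (\<lambda>z. \<Sum>i\<in>X. F i z)"
        unfolding F_def case_prod_unfold by (intro always_eventually allI continuous_intros)
    qed auto
    also have "continuous_on S (\<lambda>z. infsum (\<lambda>i. F i z) UNIV) \<longleftrightarrow> continuous_on S f"
    proof (intro continuous_on_cong refl infsumI Ff)
      fix z assume "z \<in> S"
      thus "\<bar>fst z - x0\<bar> < r" "\<bar>snd z - y0\<bar> < r" using t by (auto simp: S_def mem_Times_iff)
    qed
    finally have "continuous_on S f" .
    moreover have "open S" unfolding S_def by (intro open_Times open_greaterThanLessThan)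
    moreover have "(x0, y0) \<in> S" using t by (simp add: S_def)
    ultimately show ?thesis by (simp add: continuous_on_eq_continuous_at)
  qed
  thus ?thesis by (auto simp: continuous_on_eq_continuous_at)
qed

section \<open>Periodic functions and Fourier coefficients on the torus\<close>

abbreviation torus_box :: "(real \<times> real) set" where
  "torus_box \<equiv> cbox (0, 0) (2 * pi, 2 * pi)"

lemma periodic2_int:
  assumes "periodic2 f"
  shows "f (x + 2 * pi * of_int k, y) = f (x, y)" "f (x, y + 2 * pi * of_int k) = f (x, y)"
proof -
  have n1: "f (x + 2 * pi * of_nat n, y) = f (x, y)" for n x y
  proof (induction n)
    case (Suc n)
    have "f ((x + 2 * pi * of_nat n, y) + (2 * pi, 0)) = f (x + 2 * pi * of_nat n, y)"
      using assms unfolding periodic2_def by blast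
    thus ?case using Suc by (simp add: algebra_simps)
  qed simp
  have n2: "f (x, y + 2 * pi * of_nat n) = f (x, y)" for n x y
  proof (induction n)
    case (Suc n)
    have "f ((x, y + 2 * pi * of_nat n) + (0, 2 * pi)) = f (x, y + 2 * pi * of_nat n)"
      using assms unfolding periodic2_def by blast
    thus ?case using Suc by (simp add: algebra_simps)
  qed simp
  show "f (x + 2 * pi * of_int k, y) = f (x, y)"
    using n1[of x "nat k" y] n1[of "x + 2 * pi * of_int k" "nat (- k)" y] by (cases "k \<ge> 0") auto
  show "f (x, y + 2 * pi * of_int k) = f (x, y)"
    using n2[of x y "nat k"] n2[of x "y + 2 * pi * of_int k" "nat (- k)"] by (cases "k \<ge> 0") auto
qed

lemma periodic2_reduce:
  assumes "periodic2 f"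
  obtains \<psi>' where "\<psi>' \<in> torus_box" "f \<psi>' = f \<psi>"
proof -
  define red where "red = (\<lambda>x::real. x + 2 * pi * of_int (- \<lfloor>x / (2 * pi)\<rfloor>))"
  have red: "0 \<le> red x" "red x \<le> 2 * pi" for x
  proof -
    have "of_int \<lfloor>x / (2 * pi)\<rfloor> * (2 * pi) \<le> x" by (rule floor_divide_lower) simp
    moreover have "x < (of_int \<lfloor>x / (2 * pi)\<rfloor> + 1) * (2 * pi)" by (rule floor_divide_upper) simp
    ultimately show "0 \<le> red x" "red x \<le> 2 * pi" by (simp_all add: red_def algebra_simps)
  qed
  have "f (red (fst \<psi>), red (snd \<psi>)) = f \<psi>"
    unfolding red_def periodic2_int[OF assms] by simp
  thus ?thesis using that[of "(red (fst \<psi>), red (snd \<psi>))"] red by (simp add: cbox_Pair_iff)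
qed

lemma periodic2_bounded:
  fixes f :: "real \<times> real \<Rightarrow> real"
  assumes "periodic2 f" "continuous_on UNIV f"
  obtains B where "\<And>\<psi>. \<bar>f \<psi>\<bar> \<le> B"
proof -
  have "bounded (f ` torus_box)"
    by (intro compact_imp_bounded compact_continuous_image continuous_on_subset[OF assms(2)]) auto
  then obtain B where B: "\<And>\<psi>. \<psi> \<in> torus_box \<Longrightarrow> \<bar>f \<psi>\<bar> \<le> B"
    unfolding bounded_iff by (metis imageI real_norm_def)
  show ?thesis
  proof (rule that)
    fix \<psi>
    obtain \<psi>' where "\<psi>' \<in> torus_box" "f \<psi>' = f \<psi>" by (rule periodic2_reduce[OF assms(1)])
    thus "\<bar>f \<psi>\<bar> \<le> B" using B by metis
  qed
qed

lemma fourier_coeff_iterated: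
  assumes "continuous_on UNIV f"
  shows "fourier_coeff f (k, l) * of_real ((2 * pi)\<^sup>2) =
    integral {0..2 * pi} (\<lambda>x. integral {0..2 * pi} (\<lambda>y. of_real (f (x, y)) * cis (- (of_int k * x)) * cis (- (of_int l * y))))"
    and "fourier_coeff f (k, l) * of_real ((2 * pi)\<^sup>2) =
    integral {0..2 * pi} (\<lambda>y. integral {0..2 * pi} (\<lambda>x. of_real (f (x, y)) * cis (- (of_int k * x)) * cis (- (of_int l * y))))"
proof -
  let ?g = "\<lambda>x y. of_real (f (x, y)) * cis (- (of_int k * x)) * cis (- (of_int l * y))"
  have c: "continuous_on UNIV (\<lambda>z. ?g (fst z) (snd z))"
    by (intro continuous_intros continuous_on_compose2[OF assms]) auto
  have "fourier_coeff f (k, l) * of_real ((2 * pi)\<^sup>2) = integral torus_box (\<lambda>z. ?g (fst z) (snd z))"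
    unfolding fourier_coeff_def freq_def
    by (simp add: inner_prod_def cis_mult mult.assoc)
  also have "\<dots> = integral {0..2 * pi} (\<lambda>x. integral {0..2 * pi} (\<lambda>y. ?g x y))"
    using integral_prod_continuous[of 0 0 "2 * pi" "2 * pi" "\<lambda>z. ?g (fst z) (snd z)"] continuous_on_subset[OF c]
    by simp
  finally show 1: "fourier_coeff f (k, l) * of_real ((2 * pi)\<^sup>2) = integral {0..2 * pi} (\<lambda>x. integral {0..2 * pi} (\<lambda>y. ?g x y))" .
  show "fourier_coeff f (k, l) * of_real ((2 * pi)\<^sup>2) = integral {0..2 * pi} (\<lambda>y. integral {0..2 * pi} (\<lambda>x. ?g x y))"
    unfolding 1
    using integral_swap_continuous[of 0 0 "2 * pi" "2 * pi" ?g] continuous_on_subset[OF c, of torus_box]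
    by (simp add: case_prod_unfold)
qed

lemma norm_integral_le_const:
  fixes h :: "real \<Rightarrow> complex"
  assumes "continuous_on {0..2 * pi} h" "\<And>x. x \<in> {0..2 * pi} \<Longrightarrow> norm (h x) \<le> B"
  shows "norm (integral {0..2 * pi} h) \<le> 2 * pi * B"
  using integral_norm_bound_integral[of h "{0..2 * pi}" "\<lambda>_. B"] assms
  by (simp add: integrable_continuous_interval)

lemma gevrey1_uniform:
  assumes "real_analytic2 f"
  obtains C where "\<And>x y. (x, y) \<in> torus_box \<Longrightarrow> gevrey1 (\<lambda>x. f (x, y)) C x"
proof -
  have "\<exists>C. \<forall>z\<in>torus_box. gevrey1 (\<lambda>x. f (x, snd z)) C (fst z)"
  proof (rule compact_uniform_bound[OF compact_cbox])
    fix C D z assume "gevrey1 (\<lambda>x. f (x, snd z)) C (fst z)" "C \<le> D"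
    thus "gevrey1 (\<lambda>x. f (x, snd z)) D (fst z)" by (rule gevrey1_mono)
  next
    fix z :: "real \<times> real"
    obtain s C where s: "s > 0" "\<And>x y. \<bar>x - fst z\<bar> < s \<Longrightarrow> \<bar>y - snd z\<bar> < s \<Longrightarrow> gevrey1 (\<lambda>x. f (x, y)) C x"
      using real_analytic2_local[OF assms, of "fst z" "snd z"] by metis
    show "\<exists>U C. open U \<and> z \<in> U \<and> (\<forall>w\<in>U. gevrey1 (\<lambda>x. f (x, snd w)) C (fst w))"
    proof (intro exI[of _ "{fst z - s<..<fst z + s} \<times> {snd z - s<..<snd z + s}"] exI[of _ C] conjI ballI)
      fix w assume "w \<in> {fst z - s<..<fst z + s} \<times> {snd z - s<..<snd z + s}"
      thus "gevrey1 (\<lambda>x. f (x, snd w)) C (fst w)" by (intro s(2)) (auto simp: mem_Times_iff abs_less_iff)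
    qed (use s(1) in \<open>auto simp: mem_Times_iff intro!: open_Times\<close>)
  qed
  then obtain C where "\<forall>z\<in>torus_box. gevrey1 (\<lambda>x. f (x, snd z)) C (fst z)" by blast
  thus ?thesis using that[of C] by force
qed

text \<open>Decay comes from the inner integral over the first variable; the outer integral is
  estimated trivially.\<close>

lemma fourier_coeff_decay_fst:
  assumes an: "real_analytic2 f" and per: "periodic2 f"
  obtains C where "C \<ge> 1" "\<And>k l. norm (fourier_coeff f (k, l)) \<le> 2 * C * exp (- (ln 2 / (2 * C)) * \<bar>of_int k\<bar>)"
proof -
  obtain C where C: "\<And>x y. (x, y) \<in> torus_box \<Longrightarrow> gevrey1 (\<lambda>x. f (x, y)) C x"
    using gevrey1_uniform[OF an] by metis
  have C1: "C \<ge> 1" using C[of 0 0] by (simp add: gevrey1_def)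
  note cont = real_analytic2_continuous[OF an]
  have "norm (fourier_coeff f (k, l)) \<le> 2 * C * exp (- (ln 2 / (2 * C)) * \<bar>of_int k\<bar>)" for k l
  proof -
    let ?E = "exp (- (ln 2 / (2 * C)) * \<bar>of_int k\<bar>)"
    define J where "J = (\<lambda>y. integral {0..2 * pi} (\<lambda>x. of_real (f (x, y)) * cis (- (of_int k * x)) * cis (- (of_int l * y))))"
    have Jb: "norm (J y) \<le> 4 * pi * C * ?E" if y: "y \<in> {0..2 * pi}" for y
    proof -
      have "J y = integral {0..2 * pi} (\<lambda>x. of_real (f (x, y)) * cis (- (of_int k * x))) * cis (- (of_int l * y))"
        unfolding J_def by (rule integral_mult_left)
      hence "norm (J y) = norm (integral {0..2 * pi} (\<lambda>x. of_real (f (x, y)) * cis (- (of_int k * x))))"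
        by (simp add: norm_mult)
      also have "\<dots> \<le> 4 * pi * C * ?E"
      proof (rule fourier_decay_1d)
        fix n x
        show "((deriv ^^ n) (\<lambda>x. f (x, y)) has_real_derivative (deriv ^^ Suc n) (\<lambda>x. f (x, y)) x) (at x)"
          using real_analytic2_local[OF an, of x y] by (metis abs_zero diff_self)
        show "f (x + 2 * pi, y) = f (x, y)" using periodic2_int(1)[OF per, of x 1 y] by simp
      next
        fix x assume "x \<in> {0..2 * pi}"
        thus "gevrey1 (\<lambda>x. f (x, y)) C x" using y by (intro C) (auto simp: cbox_Pair_iff)
      qed
      finally show ?thesis .
    qed
    have Jc: "continuous_on {0..2 * pi} J"
    proof -
      have "continuous_on {0..2 * pi} (\<lambda>y. integral (cbox 0 (2 * pi)) (\<lambda>x. of_real (f (x, y)) * cis (- (of_int k * x)) * cis (- (of_int l * y))))"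
        by (rule integral_continuous_on_param)
           (auto simp: case_prod_unfold intro!: continuous_intros continuous_on_compose2[OF cont])
      thus ?thesis unfolding J_def box_real .
    qed
    have "(2 * pi)\<^sup>2 * norm (fourier_coeff f (k, l)) = norm (fourier_coeff f (k, l) * of_real ((2 * pi)\<^sup>2))"
      by (simp add: norm_mult norm_power)
    also have "\<dots> \<le> 2 * pi * (4 * pi * C * ?E)"
      unfolding fourier_coeff_iterated(2)[OF cont] J_def[symmetric] by (rule norm_integral_le_const[OF Jc Jb])
    also have "\<dots> = (2 * pi)\<^sup>2 * (2 * C * ?E)" by (simp add: power2_eq_square)
    finally show ?thesis by (simp add: mult_le_cancel_left)
  qed
  thus ?thesis using that C1 by blast
qed

lemma periodic2_swap: "periodic2 f \<Longrightarrow> periodic2 (\<lambda>(x, y). f (y, x))"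
  unfolding periodic2_def
proof (intro allI)
  fix \<psi> :: "real \<times> real"
  assume per: "\<forall>\<psi>. f (\<psi> + (2 * pi, 0)) = f \<psi> \<and> f (\<psi> + (0, 2 * pi)) = f \<psi>"
  show "(case \<psi> + (2 * pi, 0) of (x, y) \<Rightarrow> f (y, x)) = (case \<psi> of (x, y) \<Rightarrow> f (y, x)) \<and>
      (case \<psi> + (0, 2 * pi) of (x, y) \<Rightarrow> f (y, x)) = (case \<psi> of (x, y) \<Rightarrow> f (y, x))"
    using spec[OF per, of "(snd \<psi>, fst \<psi>)"] by (simp add: case_prod_unfold)
qed

lemma fourier_coeff_swap:
  assumes "continuous_on UNIV f"
  shows "fourier_coeff (\<lambda>(x, y). f (y, x)) (k, l) = fourier_coeff f (l, k)"
proof -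
  have c: "continuous_on UNIV (\<lambda>(x, y). f (y, x))"
    unfolding case_prod_unfold by (intro continuous_on_compose2[OF assms] continuous_intros) auto
  have "fourier_coeff (\<lambda>(x, y). f (y, x)) (k, l) * of_real ((2 * pi)\<^sup>2) = fourier_coeff f (l, k) * of_real ((2 * pi)\<^sup>2)"
    unfolding fourier_coeff_iterated(1)[OF c] fourier_coeff_iterated(2)[OF assms] by (simp add: mult_ac)
  thus ?thesis by simp
qed

text \<open>The bounds for the decay in each index alone are combined by their geometric mean, which
  halves the rate.\<close>

lemma fourier_coeff_decay:
  assumes an: "real_analytic2 f" and per: "periodic2 f"
  obtains M \<xi> where "\<xi> > 0" "\<And>\<nu>. norm (fourier_coeff f \<nu>) \<le> M * exp (- \<xi> * nn \<nu>)"
proof -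
  obtain C where C: "C \<ge> 1" "\<And>k l. norm (fourier_coeff f (k, l)) \<le> 2 * C * exp (- (ln 2 / (2 * C)) * \<bar>of_int k\<bar>)"
    using fourier_coeff_decay_fst[OF an per] by metis
  obtain D where D: "D \<ge> 1" "\<And>k l. norm (fourier_coeff f (l, k)) \<le> 2 * D * exp (- (ln 2 / (2 * D)) * \<bar>of_int k\<bar>)"
    using fourier_coeff_decay_fst[OF real_analytic2_swap[OF an] periodic2_swap[OF per]]
    unfolding fourier_coeff_swap[OF real_analytic2_continuous[OF an]] by metis
  define E where "E = max C D"
  have E: "E \<ge> 1" "C \<le> E" "D \<le> E" using C D by (auto simp: E_def)
  have mono: "2 * A * exp (- (ln 2 / (2 * A)) * \<bar>of_int k\<bar>) \<le> 2 * E * exp (- (ln 2 / (2 * E)) * \<bar>of_int k\<bar>)"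
    if "1 \<le> A" "A \<le> E" for A and k :: int
  proof (intro mult_mono)
    have "ln 2 / (2 * E) \<le> ln 2 / (2 * A)" using that by (intro divide_left_mono) auto
    thus "exp (- (ln 2 / (2 * A)) * \<bar>of_int k\<bar>) \<le> exp (- (ln 2 / (2 * E)) * \<bar>of_int k\<bar> :: real)"
      unfolding exp_le_cancel_iff mult_minus_left neg_le_iff_le by (rule mult_right_mono) simp
  qed (use that E in auto)
  have "norm (fourier_coeff f (k, l)) \<le> 2 * E * exp (- (ln 2 / (4 * E)) * nn (k, l))" for k l
  proof -
    let ?e = "\<lambda>k. 2 * E * exp (- (ln 2 / (2 * E)) * \<bar>of_int k\<bar>)"
    have "norm (fourier_coeff f (k, l)) * norm (fourier_coeff f (k, l)) \<le> ?e k * ?e l"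
      using order_trans[OF C(2) mono[OF C(1) E(2)]] order_trans[OF D(2) mono[OF D(1) E(3)]] E by (intro mult_mono) auto
    also have "\<dots> = (2 * E * exp (- (ln 2 / (4 * E)) * nn (k, l)))\<^sup>2"
    proof -
      have "exp (- (ln 2 / (2 * E)) * \<bar>of_int k\<bar>) * exp (- (ln 2 / (2 * E)) * \<bar>of_int l\<bar>) = exp (- (ln 2 / (4 * E)) * nn (k, l)) ^ 2"
        unfolding exp_add[symmetric] exp_of_nat_mult[symmetric]
        by (rule arg_cong[where f = exp]) (use E in \<open>simp add: nn_def field_simps\<close>)
      thus ?thesis by (simp add: power2_eq_square mult_ac)
    qed
    finally have "(norm (fourier_coeff f (k, l)))\<^sup>2 \<le> (2 * E * exp (- (ln 2 / (4 * E)) * nn (k, l)))\<^sup>2"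
      by (simp add: power2_eq_square)
    thus ?thesis by (rule power2_le_imp_le) (use E in auto)
  qed
  thus ?thesis using E by (intro that[of "ln 2 / (4 * E)" "2 * E"]) (auto simp: prod.split)
qed

lemma fourier_coeff_uminus: "fourier_coeff f (- \<nu>) = cnj (fourier_coeff f \<nu>)"
proof -
  have "integral torus_box (\<lambda>\<psi>. complex_of_real (f \<psi>) * cis (- (freq (- \<nu>) \<bullet> \<psi>)))
     = cnj (integral torus_box (\<lambda>\<psi>. complex_of_real (f \<psi>) * cis (- (freq \<nu> \<bullet> \<psi>))))"
    unfolding integral_cnj by (simp add: cis_cnj freq_def inner_prod_def)
  thus ?thesis by (simp add: fourier_coeff_def)
qed

lemma continuous_fcis: "continuous_on S (\<lambda>\<psi>. fcis \<psi> \<nu>)"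
  unfolding fcis_def by (intro continuous_intros)

lemma continuous_fourier_series:
  assumes "rdec b"
  shows "continuous_on UNIV (\<lambda>\<psi>. infsum (\<lambda>\<nu>. fcis \<psi> \<nu> * b \<nu>) UNIV)"
    and "uniform_limit UNIV (\<lambda>X \<psi>. \<Sum>\<nu>\<in>X. fcis \<psi> \<nu> * b \<nu>) (\<lambda>\<psi>. infsum (\<lambda>\<nu>. fcis \<psi> \<nu> * b \<nu>) UNIV) (finite_subsets_at_top UNIV)"
proof -
  have s: "(\<lambda>\<nu>. norm (b \<nu>)) summable_on UNIV" by (rule rdec_summable[OF assms]) simp
  show ul: "uniform_limit UNIV (\<lambda>X \<psi>. \<Sum>\<nu>\<in>X. fcis \<psi> \<nu> * b \<nu>) (\<lambda>\<psi>. infsum (\<lambda>\<nu>. fcis \<psi> \<nu> * b \<nu>) UNIV) (finite_subsets_at_top UNIV)"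
    by (rule Weierstrass_m_test_general[OF _ s]) (simp add: norm_mult)
  show "continuous_on UNIV (\<lambda>\<psi>. infsum (\<lambda>\<nu>. fcis \<psi> \<nu> * b \<nu>) UNIV)"
    by (rule uniform_limit_theorem[OF _ ul])
       (auto intro!: always_eventually continuous_intros continuous_fcis)
qed

lemma periodic2_fourier_series: "periodic2 (\<lambda>\<psi>. infsum (\<lambda>\<nu>. fcis \<psi> \<nu> * b \<nu>) UNIV)"
proof -
  have "fcis (\<psi> + (2 * pi, 0)) \<nu> = fcis \<psi> \<nu>" "fcis (\<psi> + (0, 2 * pi)) \<nu> = fcis \<psi> \<nu>" for \<psi> \<nu>
    using cis_multiple_2pi[of "of_int (fst \<nu>)"] cis_multiple_2pi[of "of_int (snd \<nu>)"]
    by (simp_all add: fcis_def freq_def inner_add_right cis_mult[symmetric] mult_ac)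
  thus ?thesis by (simp add: periodic2_def)
qed

lemma integral_fcis: "((\<lambda>\<psi>. fcis \<psi> \<nu>) has_integral (if \<nu> = 0 then of_real ((2 * pi)\<^sup>2) else 0)) torus_box"
proof -
  obtain k l where \<nu>: "\<nu> = (k, l)" by (cases \<nu>)
  have f: "fcis (x, y) \<nu> = cis (of_int k * x) * cis (of_int l * y)" for x y
    by (simp add: fcis_def freq_def cis_mult \<nu>)
  have "integral torus_box (\<lambda>\<psi>. fcis \<psi> \<nu>) = integral {0..2 * pi} (\<lambda>x. integral {0..2 * pi} (\<lambda>y. cis (of_int k * x) * cis (of_int l * y)))"
    using integral_prod_continuous[OF continuous_fcis[of torus_box \<nu>]] by (simp add: f)
  also have "\<dots> = (if \<nu> = 0 then of_real ((2 * pi)\<^sup>2) else 0)"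
    using integral_unique[OF integral_cis_2pi[of k]] integral_unique[OF integral_cis_2pi[of l]]
    by (simp add: \<nu> zero_prod_def power2_eq_square)
  finally show ?thesis
    using integrable_integral[OF integrable_continuous[OF continuous_fcis[of torus_box \<nu>]]] by simp
qed

text \<open>All Fourier coefficients of the difference \<open>D\<close> between f and its Fourier
  series vanish, by uniform convergence of the series. One-dimensional uniqueness is then used
  twice: in x for the partial coefficients in y, and in y for \<open>D\<close> itself.\<close>

lemma fourier_inversion:
  assumes cont: "continuous_on UNIV f" and per: "periodic2 f" and b: "rdec (fourier_coeff f)"
  shows "infsum (\<lambda>\<nu>. fcis \<psi> \<nu> * fourier_coeff f \<nu>) UNIV = of_real (f \<psi>)"
proof -
  define S where "S = (\<lambda>\<psi>. infsum (\<lambda>\<nu>. fcis \<psi> \<nu> * fourier_coeff f \<nu>) UNIV)"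
  define D where "D = (\<lambda>\<psi>. of_real (f \<psi>) - S \<psi>)"
  note Sc = continuous_fourier_series(1)[OF b, folded S_def]
  have Dc: "continuous_on UNIV D" unfolding D_def by (intro continuous_intros cont Sc)
  have Dp: "periodic2 D" using per periodic2_fourier_series[of "fourier_coeff f", folded S_def]
    unfolding D_def periodic2_def by simp
  have D0: "integral torus_box (\<lambda>\<psi>. D \<psi> * fcis \<psi> \<mu>) = 0" for \<mu>
  proof -
    have fi: "((\<lambda>\<psi>. of_real (f \<psi>) * fcis \<psi> \<mu>) has_integral fourier_coeff f (- \<mu>) * of_real ((2 * pi)\<^sup>2)) torus_box"
    proof -
      have i: "(\<lambda>\<psi>. of_real (f \<psi>) * fcis \<psi> \<mu>) integrable_on torus_box"
        by (intro integrable_continuous continuous_intros continuous_fcis continuous_on_subset[OF cont]) auto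
      have v: "integral torus_box (\<lambda>\<psi>. of_real (f \<psi>) * fcis \<psi> \<mu>) = fourier_coeff f (- \<mu>) * of_real ((2 * pi)\<^sup>2)"
        by (simp add: fourier_coeff_def fcis_def freq_def inner_prod_def add.commute)
      show ?thesis using integrable_integral[OF i] unfolding v .
    qed
    have ul: "uniform_limit torus_box (\<lambda>X \<psi>. \<Sum>\<nu>\<in>X. fcis \<psi> \<nu> * fourier_coeff f \<nu> * fcis \<psi> \<mu>) (\<lambda>\<psi>. S \<psi> * fcis \<psi> \<mu>) (finite_subsets_at_top UNIV)"
    proof -
      have s: "(\<lambda>\<nu>. norm (fourier_coeff f \<nu>)) summable_on UNIV" by (rule rdec_summable[OF b]) simp
      have "uniform_limit torus_box (\<lambda>X \<psi>. \<Sum>\<nu>\<in>X. fcis \<psi> \<nu> * fourier_coeff f \<nu> * fcis \<psi> \<mu>)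
          (\<lambda>\<psi>. infsum (\<lambda>\<nu>. fcis \<psi> \<nu> * fourier_coeff f \<nu> * fcis \<psi> \<mu>) UNIV) (finite_subsets_at_top UNIV)"
        by (rule Weierstrass_m_test_general[OF _ s]) (simp add: norm_mult)
      thus ?thesis unfolding S_def infsum_cmult_left' .
    qed
    obtain I J where IJ: "\<And>X. ((\<lambda>\<psi>. \<Sum>\<nu>\<in>X. fcis \<psi> \<nu> * fourier_coeff f \<nu> * fcis \<psi> \<mu>) has_integral I X) torus_box"
        "((\<lambda>\<psi>. S \<psi> * fcis \<psi> \<mu>) has_integral J) torus_box" "(I \<longlongrightarrow> J) (finite_subsets_at_top UNIV)"
      by (rule uniform_limit_integral_cbox[OF ul]) (auto intro!: continuous_intros continuous_fcis)
    \<comment> \<open>By orthogonality only the mode \<nu> = -\<mu> survives.\<close>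
    let ?c = "\<lambda>\<nu>. fourier_coeff f \<nu> * (if \<nu> = - \<mu> then of_real ((2 * pi)\<^sup>2) else 0)"
    have "I X = (\<Sum>\<nu>\<in>X. ?c \<nu>)" if "finite X" for X
    proof (rule has_integral_unique[OF IJ(1)])
      have "((\<lambda>\<psi>. \<Sum>\<nu>\<in>X. fourier_coeff f \<nu> * fcis \<psi> (\<nu> + \<mu>)) has_integral (\<Sum>\<nu>\<in>X. fourier_coeff f \<nu> * (if \<nu> + \<mu> = 0 then of_real ((2 * pi)\<^sup>2) else 0))) torus_box"
        by (intro has_integral_sum that has_integral_mult_right integral_fcis)
      thus "((\<lambda>\<psi>. \<Sum>\<nu>\<in>X. fcis \<psi> \<nu> * fourier_coeff f \<nu> * fcis \<psi> \<mu>) has_integral (\<Sum>\<nu>\<in>X. ?c \<nu>)) torus_box"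
        by (simp add: fcis_add mult_ac eq_neg_iff_add_eq_0)
    qed
    hence "(sum ?c \<longlongrightarrow> J) (finite_subsets_at_top UNIV)"
      using IJ(3) by (rule_tac tendsto_cong[THEN iffD1, rotated]) (auto intro!: eventually_finite_subsets_at_top_weakI)
    hence "(?c has_sum J) UNIV" by (simp add: has_sum_def)
    moreover have "(?c has_sum fourier_coeff f (- \<mu>) * of_real ((2 * pi)\<^sup>2)) UNIV"
      by (rule has_sum_finite_neutralI[where B = "{- \<mu>}"]) auto
    ultimately have J: "J = fourier_coeff f (- \<mu>) * of_real ((2 * pi)\<^sup>2)" by (rule has_sum_unique)
    have "((\<lambda>\<psi>. of_real (f \<psi>) * fcis \<psi> \<mu> - S \<psi> * fcis \<psi> \<mu>) has_integral 0) torus_box"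
      using has_integral_diff[OF fi IJ(2)] by (simp add: J)
    hence "((\<lambda>\<psi>. D \<psi> * fcis \<psi> \<mu>) has_integral 0) torus_box" by (simp add: D_def left_diff_distrib)
    thus ?thesis by (rule integral_unique)
  qed
  have cD: "continuous_on S' (\<lambda>z. D (g z))" if "continuous_on S' g" for S' :: "'z::topological_space set" and g
    by (rule continuous_on_compose2[OF Dc that]) auto
  have zero: "D (x, y) = 0" if x: "x \<in> {0..2 * pi}" and y: "y \<in> {0..2 * pi}" for x y
  proof (rule fourier_unique[OF _ _ y])
    show "continuous_on {0..2 * pi} (\<lambda>y. D (x, y))" by (intro cD continuous_intros)
    fix l :: int
    show "integral {0..2 * pi} (\<lambda>y. D (x, y) * cis (of_int l * y)) = 0"
    proof (rule fourier_unique[OF _ _ x])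
      show "continuous_on {0..2 * pi} (\<lambda>x. integral {0..2 * pi} (\<lambda>y. D (x, y) * cis (of_int l * y)))"
      proof -
        have "continuous_on {0..2 * pi} (\<lambda>x. integral (cbox 0 (2 * pi)) (\<lambda>y. D (x, y) * cis (of_int l * y)))"
          by (rule integral_continuous_on_param) (auto simp: case_prod_unfold intro!: continuous_intros continuous_on_compose2[OF Dc])
        thus ?thesis unfolding box_real .
      qed
      fix k :: int
      have "integral {0..2 * pi} (\<lambda>x. integral {0..2 * pi} (\<lambda>y. D (x, y) * cis (of_int l * y)) * cis (of_int k * x))
          = integral {0..2 * pi} (\<lambda>x. integral {0..2 * pi} (\<lambda>y. D (x, y) * fcis (x, y) (k, l)))"
        unfolding integral_mult_left[symmetric] by (simp add: fcis_def freq_def cis_mult[symmetric] mult_ac)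
      also have "\<dots> = integral torus_box (\<lambda>\<psi>. D \<psi> * fcis \<psi> (k, l))"
      proof -
        have "continuous_on torus_box (\<lambda>\<psi>. D \<psi> * fcis \<psi> (k, l))"
          by (intro continuous_intros continuous_fcis continuous_on_subset[OF Dc]) auto
        from integral_prod_continuous[OF this] show ?thesis by simp
      qed
      finally show "integral {0..2 * pi} (\<lambda>x. integral {0..2 * pi} (\<lambda>y. D (x, y) * cis (of_int l * y)) * cis (of_int k * x)) = 0"
        unfolding D0 .
    qed
  qed
  obtain \<psi>' where "\<psi>' \<in> torus_box" "D \<psi>' = D \<psi>" by (rule periodic2_reduce[OF Dp])
  hence "D \<psi> = 0" using zero[of "fst \<psi>'" "snd \<psi>'"] by (cases \<psi>') (auto simp: cbox_Pair_iff)
  thus ?thesis by (simp add: D_def S_def)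
qed

section \<open>Global solutions of Lipschitz differential equations\<close>

lemma integral_has_vector_derivative_atLeast:
  fixes h :: "real \<Rightarrow> 'a::banach"
  assumes h: "continuous_on {0..} h" and t: "t \<ge> 0"
  shows "((\<lambda>u. integral {0..u} h) has_vector_derivative h t) (at t within {0..})"
proof -
  have "((\<lambda>u. integral {0..u} h) has_vector_derivative h t) (at t within {0..t+1})"
    by (rule integral_has_vector_derivative) (use t in \<open>auto intro: continuous_on_subset[OF h]\<close>)
  also have "at t within {0..t+1} = at t within {0..}"
    by (rule at_within_nhd[of _ "{..<t+1}"]) auto
  finally show ?thesis .
qed

text \<open>For the constant part of the bound, t exp(- K t) <= 1/K.\<close>

lemma weighted_integral_bound:
  fixes h :: "real \<Rightarrow> 'a::euclidean_space"
  assumes K: "K > 0" and t: "t \<ge> 0" and h: "continuous_on {0..t} h" and M: "M \<ge> 0" "N \<ge> 0"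
    and le: "\<And>s. s \<in> {0..t} \<Longrightarrow> norm (h s) \<le> M + N * exp (K * s)"
  shows "norm (exp (- (K * t)) *\<^sub>R integral {0..t} h) \<le> M / K + N / K"
proof -
  have "((\<lambda>s. M + N * exp (K * s)) has_integral (M * t + N / K * exp (K * t)) - (M * 0 + N / K * exp (K * 0))) {0..t}"
    by (rule fundamental_theorem_of_calculus)
       (use t K in \<open>auto intro!: derivative_eq_intros simp flip: has_real_derivative_iff_has_vector_derivative\<close>)
  hence "norm (integral {0..t} h) \<le> M * t + N / K * exp (K * t) - N / K"
    using integral_norm_bound_integral[of h "{0..t}" "\<lambda>s. M + N * exp (K * s)"] le h
    by (auto simp: has_integral_iff integrable_continuous_interval)
  also have "\<dots> \<le> M * (exp (K * t) / K) + N / K * exp (K * t)"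
  proof -
    have "K * t \<le> exp (K * t)" using exp_ge_add_one_self[of "K * t"] by linarith
    hence "t \<le> exp (K * t) / K" using K by (simp add: field_simps)
    thus ?thesis using M K mult_left_mono[of t "exp (K * t) / K" M] divide_nonneg_pos[of N K] by linarith
  qed
  finally have "norm (integral {0..t} h) \<le> (M / K + N / K) * exp (K * t)"
    by (simp add: distrib_right)
  thus ?thesis by (simp add: exp_minus field_simps)
qed

text \<open>Picard iteration on the whole half-line at once: in the norm weighted by exp(- K t) the
  integral operator has Lipschitz constant L/K, which is 1/2 for K = 2 L.\<close>

lemma lipschitz_global_solution:
  fixes F :: "real \<Rightarrow> 'a::euclidean_space \<Rightarrow> 'a"
  assumes cont: "continuous_on UNIV (\<lambda>(t, y). F t y)" and L: "L > 0" "\<And>t y z. norm (F t y - F t z) \<le> L * norm (y - z)"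
    and M: "\<And>t. norm (F t y0) \<le> M"
  shows "\<exists>y. y 0 = y0 \<and> (\<forall>t\<ge>0. (y has_vector_derivative F t (y t)) (at t within {0..}))"
proof -
  define K where "K = 2 * L"
  have K: "K > 0" using L by (simp add: K_def)
  have M0: "M \<ge> 0" using M[of 0] norm_ge_zero order_trans by blast
  \<comment> \<open>\<phi> stands for exp(- K t) (y - y0), which is bounded.\<close>
  define G where "G = (\<lambda>(\<phi> :: real \<Rightarrow>\<^sub>C 'a) s. F s (y0 + exp (K * s) *\<^sub>R apply_bcontfun \<phi> s))"
  have cG: "continuous_on S (G \<phi>)" for S \<phi>
  proof -
    have "continuous_on S (\<lambda>s. (\<lambda>(t, y). F t y) (s, y0 + exp (K * s) *\<^sub>R apply_bcontfun \<phi> s))"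
      by (rule continuous_on_compose2[OF cont]) (auto intro!: continuous_intros)
    thus ?thesis by (simp add: G_def)
  qed
  \<comment> \<open>\<open>max 0 t\<close> extends the function continuously to the whole line, the
    domain of the elements of \<open>bcontfun\<close>.\<close>
  define \<Psi> where "\<Psi> = (\<lambda>\<phi> t. exp (- (K * max 0 t)) *\<^sub>R integral {0..max 0 t} (G \<phi>))"
  have Gb: "norm (G \<phi> s) \<le> M + (L * norm \<phi>) * exp (K * s)" for \<phi> s
  proof -
    have "norm (G \<phi> s) \<le> norm (F s y0) + norm (F s (y0 + exp (K * s) *\<^sub>R apply_bcontfun \<phi> s) - F s y0)"
      unfolding G_def by (metis add_diff_cancel_left' diff_add_cancel norm_triangle_ineq add.commute)
    also have "\<dots> \<le> M + L * norm (exp (K * s) *\<^sub>R apply_bcontfun \<phi> s)"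
      using L(2)[of s "y0 + exp (K * s) *\<^sub>R apply_bcontfun \<phi> s" y0] M[of s] by simp
    also have "\<dots> \<le> M + L * (exp (K * s) * norm \<phi>)"
      using L(1) norm_bounded[of \<phi> s] by (intro add_left_mono mult_left_mono) auto
    finally show ?thesis by (simp add: mult_ac)
  qed
  have \<Psi>: "\<Psi> \<phi> \<in> bcontfun" for \<phi>
    unfolding bcontfun_def
  proof (rule CollectI, rule conjI)
    have "continuous_on {0..} (\<lambda>u. integral {0..u} (G \<phi>))"
      unfolding continuous_on_eq_continuous_within
      using integral_has_vector_derivative_atLeast[OF cG] has_vector_derivative_continuous by fastforce
    hence "continuous_on UNIV (\<lambda>t. integral {0..max 0 t} (G \<phi>))"
      by (rule continuous_on_compose2) (auto intro!: continuous_intros)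
    thus "continuous_on UNIV (\<Psi> \<phi>)" unfolding \<Psi>_def by (intro continuous_intros)
    show "bounded (range (\<Psi> \<phi>))"
      unfolding bounded_iff
    proof (intro exI[of _ "M / K + L * norm \<phi> / K"] ballI, elim rangeE)
      fix x t assume x: "x = \<Psi> \<phi> t"
      show "norm x \<le> M / K + L * norm \<phi> / K"
        unfolding x \<Psi>_def by (rule weighted_integral_bound) (use K M0 L Gb cG in auto)
    qed
  qed
  define P where "P = (\<lambda>\<phi>. Bcontfun (\<Psi> \<phi>))"
  have aP: "apply_bcontfun (P \<phi>) = \<Psi> \<phi>" for \<phi>
    unfolding P_def using \<Psi> by (simp add: Bcontfun_inverse)
  have "\<exists>!\<phi>. P \<phi> = \<phi>"
  proof (rule banach_fix_type[of "1/2"])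
    show "\<forall>\<phi> \<chi>. dist (P \<phi>) (P \<chi>) \<le> 1 / 2 * dist \<phi> \<chi>"
    proof (intro allI dist_bound)
      fix \<phi> \<chi> :: "real \<Rightarrow>\<^sub>C 'a" and t :: real
      let ?t = "max 0 t"
      have "dist (apply_bcontfun (P \<phi>) t) (apply_bcontfun (P \<chi>) t)
          = norm (exp (- (K * ?t)) *\<^sub>R integral {0..?t} (\<lambda>s. G \<phi> s - G \<chi> s))"
        unfolding aP \<Psi>_def dist_norm scaleR_diff_right[symmetric]
        by (subst integral_diff) (auto intro!: integrable_continuous_interval cG)
      also have "\<dots> \<le> 0 / K + (L * dist \<phi> \<chi>) / K"
      proof (rule weighted_integral_bound)
        fix s
        have "norm (G \<phi> s - G \<chi> s) \<le> L * norm (exp (K * s) *\<^sub>R (apply_bcontfun \<phi> s - apply_bcontfun \<chi> s))"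
          unfolding G_def by (rule order_trans[OF L(2)]) (simp add: scaleR_diff_right)
        also have "\<dots> \<le> L * (exp (K * s) * dist \<phi> \<chi>)"
          using L(1) dist_bounded[of \<phi> s \<chi>] by (intro mult_left_mono) (auto simp: dist_norm)
        finally show "norm (G \<phi> s - G \<chi> s) \<le> 0 + L * dist \<phi> \<chi> * exp (K * s)" by (simp add: mult_ac)
      qed (use K L cG in \<open>auto intro!: continuous_intros\<close>)
      also have "\<dots> = 1 / 2 * dist \<phi> \<chi>" using L(1) by (simp add: K_def)
      finally show "dist (apply_bcontfun (P \<phi>) t) (apply_bcontfun (P \<chi>) t) \<le> 1 / 2 * dist \<phi> \<chi>" .
    qed
  qed auto
  then obtain \<phi> where \<phi>: "P \<phi> = \<phi>" by blast
  define y where "y = (\<lambda>t. y0 + integral {0..t} (G \<phi>))"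
  have yG: "G \<phi> t = F t (y t)" if t: "t \<ge> 0" for t
  proof -
    have "apply_bcontfun \<phi> t = \<Psi> \<phi> t" using aP[of \<phi>] \<phi> by simp
    hence "exp (K * t) *\<^sub>R apply_bcontfun \<phi> t = integral {0..t} (G \<phi>)"
      using t by (simp add: \<Psi>_def exp_minus)
    thus ?thesis by (simp add: G_def y_def)
  qed
  have "(y has_vector_derivative F t (y t)) (at t within {0..})" if t: "t \<ge> 0" for t
    using integral_has_vector_derivative_atLeast[OF cG t, of \<phi>] unfolding yG[OF t] y_def
    by (auto intro!: derivative_eq_intros)
  moreover have "y 0 = y0" by (simp add: y_def)
  ultimately show ?thesis by blast
qed

section \<open>A Lyapunov function for the damped equation\<close>

text \<open>For the difference z of two solutions and q = z', a mean value \<gamma> of g' gives (z +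
  \<epsilon> q)' = - \<epsilon> \<gamma> z and (\<epsilon> q)' = - q - \<epsilon> \<gamma> z. So
  \<open>lyap\<close> has the derivative that stands on the left in \<open>lyap_decay_rate\<close>,
  negative definite for small \<epsilon>.\<close>

definition lyap :: "real \<Rightarrow> real \<Rightarrow> real \<Rightarrow> real" where
  "lyap \<epsilon> z q = (z + \<epsilon> * q)\<^sup>2 / 2 + (\<epsilon> * q)\<^sup>2 / 2"

lemma lyap_lower: "z\<^sup>2 \<le> 4 * lyap \<epsilon> z q" "(\<epsilon> * q)\<^sup>2 \<le> 2 * lyap \<epsilon> z q"
proof -
  have "4 * lyap \<epsilon> z q = z\<^sup>2 + (z + 2 * (\<epsilon> * q))\<^sup>2"
    by (simp add: lyap_def power2_eq_square field_simps)
  thus "z\<^sup>2 \<le> 4 * lyap \<epsilon> z q" by simp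
  show "(\<epsilon> * q)\<^sup>2 \<le> 2 * lyap \<epsilon> z q" unfolding lyap_def by simp
qed

lemma lyap_nonneg: "lyap \<epsilon> z q \<ge> 0"
  unfolding lyap_def by simp

text \<open>The mixed term is absorbed by means of \<gamma> (z + 2 \<epsilon> q)^2 >= 0; the price 2
  \<epsilon>^2 \<gamma> q^2 stays below q^2/2 because \<epsilon>^2 m2 <= 1/4. Half of both squares
  remains, while \<open>lyap\<close> is at most 2 (z^2 + q^2).\<close>

lemma lyap_decay_rate:
  assumes \<epsilon>: "0 < \<epsilon>" "\<epsilon> \<le> 1" and m: "0 < m1" "m1 \<le> \<gamma>" "\<gamma> \<le> m2" "\<epsilon>\<^sup>2 * m2 \<le> 1 / 4"
  shows "- \<epsilon> * (\<gamma> * z\<^sup>2 + 2 * \<epsilon> * \<gamma> * z * q + q\<^sup>2) \<le> - (\<epsilon> * min m1 1 / 4) * lyap \<epsilon> z q"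
proof -
  have g: "\<epsilon>\<^sup>2 * \<gamma> \<le> 1 / 4" using m(4) mult_left_mono[OF m(3) zero_le_power2[of \<epsilon>]] by linarith
  have "0 \<le> \<gamma> * (z + 2 * \<epsilon> * q)\<^sup>2" using m by simp
  hence "- (2 * \<epsilon> * \<gamma> * z * q) \<le> \<gamma> * z\<^sup>2 / 2 + 2 * (\<epsilon>\<^sup>2 * \<gamma>) * q\<^sup>2"
    by (simp add: power2_eq_square algebra_simps)
  also have "\<dots> \<le> \<gamma> * z\<^sup>2 / 2 + q\<^sup>2 / 2"
    using mult_right_mono[OF g zero_le_power2[of q]] by simp
  finally have 1: "\<gamma> * z\<^sup>2 / 2 + q\<^sup>2 / 2 \<le> \<gamma> * z\<^sup>2 + 2 * \<epsilon> * \<gamma> * z * q + q\<^sup>2" by simp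
  have mg: "min m1 1 \<le> \<gamma>" using m by linarith
  have 2: "min m1 1 * (z\<^sup>2 + q\<^sup>2) / 2 \<le> \<gamma> * z\<^sup>2 / 2 + q\<^sup>2 / 2"
    using mult_right_mono[OF mg zero_le_power2[of z]] mult_right_mono[of "min m1 1" 1 "q\<^sup>2"] m
    by (simp add: distrib_left)
  have "lyap \<epsilon> z q \<le> 2 * (z\<^sup>2 + q\<^sup>2)"
  proof -
    have "(\<epsilon> * q)\<^sup>2 \<le> q\<^sup>2"
      using \<epsilon> mult_right_mono[of "\<epsilon>\<^sup>2" 1 "q\<^sup>2"] power_le_one[of \<epsilon> 2] by (simp add: power_mult_distrib)
    moreover have "0 \<le> (z - \<epsilon> * q)\<^sup>2" by simp
    hence "(z + \<epsilon> * q)\<^sup>2 \<le> 2 * z\<^sup>2 + 2 * (\<epsilon> * q)\<^sup>2" by (simp add: power2_sum power2_diff)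
    ultimately have "(z + \<epsilon> * q)\<^sup>2 / 2 + (\<epsilon> * q)\<^sup>2 / 2 \<le> 2 * (z\<^sup>2 + q\<^sup>2)" using zero_le_power2[of z] zero_le_power2[of q] by argo
    thus ?thesis by (simp add: lyap_def)
  qed
  hence "min m1 1 / 4 * lyap \<epsilon> z q \<le> min m1 1 / 4 * (2 * (z\<^sup>2 + q\<^sup>2))"
    using m by (intro mult_left_mono) auto
  also have "\<dots> = min m1 1 * (z\<^sup>2 + q\<^sup>2) / 2" by simp
  also note 2 also note 1
  finally have "\<epsilon> * (min m1 1 / 4 * lyap \<epsilon> z q) \<le> \<epsilon> * (\<gamma> * z\<^sup>2 + 2 * \<epsilon> * \<gamma> * z * q + q\<^sup>2)"
    using \<epsilon> by (intro mult_left_mono) auto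
  thus ?thesis by simp
qed

text \<open>\<open>slope\<close> is the mean value form of m1 <= G' <= m2. In this form it also
  holds for the truncated g in \<open>local_attractorI\<close>, which may fail to be differentiable
  at the ends of the interval.\<close>

locale damped =
  fixes G :: "real \<Rightarrow> real" and h :: "real \<Rightarrow> real" and \<epsilon> c r m1 m2 :: real
  assumes \<epsilon>: "0 < \<epsilon>" "\<epsilon> \<le> 1" and r: "r > 0" and m: "0 < m1" "\<epsilon>\<^sup>2 * m2 \<le> 1 / 4"
    and slope: "\<And>x y. \<bar>x - c\<bar> \<le> r \<Longrightarrow> \<bar>y - c\<bar> \<le> r \<Longrightarrow> \<exists>\<gamma>. m1 \<le> \<gamma> \<and> \<gamma> \<le> m2 \<and> G y - G x = \<gamma> * (y - x)"
begin

definition sol :: "real set \<Rightarrow> (real \<Rightarrow> real) \<Rightarrow> (real \<Rightarrow> real) \<Rightarrow> bool" where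
  "sol I x v \<longleftrightarrow> (\<forall>t\<in>I. (x has_real_derivative v t) (at t within I) \<and>
     (v has_real_derivative (h t - G (x t) - v t / \<epsilon>)) (at t within I))"

lemma sol_subset: "sol I x v \<Longrightarrow> J \<subseteq> I \<Longrightarrow> sol J x v"
  unfolding sol_def by (meson DERIV_subset subsetD)

text \<open>\<open>reg\<close> is demanded only strictly between 0 and s, so that the estimate
  reaches up to a first exit time.\<close>

lemma lyap_decay:
  assumes x: "sol {0..s} x v" and y: "sol {0..s} y w" and s: "s \<ge> 0"
    and reg: "\<And>t. 0 < t \<Longrightarrow> t < s \<Longrightarrow> \<bar>x t - c\<bar> \<le> r \<and> \<bar>y t - c\<bar> \<le> r"
  shows "lyap \<epsilon> (y s - x s) (w s - v s) \<le> exp (- (\<epsilon> * min m1 1 / 4) * s) * lyap \<epsilon> (y 0 - x 0) (w 0 - v 0)"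
proof (cases "s = 0")
  case False
  hence s: "s > 0" using s by simp
  define \<mu> where "\<mu> = \<epsilon> * min m1 1 / 4"
  define V where "V = (\<lambda>t. lyap \<epsilon> (y t - x t) (w t - v t))"
  have "exp (\<mu> * s) * V s \<le> exp (\<mu> * 0) * V 0"
  proof (rule DERIV_nonpos_imp_decreasing_open[OF less_imp_le[OF s]])
    have c: "continuous_on {0..s} x" "continuous_on {0..s} v" "continuous_on {0..s} y" "continuous_on {0..s} w"
      using x y unfolding sol_def continuous_on_eq_continuous_within
      by (blast intro: DERIV_continuous)+
    show "continuous_on {0..s} (\<lambda>t. exp (\<mu> * t) * V t)"
      unfolding V_def lyap_def by (intro continuous_intros c) auto
    fix t assume t: "0 < t" "t < s"
    have at: "at t within {0..s} = at t" using t by (intro at_within_interior) (simp add: interior_atLeastAtMost_real)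
    have d: "(x has_real_derivative v t) (at t)" "(v has_real_derivative (h t - G (x t) - v t / \<epsilon>)) (at t)"
      "(y has_real_derivative w t) (at t)" "(w has_real_derivative (h t - G (y t) - w t / \<epsilon>)) (at t)"
      using x y t at unfolding sol_def by (metis atLeastAtMost_iff less_imp_le)+
    obtain \<gamma> where \<gamma>: "m1 \<le> \<gamma>" "\<gamma> \<le> m2" "G (y t) - G (x t) = \<gamma> * (y t - x t)"
      using slope[of "x t" "y t"] reg[OF t] by blast
    define z where "z = y t - x t"
    define q where "q = w t - v t"
    define D where "D = - \<epsilon> * (\<gamma> * z\<^sup>2 + 2 * \<epsilon> * \<gamma> * z * q + q\<^sup>2)"
    have q': "((\<lambda>t. w t - v t) has_real_derivative (- q / \<epsilon> - \<gamma> * z)) (at t)"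
      by (rule DERIV_cong[OF DERIV_diff[OF d(4,2)]]) (use \<gamma>(3) in \<open>simp add: z_def q_def diff_divide_distrib\<close>)
    have z': "((\<lambda>t. y t - x t) has_real_derivative q) (at t)"
      unfolding q_def by (rule DERIV_diff[OF d(3,1)])
    define P where "P = (\<lambda>t. (y t - x t) + \<epsilon> * (w t - v t))"
    define Q where "Q = (\<lambda>t. \<epsilon> * (w t - v t))"
    have P': "(P has_real_derivative q + \<epsilon> * (- q / \<epsilon> - \<gamma> * z)) (at t)"
      unfolding P_def by (rule DERIV_add[OF z' DERIV_cmult[OF q']])
    have Q': "(Q has_real_derivative \<epsilon> * (- q / \<epsilon> - \<gamma> * z)) (at t)"
      unfolding Q_def by (rule DERIV_cmult[OF q'])
    have PQ: "P t = z + \<epsilon> * q" "Q t = \<epsilon> * q" by (simp_all add: P_def Q_def z_def q_def)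
    have V: "V = (\<lambda>t. P t * P t / 2 + Q t * Q t / 2)"
      by (simp add: V_def lyap_def P_def Q_def power2_eq_square)
    have V': "(V has_real_derivative D) (at t)"
      unfolding V
      by (rule DERIV_cong[OF DERIV_add[OF DERIV_cdivide[OF DERIV_mult[OF P' P']] DERIV_cdivide[OF DERIV_mult[OF Q' Q']]]])
         (use \<epsilon>(1) in \<open>simp add: D_def PQ power2_eq_square field_simps\<close>)
    have E': "((\<lambda>t. exp (\<mu> * t)) has_real_derivative exp (\<mu> * t) * \<mu>) (at t)"
      by (auto intro!: derivative_eq_intros)
    have "((\<lambda>t. exp (\<mu> * t) * V t) has_real_derivative exp (\<mu> * t) * (\<mu> * V t + D)) (at t)"
      by (rule DERIV_cong[OF DERIV_mult[OF E' V']]) (simp add: algebra_simps)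
    moreover have "D \<le> - \<mu> * V t"
      unfolding D_def \<mu>_def V_def z_def[symmetric] q_def[symmetric]
      by (rule lyap_decay_rate[OF \<epsilon> m(1) \<gamma>(1,2) m(2)])
    hence "exp (\<mu> * t) * (\<mu> * V t + D) \<le> 0" by (intro mult_nonneg_nonpos) auto
    ultimately show "\<exists>y. ((\<lambda>t. exp (\<mu> * t) * V t) has_real_derivative y) (at t) \<and> y \<le> 0" by blast
  qed
  hence "exp (- (\<mu> * s)) * (exp (\<mu> * s) * V s) \<le> exp (- (\<mu> * s)) * V 0" by simp
  thus ?thesis by (simp add: V_def \<mu>_def exp_minus field_simps)
qed simp

text \<open>At the first time with |y - x| >= r/2 the Lyapunov function is at most its initial
  value, so \<open>lyap_lower\<close> and the initial bound contradict the exit.\<close>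

lemma trapped:
  assumes I: "0 \<in> I" "\<And>s. s \<in> I \<Longrightarrow> s \<ge> 0 \<and> {0..s} \<subseteq> I" and x: "sol I x v" and y: "sol I y w"
    and xr: "\<And>t. t \<in> I \<Longrightarrow> \<bar>x t - c\<bar> \<le> r / 2" and V0: "4 * lyap \<epsilon> (y 0 - x 0) (w 0 - v 0) < (r / 2)\<^sup>2"
    and t: "t \<in> I"
  shows "\<bar>y t - x t\<bar> < r / 2"
proof (rule ccontr)
  assume nt: "\<not> \<bar>y t - x t\<bar> < r / 2"
  have t0: "t \<ge> 0" and tI: "{0..t} \<subseteq> I" using I(2)[OF t] by auto
  have c: "continuous_on {0..t} (\<lambda>t. y t - x t)"
    using sol_subset[OF x tI] sol_subset[OF y tI] unfolding sol_def
    by (intro continuous_on_diff) (auto simp: continuous_on_eq_continuous_within intro: DERIV_continuous)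
  define S where "S = {s \<in> {0..t}. r / 2 \<le> \<bar>y s - x s\<bar>}"
  have "closed S" unfolding S_def
    by (intro continuous_on_closed_Collect_le continuous_intros c) auto
  moreover have tS: "t \<in> S" using nt t0 by (simp add: S_def)
  moreover have bS: "bdd_below S" unfolding S_def by (auto intro: bdd_belowI[of _ 0])
  ultimately have SI: "Inf S \<in> S" by (intro closed_contains_Inf) auto
  define s where "s = Inf S"
  have s: "s \<in> {0..t}" "r / 2 \<le> \<bar>y s - x s\<bar>" using SI by (auto simp: S_def s_def)
  have sI: "{0..s} \<subseteq> I" using s tI by auto
  have "lyap \<epsilon> (y s - x s) (w s - v s) \<le> exp (- (\<epsilon> * min m1 1 / 4) * s) * lyap \<epsilon> (y 0 - x 0) (w 0 - v 0)"
  proof (rule lyap_decay[OF sol_subset[OF x sI] sol_subset[OF y sI]])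
    show "s \<ge> 0" using s by simp
    fix u assume u: "0 < u" "u < s"
    have "u \<notin> S" using u cInf_lower[OF _ bS, of u] by (auto simp: s_def)
    hence "\<bar>y u - x u\<bar> < r / 2" using u s by (auto simp: S_def)
    moreover have "u \<in> I" using u sI by auto
    hence "\<bar>x u - c\<bar> \<le> r / 2" by (rule xr)
    ultimately show "\<bar>x u - c\<bar> \<le> r \<and> \<bar>y u - c\<bar> \<le> r" using r by linarith
  qed
  also have "\<dots> \<le> 1 * lyap \<epsilon> (y 0 - x 0) (w 0 - v 0)"
    using s \<epsilon> m lyap_nonneg by (intro mult_right_mono) auto
  finally have "(y s - x s)\<^sup>2 < (r / 2)\<^sup>2"
    using V0 lyap_lower(1)[of "y s - x s" \<epsilon> "w s - v s"] by simp
  hence "\<bar>y s - x s\<bar> < r / 2" using r power2_less_imp_less[of "\<bar>y s - x s\<bar>" "r / 2"] by simp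
  thus False using s by simp
qed

end

section \<open>From the Lyapunov estimate to the local attractor\<close>

lemma ode_solution_iff:
  assumes "\<epsilon> > 0"
  shows "ode_solution g f \<omega> \<epsilon> I y w \<longleftrightarrow> (\<forall>t\<in>I. (y has_real_derivative w t) (at t within I) \<and>
     (w has_real_derivative (f (t *\<^sub>R \<omega>) - g (y t) - w t / \<epsilon>)) (at t within I))"
proof
  assume "ode_solution g f \<omega> \<epsilon> I y w"
  then obtain a where a: "\<And>t. t \<in> I \<Longrightarrow> (y has_real_derivative w t) (at t within I)
            \<and> (w has_real_derivative a t) (at t within I) \<and> \<epsilon> * a t + w t + \<epsilon> * g (y t) = \<epsilon> * f (t *\<^sub>R \<omega>)"
    unfolding ode_solution_def by blast
  have "a t = f (t *\<^sub>R \<omega>) - g (y t) - w t / \<epsilon>" if "t \<in> I" for t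
    using a[OF that] assms by (simp add: field_simps)
  thus "\<forall>t\<in>I. (y has_real_derivative w t) (at t within I) \<and>
     (w has_real_derivative (f (t *\<^sub>R \<omega>) - g (y t) - w t / \<epsilon>)) (at t within I)" using a by metis
next
  assume "\<forall>t\<in>I. (y has_real_derivative w t) (at t within I) \<and>
     (w has_real_derivative (f (t *\<^sub>R \<omega>) - g (y t) - w t / \<epsilon>)) (at t within I)"
  thus "ode_solution g f \<omega> \<epsilon> I y w"
    unfolding ode_solution_def using assms
    by (intro exI[of _ "\<lambda>t. f (t *\<^sub>R \<omega>) - g (y t) - w t / \<epsilon>"]) (auto simp: algebra_simps)
qed

text \<open>Existence: g is made constant outside the interval of radius r about c, which gives a
  globally Lipschitz field, and \<open>trapped\<close> shows that its solution never leaves the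
  interval. Uniqueness: two solutions with equal data have Lyapunov distance 0.\<close>

lemma local_attractorI:
  assumes D: "damped g \<epsilon> c r m1 m2"
    and f: "continuous_on UNIV f" "\<And>\<psi>. \<bar>f \<psi>\<bar> \<le> B"
    and x: "ode_solution g f \<omega> \<epsilon> UNIV x v" and xr: "\<And>t. \<bar>x t - c\<bar> \<le> r / 2"
  shows "local_attractor g f \<omega> \<epsilon> x v"
proof -
  define h where "h = (\<lambda>t. f (t *\<^sub>R \<omega>))"
  interpret D: damped g h \<epsilon> c r m1 m2 by (rule D)
  note \<epsilon> = D.\<epsilon> and r = D.r and m = D.m
  have sol: "ode_solution g f \<omega> \<epsilon> I y w \<longleftrightarrow> D.sol I y w" for I y w
    unfolding ode_solution_iff[OF \<epsilon>(1)] D.sol_def unfolding h_def ..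
  define cl where "cl = (\<lambda>u. max (c - r) (min (c + r) u))"
  define gt where "gt = (\<lambda>u. g (cl u))"
  have cl: "\<bar>cl u - c\<bar> \<le> r" for u using r by (auto simp: cl_def max_def min_def)
  have cl_id: "cl u = u" if "\<bar>u - c\<bar> \<le> r" for u using that by (auto simp: cl_def max_def min_def abs_le_iff)
  have cl_lip: "\<bar>cl u - cl w\<bar> \<le> \<bar>u - w\<bar>" for u w by (auto simp: cl_def max_def min_def)
  obtain \<gamma>0 where "m1 \<le> \<gamma>0" "\<gamma>0 \<le> m2" using D.slope[of c c] r by auto
  hence m2: "m2 > 0" using m by linarith
  have gt_lip: "\<bar>gt u - gt w\<bar> \<le> m2 * \<bar>u - w\<bar>" for u w
  proof -
    obtain \<gamma> where \<gamma>: "m1 \<le> \<gamma>" "\<gamma> \<le> m2" "g (cl u) - g (cl w) = \<gamma> * (cl u - cl w)"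
      using D.slope[OF cl cl] by blast
    have "\<bar>gt u - gt w\<bar> = \<gamma> * \<bar>cl u - cl w\<bar>" using \<gamma> m by (simp add: gt_def abs_mult)
    also have "\<dots> \<le> m2 * \<bar>u - w\<bar>" using \<gamma> m cl_lip by (intro mult_mono) auto
    finally show ?thesis .
  qed
  interpret Dt: damped gt h \<epsilon> c r m1 m2
  proof
    fix u w assume "\<bar>u - c\<bar> \<le> r" "\<bar>w - c\<bar> \<le> r"
    thus "\<exists>\<gamma>. m1 \<le> \<gamma> \<and> \<gamma> \<le> m2 \<and> gt w - gt u = \<gamma> * (w - u)"
      unfolding gt_def using D.slope[of u w] by (simp add: cl_id)
  qed (use \<epsilon> r m in auto)
  have gt_id: "gt u = g u" if "\<bar>u - c\<bar> \<le> r" for u using that by (simp add: gt_def cl_id)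
  have region: "D.sol I y w \<longleftrightarrow> Dt.sol I y w" if "\<And>t. t \<in> I \<Longrightarrow> \<bar>y t - c\<bar> \<le> r" for I y w
    unfolding D.sol_def Dt.sol_def using that by (simp add: gt_id)
  have xD: "D.sol I x v" for I using D.sol_subset[of UNIV x v I] x sol by simp
  have xr': "\<bar>x t - c\<bar> \<le> r" for t using xr[of t] r by linarith
  have xDt: "Dt.sol I x v" for I using region[of I x v] xD[of I] xr' by blast
  have ch: "continuous_on UNIV h" unfolding h_def by (intro continuous_on_compose2[OF f(1)] continuous_intros) auto
  have cgt: "continuous_on UNIV gt"
  proof (rule continuous_onI)
    fix u and e :: real assume e: "e > 0"
    show "\<exists>d>0. \<forall>w\<in>UNIV. dist w u < d \<longrightarrow> dist (gt w) (gt u) \<le> e"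
    proof (intro exI[of _ "e / m2"] conjI ballI impI)
      fix w assume "dist w u < e / m2"
      hence "m2 * \<bar>w - u\<bar> \<le> e" using m2 by (simp add: dist_real_def field_simps)
      thus "dist (gt w) (gt u) \<le> e" using gt_lip[of w u] by (simp add: dist_real_def)
    qed (use e m2 in auto)
  qed
  have global: "\<exists>Y W. Dt.sol {0..} Y W \<and> Y 0 = a \<and> W 0 = b" for a b
  proof -
    define F where "F = (\<lambda>t p. (snd p, h t - gt (fst p) - snd p / \<epsilon>))"
    have "\<exists>p. p 0 = (a, b) \<and> (\<forall>t\<ge>0. (p has_vector_derivative F t (p t)) (at t within {0..}))"
    proof (rule lipschitz_global_solution)
      show "continuous_on UNIV (\<lambda>(t, p). F t p)"
        unfolding F_def case_prod_beta
        by (intro continuous_intros continuous_on_compose2[OF ch] continuous_on_compose2[OF cgt]) (use \<epsilon> in auto)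
      show "1 + m2 + 1 / \<epsilon> > 0" using m2 \<epsilon> by (simp add: add_pos_pos)
      fix t p q
      have "norm (F t p - F t q) \<le> \<bar>snd p - snd q\<bar> + \<bar>(gt (fst q) - gt (fst p)) + (snd q - snd p) / \<epsilon>\<bar>"
        unfolding F_def diff_Pair by (rule order_trans[OF norm_Pair_le]) (simp add: algebra_simps diff_divide_distrib)
      also have "\<dots> \<le> \<bar>snd p - snd q\<bar> + (m2 * \<bar>fst q - fst p\<bar> + \<bar>snd q - snd p\<bar> / \<epsilon>)"
        using gt_lip[of "fst q" "fst p"] \<epsilon>
        by (intro add_left_mono order_trans[OF abs_triangle_ineq] add_mono) (auto simp: abs_divide)
      also have "\<dots> \<le> norm (p - q) + (m2 * norm (p - q) + norm (p - q) / \<epsilon>)"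
      proof -
        have "\<bar>fst q - fst p\<bar> \<le> norm (p - q)" "\<bar>snd q - snd p\<bar> \<le> norm (p - q)" "\<bar>snd p - snd q\<bar> \<le> norm (p - q)"
          using norm_fst_le[of "fst (p - q)" "snd (p - q)"] norm_snd_le[of "snd (p - q)" "fst (p - q)"]
          unfolding prod.collapse
          by (simp_all add: abs_minus_commute)
        thus ?thesis using m2 \<epsilon> by (intro add_mono mult_left_mono divide_right_mono) auto
      qed
      also have "\<dots> = (1 + m2 + 1 / \<epsilon>) * norm (p - q)" by (simp add: distrib_right)
      finally show "norm (F t p - F t q) \<le> (1 + m2 + 1 / \<epsilon>) * norm (p - q)" .
    next
      fix t
      have "norm (F t (a, b)) \<le> \<bar>b\<bar> + \<bar>h t - gt a - b / \<epsilon>\<bar>"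
        unfolding F_def by (rule order_trans[OF norm_Pair_le]) simp
      also have "\<dots> \<le> \<bar>b\<bar> + (B + \<bar>gt a + b / \<epsilon>\<bar>)"
        using f(2)[of "t *\<^sub>R \<omega>"] unfolding h_def by (intro add_left_mono) linarith
      finally show "norm (F t (a, b)) \<le> \<bar>b\<bar> + (B + \<bar>gt a + b / \<epsilon>\<bar>)" .
    qed
    then obtain p where p: "p 0 = (a, b)" "\<And>t. t \<ge> 0 \<Longrightarrow> (p has_vector_derivative F t (p t)) (at t within {0..})" by blast
    have "Dt.sol {0..} (\<lambda>t. fst (p t)) (\<lambda>t. snd (p t))"
      unfolding Dt.sol_def
      using bounded_linear.has_vector_derivative[OF bounded_linear_fst p(2)]
        bounded_linear.has_vector_derivative[OF bounded_linear_snd p(2)]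
      by (auto simp: F_def has_real_derivative_iff_has_vector_derivative)
    thus ?thesis using p(1) by (intro exI[of _ "\<lambda>t. fst (p t)"] exI[of _ "\<lambda>t. snd (p t)"]) auto
  qed
  \<comment> \<open>If |a - x 0| + |b - v 0| < \<eta>, both terms that are squared in
    \<open>lyap\<close> are less than \<eta> in modulus, as \<epsilon> <= 1, so 4
    \<open>lyap\<close> < 4 \<eta>^2 = (r/2)^2.\<close>
  define \<eta> where "\<eta> = r / 4"
  have \<eta>: "\<eta> > 0" using r by (simp add: \<eta>_def)
  have V0: "4 * lyap \<epsilon> (a - x 0) (b - v 0) < (r / 2)\<^sup>2" if "\<bar>a - x 0\<bar> + \<bar>b - v 0\<bar> < \<eta>" for a b
  proof -
    have e: "\<bar>\<epsilon> * (b - v 0)\<bar> \<le> \<bar>b - v 0\<bar>" using \<epsilon> mult_right_mono[of \<epsilon> 1 "\<bar>b - v 0\<bar>"] by (simp add: abs_mult)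
    have "\<bar>\<epsilon> * (b - v 0)\<bar> < \<eta>" "\<bar>(a - x 0) + \<epsilon> * (b - v 0)\<bar> < \<eta>" using e that by linarith+
    hence "(\<epsilon> * (b - v 0))\<^sup>2 < \<eta>\<^sup>2" "((a - x 0) + \<epsilon> * (b - v 0))\<^sup>2 < \<eta>\<^sup>2"
      using \<eta> by (metis abs_ge_zero power2_abs power_strict_mono zero_less_numeral)+
    hence "4 * lyap \<epsilon> (a - x 0) (b - v 0) < 4 * \<eta>\<^sup>2" by (simp add: lyap_def)
    also have "\<dots> = (r / 2)\<^sup>2" by (simp add: \<eta>_def power2_eq_square)
    finally show ?thesis .
  qed
  have init: "I = {0..} \<or> (\<exists>T>0. I = {0..<T}) \<Longrightarrow> 0 \<in> I" "I = {0..} \<or> (\<exists>T>0. I = {0..<T}) \<Longrightarrow> s \<in> I \<Longrightarrow> s \<ge> 0 \<and> {0..s} \<subseteq> I"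
    for I and s :: real by auto
  have near: "\<bar>y t - c\<bar> \<le> r" if "\<bar>y t - x t\<bar> < r / 2" for y t
    using that xr[of t] by linarith
  have stay: "\<bar>y t - c\<bar> \<le> r" if "I = {0..} \<or> (\<exists>T>0. I = {0..<T})" "D.sol I y w"
     "\<bar>y 0 - x 0\<bar> + \<bar>w 0 - v 0\<bar> < \<eta>" "t \<in> I" for I y w t
  proof (rule near[of y t], rule D.trapped[where I = I and x = x and v = v and y = y and w = w and t = t])
    show "0 \<in> I" by (rule init(1)[OF that(1)])
    show "s \<ge> 0 \<and> {0..s} \<subseteq> I" if "s \<in> I" for s by (rule init(2)[OF \<open>I = {0..} \<or> (\<exists>T>0. I = {0..<T})\<close> that])
  qed (use that xD xr V0 in auto)
  show ?thesis
    unfolding local_attractor_def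
  proof (intro exI[of _ \<eta>] conjI \<eta> allI impI)
    fix a b assume ab: "\<bar>a - x 0\<bar> + \<bar>b - v 0\<bar> < \<eta>"
    obtain Y W where YW: "Dt.sol {0..} Y W" "Y 0 = a" "W 0 = b" using global by blast
    have Yr: "\<bar>Y t - c\<bar> \<le> r" if "t \<in> {0..}" for t
    proof (rule near[of Y t], rule Dt.trapped[where I = "{0..}" and x = x and v = v and y = Y and w = W and t = t])
      show "4 * lyap \<epsilon> (Y 0 - x 0) (W 0 - v 0) < (r / 2)\<^sup>2" using V0[OF ab] YW by simp
    qed (use that xDt YW(1) xr in auto)
    have YD: "D.sol {0..} Y W" using region[of "{0..}" Y W, OF Yr] YW(1) by simp
    show "\<exists>y w. ode_solution g f \<omega> \<epsilon> {0..} y w \<and> y 0 = a \<and> w 0 = b"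
      using YD YW sol by blast
    {
      fix T y w assume T: "(T::real) > 0" and y: "ode_solution g f \<omega> \<epsilon> {0..<T} y w \<and> y 0 = a \<and> w 0 = b"
      have yD: "D.sol {0..<T} y w" using y sol by blast
      have yr: "\<bar>y t - c\<bar> \<le> r" if "t \<in> {0..<T}" for t
        by (rule stay[OF _ yD _ that]) (use T y ab in auto)
      have "Y t = y t \<and> W t = w t" if t: "t \<in> {0..<T}" for t
      proof -
        have "lyap \<epsilon> (y t - Y t) (w t - W t) \<le> exp (- (\<epsilon> * min m1 1 / 4) * t) * lyap \<epsilon> (y 0 - Y 0) (w 0 - W 0)"
          using t by (intro D.lyap_decay D.sol_subset[OF YD] D.sol_subset[OF yD]) (auto intro: yr Yr)
        also have "\<dots> = 0" using y YW by (simp add: lyap_def)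
        finally have l: "lyap \<epsilon> (y t - Y t) (w t - W t) \<le> 0" .
        have "(y t - Y t)\<^sup>2 \<le> 0" "(\<epsilon> * (w t - W t))\<^sup>2 \<le> 0"
          using lyap_lower(1)[of "y t - Y t" \<epsilon> "w t - W t"] lyap_lower(2)[of \<epsilon> "w t - W t" "y t - Y t"] l by linarith+
        thus ?thesis using \<epsilon> by simp
      qed
      thus "\<exists>Y W. ode_solution g f \<omega> \<epsilon> {0..} Y W \<and> (\<forall>t\<in>{0..<T}. Y t = y t \<and> W t = w t)"
        using YD sol by blast
    }
    fix y w assume y: "ode_solution g f \<omega> \<epsilon> {0..} y w \<and> y 0 = a \<and> w 0 = b"
    have yD: "D.sol {0..} y w" using y sol by blast
    have yr: "\<bar>y t - c\<bar> \<le> r" if "t \<in> {0..}" for t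
      by (rule stay[OF _ yD _ that]) (use y ab in auto)
    define V where "V = (\<lambda>t. lyap \<epsilon> (y t - x t) (w t - v t))"
    define \<mu> where "\<mu> = \<epsilon> * min m1 1 / 4"
    have \<mu>: "\<mu> > 0" using \<epsilon> m by (simp add: \<mu>_def)
    have Vd: "V t \<le> exp (- \<mu> * t) * V 0" if "t \<ge> 0" for t
      unfolding V_def \<mu>_def using that
      by (intro D.lyap_decay xD D.sol_subset[OF yD]) (auto intro: yr xr')
    have e0: "((\<lambda>t. exp (- \<mu> * t) * V 0) \<longlongrightarrow> 0) at_top"
    proof -
      have "((\<lambda>t. exp (- \<mu> * t)) \<longlongrightarrow> 0) at_top"
        using \<mu> by (intro filterlim_compose[OF exp_at_bot] filterlim_tendsto_neg_mult_at_bot[OF tendsto_const] filterlim_ident) auto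
      from tendsto_mult_right[OF this, of "V 0"] show ?thesis by (simp add: mult.commute)
    qed
    have V_lim: "(V \<longlongrightarrow> 0) at_top"
    proof (rule tendsto_sandwich[OF _ _ tendsto_const e0])
      show "\<forall>\<^sub>F t in at_top. 0 \<le> V t" by (simp add: V_def lyap_nonneg)
      show "\<forall>\<^sub>F t in at_top. V t \<le> exp (- \<mu> * t) * V 0"
        using Vd by (intro eventually_mono[OF eventually_ge_at_top[of 0]])
    qed
    have up: "((\<lambda>t. sqrt (4 * V t) + sqrt (2 * V t) / \<epsilon>) \<longlongrightarrow> 0) at_top"
      using tendsto_add[OF tendsto_real_sqrt[OF tendsto_mult_right[OF V_lim, of 4]]
        tendsto_divide[OF tendsto_real_sqrt[OF tendsto_mult_right[OF V_lim, of 2]] tendsto_const, of \<epsilon>]] \<epsilon>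
      by (simp add: mult.commute)
    show "((\<lambda>t. \<bar>y t - x t\<bar> + \<bar>w t - v t\<bar>) \<longlongrightarrow> 0) at_top"
    proof (rule tendsto_sandwich[OF _ _ tendsto_const up])
      show "\<forall>\<^sub>F t in at_top. 0 \<le> \<bar>y t - x t\<bar> + \<bar>w t - v t\<bar>" by simp
      show "\<forall>\<^sub>F t in at_top. \<bar>y t - x t\<bar> + \<bar>w t - v t\<bar> \<le> sqrt (4 * V t) + sqrt (2 * V t) / \<epsilon>"
      proof (intro always_eventually allI add_mono)
        fix t
        show "\<bar>y t - x t\<bar> \<le> sqrt (4 * V t)"
          by (rule real_le_rsqrt) (use lyap_lower(1)[of "y t - x t" \<epsilon> "w t - v t"] in \<open>simp add: V_def\<close>)
        have "\<epsilon> * \<bar>w t - v t\<bar> \<le> sqrt (2 * V t)"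
          by (rule real_le_rsqrt) (use lyap_lower(2)[of \<epsilon> "w t - v t" "y t - x t"] in \<open>simp add: V_def power_mult_distrib\<close>)
        thus "\<bar>w t - v t\<bar> \<le> sqrt (2 * V t) / \<epsilon>" using \<epsilon> by (simp add: field_simps)
      qed
    qed
  qed
qed

section \<open>The quasi-periodic solution\<close>

definition cpx :: "real fps \<Rightarrow> complex fps" where
  "cpx F = Abs_fps (\<lambda>n. of_real (F $ n))"

lemma cpx_nth [simp]: "cpx F $ n = of_real (F $ n)"
  by (simp add: cpx_def)

lemma cpx_mult: "cpx (F * G) = cpx F * cpx G"
  by (rule fps_ext) (simp add: fps_mult_nth)

lemma cpx_power: "cpx (F ^ n) = cpx F ^ n"
  by (induction n) (auto simp: cpx_mult intro!: fps_ext)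

lemma cpx_X: "cpx fps_X = fps_X"
  by (rule fps_ext) (simp add: fps_X_def)

lemma has_real_derivative_Re:
  "(f has_vector_derivative D) (at t) \<Longrightarrow> ((\<lambda>t. Re (f t)) has_real_derivative Re D) (at t)"
  unfolding has_real_derivative_iff_has_vector_derivative
  by (rule bounded_linear.has_vector_derivative[OF bounded_linear_Re])

context quasi
begin

lemma rdec_fc: "rdec fc"
proof -
  have xi: "\<xi>0 / 2 > 0" using xi0 by simp
  define K where "K = fact 4 * exp (\<xi>0 / 2) / (\<xi>0 / 2) ^ 4"
  have "norm (fc \<nu>) \<le> (Mf * K) * qq \<nu> * exp (- (\<xi>0 / 2) * nn \<nu>)" for \<nu>
  proof -
    have "1 * exp (- (\<xi>0 / 2) * nn \<nu>) \<le> (qq \<nu> * (1 + nn \<nu>) ^ 4) * exp (- (\<xi>0 / 2) * nn \<nu>)"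
      by (intro mult_right_mono qq_lower) auto
    also have "\<dots> = qq \<nu> * ((1 + nn \<nu>) ^ 4 * exp (- (\<xi>0 / 2) * nn \<nu>))" by simp
    also have "\<dots> \<le> qq \<nu> * K"
      unfolding K_def using qq_pos[of \<nu>] by (intro mult_left_mono poly_exp_bound xi) auto
    finally have "exp (- (\<xi>0 / 2) * nn \<nu>) \<le> qq \<nu> * K" by simp
    hence "exp (- (\<xi>0 / 2) * nn \<nu>) * exp (- (\<xi>0 / 2) * nn \<nu>) \<le> qq \<nu> * K * exp (- (\<xi>0 / 2) * nn \<nu>)"
      by (intro mult_right_mono) auto
    hence "exp (- \<xi>0 * nn \<nu>) \<le> qq \<nu> * K * exp (- (\<xi>0 / 2) * nn \<nu>)"
      unfolding exp_add[symmetric] by (simp add: field_simps)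
    hence "Mf * exp (- \<xi>0 * nn \<nu>) \<le> Mf * (qq \<nu> * K * exp (- (\<xi>0 / 2) * nn \<nu>))"
      by (intro mult_left_mono Mf_nonneg)
    thus ?thesis using fc[of \<nu>] by (simp add: mult_ac)
  qed
  thus ?thesis by (rule rdec_exp[OF xi])
qed

text \<open>All Taylor coefficients of g at c0; the first is written as f_0, which equals
  g(c0).\<close>

definition Gc :: "nat \<Rightarrow> complex" where
  "Gc n = (case n of 0 \<Rightarrow> fc 0 | Suc 0 \<Rightarrow> of_real a | Suc (Suc j) \<Rightarrow> gc j)"

text \<open>The forcing of the modes lacks f_0; \<open>taylor_sum\<close> moves it to the other side
  as the term g(c0).\<close>

lemma ev_forcing:
  "ev (\<lambda>\<nu>. fps_const (if \<nu> = 0 then 0 else fc \<nu>)) \<psi> = fps_const (infsum (\<lambda>\<nu>. fcis \<psi> \<nu> * fc \<nu>) UNIV - fc 0)"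
proof (rule fps_ext)
  fix n
  have s: "((\<lambda>\<nu>. fcis \<psi> \<nu> * fc \<nu>) has_sum infsum (\<lambda>\<nu>. fcis \<psi> \<nu> * fc \<nu>) UNIV) UNIV"
    by (intro has_sum_infsum rdec_summable[OF rdec_fc]) (simp add: norm_mult)
  have z: "((\<lambda>\<nu>. if \<nu> = 0 then - fc 0 else 0) has_sum - fc 0) UNIV"
    by (rule has_sum_finite_neutralI[where B = "{0}"]) auto
  have "(\<lambda>\<nu>. fcis \<psi> \<nu> * fc \<nu> + (if \<nu> = 0 then - fc 0 else 0)) = (\<lambda>\<nu>. fcis \<psi> \<nu> * (if \<nu> = 0 then 0 else fc \<nu>))"
    by (rule ext) (simp add: fcis_def freq_def inner_prod_def)
  with infsumI[OF has_sum_add[OF s z]]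
  have "infsum (\<lambda>\<nu>. fcis \<psi> \<nu> * (if \<nu> = 0 then 0 else fc \<nu>)) UNIV = infsum (\<lambda>\<nu>. fcis \<psi> \<nu> * fc \<nu>) UNIV - fc 0" by simp
  thus "ev (\<lambda>\<nu>. fps_const (if \<nu> = 0 then 0 else fc \<nu>)) \<psi> $ n = fps_const (infsum (\<lambda>\<nu>. fcis \<psi> \<nu> * fc \<nu>) UNIV - fc 0) $ n"
    by (cases n) (simp_all add: ev_def)
qed

text \<open>The terms of orders 0 and 1 are joined to the nonlinearity, so that with u = \<epsilon>
  z the full Taylor series of g(c0 + u) equals f - z' - \<epsilon> z''. This is the original
  equation divided by \<epsilon>.\<close>

lemma taylor_sum:
  assumes ch: "character \<sigma> \<delta> \<xi> \<kappa> chi"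
  defines "L \<equiv> \<lambda>\<nu>. fps_const (\<i> * of_real (lam \<nu>))"
  shows "((\<lambda>n. Gc n * ((chi epsx * ev (\<lambda>\<nu>. chi (Z \<nu>)) \<psi>) ^ n) $ k) has_sum
     (fps_const (infsum (\<lambda>\<nu>. fcis \<psi> \<nu> * fc \<nu>) UNIV) - ev (\<lambda>\<nu>. L \<nu> * chi (Z \<nu>)) \<psi>
       - chi epsx * ev (\<lambda>\<nu>. L \<nu> * (L \<nu> * chi (Z \<nu>))) \<psi>) $ k) UNIV"
proof -
  define E V where "E = chi epsx" and "V = ev (\<lambda>\<nu>. chi (Z \<nu>)) \<psi>"
  define Yv where "Yv = ev (\<lambda>\<nu>. chi (Y \<nu>)) \<psi>"
  have "((\<lambda>j. \<Sum>i=0..k. (E\<^sup>2) $ i * (gc j * (V\<^sup>2 * (E * V) ^ j) $ (k - i))) has_sum (\<Sum>i=0..k. (E\<^sup>2) $ i * Yv $ (k - i))) UNIV"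
    unfolding Yv_def V_def E_def by (intro has_sum_finite_sum has_sum_cmult_right ev_nonlin[OF ch]) auto
  moreover have "(\<Sum>i=0..k. (E\<^sup>2) $ i * (gc j * (V\<^sup>2 * (E * V) ^ j) $ (k - i))) = Gc (j + 2) * ((E * V) ^ (j + 2)) $ k" for j
  proof -
    have "(E * V) ^ (j + 2) = E\<^sup>2 * (V\<^sup>2 * (E * V) ^ j)" by (simp add: power_add power_mult_distrib power2_eq_square mult_ac)
    hence "((E * V) ^ (j + 2)) $ k = (\<Sum>i=0..k. (E\<^sup>2) $ i * (V\<^sup>2 * (E * V) ^ j) $ (k - i))"
      by (simp only: fps_mult_nth)
    thus ?thesis by (simp add: Gc_def sum_distrib_left mult_ac)
  qed
  ultimately have t: "((\<lambda>j. Gc (j + 2) * ((E * V) ^ (j + 2)) $ k) has_sum (E\<^sup>2 * Yv) $ k) UNIV"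
    by (simp add: fps_mult_nth)
  have bij: "bij_betw (\<lambda>j::nat. j + 2) UNIV {2..}"
    by (rule bij_betw_byWitness[where f' = "\<lambda>n. n - 2"]) auto
  have "((\<lambda>n. Gc n * ((E * V) ^ n) $ k) has_sum (E\<^sup>2 * Yv) $ k) {2..}"
    using has_sum_reindex_bij_betw[OF bij, of "\<lambda>n. Gc n * ((E * V) ^ n) $ k" "(E\<^sup>2 * Yv) $ k"] t by blast
  moreover have "((\<lambda>n. Gc n * ((E * V) ^ n) $ k) has_sum (\<Sum>n<2. Gc n * ((E * V) ^ n) $ k)) {..<2}"
    by (rule has_sum_finite) simp
  ultimately have "((\<lambda>n. Gc n * ((E * V) ^ n) $ k) has_sum (\<Sum>n<2. Gc n * ((E * V) ^ n) $ k) + (E\<^sup>2 * Yv) $ k) ({..<2} \<union> {2..})"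
    by (intro has_sum_Un_disjoint) auto
  moreover have "{..<2} \<union> {2..} = (UNIV :: nat set)" by auto
  moreover have "(\<Sum>n<2. Gc n * ((E * V) ^ n) $ k) + (E\<^sup>2 * Yv) $ k
      = (fps_const (fc 0) + fps_const (of_real a) * (E * V) + E\<^sup>2 * Yv) $ k"
    by (simp add: Gc_def numeral_2_eq_2)
  moreover have "fps_const (fc 0) + fps_const (of_real a) * (E * V) + E\<^sup>2 * Yv
      = fps_const (infsum (\<lambda>\<nu>. fcis \<psi> \<nu> * fc \<nu>) UNIV) - ev (\<lambda>\<nu>. L \<nu> * chi (Z \<nu>)) \<psi> - E * ev (\<lambda>\<nu>. L \<nu> * (L \<nu> * chi (Z \<nu>))) \<psi>"
    using evaluated_equation[OF ch, of \<psi>] unfolding ev_forcing E_def V_def Yv_def L_def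
    by (simp add: algebra_simps fps_const_sub[symmetric] del: fps_const_sub)
  ultimately show ?thesis unfolding E_def V_def by simp
qed

text \<open>The m-th time derivative of z: each derivative along \<omega> multiplies the mode \<nu>
  by \<i> \<lambda>.\<close>

definition zev :: "((complex option \<Rightarrow> complex) \<Rightarrow> complex fps) \<Rightarrow> nat \<Rightarrow> real \<times> real \<Rightarrow> complex fps" where
  "zev chi m \<psi> = ev (\<lambda>\<nu>. fps_const (\<i> * of_real (lam \<nu>)) ^ m * chi (Z \<nu>)) \<psi>"

lemma zev_derivative:
  assumes ch: "character \<sigma> \<delta> \<xi> \<kappa> chi"
  shows "((\<lambda>t. Re (zev chi m (t *\<^sub>R \<omega>) $ n)) has_real_derivative Re (zev chi (Suc m) (t *\<^sub>R \<omega>) $ n)) (at t)"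
proof -
  interpret character \<sigma> \<delta> \<xi> \<kappa> chi by (rule ch)
  have "fdec (\<lambda>\<nu>. fps_const (\<i> * of_real (lam \<nu>)) ^ m * chi (Z \<nu>))"
  proof (induction m)
    case (Suc m)
    show ?case using fdec_lam[OF Suc.IH] by (simp only: power_Suc mult.assoc)
  qed (use fdec_chi[OF fam_Z] in simp)
  from ev_derivative[OF this] show ?thesis
    unfolding zev_def power_Suc mult.assoc by (rule has_real_derivative_Re)
qed

lemma zev_real:
  assumes ch: "character \<sigma> \<delta> \<xi> \<kappa> chi"
  shows "zev chi 0 \<psi> $ n = of_real (Re (zev chi 0 \<psi> $ n))"
proof -
  interpret character \<sigma> \<delta> \<xi> \<kappa> chi by (rule ch)
  show ?thesis
    using ev_real[OF fam_Z fsym_Z, of \<psi>] by (simp add: zev_def complex_eq_iff)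
qed

lemma zev_taylor_sum:
  assumes ch: "character \<sigma> \<delta> \<xi> \<kappa> chi"
  shows "((\<lambda>n. Gc n * ((chi epsx * zev chi 0 \<psi>) ^ n) $ k) has_sum
     (fps_const (infsum (\<lambda>\<nu>. fcis \<psi> \<nu> * fc \<nu>) UNIV) - zev chi 1 \<psi> - chi epsx * zev chi 2 \<psi>) $ k) UNIV"
  using taylor_sum[OF ch, of \<psi> k] unfolding zev_def power_0 mult_1 power_one_right power2_eq_square mult.assoc .

lemma zev_continuous_periodic:
  assumes ch: "character \<sigma> \<delta> \<xi> \<kappa> chi"
  shows "continuous_on UNIV (\<lambda>\<psi>. zev chi 0 \<psi> $ n)" "periodic2 (\<lambda>\<psi>. zev chi 0 \<psi> $ n)"
proof -
  interpret character \<sigma> \<delta> \<xi> \<kappa> chi by (rule ch)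
  have "rdec (\<lambda>\<nu>. chi (Z \<nu>) $ n)" using fdec_chi[OF fam_Z] by (simp add: fdec_def)
  from continuous_fourier_series(1)[OF this] show "continuous_on UNIV (\<lambda>\<psi>. zev chi 0 \<psi> $ n)"
    by (simp add: zev_def ev_def)
  show "periodic2 (\<lambda>\<psi>. zev chi 0 \<psi> $ n)"
    using periodic2_fourier_series[of "\<lambda>\<nu>. chi (Z \<nu>) $ n"] by (simp add: zev_def ev_def)
qed

text \<open>The Borel transform of u = \<epsilon> z at \<psi>. Convolution with \<open>epsx\<close>
  turns the Dirac mass of z into a function, as Borel summability demands, and by
  \<open>chi_bsum\<close> the Taylor and Laplace images are those of u.\<close>

definition bsum :: "real \<times> real \<Rightarrow> complex option \<Rightarrow> complex" where
  "bsum \<psi> x = infsum (\<lambda>\<nu>. fcis \<psi> \<nu> * star epsx (Z \<nu>) x) UNIV"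

lemma bsum_terms:
  defines "B \<equiv> \<lambda>\<nu>. 9 * (6 / \<sigma> * (A * (qq \<nu> * exp (- (\<xi> / 2) * nn \<nu>))))"
  shows "adm \<delta> \<sigma> (B \<nu>) (\<lambda>x. fcis \<psi> \<nu> * star epsx (Z \<nu>) x)" "B summable_on UNIV"
proof -
  interpret tay: character \<sigma> \<delta> \<xi> \<kappa> tay by (rule character_tay)
  show "adm \<delta> \<sigma> (B \<nu>) (\<lambda>x. fcis \<psi> \<nu> * star epsx (Z \<nu>) x)"
    using adm_cmult[OF adm_star[OF sigma_pos adm_epsx tay.fam_adm[OF fam_Z]], of "fcis \<psi> \<nu>" \<nu>]
    by (simp add: B_def)
  show "B summable_on UNIV"
  proof (rule dominated_summable[where B = "\<lambda>\<nu>. 9 * (6 / \<sigma> * A) * qq \<nu>"])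
    fix \<nu>
    have "exp (- (\<xi> / 2) * nn \<nu>) \<le> 1" using xi_pos by simp
    hence "9 * (6 / \<sigma> * A) * qq \<nu> * exp (- (\<xi> / 2) * nn \<nu>) \<le> 9 * (6 / \<sigma> * A) * qq \<nu> * 1"
      using A_ge_1 sigma_pos qq_pos[of \<nu>] by (intro mult_left_mono) auto
    moreover have "B \<nu> \<ge> 0" using A_ge_1 sigma_pos qq_pos[of \<nu>] by (simp add: B_def)
    ultimately show "norm (B \<nu>) \<le> 9 * (6 / \<sigma> * A) * qq \<nu>" by (simp add: B_def mult_ac)
  qed (intro summable_on_cmult_right qq_summable)
qed

lemma adm_bsum: "\<exists>K. adm \<delta> \<sigma> K (bsum \<psi>)"
  unfolding bsum_def[abs_def] by (rule exI, rule adm_infsum[OF bsum_terms])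

lemma bsum_None: "bsum \<psi> None = 0"
  by (simp add: bsum_def star_simps)

lemma chi_bsum:
  assumes ch: "character \<sigma> \<delta> \<xi> \<kappa> chi"
  shows "chi (bsum \<psi>) = chi epsx * zev chi 0 \<psi>"
proof (rule fps_ext)
  fix n
  interpret character \<sigma> \<delta> \<xi> \<kappa> chi by (rule ch)
  have "chi (\<lambda>x. fcis \<psi> \<nu> * star epsx (Z \<nu>) x) = fps_const (fcis \<psi> \<nu>) * (chi epsx * chi (Z \<nu>))" for \<nu>
    using chi_cmult[OF adm_star[OF sigma_pos adm_epsx fam_adm[OF fam_Z]], of "fcis \<psi> \<nu>" \<nu>]
      chi_star[OF adm_epsx fam_adm[OF fam_Z], of \<nu>] by simp
  hence "((\<lambda>\<nu>. fcis \<psi> \<nu> * (chi epsx * chi (Z \<nu>)) $ n) has_sum chi (bsum \<psi>) $ n) UNIV"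
    using chi_infsum[where n = n, OF bsum_terms(1)[where \<psi> = \<psi>] bsum_terms(2)] unfolding bsum_def[abs_def] by simp
  moreover have "((\<lambda>\<nu>. fcis \<psi> \<nu> * (chi epsx * chi (Z \<nu>)) $ n) has_sum ev (\<lambda>\<nu>. chi epsx * chi (Z \<nu>)) \<psi> $ n) UNIV"
    by (rule ev_has_sum[OF fdec_cmult[OF fdec_chi[OF fam_Z]]])
  ultimately have "chi (bsum \<psi>) $ n = ev (\<lambda>\<nu>. chi epsx * chi (Z \<nu>)) \<psi> $ n" by (rule has_sum_unique)
  thus "chi (bsum \<psi>) $ n = (chi epsx * zev chi 0 \<psi>) $ n"
    using ev_cmult[OF fdec_chi[OF fam_Z], of "chi epsx" \<psi>] by (simp add: zev_def)
qed

definition xc :: "real \<Rightarrow> nat \<Rightarrow> real \<Rightarrow> real" where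
  "xc c0 k t = (case k of 0 \<Rightarrow> c0 | Suc n \<Rightarrow> Re (zev tay 0 (t *\<^sub>R \<omega>) $ n))"

lemma borel_continuation_bsum:
  "borel_continuation (\<lambda>k. of_real (xc c0 k t)) (\<lambda>p. bsum (t *\<^sub>R \<omega>) (Some p))"
  unfolding borel_continuation_def
proof (intro exI[of _ "hstrip \<delta>"] exI[of _ \<delta>] conjI ballI)
  obtain K where K: "adm \<delta> \<sigma> K (bsum (t *\<^sub>R \<omega>))" using adm_bsum by blast
  show hol: "(\<lambda>p. bsum (t *\<^sub>R \<omega>) (Some p)) holomorphic_on hstrip \<delta>" by (rule adm_holomorphic[OF K])
  fix p :: complex assume p: "p \<in> ball 0 \<delta>"
  have "of_real (xc c0 (Suc n) t) = (deriv ^^ n) (\<lambda>p. bsum (t *\<^sub>R \<omega>) (Some p)) 0" for n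
  proof -
    have "(deriv ^^ n) (\<lambda>p. bsum (t *\<^sub>R \<omega>) (Some p)) 0 = tay (bsum (t *\<^sub>R \<omega>)) $ Suc n" by (simp add: tay_nth)
    also have "\<dots> = zev tay 0 (t *\<^sub>R \<omega>) $ n" by (simp add: chi_bsum[OF character_tay] tay_epsx)
    also have "\<dots> = of_real (xc c0 (Suc n) t)"
      using zev_real[OF character_tay] by (simp add: xc_def)
    finally show ?thesis ..
  qed
  thus "(\<lambda>n. of_real (xc c0 (Suc n) t) * p ^ n / fact n) sums bsum (t *\<^sub>R \<omega>) (Some p)"
    using holomorphic_power_series[OF holomorphic_on_subset[OF hol ball_subset_hstrip] p] by simp
qed (use delta ball_subset_hstrip open_hstrip real_in_hstrip in auto)

definition xs :: "real \<Rightarrow> real \<Rightarrow> real \<Rightarrow> real" where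
  "xs c0 \<epsilon> t = c0 + \<epsilon> * Re (zev (lap \<epsilon>) 0 (t *\<^sub>R \<omega>) $ 0)"

definition vs :: "real \<Rightarrow> real \<Rightarrow> real" where
  "vs \<epsilon> t = \<epsilon> * Re (zev (lap \<epsilon>) 1 (t *\<^sub>R \<omega>) $ 0)"

lemma laplace_bsum:
  assumes "\<epsilon> > 0" "2 * \<sigma> * \<epsilon> \<le> 1"
  shows "((\<lambda>p::real. of_real (exp (- p / \<epsilon>)) * bsum (t *\<^sub>R \<omega>) (Some (of_real p))) has_integral of_real (xs c0 \<epsilon> t - c0)) {0..}"
proof -
  note ch = character_lap[OF assms]
  obtain K where K: "adm \<delta> \<sigma> K (bsum (t *\<^sub>R \<omega>))" using adm_bsum by blast
  have "lapi \<epsilon> (\<lambda>p. bsum (t *\<^sub>R \<omega>) (Some p)) = lap \<epsilon> (bsum (t *\<^sub>R \<omega>)) $ 0" by (simp add: lap_def bsum_None)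
  also have "\<dots> = of_real \<epsilon> * zev (lap \<epsilon>) 0 (t *\<^sub>R \<omega>) $ 0" by (simp add: chi_bsum[OF ch] lap_epsx[OF assms])
  also have "zev (lap \<epsilon>) 0 (t *\<^sub>R \<omega>) $ 0 = of_real (Re (zev (lap \<epsilon>) 0 (t *\<^sub>R \<omega>) $ 0))"
    by (rule zev_real[OF ch])
  finally have "lapi \<epsilon> (\<lambda>p. bsum (t *\<^sub>R \<omega>) (Some p)) = of_real (xs c0 \<epsilon> t - c0)" by (simp add: xs_def)
  with adm_lap(2)[OF assms K] show ?thesis by simp
qed

lemma borel_sum:
  assumes "\<epsilon> > 0" "2 * \<sigma> * \<epsilon> \<le> 1"
  shows "has_borel_sum (\<lambda>k. of_real (xc c0 k t)) \<epsilon> (of_real (xs c0 \<epsilon> t - c0))"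
    and "borel_summable (\<lambda>k. of_real (xc c0 k t))"
  using borel_continuation_bsum laplace_bsum[OF assms] has_integral_integrable assms(1)
  unfolding has_borel_sum_def borel_summable_def by blast+

text \<open>Uniform in t: this keeps the solution inside the interval of convergence of g and inside
  the region where the Lyapunov estimate holds.\<close>

lemma xs_bound:
  assumes "\<epsilon> > 0" "2 * \<sigma> * \<epsilon> \<le> 1"
  shows "\<bar>xs c0 \<epsilon> t - c0\<bar> \<le> \<epsilon> * (2 * A * sq)"
proof -
  interpret character \<sigma> \<delta> \<xi> \<kappa> "lap \<epsilon>" by (rule character_lap[OF assms])
  have b: "norm (fcis \<psi> \<nu> * lap \<epsilon> (Z \<nu>) $ 0) \<le> 2 * A * qq \<nu>" for \<psi> \<nu>
  proof -
    define B where "B = A * (qq \<nu> * exp (- (\<xi> / 2) * nn \<nu>))"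
    have Z: "adm \<delta> \<sigma> B (Z \<nu>)" unfolding B_def by (rule fam_adm[OF fam_Z])
    have "norm (Z \<nu> None) \<le> B" using Z by (auto simp: adm_def Ball_hdom mm_simps)
    hence "norm (lap \<epsilon> (Z \<nu>) $ 0) \<le> B + B"
      using adm_lap(4)[OF assms Z] unfolding lap_def by (simp add: norm_triangle_le)
    moreover have "B \<le> A * (qq \<nu> * 1)"
      unfolding B_def using A_ge_1 qq_pos[of \<nu>] xi_pos by (intro mult_left_mono) auto
    ultimately show ?thesis by (simp add: norm_mult)
  qed
  have "norm (zev (lap \<epsilon>) 0 (t *\<^sub>R \<omega>) $ 0) \<le> infsum (\<lambda>\<nu>. 2 * A * qq \<nu>) UNIV"
    unfolding zev_def ev_def using b
    by (simp only: fps_nth_Abs_fps power_0 mult_1) (intro dominated_infsum_le summable_on_cmult_right qq_summable, simp)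
  also have "\<dots> = 2 * A * sq" unfolding sq_def by (rule infsum_cmult_right')
  finally have "\<bar>Re (zev (lap \<epsilon>) 0 (t *\<^sub>R \<omega>) $ 0)\<bar> \<le> 2 * A * sq" using abs_Re_le_cmod order_trans by blast
  thus ?thesis using assms(1) by (simp add: xs_def abs_mult)
qed

lemma xs_quasi_periodic:
  assumes "\<epsilon> > 0" "2 * \<sigma> * \<epsilon> \<le> 1"
  shows "quasi_periodic \<omega> (xs c0 \<epsilon>)"
  unfolding quasi_periodic_def
proof (intro exI conjI allI)
  note c = zev_continuous_periodic[OF character_lap[OF assms], of 0]
  show "continuous_on UNIV (\<lambda>\<psi>. c0 + \<epsilon> * Re (zev (lap \<epsilon>) 0 \<psi> $ 0))" by (intro continuous_intros c)
  show "periodic2 (\<lambda>\<psi>. c0 + \<epsilon> * Re (zev (lap \<epsilon>) 0 \<psi> $ 0))" using c(2) unfolding periodic2_def by simp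
qed (simp add: xs_def)

end

section \<open>The original equation, formally and for small \<epsilon>\<close>

locale quasi_forced = quasi +
  fixes f :: "real \<times> real \<Rightarrow> real" and g :: "real \<Rightarrow> real" and c0 r :: real
  assumes f_series: "\<And>\<psi>. infsum (\<lambda>\<nu>. fcis \<psi> \<nu> * fc \<nu>) UNIV = of_real (f \<psi>)"
    and g_coeff: "\<And>n. Gc n = of_real ((deriv ^^ n) g c0 / fact n)"
    and g_sums: "\<And>x. \<bar>x - c0\<bar> < r \<Longrightarrow> (\<lambda>n. (deriv ^^ n) g c0 / fact n * (x - c0) ^ n) sums g x"
begin

lemma xs_solution:
  assumes E: "\<epsilon> > 0" "2 * \<sigma> * \<epsilon> \<le> 1" and small: "\<epsilon> * (2 * A * sq) < r"
  shows "ode_solution g f \<omega> \<epsilon> UNIV (xs c0 \<epsilon>) (vs \<epsilon>)"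
  unfolding ode_solution_def
proof (intro exI[of _ "\<lambda>t. \<epsilon> * Re (zev (lap \<epsilon>) 2 (t *\<^sub>R \<omega>) $ 0)"] ballI conjI)
  fix t :: real
  note ch = character_lap[OF E]
  note d = zev_derivative[OF ch, of _ 0 t]
  show "(xs c0 \<epsilon> has_real_derivative vs \<epsilon> t) (at t)"
    unfolding xs_def[abs_def] vs_def using DERIV_add[OF DERIV_const[of c0] DERIV_cmult[OF d[of 0], of \<epsilon>]] by simp
  show "(vs \<epsilon> has_real_derivative \<epsilon> * Re (zev (lap \<epsilon>) 2 (t *\<^sub>R \<omega>) $ 0)) (at t)"
    unfolding vs_def[abs_def] using DERIV_cmult[OF d[of 1], of \<epsilon>] by (simp add: numeral_2_eq_2)
  define v where "v = Re (zev (lap \<epsilon>) 0 (t *\<^sub>R \<omega>) $ 0)"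
  have zv: "zev (lap \<epsilon>) 0 (t *\<^sub>R \<omega>) $ 0 = of_real v"
    unfolding v_def by (rule zev_real[OF ch])
  have x: "xs c0 \<epsilon> t - c0 = \<epsilon> * v" by (simp add: xs_def v_def)
  let ?R = "of_real (f (t *\<^sub>R \<omega>)) - zev (lap \<epsilon>) 1 (t *\<^sub>R \<omega>) $ 0 - of_real \<epsilon> * zev (lap \<epsilon>) 2 (t *\<^sub>R \<omega>) $ 0"
  \<comment> \<open>The values of \<open>lap\<close> are constant series, so the coefficient of
    order 0 is the value itself.\<close>
  have "(\<lambda>n. Gc n * ((lap \<epsilon> epsx * zev (lap \<epsilon>) 0 (t *\<^sub>R \<omega>)) ^ n) $ 0) sums
      ((fps_const (of_real (f (t *\<^sub>R \<omega>))) - zev (lap \<epsilon>) 1 (t *\<^sub>R \<omega>) - lap \<epsilon> epsx * zev (lap \<epsilon>) 2 (t *\<^sub>R \<omega>)) $ 0)"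
    using has_sum_imp_sums[OF zev_taylor_sum[OF ch, of "t *\<^sub>R \<omega>" 0]] unfolding f_series .
  hence "(\<lambda>n. complex_of_real ((deriv ^^ n) g c0 / fact n * (\<epsilon> * v) ^ n)) sums ?R"
    by (simp add: g_coeff lap_epsx[OF E] fps_nth_power_0 zv)
  moreover have "\<bar>xs c0 \<epsilon> t - c0\<bar> < r" using xs_bound[OF E, of c0 t] small by linarith
  hence "(\<lambda>n. complex_of_real ((deriv ^^ n) g c0 / fact n * (\<epsilon> * v) ^ n)) sums of_real (g (xs c0 \<epsilon> t))"
    unfolding sums_of_real_iff x[symmetric] by (rule g_sums)
  ultimately have "?R = of_real (g (xs c0 \<epsilon> t))" by (rule sums_unique2)
  hence "Re ?R = g (xs c0 \<epsilon> t)" by simp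
  hence gx: "g (xs c0 \<epsilon> t) = f (t *\<^sub>R \<omega>) - Re (zev (lap \<epsilon>) 1 (t *\<^sub>R \<omega>) $ 0) - \<epsilon> * Re (zev (lap \<epsilon>) 2 (t *\<^sub>R \<omega>) $ 0)" by simp
  show "\<epsilon> * (\<epsilon> * Re (zev (lap \<epsilon>) 2 (t *\<^sub>R \<omega>) $ 0)) + vs \<epsilon> t + \<epsilon> * g (xs c0 \<epsilon> t) = \<epsilon> * f (t *\<^sub>R \<omega>)"
    unfolding vs_def gx by (simp add: right_diff_distrib)
qed

lemma xc_derivative:
  defines "D \<equiv> \<lambda>m k t. case k of 0 \<Rightarrow> 0 | Suc n \<Rightarrow> Re (zev tay m (t *\<^sub>R \<omega>) $ n)"
  shows "(xc c0 k has_real_derivative D 1 k t) (at t)" "(D m k has_real_derivative D (Suc m) k t) (at t)"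
  using zev_derivative[OF character_tay, of 0 _ t] zev_derivative[OF character_tay, of m _ t]
  unfolding xc_def[abs_def] D_def by (auto split: nat.split)

lemma xc_formal_solution: "formal_solution g f \<omega> c0 (xc c0)"
  unfolding formal_solution_def
proof (intro conjI allI)
  define D where "D = (\<lambda>m k t. case k of 0 \<Rightarrow> 0 | Suc n \<Rightarrow> Re (zev tay m (t *\<^sub>R \<omega>) $ n))"
  have D1: "(xc c0 k has_real_derivative D 1 k t) (at t)" for k t
    unfolding D_def by (rule xc_derivative(1))
  have D2: "(D 1 k has_real_derivative D 2 k t) (at t)" for k t
    using xc_derivative(2)[of 1 k t] unfolding D_def Suc_1 .
  have d1: "deriv (xc c0 k) = D 1 k" for k by (rule ext) (rule DERIV_imp_deriv[OF D1])
  have d2: "deriv (D 1 k) = D 2 k" for k by (rule ext) (rule DERIV_imp_deriv[OF D2])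
  fix t k
  show "xc c0 0 t = c0" by (simp add: xc_def)
  show "xc c0 k field_differentiable at t" "deriv (xc c0 k) field_differentiable at t"
    unfolding d1 field_differentiable_def using D1 D2 by blast+
  define V where "V = Abs_fps (\<lambda>n. Re (zev tay 0 (t *\<^sub>R \<omega>) $ n))"
  define G where "G = Abs_fps (\<lambda>n. (deriv ^^ n) g c0 / fact n)"
  have V: "zev tay 0 (t *\<^sub>R \<omega>) = cpx V" unfolding V_def using zev_real[OF character_tay] by (intro fps_ext) simp
  have e: "Abs_fps (\<lambda>k. D m k t) = fps_X * Abs_fps (\<lambda>n. Re (zev tay m (t *\<^sub>R \<omega>) $ n))" for m
    by (rule fps_ext) (simp add: D_def split: nat.split)
  have ex: "Abs_fps (\<lambda>k. xc c0 k t) - fps_const c0 = fps_X * V"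
    by (rule fps_ext) (simp add: xc_def V_def split: nat.split)
  have "fps_X * Abs_fps (\<lambda>n. Re (zev tay 2 (t *\<^sub>R \<omega>) $ n)) + Abs_fps (\<lambda>n. Re (zev tay 1 (t *\<^sub>R \<omega>) $ n)) + (G oo (fps_X * V))
    = fps_const (f (t *\<^sub>R \<omega>))"
  proof (rule fps_ext)
    fix k
    have z: "Gc n * ((fps_X * cpx V) ^ n) $ k = of_real (G $ n * ((fps_X * V) ^ n) $ k)" for n
      by (simp add: g_coeff G_def cpx_X[symmetric] cpx_mult[symmetric] cpx_power[symmetric])
    \<comment> \<open>The n-th power of a series without constant term starts at order n, so the sum
      over n is finite in each coefficient and agrees with the composition of power series.\<close>
    have s1: "((\<lambda>n. Gc n * ((fps_X * cpx V) ^ n) $ k) has_sum (\<Sum>n\<in>{0..k}. Gc n * ((fps_X * cpx V) ^ n) $ k)) UNIV"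
      by (rule has_sum_finite_neutralI[where B = "{0..k}"]) (auto simp: power_mult_distrib fps_X_power_mult_nth)
    have s2: "(\<Sum>n\<in>{0..k}. Gc n * ((fps_X * cpx V) ^ n) $ k) = of_real ((G oo (fps_X * V)) $ k)"
      unfolding z fps_compose_nth by simp
    have s3: "((\<lambda>n. Gc n * ((fps_X * cpx V) ^ n) $ k) has_sum
        (fps_const (of_real (f (t *\<^sub>R \<omega>))) - zev tay 1 (t *\<^sub>R \<omega>) - fps_X * zev tay 2 (t *\<^sub>R \<omega>)) $ k) UNIV"
      using zev_taylor_sum[OF character_tay, of "t *\<^sub>R \<omega>" k] unfolding f_series tay_epsx V .
    have "(G oo (fps_X * V)) $ k =
        Re ((fps_const (of_real (f (t *\<^sub>R \<omega>))) - zev tay 1 (t *\<^sub>R \<omega>) - fps_X * zev tay 2 (t *\<^sub>R \<omega>)) $ k)"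
      unfolding has_sum_unique[OF s3 s1[unfolded s2]] by simp
    thus "(fps_X * Abs_fps (\<lambda>n. Re (zev tay 2 (t *\<^sub>R \<omega>) $ n)) + Abs_fps (\<lambda>n. Re (zev tay 1 (t *\<^sub>R \<omega>) $ n)) + (G oo (fps_X * V))) $ k
      = fps_const (f (t *\<^sub>R \<omega>)) $ k" by (cases k) simp_all
  qed
  \<comment> \<open>The factor \<epsilon> that was divided out in passing to z is restored.\<close>
  hence "fps_X * (fps_X * Abs_fps (\<lambda>n. Re (zev tay 2 (t *\<^sub>R \<omega>) $ n)) + Abs_fps (\<lambda>n. Re (zev tay 1 (t *\<^sub>R \<omega>) $ n)) + (G oo (fps_X * V)))
    = fps_X * fps_const (f (t *\<^sub>R \<omega>))" by simp
  thus "fps_X * Abs_fps (\<lambda>k. deriv (deriv (xc c0 k)) t) + Abs_fps (\<lambda>k. deriv (xc c0 k) t)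
      + fps_X * (Abs_fps (\<lambda>n. (deriv ^^ n) g c0 / fact n) oo (Abs_fps (\<lambda>k. xc c0 k t) - fps_const c0))
      = fps_X * fps_const (f (t *\<^sub>R \<omega>))"
    unfolding d1 d2 e ex G_def by (simp only: distrib_left mult.assoc)
next
  fix k
  show "\<exists>c. \<forall>t. ((\<lambda>\<nu>. cis (t * (\<omega> \<bullet> freq \<nu>)) * c \<nu>) has_sum complex_of_real (xc c0 k t)) UNIV"
  proof (cases k)
    case 0
    show ?thesis
    proof (intro exI[of _ "\<lambda>\<nu>. if \<nu> = 0 then of_real c0 else 0"] allI)
      fix t
      show "((\<lambda>\<nu>. cis (t * (\<omega> \<bullet> freq \<nu>)) * (if \<nu> = 0 then of_real c0 else 0)) has_sum complex_of_real (xc c0 k t)) UNIV"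
        by (rule has_sum_finite_neutralI[where B = "{0}"]) (auto simp: 0 xc_def freq_def inner_prod_def)
    qed
  next
    case (Suc n)
    interpret tay: character \<sigma> \<delta> \<xi> \<kappa> tay by (rule character_tay)
    show ?thesis
    proof (intro exI[of _ "\<lambda>\<nu>. tay (Z \<nu>) $ n"] allI)
      fix t
      have "complex_of_real (xc c0 k t) = ev (\<lambda>\<nu>. tay (Z \<nu>)) (t *\<^sub>R \<omega>) $ n"
        using zev_real[OF character_tay, of "t *\<^sub>R \<omega>" n] by (simp add: Suc xc_def zev_def)
      thus "((\<lambda>\<nu>. cis (t * (\<omega> \<bullet> freq \<nu>)) * tay (Z \<nu>) $ n) has_sum complex_of_real (xc c0 k t)) UNIV"
        using ev_has_sum[OF tay.fdec_chi[OF fam_Z], of "t *\<^sub>R \<omega>" n] by (simp add: fcis_scaleR lam_def)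
    qed
  qed
qed

end

text \<open>By continuity |g' - g'(c0)| < g'(c0)/2 near c0, and the mean value theorem turns this
  into \<open>slope\<close>; the halving in \<rho> keeps the closed interval inside the open
  ones.\<close>

lemma damped_near_equilibrium:
  fixes g :: "real \<Rightarrow> real"
  assumes r: "r > 0" and d: "\<And>x. \<bar>x - c0\<bar> < r \<Longrightarrow> (g has_real_derivative deriv g x) (at x)"
    and c: "isCont (deriv g) c0" and a: "deriv g c0 > 0"
  obtains \<rho> where "\<rho> > 0" "\<And>\<epsilon>. 0 < \<epsilon> \<Longrightarrow> \<epsilon> \<le> 1 \<Longrightarrow> \<epsilon>\<^sup>2 * (2 * deriv g c0) \<le> 1 / 4 \<Longrightarrow> damped g \<epsilon> c0 \<rho> (deriv g c0 / 2) (2 * deriv g c0)"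
proof -
  obtain s where s: "s > 0" "\<And>x. \<bar>x - c0\<bar> < s \<Longrightarrow> \<bar>deriv g x - deriv g c0\<bar> < deriv g c0 / 2"
    using c a unfolding continuous_at_eps_delta dist_real_def by (meson half_gt_zero)
  define \<rho> where "\<rho> = min r s / 2"
  have rho: "\<rho> > 0" "\<rho> < r" "\<rho> < s" using r s(1) by (auto simp: \<rho>_def min_def)
  have lt: "\<exists>\<gamma>. deriv g c0 / 2 \<le> \<gamma> \<and> \<gamma> \<le> 2 * deriv g c0 \<and> g y - g x = \<gamma> * (y - x)"
    if "\<bar>x - c0\<bar> \<le> \<rho>" "\<bar>y - c0\<bar> \<le> \<rho>" "x < y" for x y
  proof -
    have "(g has_real_derivative deriv g z) (at z)" if "x \<le> z" "z \<le> y" for z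
      using d[of z] \<open>\<bar>x - c0\<bar> \<le> \<rho>\<close> \<open>\<bar>y - c0\<bar> \<le> \<rho>\<close> that rho by linarith
    from MVT2[OF \<open>x < y\<close> this] obtain z where z: "x < z" "z < y" "g y - g x = (y - x) * deriv g z" by blast
    have "\<bar>deriv g z - deriv g c0\<bar> < deriv g c0 / 2" using s(2)[of z] z that rho by linarith
    thus ?thesis using z(3) a by (intro exI[of _ "deriv g z"]) (auto simp: mult.commute abs_if split: if_splits)
  qed
  have slope: "\<exists>\<gamma>. deriv g c0 / 2 \<le> \<gamma> \<and> \<gamma> \<le> 2 * deriv g c0 \<and> g y - g x = \<gamma> * (y - x)"
    if "\<bar>x - c0\<bar> \<le> \<rho>" "\<bar>y - c0\<bar> \<le> \<rho>" for x y
  proof (cases x y rule: linorder_cases)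
    case less
    thus ?thesis by (rule lt[OF that])
  next
    case equal
    thus ?thesis using a by (intro exI[of _ "deriv g c0"]) auto
  next
    case greater
    from lt[OF that(2,1) greater] obtain \<gamma> where g: "deriv g c0 / 2 \<le> \<gamma>" "\<gamma> \<le> 2 * deriv g c0"
      and e: "g x - g y = \<gamma> * (x - y)" by (elim exE conjE)
    have "g y - g x = - (g x - g y)" by simp
    also have "\<dots> = \<gamma> * (y - x)" unfolding e by (simp add: right_diff_distrib)
    finally show ?thesis using g by (intro exI conjI)
  qed
  show ?thesis
    by (rule that[OF rho(1)]) (unfold_locales, use rho a slope in auto)
qed

theorem theorem2:
  fixes \<omega> :: "real \<times> real" and g :: "real \<Rightarrow> real" and f :: "real \<times> real \<Rightarrow> real" and c0 :: real
  assumes "diophantine1 \<omega>"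
    and "real_analytic g"
    and "real_analytic2 f" and "periodic2 f"
    and "complex_of_real (g c0) = fourier_coeff f (0, 0)"
    and "deriv g c0 \<noteq> 0"
  shows "\<exists>X. formal_solution g f \<omega> c0 X \<and>
    (\<exists>\<epsilon>0>0. \<exists>x v :: real \<Rightarrow> real \<Rightarrow> real.
       (\<forall>\<epsilon>. 0 < \<epsilon> \<and> \<epsilon> < \<epsilon>0 \<longrightarrow>
          ode_solution g f \<omega> \<epsilon> UNIV (x \<epsilon>) (v \<epsilon>) \<and> quasi_periodic \<omega> (x \<epsilon>)) \<and>
       (\<forall>t. borel_summable (\<lambda>k. complex_of_real (X k t)) \<and>
          (\<forall>\<epsilon>. 0 < \<epsilon> \<and> \<epsilon> < \<epsilon>0 \<longrightarrow>
             has_borel_sum (\<lambda>k. complex_of_real (X k t)) \<epsilon> (complex_of_real (x \<epsilon> t - c0)))) \<and>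
       (deriv g c0 > 0 \<longrightarrow>
          (\<forall>\<epsilon>. 0 < \<epsilon> \<and> \<epsilon> < \<epsilon>0 \<longrightarrow> local_attractor g f \<omega> \<epsilon> (x \<epsilon>) (v \<epsilon>))))"
proof -
  define a where "a = deriv g c0"
  obtain C0 where C0: "C0 > 0" "\<And>\<nu>. \<nu> \<noteq> (0, 0) \<Longrightarrow> \<bar>\<omega> \<bullet> freq \<nu>\<bar> \<ge> C0 / of_int (\<bar>fst \<nu>\<bar> + \<bar>snd \<nu>\<bar>)"
    using assms(1) unfolding diophantine1_def by blast
  obtain r M where r: "r > 0" and M: "M > 0" and coeff: "\<And>n. \<bar>(deriv ^^ n) g c0 / fact n\<bar> \<le> M * (1 / r) ^ n"
    and sums: "\<And>x. \<bar>x - c0\<bar> < r \<Longrightarrow> (\<lambda>n. (deriv ^^ n) g c0 / fact n * (x - c0) ^ n) sums g x"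
    and der: "\<And>x n. \<bar>x - c0\<bar> < r \<Longrightarrow> ((deriv ^^ n) g has_real_derivative (deriv ^^ Suc n) g x) (at x)"
    using real_analytic_taylor[OF assms(2)] by blast
  obtain Mf \<xi>0 where xi0: "\<xi>0 > 0" and fc: "\<And>\<nu>. norm (fourier_coeff f \<nu>) \<le> Mf * exp (- \<xi>0 * nn \<nu>)"
    using fourier_coeff_decay[OF assms(3,4)] by blast
  note fcont = real_analytic2_continuous[OF assms(3)]
  define gc where "gc = (\<lambda>j. complex_of_real ((deriv ^^ (j + 2)) g c0 / fact (j + 2)))"
  interpret quasi \<omega> a C0 "fourier_coeff f" Mf \<xi>0 gc "M * (1 / r)\<^sup>2" "1 / r"
  proof
    show "\<bar>\<omega> \<bullet> freq \<nu>\<bar> \<ge> C0 / nn \<nu>" if "\<nu> \<noteq> 0" for \<nu>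
      using C0(2)[of \<nu>] that by (simp add: nn_def zero_prod_def)
    show "norm (gc j) \<le> M * (1 / r)\<^sup>2 * (1 / r) ^ j" for j
      using coeff[of "j + 2"] unfolding gc_def norm_of_real power_add by (simp only: mult_ac)
    show "gc j \<in> \<real>" for j unfolding gc_def by (rule Reals_of_real)
  qed (use assms(6) C0(1) xi0 fc r M in \<open>auto simp: a_def fourier_coeff_uminus\<close>)
  have G: "Gc n = of_real ((deriv ^^ n) g c0 / fact n)" for n
  proof -
    consider "n = 0" | "n = Suc 0" | j where "n = Suc (Suc j)" by (metis not0_implies_Suc)
    thus ?thesis
    proof cases
      case 1
      thus ?thesis using assms(5) unfolding Gc_def by (simp add: zero_prod_def)
    next
      case 2
      thus ?thesis unfolding Gc_def by (simp add: a_def)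
    next
      case 3
      have "Gc n = gc j" unfolding Gc_def 3 by simp
      thus ?thesis by (simp only: gc_def 3 add_2_eq_Suc')
    qed
  qed
  interpret quasi_forced \<omega> a C0 "fourier_coeff f" Mf \<xi>0 gc "M * (1 / r)\<^sup>2" "1 / r" f g c0 r
    by unfold_locales (use fourier_inversion[OF fcont assms(4) rdec_fc] G sums in auto)
  obtain \<rho> where rho: "\<rho> > 0" and damp: "\<And>\<epsilon>. deriv g c0 > 0 \<Longrightarrow> 0 < \<epsilon> \<Longrightarrow> \<epsilon> \<le> 1 \<Longrightarrow>
      \<epsilon>\<^sup>2 * (2 * deriv g c0) \<le> 1 / 4 \<Longrightarrow> damped g \<epsilon> c0 \<rho> (deriv g c0 / 2) (2 * deriv g c0)"
  proof (cases "deriv g c0 > 0")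
    case True
    note D = that
    have "(deriv g has_real_derivative deriv (deriv g) c0) (at c0)" using der[of c0 1] r by simp
    hence c: "isCont (deriv g) c0" by (rule DERIV_isCont)
    have d: "(g has_real_derivative deriv g x) (at x)" if "\<bar>x - c0\<bar> < r" for x
      using der[OF that, of 0] by simp
    show ?thesis by (rule damped_near_equilibrium[OF r d c True], assumption) (rule D)
  next
    case False
    \<comment> \<open>Attraction is claimed only for g'(c0) > 0, so any \<rho> will do.\<close>
    thus ?thesis using that[of 1] by auto
  qed
  define Vb where "Vb = 2 * A * sq"
  have Vb: "Vb > 0" using A_ge_1 sq_pos by (simp add: Vb_def)
  \<comment> \<open>The bounds 1 and 1 / (8 |a|) give \<epsilon>^2 * 2 |a| <= 1/4 for the Lyapunov
    estimate, 1 / (2 \<sigma>) makes the Laplace integrals converge, and by \<open>xs_bound\<close>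
    the other two keep the solution within the Taylor radius \<open>r\<close> of g and within
    \<rho>/2 of c0.\<close>
  define \<epsilon>0 where "\<epsilon>0 = Min {1, 1 / (2 * \<sigma>), r / Vb, \<rho> / (2 * Vb), 1 / (8 * \<bar>a\<bar>)}"
  have e0: "\<epsilon>0 > 0" using sigma_pos r rho Vb assms(6) by (simp add: \<epsilon>0_def a_def)
  have e: "\<epsilon> \<le> 1" "2 * \<sigma> * \<epsilon> \<le> 1" "\<epsilon> * (2 * A * sq) < r" "\<epsilon> * (2 * A * sq) \<le> \<rho> / 2" "\<epsilon>\<^sup>2 * (2 * \<bar>a\<bar>) \<le> 1 / 4"
    if h: "0 < \<epsilon>" "\<epsilon> < \<epsilon>0" for \<epsilon>
  proof -
    have l: "\<epsilon> < 1" "\<epsilon> < 1 / (2 * \<sigma>)" "\<epsilon> < r / Vb" "\<epsilon> < \<rho> / (2 * Vb)" "\<epsilon> < 1 / (8 * \<bar>a\<bar>)"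
      using h(2) by (auto simp: \<epsilon>0_def)
    show "\<epsilon> \<le> 1" "2 * \<sigma> * \<epsilon> \<le> 1" "\<epsilon> * (2 * A * sq) < r" "\<epsilon> * (2 * A * sq) \<le> \<rho> / 2"
      using l(1-4) sigma_pos Vb unfolding Vb_def[symmetric] by (auto simp: field_simps)
    have "\<epsilon> * \<bar>a\<bar> < 1 / 8" using l(5) assms(6) by (simp add: field_simps a_def)
    moreover have "\<epsilon> * (\<epsilon> * \<bar>a\<bar>) \<le> 1 * (\<epsilon> * \<bar>a\<bar>)" using h(1) l(1) by (intro mult_right_mono) auto
    ultimately show "\<epsilon>\<^sup>2 * (2 * \<bar>a\<bar>) \<le> 1 / 4" by (simp add: power2_eq_square)
  qed
  obtain B where B: "\<And>\<psi>. \<bar>f \<psi>\<bar> \<le> B" using periodic2_bounded[OF assms(4) fcont] by blast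
  have "local_attractor g f \<omega> \<epsilon> (xs c0 \<epsilon>) (vs \<epsilon>)" if "deriv g c0 > 0" and h: "0 < \<epsilon>" "\<epsilon> < \<epsilon>0" for \<epsilon>
  proof (rule local_attractorI[OF _ fcont B xs_solution])
    show "damped g \<epsilon> c0 \<rho> (deriv g c0 / 2) (2 * deriv g c0)"
      using e(1,5)[OF h] that by (intro damp) (auto simp: a_def)
    show "\<bar>xs c0 \<epsilon> t - c0\<bar> \<le> \<rho> / 2" for t
      using xs_bound[OF h(1) e(2)[OF h], of c0 t] e(4)[OF h] by linarith
  qed (use e h in auto)
  moreover have "ode_solution g f \<omega> \<epsilon> UNIV (xs c0 \<epsilon>) (vs \<epsilon>) \<and> quasi_periodic \<omega> (xs c0 \<epsilon>)" if h: "0 < \<epsilon>" "\<epsilon> < \<epsilon>0" for \<epsilon>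
    using xs_solution[OF h(1) e(2,3)[OF h]] xs_quasi_periodic[OF h(1) e(2)[OF h]] by blast
  moreover have "has_borel_sum (\<lambda>k. complex_of_real (xc c0 k t)) \<epsilon> (complex_of_real (xs c0 \<epsilon> t - c0))"
    if h: "0 < \<epsilon>" "\<epsilon> < \<epsilon>0" for \<epsilon> t
    by (rule borel_sum(1)[OF h(1) e(2)[OF h]])
  \<comment> \<open>Summability asks for the convergence of the integral at one \<epsilon>; the
    largest with 2 \<sigma> \<epsilon> <= 1 is taken.\<close>
  moreover have "borel_summable (\<lambda>k. complex_of_real (xc c0 k t))" for t
    using borel_sum(2)[of "1 / (2 * \<sigma>)"] sigma_pos by simp
  ultimately show ?thesis using xc_formal_solution e0 by blast
qed

end
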